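(* Let $\mathbb{F}_q$ be a finite field and $\alpha>1$. Assuming $\mathrm{P}\neq\mathrm{NP}$, there is no $\alpha$-approximation algorithm for Entrywise $\ell_0$-Rank-$k$ Approximation over $\mathbb{F}_q$ that runs in time $\mathrm{poly}(n)$. Consequently, assuming the Exponential Time Hypothesis, there exists $\delta=\delta(\alpha)>0$ such that there is no $\alpha$-approximation algorithm for Entrywise $\ell_0$-Rank-$k$ Approximation over $\mathbb{F}_q$ that runs in time $2^{k^{\delta}}$.
   Context: Entrywise $\ell_0$-Rank-$k$ Approximation over $\mathbb{F}_q$: given an $n\times d$ matrix $A$ ($n\ge d$) over $\mathbb{F}_q$ and a positive integer $k$, output $U\in\mathbb{F}_q^{n\times k}$, $V\in\mathbb{F}_q^{k\times d}$ minimizing $\|A-UV\|_0$ (the number of nonzero entries); an $\alpha$-approximation outputs $U,V$ with $\|A-UV\|_0\le\alpha\cdot\min_{U',V'}\|A-U'V'\|_0$. Exponential Time Hypothesis: 3-SAT on $n$ variables cannot be solved in time $2^{o(n)}$. *)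

theory Defs
  imports "Jordan_Normal_Form.Matrix" "HOL-Library.Landau_Symbols"
begin

text \<open>Deterministic multi-tape Turing machines. Words over a finite input alphabet \<open>'a\<close> are written on two-way infinite tapes, one symbol
  per cell. Besides the blank and the input symbols a machine may use finitely many auxiliary
  symbols \<open>Aux i\<close>. A machine halts when \<open>delta\<close> returns \<open>None\<close>; it starts in state 0.\<close>

datatype 'a symb = Blank | Sym 'a | Aux nat

datatype move = Leftwards | Stay | Rightwards

record 'a tm =
  tapes :: nat
  states :: nat
  auxs :: nat
  delta :: "nat \<Rightarrow> 'a symb list \<Rightarrow> (nat \<times> ('a symb \<times> move) list) option"
  accepting :: "nat set"

definition alphabet :: "'a tm \<Rightarrow> 'a symb set" where
  "alphabet M = insert Blank (range Sym \<union> Aux ` {..<auxs M})"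

definition wf_tm :: "'a::finite tm \<Rightarrow> bool" where
  "wf_tm M \<longleftrightarrow> 0 < tapes M \<and> 0 < states M \<and>
     (\<forall>q rs q' as. q < states M \<and> length rs = tapes M \<and> set rs \<subseteq> alphabet M \<and>
        delta M q rs = Some (q', as) \<longrightarrow>
        q' < states M \<and> length as = tapes M \<and> fst ` set as \<subseteq> alphabet M)"

text \<open>A tape is its content together with the head position.\<close>

type_synonym 'a tape = "(int \<Rightarrow> 'a symb) \<times> int"
type_synonym 'a config = "nat \<times> 'a tape list"

definition read_tape :: "'a tape \<Rightarrow> 'a symb" where
  "read_tape tp = fst tp (snd tp)"

definition offset :: "move \<Rightarrow> int" where
  "offset m = (case m of Leftwards \<Rightarrow> -1 | Stay \<Rightarrow> 0 | Rightwards \<Rightarrow> 1)"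

definition act :: "'a symb \<times> move \<Rightarrow> 'a tape \<Rightarrow> 'a tape" where
  "act a tp = ((fst tp)(snd tp := fst a), snd tp + offset (snd a))"

definition halted :: "'a tm \<Rightarrow> 'a config \<Rightarrow> bool" where
  "halted M c \<longleftrightarrow> delta M (fst c) (map read_tape (snd c)) = None"

text \<open>Halted configurations are fixed points, so being halted after \<open>t\<close> applications of
  \<open>tm_step\<close> means that the machine halts within \<open>t\<close> steps.\<close>

definition tm_step :: "'a tm \<Rightarrow> 'a config \<Rightarrow> 'a config" where
  "tm_step M c = (case delta M (fst c) (map read_tape (snd c)) of
      None \<Rightarrow> c
    | Some (q', as) \<Rightarrow> (q', map2 act as (snd c)))"

definition input_tape :: "'a list \<Rightarrow> 'a tape" where
  "input_tape x =
     ((\<lambda>i. if 0 \<le> i \<and> i < int (length x) then Sym (x ! nat i) else Blank), 0)"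

definition init_config :: "'a tm \<Rightarrow> 'a list \<Rightarrow> 'a config" where
  "init_config M x = (0, input_tape x # replicate (tapes M - 1) (input_tape []))"

definition run :: "'a tm \<Rightarrow> 'a list \<Rightarrow> nat \<Rightarrow> 'a config" where
  "run M x t = (tm_step M ^^ t) (init_config M x)"

definition decides_within :: "'a tm \<Rightarrow> 'a list \<Rightarrow> nat \<Rightarrow> bool \<Rightarrow> bool" where
  "decides_within M x t b \<longleftrightarrow>
     halted M (run M x t) \<and> (fst (run M x t) \<in> accepting M \<longleftrightarrow> b)"

text \<open>The output word is read off the last tape, from cell 0 up to the first blank.\<close>

definition outputs_within :: "'a tm \<Rightarrow> 'a list \<Rightarrow> nat \<Rightarrow> 'a list \<Rightarrow> bool" where
  "outputs_within M x t y \<longleftrightarrow>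
     halted M (run M x t) \<and>
     (let content = fst (last (snd (run M x t))) in
        (\<forall>i<length y. content (int i) = Sym (y ! i)) \<and> content (int (length y)) = Blank)"

definition class_P :: "'a::finite list set set" where
  "class_P = {L. \<exists>M c. wf_tm M \<and> (\<forall>x. decides_within M x (c * length x ^ c + c) (x \<in> L))}"

definition pair_word :: "'a list \<Rightarrow> 'a list \<Rightarrow> 'a option list" where
  "pair_word x w = map Some x @ None # map Some w"

definition class_NP :: "'a::finite list set set" where
  "class_NP = {L. \<exists>V \<in> class_P. \<exists>c. \<forall>x.
     x \<in> L \<longleftrightarrow> (\<exists>w. length w \<le> c * length x ^ c + c \<and> pair_word x w \<in> V)}"

text \<open>A literal \<open>(i, b)\<close> holds under an assignment \<open>v\<close> iff \<open>v i = b\<close>. A clause has three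
  literals, not necessarily distinct.\<close>

type_synonym literal = "nat \<times> bool"
type_synonym clause3 = "literal \<times> literal \<times> literal"

definition clause_lits :: "clause3 \<Rightarrow> literal list" where
  "clause_lits C = (case C of (l1, l2, l3) \<Rightarrow> [l1, l2, l3])"

definition cnf3_on :: "nat \<Rightarrow> clause3 list \<Rightarrow> bool" where
  "cnf3_on n F \<longleftrightarrow> (\<forall>C \<in> set F. \<forall>l \<in> set (clause_lits C). fst l < n)"

definition satisfiable :: "clause3 list \<Rightarrow> bool" where
  "satisfiable F \<longleftrightarrow>
     (\<exists>v :: nat \<Rightarrow> bool. \<forall>C \<in> set F. \<exists>l \<in> set (clause_lits C). v (fst l) = snd l)"

text \<open>A number is written in unary with ticks \<open>None\<close>; the terminating symbol \<open>Some b\<close> carries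
  the sign of a literal. The number of variables comes first.\<close>

definition lit_word :: "literal \<Rightarrow> bool option list" where
  "lit_word l = replicate (fst l) None @ [Some (snd l)]"

definition cnf_word :: "nat \<Rightarrow> clause3 list \<Rightarrow> bool option list" where
  "cnf_word n F = lit_word (n, True) @ concat (map lit_word (concat (map clause_lits F)))"

text \<open>The time bound \<open>T\<close> takes the number of variables and the length of the input.\<close>

definition solves_3SAT_in_time :: "bool option tm \<Rightarrow> (nat \<Rightarrow> nat \<Rightarrow> real) \<Rightarrow> bool" where
  "solves_3SAT_in_time M T \<longleftrightarrow> wf_tm M \<and>
     (\<forall>n F. cnf3_on n F \<longrightarrow>
        (\<exists>t. real t \<le> T n (length (cnf_word n F)) \<and>
             decides_within M (cnf_word n F) t (satisfiable F)))"

text \<open>As usual, \<open>2\<^sup>o\<^sup>(\<^sup>n\<^sup>)\<close> leaves a factor polynomial in the input length implicit: without it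
  the hypothesis would hold trivially, since the number of clauses of a formula (which may be
  repeated) is not bounded in terms of \<open>n\<close>.\<close>

definition ETH :: bool where
  "ETH \<longleftrightarrow> \<not> (\<exists>M (f :: nat \<Rightarrow> real) (c :: nat). f \<in> o(\<lambda>n. real n) \<and>
     solves_3SAT_in_time M (\<lambda>n l. real c * real l ^ c * 2 powr f n))"

definition l0_norm :: "'q::zero mat \<Rightarrow> nat" where
  "l0_norm A = card {(i, j). i < dim_row A \<and> j < dim_col A \<and> A $$ (i, j) \<noteq> 0}"

text \<open>The infimum of a nonempty set of natural numbers is its minimum.\<close>

definition l0_opt :: "nat \<Rightarrow> 'q::field mat \<Rightarrow> nat" where
  "l0_opt k A = (INF (U, V) \<in> carrier_mat (dim_row A) k \<times> carrier_mat k (dim_col A).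
     l0_norm (A - U * V))"

definition l0_approx_solution ::
    "real \<Rightarrow> nat \<Rightarrow> 'q::field mat \<Rightarrow> 'q mat \<Rightarrow> 'q mat \<Rightarrow> bool" where
  "l0_approx_solution \<alpha> k A U V \<longleftrightarrow>
     U \<in> carrier_mat (dim_row A) k \<and> V \<in> carrier_mat k (dim_col A) \<and>
     real (l0_norm (A - U * V)) \<le> \<alpha> * real (l0_opt k A)"

text \<open>Matrices are written row by row, each row being terminated by \<open>None\<close>. An instance consists of
  \<open>k\<close> ticks \<open>None\<close> followed by the matrix; as there is at least one column, the first row starts with
  a symbol \<open>Some a\<close>.\<close>

definition mat_word :: "'q mat \<Rightarrow> 'q option list" where
  "mat_word A = concat (map (\<lambda>i. map (\<lambda>j. Some (A $$ (i, j))) [0..<dim_col A] @ [None])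
     [0..<dim_row A])"

definition instance_word :: "nat \<Rightarrow> 'q mat \<Rightarrow> 'q option list" where
  "instance_word k A = replicate k None @ mat_word A"

text \<open>The time bound \<open>T\<close> takes the number \<open>n\<close> of rows and the target rank \<open>k\<close>. Inputs are restricted
  to \<open>k \<le> d\<close>. For \<open>k \<ge> d\<close> the optimum is 0 and trivially attained, and for \<open>k\<close> unbounded
  in \<open>n\<close> the mere size of the output would rule out running time \<open>poly(n)\<close>.\<close>

definition l0_approx_in_time ::
    "real \<Rightarrow> 'q::{finite,field} option tm \<Rightarrow> (nat \<Rightarrow> nat \<Rightarrow> real) \<Rightarrow> bool" where
  "l0_approx_in_time \<alpha> M T \<longleftrightarrow> wf_tm M \<and>
     (\<forall>n d k. \<forall>A \<in> carrier_mat n d. d \<le> n \<and> 1 \<le> k \<and> k \<le> d \<longrightarrow>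
        (\<exists>t U V. real t \<le> T n k \<and>
           outputs_within M (instance_word k A) t (mat_word U @ mat_word V) \<and>
           l0_approx_solution \<alpha> k A U V))"

text \<open>Here \<open>c \<sqdot> n\<^sup>c\<close> with a constant \<open>c\<close> stands for \<open>poly(n)\<close>. In the second bound the factor
  \<open>poly(n)\<close> is again implicit in \<open>2 powr (k powr \<delta>)\<close>: for bounded \<open>k\<close> and growing \<open>n\<close> the bare bound
  would not even leave time to write the output.\<close>

definition poly_time :: "nat \<Rightarrow> nat \<Rightarrow> nat \<Rightarrow> real" where
  "poly_time c n k = real c * real n ^ c"

definition subexp_time :: "real \<Rightarrow> nat \<Rightarrow> nat \<Rightarrow> nat \<Rightarrow> real" where
  "subexp_time \<delta> c n k = real c * real n ^ c * 2 powr (real k powr \<delta>)"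

end

theory Submission
  imports Defs "HOL-Library.Cardinality"
begin

text \<open>For a matrix with \<open>d\<close> linearly independent columns and target rank \<open>k = d - 1\<close>, an optimal
  approximation changes the matrix so that a single vector \<open>y \<noteq> 0\<close> enters its kernel; the optimum is the
  minimum distance of the code generated by the columns. So it suffices to reduce an NP-hard problem to approximating
  the minimum distance, with an arbitrary constant gap.

  An assignment of a constraint satisfaction problem with clauses on four cells is encoded by a vector \<open>z\<close>
  of indicators, together with a homogenizing entry, and the unknown is its fourth tensor power \<open>X\<close>. The
  consistency conditions and the forbidden patterns are linear equations in \<open>X\<close>. The code consists of many
  copies of these equations and of the tensor square of an almost balanced code, applied to \<open>X\<close> as a matrix
  whose rows and columns are indexed by pairs. A solution gives a matrix of rank one, of weight about
  \<open>(1 - 1/q)\<^sup>2\<close>. If there is no solution, then either an equation is violated many times or \<open>X\<close>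
  has rank at least two, and its weight is larger by a factor of at least \<open>1 + 1/(2q)\<close>. Minimum distance is
  multiplicative under tensor powers, which amplifies the gap beyond \<open>\<alpha>\<close>.

  NP is captured by the tableau of a verifier. A formula in \<open>n\<close> variables leads to a rank
  \<open>k < (2n + 3)\<^sup>4\<^sup>t\<close> with \<open>t\<close> depending only on \<open>\<alpha>\<close> and \<open>q\<close>, so that for
  \<open>\<delta> = 1/(8t)\<close> the time \<open>2 powr (k powr \<delta>)\<close> is \<open>2\<^sup>o\<^sup>(\<^sup>n\<^sup>)\<close>. All reductions are
  computed by counter programs whose registers are bounded by a polynomial: counters can be kept in unary as head
  positions of a Turing machine.\<close>

text \<open>Rank one only says that \<open>X\<close> is a function of (i, j) times a function of (k,
  l). The equations that identify entries with the same nonzero indices let indices move between the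
  two pairs, and this forces the full fourth power of a single 0-1 vector; so a gap for the rank
  becomes a gap for an NP-hard problem. The constants fit as follows. A second independent column
  enlarges the support of an encoding by the factor 1 + 1/q. A code that is balanced up to 1/(4(q +
  1)) loses at most half of that gain. One violated equation, repeated N * N times, weighs N * N,
  and 1 is at least (1 - 1/q)^2 (1 + 1/(2q)). The approximation algorithm is a black box: the
  constructed machine runs it until it halts, reads \<open>U\<close> and \<open>V\<close> off its
  tape and compares the norm of \<open>M - U * V\<close> with an integer threshold. Neither the
  optimum nor the time bound has to be computed, but the output must be found again although the
  algorithm may leave its head anywhere; hence the head tracking.\<close>

section \<open>Counter programs and their timed semantics\<close>

datatype test = Pos nat | Sym0 nat | Sym1 nat

datatype cprog = Skip | Inc nat | Dec nat | Emit nat | Seq cprog cprog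
  | Cond test cprog cprog | Loop test cprog

text \<open>The first input word comes with its length. The second, passed separately as
  \<open>y\<close>, does not: it will be the output tape of a simulated machine, whose layout is
  known from the dimensions of the instance.\<close>

type_synonym inp = "(nat \<Rightarrow> nat) \<times> nat"

fun holds :: "inp \<Rightarrow> (nat \<Rightarrow> nat) \<Rightarrow> test \<Rightarrow> (nat \<Rightarrow> nat) \<Rightarrow> bool" where
  "holds X y (Pos r) s = (0 < s r)"
| "holds X y (Sym0 a) s = (fst X (s 0) = a)"
| "holds X y (Sym1 a) s = (y (s 1) = a)"

type_synonym cstate = "(nat \<Rightarrow> nat) \<times> nat list"

text \<open>No rule covers \<open>Dec\<close> at 0: registers will be head positions, and a step to
  the left of the marked cell would leave the representation.\<close>

inductive ex :: "inp \<Rightarrow> (nat \<Rightarrow> nat) \<Rightarrow> cprog \<Rightarrow> cstate \<Rightarrow> nat \<Rightarrow> cstate \<Rightarrow> bool"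
  for X y where
  ex_Skip: "ex X y Skip s 0 s"
| ex_Inc: "ex X y (Inc r) (s, out) 1 (s(r := Suc (s r)), out)"
| ex_Dec: "0 < s r \<Longrightarrow> ex X y (Dec r) (s, out) 1 (s(r := s r - 1), out)"
| ex_Emit: "ex X y (Emit a) (s, out) 1 (s, out @ [a])"
| ex_Seq: "ex X y p s t s' \<Longrightarrow> ex X y p' s' t' s'' \<Longrightarrow> ex X y (Seq p p') s (t + t') s''"
| ex_CondT: "holds X y b (fst s) \<Longrightarrow> ex X y p s t s' \<Longrightarrow> ex X y (Cond b p p') s (Suc t) s'"
| ex_CondF: "\<not> holds X y b (fst s) \<Longrightarrow> ex X y p' s t s' \<Longrightarrow> ex X y (Cond b p p') s (Suc t) s'"
| ex_LoopF: "\<not> holds X y b (fst s) \<Longrightarrow> ex X y (Loop b p) s 1 s"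
| ex_LoopT: "holds X y b (fst s) \<Longrightarrow> ex X y p s t s' \<Longrightarrow> ex X y (Loop b p) s' t' s'' \<Longrightarrow>
    ex X y (Loop b p) s (Suc (t + t')) s''"

definition exle :: "inp \<Rightarrow> (nat \<Rightarrow> nat) \<Rightarrow> cprog \<Rightarrow> cstate \<Rightarrow> nat \<Rightarrow> cstate \<Rightarrow> bool" where
  "exle X y p s t s' \<longleftrightarrow> (\<exists>t'\<le>t. ex X y p s t' s')"

lemma exle_mono: "exle X y p s t s' \<Longrightarrow> t \<le> t' \<Longrightarrow> exle X y p s t' s'"
  unfolding exle_def by (meson order_trans)

lemma exle_Skip: "exle X y Skip s 0 s"
  using ex_Skip unfolding exle_def by blast

lemma exle_Inc: "s' = s(r := Suc (s r)) \<Longrightarrow> exle X y (Inc r) (s, out) 1 (s', out)"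
  using ex_Inc unfolding exle_def by blast

lemma exle_Dec: "0 < s r \<Longrightarrow> s' = s(r := s r - 1) \<Longrightarrow> exle X y (Dec r) (s, out) 1 (s', out)"
  using ex_Dec unfolding exle_def by blast

lemma exle_Emit: "exle X y (Emit a) (s, out) 1 (s, out @ [a])"
  using ex_Emit unfolding exle_def by blast

lemma exle_Seq: "exle X y p s t s' \<Longrightarrow> exle X y p' s' t' s'' \<Longrightarrow> exle X y (Seq p p') s (t + t') s''"
  unfolding exle_def by (meson add_mono ex_Seq)

lemma exle_CondT: "holds X y b (fst s) \<Longrightarrow> exle X y p s t s' \<Longrightarrow> exle X y (Cond b p p') s (Suc t) s'"
  unfolding exle_def by (meson Suc_le_mono ex_CondT)

lemma exle_CondF: "\<not> holds X y b (fst s) \<Longrightarrow> exle X y p' s t s' \<Longrightarrow> exle X y (Cond b p p') s (Suc t) s'"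
  unfolding exle_def by (meson Suc_le_mono ex_CondF)

lemma exle_LoopF: "\<not> holds X y b (fst s) \<Longrightarrow> exle X y (Loop b p) s 1 s"
  unfolding exle_def by (meson ex_LoopF order_refl)

lemma exle_LoopT: "holds X y b (fst s) \<Longrightarrow> exle X y p s t s' \<Longrightarrow> exle X y (Loop b p) s' t' s'' \<Longrightarrow>
    exle X y (Loop b p) s (Suc (t + t')) s''"
  unfolding exle_def by (meson Suc_le_mono add_mono ex_LoopT)

text \<open>The invariant is the whole sequence of states \<open>s i\<close>, which suits loops
  whose effect is known exactly. The induction is on the number of remaining rounds; a round costs
  one test more than its body, and the failing test adds 1.\<close>

lemma exle_countdown:
  assumes "\<And>i. i < n \<Longrightarrow> fst (s i) r = n - i"
    and "fst (s n) r = 0"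
    and "\<And>i. i < n \<Longrightarrow> exle X y p (s i) t (s (Suc i))"
  shows "exle X y (Loop (Pos r) p) (s 0) (n * Suc t + 1) (s n)"
proof -
  have "exle X y (Loop (Pos r) p) (s (n - k)) (k * Suc t + 1) (s n)" if "k \<le> n" for k
    using that
  proof (induction k)
    case 0
    then show ?case using exle_LoopF[of X y "Pos r" "s n" p] assms(2) by simp
  next
    case (Suc k)
    have e: "Suc (n - Suc k) = n - k" using Suc.prems by simp
    have "exle X y (Loop (Pos r) p) (s (n - Suc k)) (Suc (t + (k * Suc t + 1))) (s n)"
      by (rule exle_LoopT[of _ _ _ _ _ _ "s (Suc (n - Suc k))"])
        (use assms(1)[of "n - Suc k"] assms(3)[of "n - Suc k"] Suc e in auto)
    then show ?case by (simp add: algebra_simps)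
  qed
  from this[of n] show ?thesis by simp
qed

fun regs :: "cprog \<Rightarrow> nat set" where
  "regs Skip = {}" | "regs (Inc r) = {r}" | "regs (Dec r) = {r}" | "regs (Emit a) = {}"
| "regs (Seq p q) = regs p \<union> regs q"
| "regs (Cond b p q) = (case b of Pos r \<Rightarrow> {r} | _ \<Rightarrow> {}) \<union> regs p \<union> regs q"
| "regs (Loop b p) = (case b of Pos r \<Rightarrow> {r} | _ \<Rightarrow> {}) \<union> regs p"

lemma finite_regs: "finite (regs p)"
  by (induction p) (auto split: test.splits)

section \<open>Polynomially bounded functions\<close>

text \<open>From 2 on, coefficients and sums are absorbed by a larger exponent, so one power of
  \<open>S\<close> is enough as a bound.\<close>

definition polyb :: "(nat \<Rightarrow> nat) \<Rightarrow> bool" where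
  "polyb F \<longleftrightarrow> (\<exists>c. \<forall>S\<ge>2. F S \<le> S ^ c)"

lemma polybI: "(\<And>S. 2 \<le> S \<Longrightarrow> F S \<le> S ^ c) \<Longrightarrow> polyb F"
  unfolding polyb_def by blast

lemma polyb_mono: "polyb G \<Longrightarrow> (\<And>S. 2 \<le> S \<Longrightarrow> F S \<le> G S) \<Longrightarrow> polyb F"
  unfolding polyb_def by (meson order_trans)

lemma polyb_id: "polyb (\<lambda>S. S)"
  by (rule polybI[of _ 1]) simp

lemma polyb_pow: "polyb (\<lambda>S. S ^ c)"
  by (rule polybI[of _ c]) simp

lemma polyb_const: "polyb (\<lambda>S. k)"
proof (rule polybI[of _ k])
  fix S :: nat assume "2 \<le> S"
  then have "2 ^ k \<le> S ^ k" by (simp add: power_mono)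
  moreover have "k < 2 ^ k" by (rule less_exp)
  ultimately show "k \<le> S ^ k" by linarith
qed

lemma polyb_mult:
  assumes "polyb F" "polyb G"
  shows "polyb (\<lambda>S. F S * G S)"
proof -
  obtain a b where "\<forall>S\<ge>2. F S \<le> S ^ a" "\<forall>S\<ge>2. G S \<le> S ^ b"
    using assms unfolding polyb_def by blast
  then show ?thesis by (intro polybI[of _ "a + b"]) (simp add: power_add mult_le_mono)
qed

lemma polyb_add:
  assumes "polyb F" "polyb G"
  shows "polyb (\<lambda>S. F S + G S)"
proof -
  \<comment> \<open>Sums are reduced to products: F + G is at most (F + 1) * (G + 1).\<close>
  have "polyb (\<lambda>S. (F S + 1) * (G S + 1))" if "polyb (\<lambda>S. F S + 1)" "polyb (\<lambda>S. G S + 1)"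
    using polyb_mult[OF that] by simp
  moreover have inc: "polyb (\<lambda>S. F S + 1)" if F: "polyb F" for F :: "nat \<Rightarrow> nat"
  proof -
    obtain a where a: "\<forall>S\<ge>2. F S \<le> S ^ a" using F unfolding polyb_def by blast
    show ?thesis
    proof (rule polybI[of _ "Suc a"])
      fix S :: nat assume S: "2 \<le> S"
      have "F S + 1 \<le> S ^ a + 1" using a S by simp
      also have "\<dots> \<le> 2 * S ^ a" using S by simp
      also have "\<dots> \<le> S * S ^ a" using S by (rule mult_le_mono1)
      finally show "F S + 1 \<le> S ^ Suc a" by simp
    qed
  qed
  ultimately have "polyb (\<lambda>S. (F S + 1) * (G S + 1))" using assms by blast
  then show ?thesis by (rule polyb_mono) (simp add: algebra_simps)
qed

lemma polyb_Suc: "polyb F \<Longrightarrow> polyb (\<lambda>S. Suc (F S))"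
  using polyb_add[OF _ polyb_const[of 1]] by simp

lemma polyb_power: "polyb F \<Longrightarrow> polyb (\<lambda>S. F S ^ k)"
  by (induction k) (simp_all add: polyb_const polyb_mult)

lemma polyb_max: "polyb F \<Longrightarrow> polyb G \<Longrightarrow> polyb (\<lambda>S. max (F S) (G S))"
  by (rule polyb_mono[OF polyb_add, of F G]) auto

lemmas polyb_intros = polyb_id polyb_pow polyb_const polyb_mult polyb_add polyb_Suc polyb_power polyb_max

section \<open>Functions computable by polynomial-time counter programs\<close>

type_synonym env = "nat \<Rightarrow> nat"
type_synonym cfun = "inp \<Rightarrow> (nat \<Rightarrow> nat) \<Rightarrow> env \<Rightarrow> nat"

definition bnd :: "nat \<Rightarrow> inp \<Rightarrow> env \<Rightarrow> bool" where
  "bnd S X (e :: env) \<longleftrightarrow> 2 \<le> S \<and> snd X \<le> S \<and> (\<forall>k. e k \<le> S)"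

text \<open>The bound is uniform in \<open>y\<close>: a program can only compare symbols of
  \<open>y\<close> with constants, so \<open>y\<close> never contributes to the size of a
  value.\<close>

definition pb :: "cfun \<Rightarrow> bool" where
  "pb f \<longleftrightarrow> (\<exists>c. \<forall>S X y e. bnd S X e \<longrightarrow> f X y e \<le> S ^ c)"

text \<open>The environment lives in the registers \<open>\<rho> k\<close>, the result goes to register \<open>r\<close>, and the
  registers from \<open>b\<close> on are scratch space. Registers 0 and 1 are the head positions on
  the two input words; register 2 holds the length of the first one.\<close>

definition computes :: "cprog \<Rightarrow> cfun \<Rightarrow> (nat \<Rightarrow> nat) \<Rightarrow> nat \<Rightarrow> nat \<Rightarrow> nat \<Rightarrow> bool" where
  "computes p f \<rho> r b c \<longleftrightarrow> (\<forall>X y s S out. bnd S X s \<longrightarrow> s 0 = 0 \<longrightarrow> s 1 = 0 \<longrightarrow> s 2 = snd X \<longrightarrow>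
     s r = 0 \<longrightarrow> (\<forall>i\<ge>b. s i = 0) \<longrightarrow>
     exle X y p (s, out) (S ^ c) (s(r := f X y (\<lambda>k. s (\<rho> k))), out))"

definition layout :: "(nat \<Rightarrow> nat) \<Rightarrow> nat \<Rightarrow> nat \<Rightarrow> bool" where
  "layout \<rho> r b \<longleftrightarrow> (\<forall>k. 3 \<le> \<rho> k \<and> \<rho> k < b \<and> \<rho> k \<noteq> r) \<and> 3 \<le> r \<and> r < b"

text \<open>The exponent is chosen before the layout, the program after it. Thus a subprogram can be
  moved to other registers, with a larger \<open>b\<close>, without affecting the time bound of the
  whole.\<close>

definition pc :: "cfun \<Rightarrow> bool" where
  "pc f \<longleftrightarrow> pb f \<and> (\<exists>c. \<forall>\<rho> r b. layout \<rho> r b \<longrightarrow> (\<exists>p. computes p f \<rho> r b c))"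

lemma pcI:
  assumes "pb f" "polyb T"
    and "\<And>\<rho> r b. layout \<rho> r b \<Longrightarrow> \<exists>p. \<forall>X y s S out. bnd S X s \<longrightarrow> s 0 = 0 \<longrightarrow> s 1 = 0 \<longrightarrow> s 2 = snd X \<longrightarrow>
     s r = 0 \<longrightarrow> (\<forall>i\<ge>b. s i = 0) \<longrightarrow>
     exle X y p (s, out) (T S) (s(r := f X y (\<lambda>k. s (\<rho> k))), out)"
  shows "pc f"
proof -
  obtain c where c: "\<forall>S\<ge>2. T S \<le> S ^ c" using assms(2) unfolding polyb_def by blast
  show ?thesis unfolding pc_def
  proof (rule conjI[OF assms(1)], rule exI[of _ c], intro allI impI)
    fix \<rho> :: "nat \<Rightarrow> nat" and r b assume "layout \<rho> r b"
    from assms(3)[OF this] obtain p where p: "\<forall>X y s S out. bnd S X s \<longrightarrow> s 0 = 0 \<longrightarrow> s 1 = 0 \<longrightarrow> s 2 = snd X \<longrightarrow>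
     s r = 0 \<longrightarrow> (\<forall>i\<ge>b. s i = 0) \<longrightarrow>
     exle X y p (s, out) (T S) (s(r := f X y (\<lambda>k. s (\<rho> k))), out)" ..
    show "\<exists>p. computes p f \<rho> r b c"
      unfolding computes_def
    proof (intro exI[of _ p] allI impI)
      fix X y s S out
      assume "bnd S X s" "s 0 = 0" "s 1 = 0" "s 2 = snd X" "s r = 0" "\<forall>i\<ge>b. s i = 0"
      with p have "exle X y p (s, out) (T S) (s(r := f X y (\<lambda>k. s (\<rho> k))), out)" by blast
      moreover have "T S \<le> S ^ c" using c \<open>bnd S X s\<close> unfolding bnd_def by blast
      ultimately show "exle X y p (s, out) (S ^ c) (s(r := f X y (\<lambda>k. s (\<rho> k))), out)"
        by (rule exle_mono)
    qed
  qed
qed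

lemma pc_pb: "pc f \<Longrightarrow> pb f"
  unfolding pc_def by blast

lemma pbI:
  assumes "polyb T" "\<And>S X y e. bnd S X e \<Longrightarrow> f X y e \<le> T S"
  shows "pb f"
proof -
  obtain c where "\<forall>S\<ge>2. T S \<le> S ^ c" using assms(1) unfolding polyb_def by blast
  then have "\<forall>S X y e. bnd S X e \<longrightarrow> f X y e \<le> S ^ c"
    using assms(2) unfolding bnd_def by (meson order_trans)
  then show ?thesis unfolding pb_def by blast
qed

lemma bnd_env: "bnd S X s \<Longrightarrow> bnd S X (\<lambda>k. s (\<rho> k))"
  unfolding bnd_def by blast

lemma pc_zero: "pc (\<lambda>X y e. 0)"
  by (rule pcI[OF pbI[of "\<lambda>S. 0" "\<lambda>X y e. 0"], of "\<lambda>S. 0"])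
    (auto intro!: polyb_intros exI[of _ Skip] exle_Skip simp: fun_upd_idem)

fun clear :: "nat \<Rightarrow> cprog" where "clear r = Loop (Pos r) (Dec r)"

lemma exle_clear: "s' = s(r := 0) \<Longrightarrow> exle X y (clear r) (s, out) (2 * s r + 1) (s', out)"
proof -
  assume s': "s' = s(r := 0)"
  have "exle X y (Loop (Pos r) (Dec r)) (s(r := s r - 0), out) (s r * Suc 1 + 1) (s(r := s r - s r), out)"
    by (rule exle_countdown[where s = "\<lambda>i. (s(r := s r - i), out)"]) (auto intro!: exle_Dec[unfolded One_nat_def])
  then show ?thesis using s' by (simp add: mult_2)
qed

fun move :: "nat \<Rightarrow> nat \<Rightarrow> cprog" where "move a c = Loop (Pos a) (Seq (Dec a) (Inc c))"

lemma exle_move: "a \<noteq> c \<Longrightarrow> s' = s(a := 0, c := s c + s a) \<Longrightarrow>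
  exle X y (move a c) (s, out) (3 * s a + 1) (s', out)"
proof -
  assume ac: "a \<noteq> c" and s': "s' = s(a := 0, c := s c + s a)"
  have "exle X y (Loop (Pos a) (Seq (Dec a) (Inc c))) (s(a := s a - 0, c := s c + 0), out) (s a * Suc 2 + 1)
    (s(a := s a - s a, c := s c + s a), out)"
    apply (rule exle_countdown[where s = "\<lambda>i. (s(a := s a - i, c := s c + i), out)"])
    using ac apply simp
    using ac apply simp
    subgoal for i
      apply (rule exle_mono[OF exle_Seq[OF exle_Dec exle_Inc]])
      using ac by (auto simp: fun_upd_def intro!: ext)
    done
  then show ?thesis using s' by (simp add: fun_upd_idem mult.commute)
qed

text \<open>\<open>c += a\<close>, with \<open>d\<close> as a buffer.\<close>

fun addto :: "nat \<Rightarrow> nat \<Rightarrow> nat \<Rightarrow> cprog" where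
  "addto a c d = Seq (Loop (Pos a) (Seq (Dec a) (Seq (Inc c) (Inc d)))) (move d a)"

lemma exle_addto: "a \<noteq> c \<Longrightarrow> a \<noteq> d \<Longrightarrow> c \<noteq> d \<Longrightarrow> s d = 0 \<Longrightarrow> s' = s(c := s c + s a) \<Longrightarrow>
  exle X y (addto a c d) (s, out) (7 * s a + 2) (s', out)"
proof -
  assume ac: "a \<noteq> c" "a \<noteq> d" "c \<noteq> d" "s d = 0" and s': "s' = s(c := s c + s a)"
  have 1: "exle X y (Loop (Pos a) (Seq (Dec a) (Seq (Inc c) (Inc d))))
     (s(a := s a - 0, c := s c + 0, d := 0), out) (s a * Suc 3 + 1)
    (s(a := s a - s a, c := s c + s a, d := s a), out)"
    apply (rule exle_countdown[where s = "\<lambda>i. (s(a := s a - i, c := s c + i, d := i), out)"])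
    using ac apply simp
    using ac apply simp
    subgoal for i
      apply (rule exle_mono[OF exle_Seq[OF exle_Dec exle_Seq[OF exle_Inc exle_Inc]]])
      using ac by (auto simp: fun_upd_def intro!: ext)
    done
  have 2: "exle X y (move d a) (s(a := s a - s a, c := s c + s a, d := s a), out) (3 * s a + 1) (s', out)"
    by (rule exle_mono[OF exle_move]) (use ac s' in \<open>auto simp: fun_upd_def intro!: ext\<close>)
  have "s(a := s a - 0, c := s c + 0, d := 0) = s" using ac by auto
  with exle_Seq[OF 1 2] show ?thesis by simp
qed

lemma pc_var: "pc (\<lambda>X y e. e k)"
proof (rule pcI[of _ "\<lambda>S. 7 * S + 2"])
  show "pb (\<lambda>X y e. e k)" by (rule pbI[of "\<lambda>S. S"]) (auto intro: polyb_intros simp: bnd_def)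
  show "polyb (\<lambda>S. 7 * S + 2)" by (intro polyb_intros)
  fix \<rho> :: "nat \<Rightarrow> nat" and r b assume l: "layout \<rho> r b"
  have "exle X y (addto (\<rho> k) r b) (s, out) (7 * S + 2) (s(r := s (\<rho> k)), out)"
    if "bnd S X s" "s r = 0" "\<forall>i\<ge>b. s i = 0" for X y s S out
    by (rule exle_mono[OF exle_addto])
      (use that l in \<open>auto simp: bnd_def layout_def intro: less_imp_neq dest: not_sym\<close>)
  then show "\<exists>p. \<forall>X y s S out. bnd S X s \<longrightarrow> s 0 = 0 \<longrightarrow> s 1 = 0 \<longrightarrow> s 2 = snd X \<longrightarrow>
     s r = 0 \<longrightarrow> (\<forall>i\<ge>b. s i = 0) \<longrightarrow> exle X y p (s, out) (7 * S + 2) (s(r := s (\<rho> k)), out)"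
    by blast
qed

lemma pc_len: "pc (\<lambda>X y e. snd X)"
proof (rule pcI[of _ "\<lambda>S. 7 * S + 2"])
  show "pb (\<lambda>X y e. snd X)" by (rule pbI[of "\<lambda>S. S"]) (auto intro: polyb_intros simp: bnd_def)
  show "polyb (\<lambda>S. 7 * S + 2)" by (intro polyb_intros)
  fix \<rho> :: "nat \<Rightarrow> nat" and r b assume l: "layout \<rho> r b"
  have "exle X y (addto 2 r b) (s, out) (7 * S + 2) (s(r := snd X), out)"
    if "bnd S X s" "s r = 0" "\<forall>i\<ge>b. s i = 0" "s 2 = snd X" for X y s S out
    by (rule exle_mono[OF exle_addto])
      (use that l in \<open>auto simp: bnd_def layout_def intro: less_imp_neq dest: not_sym\<close>)
  then show "\<exists>p. \<forall>X y s S out. bnd S X s \<longrightarrow> s 0 = 0 \<longrightarrow> s 1 = 0 \<longrightarrow> s 2 = snd X \<longrightarrow>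
     s r = 0 \<longrightarrow> (\<forall>i\<ge>b. s i = 0) \<longrightarrow> exle X y p (s, out) (7 * S + 2) (s(r := snd X), out)"
    by blast
qed

lemma pc_Suc:
  assumes "pc f"
  shows "pc (\<lambda>X y e. Suc (f X y e))"
proof -
  from assms obtain c d where c: "\<And>S X y e. bnd S X e \<Longrightarrow> f X y e \<le> S ^ c"
    and d: "\<And>\<rho> r b. layout \<rho> r b \<Longrightarrow> \<exists>p. computes p f \<rho> r b d"
    unfolding pc_def pb_def by blast
  show ?thesis
  proof (rule pcI[of _ "\<lambda>S. S ^ d + 1"])
    show "pb (\<lambda>X y e. Suc (f X y e))" by (rule pbI[of "\<lambda>S. Suc (S ^ c)"]) (auto intro: polyb_intros c)
    show "polyb (\<lambda>S. S ^ d + 1)" by (intro polyb_intros)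
    fix \<rho> :: "nat \<Rightarrow> nat" and r b assume l: "layout \<rho> r b"
    obtain p where p: "computes p f \<rho> r b d" using d[OF l] ..
    have "exle X y (Seq p (Inc r)) (s, out) (S ^ d + 1) (s(r := Suc (f X y (\<lambda>k. s (\<rho> k)))), out)"
      if "bnd S X s" "s 0 = 0" "s 1 = 0" "s 2 = snd X" "s r = 0" "\<forall>i\<ge>b. s i = 0" for X y s S out
      by (rule exle_Seq[OF p[unfolded computes_def, rule_format, OF that(1-5)] exle_Inc])
        (use that(6) in auto)
    then show "\<exists>p. \<forall>X y s S out. bnd S X s \<longrightarrow> s 0 = 0 \<longrightarrow> s 1 = 0 \<longrightarrow> s 2 = snd X \<longrightarrow>
     s r = 0 \<longrightarrow> (\<forall>i\<ge>b. s i = 0) \<longrightarrow> exle X y p (s, out) (S ^ d + 1) (s(r := Suc (f X y (\<lambda>k. s (\<rho> k)))), out)"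
      by blast
  qed
qed

lemma pc_rename:
  assumes "pc f"
  shows "pc (\<lambda>X y e. f X y (\<lambda>k. e (\<pi> k)))"
proof -
  from assms obtain c d where c: "\<And>S X y e. bnd S X e \<Longrightarrow> f X y e \<le> S ^ c"
    and d: "\<And>\<rho> r b. layout \<rho> r b \<Longrightarrow> \<exists>p. computes p f \<rho> r b d"
    unfolding pc_def pb_def by blast
  show ?thesis unfolding pc_def
  proof (intro conjI exI[of _ d] allI impI)
    show "pb (\<lambda>X y e. f X y (\<lambda>k. e (\<pi> k)))"
      by (rule pbI[of "\<lambda>S. S ^ c"]) (auto intro: polyb_intros c bnd_env)
    fix \<rho> :: "nat \<Rightarrow> nat" and r b assume l: "layout \<rho> r b"
    then have "layout (\<lambda>k. \<rho> (\<pi> k)) r b" unfolding layout_def by blast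
    from d[OF this] show "\<exists>p. computes p (\<lambda>X y e. f X y (\<lambda>k. e (\<pi> k))) \<rho> r b d"
      unfolding computes_def by simp
  qed
qed

text \<open>Reading symbol number \<open>h\<close> of a word: the argument, in register \<open>b\<close>, is moved to the head
  register \<open>h\<close>, and the head is returned to the start afterwards.\<close>

lemma pc_sym_aux:
  assumes "pc f" and h: "h < 2" and T: "\<And>X y s. holds X y T s = P X y (s h)"
  shows "pc (\<lambda>X y e. of_bool (P X y (f X y e)))"
proof -
  from assms(1) obtain c d where c: "\<And>S X y e. bnd S X e \<Longrightarrow> f X y e \<le> S ^ c"
    and d: "\<And>\<rho> r b. layout \<rho> r b \<Longrightarrow> \<exists>p. computes p f \<rho> r b d"
    unfolding pc_def pb_def by blast
  show ?thesis
  proof (rule pcI[of _ "\<lambda>S. S ^ d + ((3 * S ^ c + 1) + (2 + (2 * S ^ c + 1)))"])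
    show "pb (\<lambda>X y e. of_bool (P X y (f X y e)))" by (rule pbI[of "\<lambda>S. 1"]) (auto intro: polyb_intros)
    show "polyb (\<lambda>S. S ^ d + ((3 * S ^ c + 1) + (2 + (2 * S ^ c + 1))))" by (intro polyb_intros)
    fix \<rho> :: "nat \<Rightarrow> nat" and r b assume l: "layout \<rho> r b"
    then have l': "layout \<rho> b (Suc b)" unfolding layout_def by (auto simp: less_Suc_eq)
    obtain p where p: "computes p f \<rho> b (Suc b) d" using d[OF l'] ..
    define q where "q = Seq p (Seq (move b h) (Seq (Cond T (Inc r) Skip) (clear h)))"
    have "exle X y q (s, out) (S ^ d + ((3 * S ^ c + 1) + (2 + (2 * S ^ c + 1))))
        (s(r := of_bool (P X y (f X y (\<lambda>k. s (\<rho> k))))), out)"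
      if s: "bnd S X s" "s 0 = 0" "s 1 = 0" "s 2 = snd X" "s r = 0" "\<forall>i\<ge>b. s i = 0" for X y s S out
    proof -
      define v where "v = f X y (\<lambda>k. s (\<rho> k))"
      have v: "v \<le> S ^ c" unfolding v_def by (rule c) (use s bnd_env in blast)
      have h0: "s h = 0" using h s by (cases h) (auto simp: less_Suc_eq)
      have hb: "h \<noteq> b" "h \<noteq> r" "r \<noteq> b" using h l unfolding layout_def by auto
      have 1: "exle X y p (s, out) (S ^ d) (s(b := v), out)"
        using p[unfolded computes_def, rule_format, OF s(1-4)] s(6) unfolding v_def by auto
      have 2: "exle X y (move b h) (s(b := v), out) (3 * S ^ c + 1) (s(h := v), out)"
        by (rule exle_mono[OF exle_move]) (use hb h0 s v in \<open>auto simp: fun_upd_def intro!: ext\<close>)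
      have 3: "exle X y (Cond T (Inc r) Skip) (s(h := v), out) 2 (s(h := v, r := of_bool (P X y v)), out)"
      proof (cases "P X y v")
        case True
        have "exle X y (Cond T (Inc r) Skip) (s(h := v), out) (Suc 1) (s(h := v, r := of_bool (P X y v)), out)"
          by (rule exle_CondT[OF _ exle_Inc]) (use True T hb s in auto)
        then show ?thesis by (simp add: numeral_2_eq_2)
      next
        case False
        have "exle X y (Cond T (Inc r) Skip) (s(h := v), out) (Suc 0) (s(h := v), out)"
          by (rule exle_CondF[OF _ exle_Skip]) (use False T hb s in auto)
        moreover have "s(h := v, r := of_bool (P X y v)) = s(h := v)"
          using False hb s by (auto simp: fun_upd_def)
        ultimately show ?thesis using exle_mono[of X y _ _ "Suc 0" _ 2] by simp
      qed
      have 4: "exle X y (clear h) (s(h := v, r := of_bool (P X y v)), out) (2 * S ^ c + 1)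
          (s(r := of_bool (P X y v)), out)"
        by (rule exle_mono[OF exle_clear]) (use hb h0 s v in \<open>auto simp: fun_upd_def intro!: ext\<close>)
      show ?thesis unfolding q_def v_def[symmetric]
        by (rule exle_Seq[OF 1 exle_Seq[OF 2 exle_Seq[OF 3 4]]])
    qed
    then show "\<exists>p. \<forall>X y s S out. bnd S X s \<longrightarrow> s 0 = 0 \<longrightarrow> s 1 = 0 \<longrightarrow> s 2 = snd X \<longrightarrow>
     s r = 0 \<longrightarrow> (\<forall>i\<ge>b. s i = 0) \<longrightarrow> exle X y p (s, out) (S ^ d + ((3 * S ^ c + 1) + (2 + (2 * S ^ c + 1))))
       (s(r := of_bool (P X y (f X y (\<lambda>k. s (\<rho> k))))), out)"
      by blast
  qed
qed

lemma pc_sym0: "pc f \<Longrightarrow> pc (\<lambda>X y e. of_bool (fst X (f X y e) = a))"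
  by (rule pc_sym_aux[of f 0 "Sym0 a" "\<lambda>X y i. fst X i = a"]) auto

lemma pc_sym1: "pc f \<Longrightarrow> pc (\<lambda>X y e. of_bool (y (f X y e) = a))"
  by (rule pc_sym_aux[of f 1 "Sym1 a" "\<lambda>X y i. y i = a"]) auto

text \<open>The step function finds the counter in \<open>e 0\<close> and the accumulator in \<open>e 1\<close>.\<close>

lemma pc_rec:
  assumes f: "pc (\<lambda>X y e. f X y (e 0) (e 1) (\<lambda>k. e (k + 2)))" and a: "pc a" and n: "pc n"
    and T: "polyb T"
    and bound: "\<And>S X y e i. bnd S X e \<Longrightarrow> i \<le> n X y e \<Longrightarrow>
      rec_nat (a X y e) (\<lambda>i acc. f X y i acc e) i \<le> T S"
  shows "pc (\<lambda>X y e. rec_nat (a X y e) (\<lambda>i acc. f X y i acc e) (n X y e))"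
proof -
  from f obtain cf where cf: "\<And>\<rho> r b. layout \<rho> r b \<Longrightarrow>
      \<exists>p. computes p (\<lambda>X y e. f X y (e 0) (e 1) (\<lambda>k. e (k + 2))) \<rho> r b cf"
    unfolding pc_def by blast
  from a obtain ca where ca: "\<And>\<rho> r b. layout \<rho> r b \<Longrightarrow> \<exists>p. computes p a \<rho> r b ca"
    unfolding pc_def by blast
  from n obtain cn vn where cn: "\<And>\<rho> r b. layout \<rho> r b \<Longrightarrow> \<exists>p. computes p n \<rho> r b cn"
    and vn: "\<And>S X y e. bnd S X e \<Longrightarrow> n X y e \<le> S ^ vn"
    unfolding pc_def pb_def by blast
  from T obtain ct where ct: "\<And>S. 2 \<le> S \<Longrightarrow> T S \<le> S ^ ct" unfolding polyb_def by blast
  \<comment> \<open>Inside the loop the registers also hold the accumulator and the counters, so the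
    step program runs within its bound for \<open>U S\<close> rather than for \<open>S\<close>. The
    accumulator is small only by hypothesis, as primitive recursion may grow exponentially.\<close>
  define U where "U = (\<lambda>S::nat. S + S ^ ct + S ^ vn)"
  define B where "B = (\<lambda>S::nat. (U S) ^ cf + ((2 * S ^ ct + 1) + ((3 * S ^ ct + 1) + (1 + 1))))"
  define TT where "TT = (\<lambda>S::nat. S ^ ca + ((U S) ^ cn + ((S ^ vn * Suc (B S) + 1) + (2 * S ^ vn + 1))))"
  show ?thesis
  proof (rule pcI)
    show "pb (\<lambda>X y e. rec_nat (a X y e) (\<lambda>i acc. f X y i acc e) (n X y e))"
      by (rule pbI[OF T]) (use bound in auto)
    show "polyb TT" unfolding TT_def B_def U_def by (intro polyb_intros)
    fix \<rho> :: "nat \<Rightarrow> nat" and r b assume l: "layout \<rho> r b"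
    have l1: "3 \<le> \<rho> k" "\<rho> k < b" "\<rho> k \<noteq> r" "r \<noteq> \<rho> k" for k
      using l unfolding layout_def by metis+
    have l2: "3 \<le> r" "r < b" using l unfolding layout_def by auto
    \<comment> \<open>Register \<open>b\<close> counts down and controls the loop,
      \<open>Suc b\<close> counts up and is the index seen by the step function, \<open>r\<close>
      holds the accumulator, and \<open>b + 2\<close> receives its next value.\<close>
    define \<rho>' where "\<rho>' = (\<lambda>k. case k of 0 \<Rightarrow> Suc b | Suc 0 \<Rightarrow> r | Suc (Suc k) \<Rightarrow> \<rho> k)"
    have \<rho>'s: "\<rho>' 0 = Suc b" "\<rho>' (Suc 0) = r" "\<rho>' (Suc (Suc k)) = \<rho> k" for k
      unfolding \<rho>'_def by auto
    have ln: "layout \<rho> b (Suc b)"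
      unfolding layout_def using l1 l2 by (simp add: less_SucI less_imp_neq)
    have "3 \<le> \<rho>' k \<and> \<rho>' k < b + 3 \<and> \<rho>' k \<noteq> b + 2" for k
    proof (cases k)
      case (Suc k')
      then show ?thesis using l1(1,2)[of "k' - 1"] l2 \<rho>'s by (cases k') auto
    qed (use l2 \<rho>'s in auto)
    then have lf: "layout \<rho>' (b + 2) (b + 3)" unfolding layout_def using l2 by simp
    obtain pn where pn: "computes pn n \<rho> b (Suc b) cn" using cn[OF ln] ..
    obtain pa where pa: "computes pa a \<rho> r b ca" using ca[OF l] ..
    obtain pf where pf: "computes pf (\<lambda>X y e. f X y (e 0) (e 1) (\<lambda>k. e (k + 2))) \<rho>' (b + 2) (b + 3) cf"
      using cf[OF lf] ..
    define body where "body = Seq pf (Seq (clear r) (Seq (move (b + 2) r) (Seq (Inc (Suc b)) (Dec b))))"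
    define p where "p = Seq pa (Seq pn (Seq (Loop (Pos b) body) (clear (Suc b))))"
    have "exle X y p (s, out) (TT S)
       (s(r := rec_nat (a X y (\<lambda>k. s (\<rho> k))) (\<lambda>i acc. f X y i acc (\<lambda>k. s (\<rho> k))) (n X y (\<lambda>k. s (\<rho> k)))), out)"
      if s: "bnd S X s" "s 0 = 0" "s 1 = 0" "s 2 = snd X" "s r = 0" "\<forall>i\<ge>b. s i = 0" for X y s S out
    proof -
      define e where "e = (\<lambda>k. s (\<rho> k))"
      define N where "N = n X y e"
      define R where "R = rec_nat (a X y e) (\<lambda>i acc. f X y i acc e)"
      have S2: "2 \<le> S" and sS: "s k \<le> S" and XS: "snd X \<le> S" for k using s(1) unfolding bnd_def by auto
      have be: "bnd S X e" unfolding e_def by (rule bnd_env[OF s(1)])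
      have RS: "R i \<le> S ^ ct" if "i \<le> N" for i
        using bound[OF be, of i y] that ct[OF S2] unfolding R_def N_def by (meson order_trans)
      have NS: "N \<le> S ^ vn" unfolding N_def by (rule vn[OF be])
      have SU: "S \<le> U S" "S ^ ct \<le> U S" "S ^ vn \<le> U S" unfolding U_def by auto
      have R0: "R 0 = a X y e" and RSuc: "R (Suc i) = f X y i (R i) e" for i unfolding R_def by auto
      have 1: "exle X y pa (s, out) (S ^ ca) (s(r := R 0), out)"
        using pa[unfolded computes_def] s unfolding R0 e_def by blast
      have bU: "bnd (U S) X (s(r := R 0))"
        unfolding bnd_def using S2 sS XS SU RS[of 0] by (auto intro: order_trans)
      have 2: "exle X y pn (s(r := R 0), out) (U S ^ cn) (s(r := R 0, b := N), out)"
        using pn[unfolded computes_def, rule_format, OF bU, of y out] s l1 l2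
        unfolding N_def e_def by auto
      define st where "st = (\<lambda>i. s(r := R i, b := N - i, Suc b := i))"
      have st_other: "st i j = s j" if "j \<noteq> r" "j \<noteq> b" "j \<noteq> Suc b" for i j
        using that unfolding st_def by auto
      have rb: "r \<noteq> b" "r \<noteq> Suc b" using l2 by auto
      have st_b: "st i b = N - i" "st i (Suc b) = i" "st i r = R i" for i
        using rb unfolding st_def by auto
      have step: "exle X y body (st i, out) (B S) (st (Suc i), out)" if i: "i < N" for i
      proof -
        have bst: "bnd (U S) X (st i)"
          unfolding bnd_def st_def using S2 sS XS SU RS[of i] NS i by (auto intro: order_trans)
        have env: "(\<lambda>k. st i (\<rho>' (k + 2))) = e"
        proof
          fix k
          show "st i (\<rho>' (k + 2)) = e k"
            unfolding e_def using l1(2,3)[of k] \<rho>'s(3)[of k] by (subst st_other) auto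
        qed
        have a1: "exle X y pf (st i, out) (U S ^ cf) ((st i)(b + 2 := R (Suc i)), out)"
        proof -
          have "exle X y pf (st i, out) (U S ^ cf)
             ((st i)(b + 2 := f X y (st i (\<rho>' 0)) (st i (\<rho>' 1)) (\<lambda>k. st i (\<rho>' (k + 2)))), out)"
            by (rule pf[unfolded computes_def, rule_format, OF bst])
              (use s l2 in \<open>auto simp: st_def\<close>)
          then show ?thesis unfolding env RSuc using \<rho>'s st_b by simp
        qed
        have a2: "exle X y (clear r) ((st i)(b + 2 := R (Suc i)), out) (2 * S ^ ct + 1)
            ((st i)(b + 2 := R (Suc i), r := 0), out)"
          by (rule exle_mono[OF exle_clear]) (use RS[of i] i l2 in \<open>auto simp: st_b\<close>)
        have a3: "exle X y (move (b + 2) r) ((st i)(b + 2 := R (Suc i), r := 0), out) (3 * S ^ ct + 1)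
            ((st i)(r := R (Suc i)), out)"
          by (rule exle_mono[OF exle_move])
            (use RS[of "Suc i"] i l2 s in \<open>auto simp: st_def fun_upd_def intro!: ext\<close>)
        have a4: "exle X y (Inc (Suc b)) ((st i)(r := R (Suc i)), out) 1
            ((st i)(r := R (Suc i), Suc b := Suc i), out)"
          by (rule exle_Inc) (use rb in \<open>auto simp: st_b\<close>)
        have a5: "exle X y (Dec b) ((st i)(r := R (Suc i), Suc b := Suc i), out) 1 (st (Suc i), out)"
          by (rule exle_Dec) (use i rb in \<open>auto simp: st_def\<close>)
        show ?thesis unfolding body_def B_def
          by (rule exle_Seq[OF a1 exle_Seq[OF a2 exle_Seq[OF a3 exle_Seq[OF a4 a5]]]])
      qed
      have 3: "exle X y (Loop (Pos b) body) (st 0, out) (N * Suc (B S) + 1) (st N, out)"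
        by (rule exle_countdown[where s = "\<lambda>i. (st i, out)"]) (use step st_b in auto)
      have st0: "st 0 = s(r := R 0, b := N)" by (rule ext) (use s rb in \<open>auto simp: st_def\<close>)
      have 4: "exle X y (clear (Suc b)) (st N, out) (2 * N + 1) (s(r := R N), out)"
      proof (rule exle_mono[OF exle_clear])
        show "s(r := R N) = (st N)(Suc b := 0)"
          by (rule ext) (use s rb in \<open>auto simp: st_def\<close>)
      qed (simp add: st_b)
      have "exle X y p (s, out) (S ^ ca + (U S ^ cn + ((N * Suc (B S) + 1) + (2 * N + 1)))) (s(r := R N), out)"
        unfolding p_def by (rule exle_Seq[OF 1 exle_Seq[OF 2 exle_Seq[OF 3[unfolded st0] 4]]])
      moreover have "S ^ ca + (U S ^ cn + ((N * Suc (B S) + 1) + (2 * N + 1))) \<le> TT S"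
        unfolding TT_def using NS by (intro add_mono mult_le_mono) auto
      ultimately show ?thesis unfolding R_def N_def e_def by (rule exle_mono)
    qed
    then show "\<exists>p. \<forall>X y s S out. bnd S X s \<longrightarrow> s 0 = 0 \<longrightarrow> s 1 = 0 \<longrightarrow> s 2 = snd X \<longrightarrow>
     s r = 0 \<longrightarrow> (\<forall>i\<ge>b. s i = 0) \<longrightarrow>
     exle X y p (s, out) (TT S) (s(r := rec_nat (a X y (\<lambda>k. s (\<rho> k))) (\<lambda>i acc. f X y i acc (\<lambda>k. s (\<rho> k))) (n X y (\<lambda>k. s (\<rho> k)))), out)"
      by blast
  qed
qed

text \<open>An additional argument of polynomial size is harmless: apply the bound of
  \<open>h\<close> with a power of \<open>S\<close> in place of \<open>S\<close>. The exponent is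
  \<open>Suc a\<close> so that the power dominates \<open>S\<close> itself as well.\<close>

lemma pb_shift:
  assumes "pb g" "pb (\<lambda>X y e. h X y (e 0) (\<lambda>k. e (Suc k)))"
  shows "\<exists>c. \<forall>S X y e v. bnd S X e \<longrightarrow> v \<le> g X y e \<longrightarrow> h X y v e \<le> S ^ c"
proof -
  obtain a b where a: "\<And>S X y e. bnd S X e \<Longrightarrow> g X y e \<le> S ^ a"
    and b: "\<And>S X y e. bnd S X e \<Longrightarrow> h X y (e 0) (\<lambda>k. e (Suc k)) \<le> S ^ b"
    using assms unfolding pb_def by blast
  have "h X y v e \<le> S ^ (Suc a * b)" if "bnd S X e" "v \<le> g X y e" for S X y e v
  proof -
    have S: "2 \<le> S" "snd X \<le> S" and e: "e k \<le> S" for k using that(1) unfolding bnd_def by auto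
    have le: "S \<le> S ^ Suc a" "S ^ a \<le> S ^ Suc a" using S by auto
    have "bnd (S ^ Suc a) X (case_nat v e)" unfolding bnd_def
      using S e a[OF that(1), of y] that(2) le
      by (auto split: nat.split simp del: power_Suc intro: order_trans)
    from b[OF this, of y] show ?thesis by (simp add: power_mult del: power_Suc mult_Suc)
  qed
  then show ?thesis by blast
qed

text \<open>Binding a value is a recursion of exactly one round that starts with this value as
  accumulator. General composition comes from here.\<close>

lemma pc_let:
  assumes g: "pc g" and h: "pc (\<lambda>X y e. h X y (e 0) (\<lambda>k. e (Suc k)))"
  shows "pc (\<lambda>X y e. h X y (g X y e) e)"
proof -
  obtain c where c: "\<And>S X y e v. bnd S X e \<Longrightarrow> v \<le> g X y e \<Longrightarrow> h X y v e \<le> S ^ c"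
    using pb_shift[OF pc_pb[OF g] pc_pb[OF h]] by blast
  obtain d where d: "\<And>S X y e. bnd S X e \<Longrightarrow> g X y e \<le> S ^ d"
    using pc_pb[OF g] unfolding pb_def by blast
  have "pc (\<lambda>X y e. rec_nat (g X y e) (\<lambda>i acc. h X y acc e) 1)"
  proof (rule pc_rec[where T = "\<lambda>S. S ^ c + S ^ d"])
    show "pc (\<lambda>X y e. h X y (e 1) (\<lambda>k. e (k + 2)))"
      using pc_rename[OF h, of Suc] by simp
    show "pc (\<lambda>X y e. 1)" using pc_Suc[OF pc_zero] by simp
    fix S X y e and i :: nat assume "bnd S X e" "i \<le> 1"
    then show "rec_nat (g X y e) (\<lambda>i acc. h X y acc e) i \<le> S ^ c + S ^ d"
      using c[of S X e "g X y e" y] d[of S X e y] by (cases i) auto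
  qed (use g in \<open>auto intro: polyb_intros\<close>)
  then show ?thesis by simp
qed

lemma pc_comp1:
  assumes "pc (\<lambda>X y e. F X y (e 0))" "pc f"
  shows "pc (\<lambda>X y e. F X y (f X y e))"
  by (rule pc_let[where h = "\<lambda>X y v e. F X y v", OF assms(2,1)])

lemma pc_const: "pc (\<lambda>X y e. n)"
  by (induction n) (auto intro: pc_zero pc_Suc)

lemma pbE: "pb f \<Longrightarrow> (\<And>c. (\<And>S X y e. bnd S X e \<Longrightarrow> f X y e \<le> S ^ c) \<Longrightarrow> thesis) \<Longrightarrow> thesis"
  unfolding pb_def by blast

lemma pc_add:
  assumes "pc f" "pc g"
  shows "pc (\<lambda>X y e. f X y e + g X y e)"
proof -
  obtain a b where a: "\<And>S X y e. bnd S X e \<Longrightarrow> f X y e \<le> S ^ a"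
    and b: "\<And>S X y e. bnd S X e \<Longrightarrow> g X y e \<le> S ^ b"
    using pbE[OF pc_pb[OF assms(1)]] pbE[OF pc_pb[OF assms(2)]] by metis
  have r: "rec_nat u (\<lambda>i acc. Suc acc) v = u + v" for u v by (induction v) auto
  have "pc (\<lambda>X y e. rec_nat (f X y e) (\<lambda>i acc. Suc acc) (g X y e))"
    apply (rule pc_rec[where T = "\<lambda>S. S ^ a + S ^ b"])
         apply (intro pc_Suc pc_var)
        apply (rule assms(1))
       apply (rule assms(2))
      apply (intro polyb_intros)
    unfolding r using a b by (meson add_mono order_trans)
  then show ?thesis by (simp only: r)
qed

lemma pc_mult:
  assumes "pc f" "pc g"
  shows "pc (\<lambda>X y e. f X y e * g X y e)"
proof -
  obtain a b where a: "\<And>S X y e. bnd S X e \<Longrightarrow> f X y e \<le> S ^ a"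
    and b: "\<And>S X y e. bnd S X e \<Longrightarrow> g X y e \<le> S ^ b"
    using pbE[OF pc_pb[OF assms(1)]] pbE[OF pc_pb[OF assms(2)]] by metis
  have r: "rec_nat 0 (\<lambda>i acc. acc + u) v = v * u" for u v :: nat by (induction v) auto
  have "pc (\<lambda>X y e. rec_nat 0 (\<lambda>i acc. acc + g X y e) (f X y e))"
    apply (rule pc_rec[where T = "\<lambda>S. S ^ a * S ^ b"])
         apply (intro pc_add pc_var pc_rename[OF assms(2)])
        apply (rule pc_zero)
       apply (rule assms(1))
      apply (intro polyb_intros)
    unfolding r using a b by (meson mult_le_mono order_trans)
  then show ?thesis by (simp only: r)
qed

lemma pc_pred:
  assumes "pc f"
  shows "pc (\<lambda>X y e. f X y e - 1)"
proof -
  obtain a where a: "\<And>S X y e. bnd S X e \<Longrightarrow> f X y e \<le> S ^ a"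
    using pbE[OF pc_pb[OF assms]] by metis
  have r: "rec_nat 0 (\<lambda>i acc. i) v = v - 1" for v :: nat by (induction v) auto
  have "pc (\<lambda>X y e. rec_nat 0 (\<lambda>i acc. i) (f X y e))"
  proof (rule pc_rec[where T = "\<lambda>S. S ^ a"])
    fix S X y e i assume "bnd S X e" "i \<le> f X y e"
    with a[of S X e y] show "rec_nat 0 (\<lambda>i acc. i) i \<le> S ^ a" by (simp add: r)
  qed (auto intro: polyb_intros pc_var pc_zero assms)
  then show ?thesis by (simp only: r)
qed

lemma pc_diff:
  assumes "pc f" "pc g"
  shows "pc (\<lambda>X y e. f X y e - g X y e)"
proof -
  obtain a where a: "\<And>S X y e. bnd S X e \<Longrightarrow> f X y e \<le> S ^ a"
    using pbE[OF pc_pb[OF assms(1)]] by metis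
  have r: "rec_nat u (\<lambda>i acc. acc - 1) v = u - v" for u v :: nat by (induction v) auto
  have "pc (\<lambda>X y e. rec_nat (f X y e) (\<lambda>i acc. acc - 1) (g X y e))"
  proof (rule pc_rec[where T = "\<lambda>S. S ^ a"])
    fix S X y e and i :: nat assume "bnd S X e"
    with a[of S X e y] show "rec_nat (f X y e) (\<lambda>i acc. acc - 1) i \<le> S ^ a" unfolding r by linarith
  qed (use assms in \<open>auto intro: polyb_intros pc_var pc_pred[unfolded One_nat_def]\<close>)
  then show ?thesis by (simp only: r)
qed

lemma pc_power: "pc f \<Longrightarrow> pc (\<lambda>X y e. f X y e ^ n)"
proof (induction n)
  case 0
  then show ?case using pc_const[of 1] by simp
next
  case (Suc n)
  then show ?case using pc_mult[OF Suc.prems Suc.IH[OF Suc.prems]] by simp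
qed

lemma pc_sum:
  assumes f: "pc (\<lambda>X y e. f X y (e 0) (\<lambda>k. e (Suc k)))" and n: "pc n"
  shows "pc (\<lambda>X y e. \<Sum>i<n X y e. f X y i e)"
proof -
  obtain c where c: "\<And>S X y e v. bnd S X e \<Longrightarrow> v \<le> n X y e \<Longrightarrow> f X y v e \<le> S ^ c"
    using pb_shift[OF pc_pb[OF n] pc_pb[OF f]] by blast
  obtain d where d: "\<And>S X y e. bnd S X e \<Longrightarrow> n X y e \<le> S ^ d"
    using pbE[OF pc_pb[OF n]] by metis
  have r: "rec_nat 0 (\<lambda>i acc. acc + g i) v = (\<Sum>i<v. g i)" for v :: nat and g :: "nat \<Rightarrow> nat"
    by (induction v) auto
  have f': "pc (\<lambda>X y e. f X y (e 0) (\<lambda>k. e (k + 2)))"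
    using pc_rename[OF f, of "\<lambda>k. case k of 0 \<Rightarrow> 0 | Suc k \<Rightarrow> k + 2"] by simp
  have "pc (\<lambda>X y e. rec_nat 0 (\<lambda>i acc. acc + f X y i e) (n X y e))"
  proof (rule pc_rec[where T = "\<lambda>S. S ^ d * S ^ c"])
    fix S X y e i assume b: "bnd S X e" and i: "i \<le> n X y e"
    have "(\<Sum>j<i. f X y j e) \<le> (\<Sum>j<i. S ^ c)" by (intro sum_mono c b) (use i in auto)
    also have "\<dots> \<le> S ^ d * S ^ c" using i d[OF b, of y] by (simp add: mult_le_mono)
    finally show "rec_nat 0 (\<lambda>i acc. acc + f X y i e) i \<le> S ^ d * S ^ c" by (simp add: r)
  qed (use f' n in \<open>auto intro: polyb_intros pc_add pc_var pc_zero\<close>)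
  then show ?thesis by (simp only: r)
qed

section \<open>Computable predicates, division and finite tables\<close>

type_synonym cpred = "inp \<Rightarrow> (nat \<Rightarrow> nat) \<Rightarrow> env \<Rightarrow> bool"

definition pcb :: "cpred \<Rightarrow> bool" where
  "pcb P \<longleftrightarrow> pc (\<lambda>X y e. of_bool (P X y e))"

lemma pc_of_bool: "pcb P \<Longrightarrow> pc (\<lambda>X y e. of_bool (P X y e))"
  unfolding pcb_def .

lemma pcb_word0: "pc f \<Longrightarrow> pcb (\<lambda>X y e. fst X (f X y e) = a)"
  unfolding pcb_def by (rule pc_sym0)

lemma pcb_word1: "pc f \<Longrightarrow> pcb (\<lambda>X y e. y (f X y e) = a)"
  unfolding pcb_def by (rule pc_sym1)

lemma pcb_const: "pcb (\<lambda>X y e. P)"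
  unfolding pcb_def by (rule pc_const)

lemma pcb_not: "pcb P \<Longrightarrow> pcb (\<lambda>X y e. \<not> P X y e)"
proof -
  assume "pcb P"
  then have "pc (\<lambda>X y e. 1 - of_bool (P X y e))"
    unfolding pcb_def by (rule pc_diff[OF pc_const])
  moreover have "1 - of_bool (P X y e) = (of_bool (\<not> P X y e) :: nat)" for X y e by simp
  ultimately show ?thesis unfolding pcb_def by simp
qed

lemma pcb_conj: "pcb P \<Longrightarrow> pcb Q \<Longrightarrow> pcb (\<lambda>X y e. P X y e \<and> Q X y e)"
  unfolding pcb_def of_bool_conj by (rule pc_mult)

lemma pcb_disj: assumes "pcb P" "pcb Q" shows "pcb (\<lambda>X y e. P X y e \<or> Q X y e)"
proof -
  have "pcb (\<lambda>X y e. \<not> (\<not> P X y e \<and> \<not> Q X y e))" by (intro pcb_not pcb_conj assms)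
  then show ?thesis by (simp only: de_Morgan_conj not_not)
qed

lemma pcb_imp: assumes "pcb P" "pcb Q" shows "pcb (\<lambda>X y e. P X y e \<longrightarrow> Q X y e)"
  unfolding imp_conv_disj by (intro pcb_not pcb_disj assms)

lemma pcb_le: assumes "pc f" "pc g" shows "pcb (\<lambda>X y e. f X y e \<le> g X y e)"
proof -
  have "of_bool (f X y e \<le> g X y e) = 1 - (f X y e - g X y e)" for X y e by auto
  then show ?thesis unfolding pcb_def using assms by (auto intro: pc_diff pc_const[of 1, simplified])
qed

lemma pcb_less: assumes "pc f" "pc g" shows "pcb (\<lambda>X y e. f X y e < g X y e)"
  unfolding Suc_le_eq[symmetric] by (intro pcb_le pc_Suc assms)

lemma pcb_eq: assumes "pc f" "pc g" shows "pcb (\<lambda>X y e. f X y e = g X y e)"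
  unfolding eq_iff by (intro pcb_conj pcb_le assms)

lemma pc_if: "pcb P \<Longrightarrow> pc f \<Longrightarrow> pc g \<Longrightarrow> pc (\<lambda>X y e. if P X y e then f X y e else g X y e)"
proof -
  assume "pcb P" "pc f" "pc g"
  then have "pc (\<lambda>X y e. of_bool (P X y e) * f X y e + of_bool (\<not> P X y e) * g X y e)"
    by (intro pc_add pc_mult pc_of_bool pcb_not)
  moreover have "of_bool (P X y e) * f X y e + of_bool (\<not> P X y e) * g X y e =
      (if P X y e then f X y e else g X y e)" for X y e by auto
  ultimately show ?thesis by simp
qed

lemma pcb_If:
  assumes "pcb P" "pcb Q" "pcb R"
  shows "pcb (\<lambda>X y e. if P X y e then Q X y e else R X y e)"
  unfolding if_bool_eq_conj by (intro pcb_conj pcb_imp pcb_not assms)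

lemma pcb_all:
  assumes "pcb (\<lambda>X y e. P X y (e 0) (\<lambda>k. e (Suc k)))" "pc n"
  shows "pcb (\<lambda>X y e. \<forall>i<n X y e. P X y i e)"
proof -
  have "pc (\<lambda>X y e. \<Sum>i<n X y e. of_bool (\<not> P X y i e))"
    by (rule pc_sum[OF pc_of_bool[OF pcb_not[OF assms(1)]] assms(2)])
  from pcb_eq[OF this pc_zero] show ?thesis by (rule back_subst[of pcb]) (auto intro!: ext)
qed

lemma pcb_ex:
  assumes "pcb (\<lambda>X y e. P X y (e 0) (\<lambda>k. e (Suc k)))" "pc n"
  shows "pcb (\<lambda>X y e. \<exists>i<n X y e. P X y i e)"
proof -
  have "pcb (\<lambda>X y e. \<not> (\<forall>i<n X y e. \<not> P X y i e))" by (intro pcb_not pcb_all assms)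
  then show ?thesis by simp
qed

text \<open>The quotient counts the positive multiples of \<open>b\<close> up to \<open>a\<close>,
  so division needs only a bounded sum.\<close>

lemma div_eq_sum: "0 < b \<Longrightarrow> a div b = (\<Sum>i<a. of_bool (Suc i * b \<le> a))" for a b :: nat
proof -
  assume b: "0 < b"
  have "Suc i * b \<le> a \<longleftrightarrow> i < a div b" for i
    using less_eq_div_iff_mult_less_eq[OF b, of "Suc i" a] by (simp add: Suc_le_eq)
  moreover have "i < a" if "i < a div b" for i using that by (rule less_le_trans) simp
  ultimately have "{..<a} \<inter> {i. Suc i * b \<le> a} = {..<a div b}" by auto
  then show ?thesis by (simp add: sum_of_bool_eq del: mult_Suc)
qed

lemma pc_div: assumes "pc f" "pc g" shows "pc (\<lambda>X y e. f X y e div g X y e)"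
proof -
  have "pc (\<lambda>X y e. (if g X y e = 0 then 0 else \<Sum>i<f X y e. of_bool (Suc i * g X y e \<le> f X y e)))"
    by (intro pc_if pcb_eq pc_zero assms pc_sum pc_of_bool pcb_le pc_mult pc_Suc pc_var pc_rename[OF assms(1)] pc_rename[OF assms(2)])
  moreover have "(if g X y e = 0 then 0 else \<Sum>i<f X y e. of_bool (Suc i * g X y e \<le> f X y e)) = f X y e div g X y e" for X y e
    using div_eq_sum[of "g X y e" "f X y e"] by auto
  ultimately show ?thesis by simp
qed

lemma pc_mod: "pc f \<Longrightarrow> pc g \<Longrightarrow> pc (\<lambda>X y e. f X y e mod g X y e)"
  unfolding modulo_nat_def by (intro pc_diff pc_mult pc_div)

text \<open>The branches are hard-wired, so \<open>f\<close> may depend on the index in an arbitrary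
  way. Field operations and the local condition on tiles enter the programs like this.\<close>

lemma pc_fin:
  assumes g: "pc g" and f: "\<And>a. a < K \<Longrightarrow> pc (f a)"
  shows "pc (\<lambda>X y e. if g X y e < K then f (g X y e) X y e else 0)"
  using f
proof (induction K)
  case 0
  then show ?case by (simp add: pc_zero)
next
  case (Suc K)
  have "pc (\<lambda>X y e. if g X y e = K then f K X y e else if g X y e < K then f (g X y e) X y e else 0)"
    by (intro pc_if pcb_eq g pc_const Suc.IH Suc.prems) auto
  moreover have "(if g X y e = K then f K X y e else if g X y e < K then f (g X y e) X y e else 0) =
      (if g X y e < Suc K then f (g X y e) X y e else 0)" for X y e by auto
  ultimately show ?case by simp
qed

lemma pc_fin':
  assumes g: "pc g" and f: "\<And>a. a < K \<Longrightarrow> pc (f a)" and "\<And>X y e. g X y e < K"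
  shows "pc (\<lambda>X y e. f (g X y e) X y e)"
  using pc_fin[of g K f, OF g f] assms(3) by simp

lemma pcb_fin:
  assumes g: "pcb g" and f: "\<And>a. pc (f a)"
  shows "pc (\<lambda>X y e. f (g X y e) X y e)"
proof -
  have "pc (\<lambda>X y e. if g X y e then f True X y e else f False X y e)"
    by (intro pc_if g f)
  then show ?thesis by (rule back_subst[of pc]) (auto intro!: ext)
qed

lemmas pc_intros = pc_const pc_var pc_len pc_Suc pc_add pc_mult pc_diff pc_power pc_sum pc_of_bool
  pcb_word0 pcb_word1 pcb_const pcb_not pcb_conj pcb_disj pcb_imp pcb_le pcb_less pcb_eq pc_if pcb_If pcb_all pcb_ex
  pc_div pc_mod

section \<open>Machine fragments\<close>

text \<open>Machines over the symbols \<open>nat\<close>, with 0 as the blank, and infinitely many tapes.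
  A fragment with \<open>n\<close> states starts in state 0 and ends in state \<open>n\<close>.\<close>

type_synonym ntape = "(int \<Rightarrow> nat) \<times> int"
type_synonym ntapes = "nat \<Rightarrow> ntape"
type_synonym acts = "nat \<Rightarrow> nat \<times> move"
type_synonym frag = "nat \<times> (nat \<Rightarrow> (nat \<Rightarrow> nat) \<Rightarrow> nat \<times> acts)"

definition rd :: "ntapes \<Rightarrow> nat \<Rightarrow> nat" where
  "rd T i = fst (T i) (snd (T i))"

definition nact :: "nat \<times> move \<Rightarrow> ntape \<Rightarrow> ntape" where
  "nact a tp = ((fst tp)(snd tp := fst a), snd tp + offset (snd a))"

definition apply_acts :: "acts \<Rightarrow> ntapes \<Rightarrow> ntapes" where
  "apply_acts as T = (\<lambda>i. nact (as i) (T i))"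

definition fstep :: "frag \<Rightarrow> nat \<times> ntapes \<Rightarrow> nat \<times> ntapes" where
  "fstep F c = (if fst c < fst F
     then (fst (snd F (fst c) (rd (snd c))), apply_acts (snd (snd F (fst c) (rd (snd c)))) (snd c))
     else c)"

definition reach :: "frag \<Rightarrow> nat \<Rightarrow> nat \<times> ntapes \<Rightarrow> nat \<times> ntapes \<Rightarrow> bool" where
  "reach F t c c' \<longleftrightarrow> (\<exists>t'\<le>t. (fstep F ^^ t') c = c')"

definition exec :: "frag \<Rightarrow> ntapes \<Rightarrow> nat \<Rightarrow> ntapes \<Rightarrow> bool" where
  "exec F T t T' \<longleftrightarrow> reach F t (0, T) (fst F, T')"

definition stay :: "(nat \<Rightarrow> nat) \<Rightarrow> acts" where
  "stay rs i = (rs i, Stay)"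

lemma nact_stay [simp]: "nact (rd T i, Stay) (T i) = T i"
  by (simp add: nact_def rd_def offset_def)

lemma apply_stay [simp]: "apply_acts (stay (rd T)) T = T"
  by (simp add: apply_acts_def stay_def)

lemma reach_refl: "reach F t c c"
  unfolding reach_def by (rule exI[of _ 0]) simp

lemma reach_step: "reach F (Suc t) c (fstep F c)"
  unfolding reach_def by (rule exI[of _ 1]) simp

lemma reach_mono: "reach F t c c' \<Longrightarrow> t \<le> t' \<Longrightarrow> reach F t' c c'"
  unfolding reach_def by (auto intro: order_trans)

lemma reach1: "fstep F c = c' \<Longrightarrow> reach F 1 c c'"
  using reach_step[of F 0 c] by simp

lemma reach_trans: "reach F t c c' \<Longrightarrow> reach F t' c' c'' \<Longrightarrow> reach F (t + t') c c''"
proof -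
  assume "reach F t c c'" "reach F t' c' c''"
  then obtain a b where "a \<le> t" "(fstep F ^^ a) c = c'" "b \<le> t'" "(fstep F ^^ b) c' = c''"
    unfolding reach_def by blast
  then have "b + a \<le> t + t'" "(fstep F ^^ (b + a)) c = c''" by (auto simp: funpow_add)
  then show ?thesis unfolding reach_def by blast
qed

lemma exec_mono: "exec F T t T' \<Longrightarrow> t \<le> t' \<Longrightarrow> exec F T t' T'"
  unfolding exec_def by (rule reach_mono)

text \<open>\<open>\<phi>\<close> embeds the states of a fragment into a larger one. Only nonfinal
  states must be simulated, so the exit can be sent wherever the compound continues, for instance
  back to the head of a loop.\<close>

lemma reach_sim:
  assumes "reach F t (q, T) (q', T')"
    and sim: "\<And>q rs. q < fst F \<Longrightarrow> \<phi> q < fst G \<and> snd G (\<phi> q) rs = (\<phi> (fst (snd F q rs)), snd (snd F q rs))"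
  shows "reach G t (\<phi> q, T) (\<phi> q', T')"
proof -
  have "reach G t (\<phi> q, T) (\<phi> (fst ((fstep F ^^ t) (q, T))), snd ((fstep F ^^ t) (q, T)))" for t
  proof (induction t)
    case 0
    then show ?case by (simp add: reach_refl)
  next
    case (Suc t)
    define c where "c = (fstep F ^^ t) (q, T)"
    have "reach G 1 (\<phi> (fst c), snd c) (\<phi> (fst (fstep F c)), snd (fstep F c))"
    proof (cases "fst c < fst F")
      case True
      then have "fstep G (\<phi> (fst c), snd c) = (\<phi> (fst (fstep F c)), snd (fstep F c))"
        using sim[OF True] by (simp add: fstep_def)
      then show ?thesis using reach_step[of G 0 "(\<phi> (fst c), snd c)"] by simp
    next
      case False
      then show ?thesis by (simp add: fstep_def reach_refl)
    qed
    from reach_trans[OF Suc.IH[folded c_def] this] show ?case by (simp add: c_def)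
  qed
  note * = this
  obtain u where u: "u \<le> t" "(fstep F ^^ u) (q, T) = (q', T')" using assms(1) unfolding reach_def by blast
  from *[of u] have "reach G u (\<phi> q, T) (\<phi> q', T')" by (simp add: u(2))
  then show ?thesis using u(1) by (rule reach_mono)
qed

definition prim :: "((nat \<Rightarrow> nat) \<Rightarrow> acts) \<Rightarrow> frag" where
  "prim f = (1, \<lambda>q rs. (1, f rs))"

lemma exec_prim: "exec (prim f) T 1 (apply_acts (f (rd T)) T)"
  unfolding exec_def using reach_step[of "prim f" 0 "(0, T)"] by (simp add: fstep_def prim_def)

definition nop :: frag where
  "nop = (0, \<lambda>q rs. (0, stay rs))"

lemma exec_nop: "exec nop T 0 T"
  unfolding exec_def nop_def by (simp add: reach_refl)

definition seqF :: "frag \<Rightarrow> frag \<Rightarrow> frag" where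
  "seqF F G = (fst F + fst G, \<lambda>q rs. if q < fst F then snd F q rs
     else (fst F + fst (snd G (q - fst F) rs), snd (snd G (q - fst F) rs)))"

lemma exec_seq:
  assumes "exec F T t T'" "exec G T' t' T''"
  shows "exec (seqF F G) T (t + t') T''"
proof -
  have 1: "reach (seqF F G) t (0, T) (fst F, T')"
    by (rule reach_sim[OF assms(1)[unfolded exec_def], of id, simplified]) (simp add: seqF_def)
  have 2: "reach (seqF F G) t' (fst F + 0, T') (fst F + fst G, T'')"
    by (rule reach_sim[OF assms(2)[unfolded exec_def], of "\<lambda>q. fst F + q"]) (simp add: seqF_def)
  from reach_trans[OF 1 2[simplified]] show ?thesis by (simp add: exec_def seqF_def)
qed

definition whlF :: "((nat \<Rightarrow> nat) \<Rightarrow> bool) \<Rightarrow> frag \<Rightarrow> frag" where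
  "whlF P F = (let \<phi> = (\<lambda>q. if q < fst F then Suc q else 0) in
     (Suc (fst F), \<lambda>q rs. if q = 0 then (if P rs then \<phi> 0 else Suc (fst F), stay rs)
       else (\<phi> (fst (snd F (q - 1) rs)), snd (snd F (q - 1) rs))))"

lemma exec_whl_done: "\<not> P (rd T) \<Longrightarrow> exec (whlF P F) T 1 T"
  unfolding exec_def by (rule reach1) (simp add: fstep_def whlF_def Let_def)

lemma exec_whl_step:
  assumes "P (rd T)" "exec F T t T'" "exec (whlF P F) T' t' T''"
  shows "exec (whlF P F) T (Suc (t + t')) T''"
proof -
  define \<phi> where "\<phi> = (\<lambda>q. if q < fst F then Suc q else 0)"
  have 1: "reach (whlF P F) 1 (0, T) (\<phi> 0, T)"
    by (rule reach1) (use assms(1) in \<open>simp add: fstep_def whlF_def Let_def \<phi>_def\<close>)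
  have 2: "reach (whlF P F) t (\<phi> 0, T) (\<phi> (fst F), T')"
    by (rule reach_sim[OF assms(2)[unfolded exec_def]]) (auto simp: whlF_def Let_def \<phi>_def)
  have "\<phi> (fst F) = 0" by (simp add: \<phi>_def)
  with reach_trans[OF reach_trans[OF 1 2]] assms(3) show ?thesis unfolding exec_def by fastforce
qed

definition iteF :: "((nat \<Rightarrow> nat) \<Rightarrow> bool) \<Rightarrow> frag \<Rightarrow> frag \<Rightarrow> frag" where
  "iteF P F G = (let E = 1 + fst F + fst G; \<phi> = (\<lambda>q. if q < fst F then Suc q else E); \<psi> = (\<lambda>q. 1 + fst F + q) in
     (E, \<lambda>q rs. if q = 0 then (if P rs then \<phi> 0 else \<psi> 0, stay rs)
       else if q \<le> fst F then (\<phi> (fst (snd F (q - 1) rs)), snd (snd F (q - 1) rs))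
       else (\<psi> (fst (snd G (q - 1 - fst F) rs)), snd (snd G (q - 1 - fst F) rs))))"

lemma exec_ite:
  assumes "if P (rd T) then exec F T t T' else exec G T t T'"
  shows "exec (iteF P F G) T (Suc t) T'"
proof (cases "P (rd T)")
  case True
  define \<phi> where "\<phi> = (\<lambda>q. if q < fst F then Suc q else 1 + fst F + fst G)"
  have 1: "reach (iteF P F G) 1 (0, T) (\<phi> 0, T)"
    by (rule reach1) (use True in \<open>simp add: fstep_def iteF_def Let_def \<phi>_def\<close>)
  have "exec F T t T'" using assms True by simp
  then have 2: "reach (iteF P F G) t (\<phi> 0, T) (\<phi> (fst F), T')" unfolding exec_def
    by (rule reach_sim) (auto simp: iteF_def Let_def \<phi>_def)
  from reach_trans[OF 1 2] show ?thesis by (simp add: \<phi>_def exec_def iteF_def Let_def)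
next
  case False
  define \<phi> where "\<phi> = (\<lambda>q. 1 + fst F + q)"
  have 1: "reach (iteF P F G) 1 (0, T) (\<phi> 0, T)"
    by (rule reach1) (use False in \<open>simp add: fstep_def iteF_def Let_def \<phi>_def\<close>)
  have "exec G T t T'" using assms False by simp
  then have 2: "reach (iteF P F G) t (\<phi> 0, T) (\<phi> (fst G), T')" unfolding exec_def
    by (rule reach_sim) (auto simp: iteF_def Let_def \<phi>_def)
  from reach_trans[OF 1 2] show ?thesis by (simp add: \<phi>_def exec_def iteF_def Let_def)
qed

text \<open>The conditions under which a fragment, which formally has infinitely many tapes and
  symbols, is a machine with \<open>K\<close> tapes and \<open>A\<close> symbols.\<close>

definition fok :: "nat \<Rightarrow> nat \<Rightarrow> frag \<Rightarrow> bool" where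
  "fok K A F \<longleftrightarrow> (\<forall>q rs. q < fst F \<longrightarrow> fst (snd F q rs) \<le> fst F \<and>
     (\<forall>i\<ge>K. snd (snd F q rs) i = (rs i, Stay)) \<and>
     ((\<forall>i. rs i < A) \<longrightarrow> (\<forall>i. fst (snd (snd F q rs) i) < A)))"

lemma fok_prim:
  "(\<And>rs i. K \<le> i \<Longrightarrow> f rs i = (rs i, Stay)) \<Longrightarrow>
   (\<And>rs i. (\<And>j. rs j < A) \<Longrightarrow> fst (f rs i) < A) \<Longrightarrow> fok K A (prim f)"
  unfolding fok_def prim_def by auto

lemma fok_nop: "fok K A nop"
  unfolding fok_def nop_def by auto

lemma fok_seq: "fok K A F \<Longrightarrow> fok K A G \<Longrightarrow> fok K A (seqF F G)"
  unfolding fok_def seqF_def by (auto simp: trans_le_add1 less_diff_conv2 not_less)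

lemma fok_whl: "fok K A F \<Longrightarrow> fok K A (whlF P F)"
  unfolding fok_def whlF_def Let_def by (auto simp: stay_def)

lemma fok_ite: "fok K A F \<Longrightarrow> fok K A G \<Longrightarrow> fok K A (iteF P F G)"
  unfolding fok_def
proof (intro allI impI)
  fix q rs
  let ?H = "iteF P F G"
  define E where "E = 1 + fst F + fst G"
  assume F: "\<forall>q rs. q < fst F \<longrightarrow> fst (snd F q rs) \<le> fst F \<and> (\<forall>i\<ge>K. snd (snd F q rs) i = (rs i, Stay)) \<and>
     ((\<forall>i. rs i < A) \<longrightarrow> (\<forall>i. fst (snd (snd F q rs) i) < A))"
    and G: "\<forall>q rs. q < fst G \<longrightarrow> fst (snd G q rs) \<le> fst G \<and> (\<forall>i\<ge>K. snd (snd G q rs) i = (rs i, Stay)) \<and>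
     ((\<forall>i. rs i < A) \<longrightarrow> (\<forall>i. fst (snd (snd G q rs) i) < A))"
    and q: "q < fst ?H"
  have E: "fst ?H = E" by (simp add: iteF_def Let_def E_def)
  consider "q = 0" | "0 < q" "q - 1 < fst F" | "fst F < q" "q - 1 - fst F < fst G"
    using q unfolding E E_def by linarith
  then show "fst (snd ?H q rs) \<le> fst ?H \<and> (\<forall>i\<ge>K. snd (snd ?H q rs) i = (rs i, Stay)) \<and>
     ((\<forall>i. rs i < A) \<longrightarrow> (\<forall>i. fst (snd (snd ?H q rs) i) < A))"
  proof cases
    case 2
    then have "q \<le> fst F" by linarith
    with 2 F[rule_format, of "q - 1" rs] show ?thesis by (auto simp: iteF_def Let_def)
  next
    case 3
    with G[rule_format, of "q - 1 - fst F" rs] show ?thesis by (auto simp: iteF_def Let_def)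
  qed (auto simp: iteF_def Let_def stay_def)
qed

section \<open>Compiling counter programs\<close>

text \<open>Register \<open>r\<close> is the head position on tape \<open>cb + r\<close>, whose cell 0 is marked by 1.
  Registers 0 and 1 move the heads on the input words along.\<close>

locale tape_layout =
  fixes w ot cb nr :: nat
  assumes dist: "0 < w" "0 < ot" "w \<noteq> ot" "w < cb" "ot < cb" and nr: "3 \<le> nr"
begin

definition lead :: "nat \<Rightarrow> nat \<Rightarrow> bool" where
  "lead r i \<longleftrightarrow> i = cb + r \<or> r = 0 \<and> i = 0 \<or> r = 1 \<and> i = w"

fun tst :: "test \<Rightarrow> (nat \<Rightarrow> nat) \<Rightarrow> bool" where
  "tst (Pos r) rs = (rs (cb + r) \<noteq> 1)"
| "tst (Sym0 a) rs = (rs 0 = a)"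
| "tst (Sym1 a) rs = (rs w = a)"

fun cpl :: "cprog \<Rightarrow> frag" where
  "cpl Skip = nop"
| "cpl (Inc r) = prim (\<lambda>rs i. (rs i, if lead r i then Rightwards else Stay))"
| "cpl (Dec r) = prim (\<lambda>rs i. (rs i, if lead r i then Leftwards else Stay))"
| "cpl (Emit a) = prim (\<lambda>rs i. if i = ot then (a, Rightwards) else (rs i, Stay))"
| "cpl (Seq p p') = seqF (cpl p) (cpl p')"
| "cpl (Cond b p p') = iteF (tst b) (cpl p) (cpl p')"
| "cpl (Loop b p) = whlF (tst b) (cpl p)"

definition rep :: "ntapes \<Rightarrow> cstate \<Rightarrow> ntapes" where
  "rep T s = (\<lambda>i. if i = 0 then (fst (T 0), int (fst s 0)) else
     if i = w then (fst (T w), int (fst s 1)) else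
     if i = ot then (\<lambda>p. if 0 \<le> p \<and> p < int (length (snd s)) then snd s ! nat p else fst (T ot) p, int (length (snd s))) else
     if cb \<le> i \<and> i < cb + nr then (\<lambda>p. if p = 0 then 1 else 0, int (fst s (i - cb))) else T i)"

lemma tst_rep:
  assumes "\<And>p. fst X p = fst (T 0) (int p)" "\<And>p. y p = fst (T w) (int p)"
    "\<And>r. b = Pos r \<Longrightarrow> r < nr"
  shows "tst b (rd (rep T s)) = holds X y b (fst s)"
  using assms dist by (cases b) (auto simp: rd_def rep_def)

lemma apply_lead:
  assumes "r < nr" "int v = int (s r) + offset m"
  shows "apply_acts (\<lambda>i. (rd (rep T (s, out)) i, if lead r i then m else Stay)) (rep T (s, out)) =
    rep T (s(r := v), out)"
proof
  fix i
  have st: "offset Stay = 0" by (simp add: offset_def)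
  consider "i = 0" | "i = w" | "i = ot" | "i \<noteq> 0" "i \<noteq> w" "i \<noteq> ot" "cb \<le> i \<and> i < cb + nr"
    | "i \<noteq> 0" "i \<noteq> w" "i \<noteq> ot" "\<not> (cb \<le> i \<and> i < cb + nr)" by blast
  then show "apply_acts (\<lambda>i. (rd (rep T (s, out)) i, if lead r i then m else Stay)) (rep T (s, out)) i =
    rep T (s(r := v), out) i"
  proof cases
    case 4
    have "lead r i \<longleftrightarrow> i - cb = r" using 4 by (auto simp: lead_def)
    with 4 assms(2) st show ?thesis by (auto simp: apply_acts_def nact_def rd_def rep_def)
  next
    case 5
    then have "\<not> lead r i" using assms(1) by (auto simp: lead_def)
    with 5 st show ?thesis by (auto simp: apply_acts_def nact_def rd_def rep_def)
  qed (use dist assms st in \<open>auto simp: apply_acts_def nact_def rd_def rep_def lead_def\<close>)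
qed

lemma exec_cpl:
  assumes "\<And>p. fst X p = fst (T 0) (int p)" "\<And>p. y p = fst (T w) (int p)"
  shows "ex X y p s t s' \<Longrightarrow> regs p \<subseteq> {..<nr} \<Longrightarrow> exec (cpl p) (rep T s) t (rep T s')"
proof (induction rule: ex.induct)
  case (ex_Skip s)
  then show ?case by (simp add: exec_nop)
next
  case (ex_Inc r s out)
  then show ?case
    using exec_prim[of "\<lambda>rs i. (rs i, if lead r i then Rightwards else Stay)" "rep T (s, out)"]
    by (subst (asm) apply_lead[where v = "Suc (s r)"]) (auto simp: offset_def)
next
  case (ex_Dec s r out)
  then show ?case
    using exec_prim[of "\<lambda>rs i. (rs i, if lead r i then Leftwards else Stay)" "rep T (s, out)"]
    by (subst (asm) apply_lead[where v = "s r - 1"]) (auto simp: offset_def)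
next
  case (ex_Emit a s out)
  have "apply_acts (\<lambda>i. if i = ot then (a, Rightwards) else (rd (rep T (s, out)) i, Stay)) (rep T (s, out)) =
      rep T (s, out @ [a])"
    using dist by (auto simp: apply_acts_def nact_def rd_def rep_def offset_def nth_append fun_eq_iff)
  then show ?case
    using exec_prim[of "\<lambda>rs i. if i = ot then (a, Rightwards) else (rs i, Stay)" "rep T (s, out)"] by simp
next
  case (ex_Seq p s t s' p' t' s'')
  then show ?case by (simp add: exec_seq)
next
  case (ex_CondT b s p t s' p')
  then have "tst b (rd (rep T s)) = holds X y b (fst s)" by (intro tst_rep assms) auto
  with ex_CondT show ?case by (auto intro!: exec_ite)
next
  case (ex_CondF b s p' t s' p)
  then have "tst b (rd (rep T s)) = holds X y b (fst s)" by (intro tst_rep assms) auto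
  with ex_CondF show ?case by (auto intro!: exec_ite)
next
  case (ex_LoopF b s p)
  then have "tst b (rd (rep T s)) = holds X y b (fst s)" by (intro tst_rep assms) auto
  with ex_LoopF show ?case by (auto intro!: exec_whl_done[unfolded One_nat_def])
next
  case (ex_LoopT b s p t s' t' s'')
  then have "tst b (rd (rep T s)) = holds X y b (fst s)" by (intro tst_rep assms) auto
  with ex_LoopT show ?case by (auto intro!: exec_whl_step)
qed

lemma exec_cpl_le:
  assumes "\<And>p. fst X p = fst (T 0) (int p)" "\<And>p. y p = fst (T w) (int p)"
    and "exle X y p s t s'" "regs p \<subseteq> {..<nr}"
  shows "exec (cpl p) (rep T s) t (rep T s')"
  using assms(3) exec_cpl[OF assms(1,2) _ assms(4)] exec_mono unfolding exle_def by blast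

end

fun emits :: "cprog \<Rightarrow> nat set" where
  "emits (Emit a) = {a}"
| "emits (Seq p q) = emits p \<union> emits q"
| "emits (Cond b p q) = emits p \<union> emits q"
| "emits (Loop b p) = emits p"
| "emits _ = {}"

lemma finite_emits: "finite (emits p)"
  by (induction p) auto

lemma (in tape_layout) fok_cpl:
  "regs p \<subseteq> {..<nr} \<Longrightarrow> emits p \<subseteq> {..<A} \<Longrightarrow> cb + nr \<le> K \<Longrightarrow> fok K A (cpl p)"
proof (induction p)
  case (Cond b p p')
  then show ?case by (auto intro!: fok_ite)
next
  case (Inc r)
  then show ?case using dist by (auto intro!: fok_prim simp: lead_def)
next
  case (Dec r)
  then show ?case using dist by (auto intro!: fok_prim simp: lead_def)
next
  case (Emit a)
  then show ?case using dist by (auto intro!: fok_prim)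
qed (auto intro!: fok_seq fok_whl fok_nop)

section \<open>Turing machines as fragments and back\<close>

definition idx :: "'a::finite \<Rightarrow> nat" where
  "idx = (SOME f. bij_betw f UNIV {..<CARD('a)})"

lemma bij_idx: "bij_betw (idx :: 'a::finite \<Rightarrow> nat) UNIV {..<CARD('a)}"
  unfolding idx_def using ex_bij_betw_finite_nat[of "UNIV :: 'a set"]
  by (intro someI_ex[of "\<lambda>f. bij_betw f UNIV {..<CARD('a)}"]) (simp add: atLeast0LessThan)

lemma idx_less: "idx (x :: 'a::finite) < CARD('a)"
  using bij_idx bij_betwE by blast

lemma idx_inj: "idx (x :: 'a::finite) = idx y \<longleftrightarrow> x = y"
  using bij_idx by (auto simp: bij_betw_def inj_on_def)

fun code :: "'a::finite symb \<Rightarrow> nat" where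
  "code Blank = 0"
| "code (Sym a) = Suc (idx a)"
| "code (Aux i :: 'a symb) = Suc (CARD('a) + i)"

definition dcd :: "nat \<Rightarrow> 'a::finite symb" where
  "dcd = inv_into UNIV code"

lemma bij_code: "bij (code :: 'a::finite symb \<Rightarrow> nat)"
proof (rule bijI)
  show "inj (code :: 'a symb \<Rightarrow> nat)"
  proof (rule injI)
    fix x y :: "'a symb" assume "code x = code y"
    moreover have "idx a \<noteq> CARD('a) + i" for a :: 'a and i using idx_less[of a] by simp
    ultimately show "x = y" by (cases x; cases y) (auto simp: idx_inj dest: not_sym)
  qed
  show "surj (code :: 'a symb \<Rightarrow> nat)"
  proof (rule surjI)
    fix n
    show "code (if n = 0 then Blank else if n - 1 < CARD('a) then Sym (inv_into UNIV (idx :: 'a \<Rightarrow> nat) (n - 1))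
      else Aux (n - 1 - CARD('a)) :: 'a symb) = n"
      using bij_betw_inv_into_right[OF bij_idx[where ?'a = 'a], of "n - 1"] by auto
  qed
qed

lemma code_dcd [simp]: "code (dcd n :: 'a::finite symb) = n"
  unfolding dcd_def by (rule surj_f_inv_f[OF bij_is_surj[OF bij_code]])

lemma dcd_code [simp]: "dcd (code s) = s"
  unfolding dcd_def by (rule inv_f_f[OF bij_is_inj[OF bij_code]])

lemma dcd_0 [simp]: "dcd 0 = Blank"
  by (metis code.simps(1) dcd_code)

lemma code_eq_iff [simp]: "code s = code s' \<longleftrightarrow> s = s'"
  by (metis dcd_code)

lemma alphabet_code: "s \<in> alphabet M \<longleftrightarrow> code (s :: 'a::finite symb) < Suc (CARD('a) + auxs M)"
  unfolding alphabet_def using idx_less[where ?'a = 'a] by (cases s) (auto intro: trans_less_add1 less_SucI)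

definition enc_tape :: "'a::finite tape \<Rightarrow> ntape" where
  "enc_tape tp = (\<lambda>p. code (fst tp p), snd tp)"

definition wcont :: "'a::finite list \<Rightarrow> int \<Rightarrow> nat" where
  "wcont x p = (if 0 \<le> p \<and> p < int (length x) then code (Sym (x ! nat p)) else 0)"

lemma enc_input: "enc_tape (input_tape x) = (wcont x, 0)"
  unfolding enc_tape_def input_tape_def wcont_def by auto

definition blank :: ntape where "blank = (\<lambda>_. 0, 0)"

lemma enc_act: "enc_tape (act a tp) = nact (code (fst a), snd a) (enc_tape tp)"
  unfolding enc_tape_def act_def nact_def by auto

definition ini :: "'a::finite list \<Rightarrow> ntapes" where
  "ini x = (\<lambda>i. if i = 0 then (wcont x, 0) else blank)"

text \<open>The embedded machine spends one extra step on halting, to write its verdict on tape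
  \<open>fl\<close>. Well-formedness says nothing about reads outside the alphabet of
  \<open>M\<close>; leaving at once in this case gives \<open>fok\<close> for larger
  alphabets.\<close>

definition embM :: "'b::finite tm \<Rightarrow> nat \<Rightarrow> nat \<Rightarrow> frag" where
  "embM M off fl = (states M, \<lambda>q rs.
     let ss = map (\<lambda>j. dcd (rs (off + j))) [0..<tapes M] in
     if set ss \<subseteq> alphabet M then
       (case delta M q ss of
          None \<Rightarrow> (states M, \<lambda>i. (if i = fl then of_bool (q \<in> accepting M) else rs i, Stay))
        | Some (q', as) \<Rightarrow> (q', \<lambda>i. if off \<le> i \<and> i < off + tapes M
             then (code (fst (as ! (i - off))), snd (as ! (i - off))) else (rs i, Stay)))
     else (states M, stay rs))"

definition put :: "nat \<Rightarrow> 'b::finite tape list \<Rightarrow> ntapes \<Rightarrow> ntapes" where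
  "put off ts T = (\<lambda>i. if off \<le> i \<and> i < off + length ts then enc_tape (ts ! (i - off)) else T i)"

definition okcfg :: "'b::finite tm \<Rightarrow> 'b config \<Rightarrow> bool" where
  "okcfg M c \<longleftrightarrow> fst c < states M \<and> length (snd c) = tapes M \<and> (\<forall>tp \<in> set (snd c). \<forall>p. fst tp p \<in> alphabet M)"

lemma okcfg_init: "wf_tm M \<Longrightarrow> okcfg M (init_config M x)"
  unfolding okcfg_def init_config_def wf_tm_def
  by (auto simp: input_tape_def alphabet_def)

lemma okcfg_reads:
  assumes "okcfg M c"
  shows "map (\<lambda>j. dcd (rd (put off (snd c) T) (off + j))) [0..<tapes M] = map read_tape (snd c)"
    "set (map read_tape (snd c)) \<subseteq> alphabet M"
  using assms unfolding okcfg_def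
  by (auto intro!: nth_equalityI simp: rd_def put_def enc_tape_def read_tape_def)

lemma okcfg_step:
  assumes "wf_tm M" "okcfg M c"
  shows "okcfg M (tm_step M c)"
proof (cases "delta M (fst c) (map read_tape (snd c))")
  case None
  then show ?thesis using assms by (simp add: tm_step_def)
next
  case (Some r)
  obtain q' as where r: "r = (q', as)" by fastforce
  have "q' < states M \<and> length as = tapes M \<and> fst ` set as \<subseteq> alphabet M"
    using assms(1)[unfolded wf_tm_def] okcfg_reads(2)[OF assms(2)] assms(2)[unfolded okcfg_def] Some r
    by (metis length_map)
  moreover have "fst (act a tp) p \<in> alphabet M" if "(a, tp) \<in> set (zip as (snd c))" for a tp p
  proof -
    have "fst a \<in> alphabet M" "\<forall>p. fst tp p \<in> alphabet M"
      using set_zip_leftD[OF that] set_zip_rightD[OF that] calculation assms(2) unfolding okcfg_def by auto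
    then show ?thesis by (auto simp: act_def)
  qed
  ultimately show ?thesis using Some r assms(2) unfolding okcfg_def
    by (auto simp: tm_step_def)
qed

lemma okcfg_run: "wf_tm M \<Longrightarrow> okcfg M (run M x t)"
  unfolding run_def by (induction t) (auto simp: okcfg_init okcfg_step)

lemma embM_step:
  assumes "wf_tm M" "okcfg M c" "\<not> halted M c"
  shows "fstep (embM M off fl) (fst c, put off (snd c) T) = (fst (tm_step M c), put off (snd (tm_step M c)) T)"
proof -
  obtain q' as where r: "delta M (fst c) (map read_tape (snd c)) = Some (q', as)"
    using assms(3) unfolding halted_def by fastforce
  have l: "length as = tapes M" "length (snd c) = tapes M" "fst c < states M"
    using assms(1)[unfolded wf_tm_def] okcfg_reads(2)[OF assms(2)] assms(2)[unfolded okcfg_def] r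
    by (metis length_map)+
  have "snd (embM M off fl) (fst c) (rd (put off (snd c) T)) = (q', \<lambda>i. if off \<le> i \<and> i < off + tapes M
             then (code (fst (as ! (i - off))), snd (as ! (i - off))) else (rd (put off (snd c) T) i, Stay))"
    unfolding embM_def Let_def snd_conv okcfg_reads(1)[OF assms(2)]
    using okcfg_reads(2)[OF assms(2)] r by simp
  then have "fstep (embM M off fl) (fst c, put off (snd c) T) = (q', apply_acts (\<lambda>i. if off \<le> i \<and> i < off + tapes M
             then (code (fst (as ! (i - off))), snd (as ! (i - off))) else (rd (put off (snd c) T) i, Stay)) (put off (snd c) T))"
    using l by (simp add: fstep_def) (simp add: embM_def)
  moreover have "apply_acts (\<lambda>i. if off \<le> i \<and> i < off + tapes M
             then (code (fst (as ! (i - off))), snd (as ! (i - off))) else (rd (put off (snd c) T) i, Stay)) (put off (snd c) T)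
     = put off (map2 act as (snd c)) T"
    using l by (auto simp: apply_acts_def put_def enc_act fun_eq_iff nact_def rd_def offset_def)
  ultimately show ?thesis using r by (simp add: tm_step_def)
qed

lemma embM_halt:
  assumes "okcfg M c" "halted M c" "\<not> (off \<le> fl \<and> fl < off + tapes M)"
  shows "fstep (embM M off fl) (fst c, put off (snd c) T) = (states M, put off (snd c)
     (T(fl := ((fst (T fl))(snd (T fl) := of_bool (fst c \<in> accepting M)), snd (T fl)))))"
proof -
  have l: "length (snd c) = tapes M" "fst c < states M" using assms(1) by (auto simp: okcfg_def)
  have "snd (embM M off fl) (fst c) (rd (put off (snd c) T)) = (states M, \<lambda>i.
      (if i = fl then of_bool (fst c \<in> accepting M) else rd (put off (snd c) T) i, Stay))"
    unfolding embM_def Let_def snd_conv okcfg_reads(1)[OF assms(1)]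
    using okcfg_reads(2)[OF assms(1)] assms(2) by (simp add: halted_def)
  then have "fstep (embM M off fl) (fst c, put off (snd c) T) = (states M, apply_acts (\<lambda>i.
      (if i = fl then of_bool (fst c \<in> accepting M) else rd (put off (snd c) T) i, Stay)) (put off (snd c) T))"
    using l by (simp add: fstep_def) (simp add: embM_def)
  moreover have "apply_acts (\<lambda>i.
      (if i = fl then of_bool (fst c \<in> accepting M) else rd (put off (snd c) T) i, Stay)) (put off (snd c) T) =
      put off (snd c) (T(fl := ((fst (T fl))(snd (T fl) := of_bool (fst c \<in> accepting M)), snd (T fl))))"
    using l assms(3) by (auto simp: apply_acts_def put_def fun_eq_iff nact_def rd_def offset_def)
  ultimately show ?thesis by simp
qed

lemma exec_embM:
  assumes "wf_tm M" "halted M (run M x t)" "\<not> (off \<le> fl \<and> fl < off + tapes M)"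
  shows "exec (embM M off fl) (put off (snd (init_config M x)) T) (Suc t) (put off (snd (run M x t))
     (T(fl := ((fst (T fl))(snd (T fl) := of_bool (fst (run M x t) \<in> accepting M)), snd (T fl)))))"
proof -
  have "reach (embM M off fl) u (0, put off (snd (init_config M x)) T) (fst (run M x u), put off (snd (run M x u)) T)" for u
  proof (induction u)
    case 0
    then show ?case by (simp add: run_def init_config_def reach_refl)
  next
    case (Suc u)
    have "reach (embM M off fl) 1 (fst (run M x u), put off (snd (run M x u)) T)
       (fst (run M x (Suc u)), put off (snd (run M x (Suc u))) T)"
    proof (cases "halted M (run M x u)")
      case True
      then have "run M x (Suc u) = run M x u" by (simp add: run_def tm_step_def halted_def)
      then show ?thesis by (simp add: reach_refl)
    next
      case False
      show ?thesis
        by (rule reach1) (use embM_step[OF assms(1) okcfg_run[OF assms(1)] False] in \<open>simp add: run_def\<close>)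
    qed
    from reach_trans[OF Suc.IH this] show ?case by simp
  qed
  from reach_trans[OF this[of t] reach1[OF embM_halt[OF okcfg_run[OF assms(1)] assms(2,3)]]]
  show ?thesis by (simp add: exec_def embM_def)
qed

lemma fok_embM:
  assumes "wf_tm M" "off + tapes M \<le> K" "fl < K" "Suc (CARD('b) + auxs M) \<le> A" "2 \<le> A"
  shows "fok K A (embM (M :: 'b::finite tm) off fl)"
  unfolding fok_def
proof (intro allI impI)
  fix q rs assume q: "q < fst (embM M off fl)"
  define ss where "ss = map (\<lambda>j. dcd (rs (off + j)) :: 'b symb) [0..<tapes M]"
  show "fst (snd (embM M off fl) q rs) \<le> fst (embM M off fl) \<and>
       (\<forall>i\<ge>K. snd (snd (embM M off fl) q rs) i = (rs i, Stay)) \<and>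
       ((\<forall>i. rs i < A) \<longrightarrow> (\<forall>i. fst (snd (snd (embM M off fl) q rs) i) < A))"
  proof (cases "set ss \<subseteq> alphabet M \<and> delta M q ss \<noteq> None")
    case True
    then obtain q' as where r: "delta M q ss = Some (q', as)" by auto
    have *: "q' < states M" "length as = tapes M" "fst ` set as \<subseteq> alphabet M"
      using assms(1)[unfolded wf_tm_def] True r q unfolding embM_def ss_def
      by (metis (no_types, lifting) fst_conv length_map length_upt minus_nat.diff_0)+
    have "code (fst (as ! j)) < A" if "j < tapes M" for j
    proof -
      have "fst (as ! j) \<in> alphabet M" using * that by (metis image_eqI nth_mem subsetD)
      then show ?thesis using assms(4) by (simp add: alphabet_code)
    qed
    then show ?thesis using True r * assms(2,3)
      by (auto simp: embM_def ss_def[symmetric] Let_def stay_def)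
  next
    case False
    have "snd (embM M off fl) q rs = (if set ss \<subseteq> alphabet M then
       (case delta M q ss of
          None \<Rightarrow> (states M, \<lambda>i. (if i = fl then of_bool (q \<in> accepting M) else rs i, Stay))
        | Some (q', as) \<Rightarrow> (q', \<lambda>i. if off \<le> i \<and> i < off + tapes M
             then (code (fst (as ! (i - off))), snd (as ! (i - off))) else (rs i, Stay)))
     else (states M, stay rs))" by (simp add: embM_def ss_def Let_def)
    then have "snd (embM M off fl) q rs = (states M, \<lambda>i. (if i = fl then of_bool (q \<in> accepting M) else rs i, Stay)) \<or>
      snd (embM M off fl) q rs = (states M, stay rs)"
      using False by (cases "set ss \<subseteq> alphabet M"; cases "delta M q ss") simp_all
    moreover have "fst (embM M off fl) = states M" by (simp add: embM_def)
    ultimately show ?thesis using assms(3,5) by (auto simp: stay_def)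
  qed
qed

text \<open>The final state of a decision procedure is determined by the symbol read on tape \<open>f\<close>.\<close>

definition pad :: "nat \<Rightarrow> 'a::finite symb list \<Rightarrow> nat \<Rightarrow> nat" where
  "pad K rs i = (if i < K then code (rs ! i) else 0)"

definition to_tm :: "nat \<Rightarrow> nat \<Rightarrow> frag \<Rightarrow> nat \<Rightarrow> (nat \<Rightarrow> bool) \<Rightarrow> 'a::finite tm" where
  "to_tm K ax F f P = \<lparr> tapes = K, states = fst F + 3, auxs = ax,
     delta = (\<lambda>q rs. if q < fst F then
         Some (fst (snd F q (pad K rs)), map (\<lambda>i. (dcd (fst (snd (snd F q (pad K rs)) i)), snd (snd (snd F q (pad K rs)) i))) [0..<K])
       else if q = fst F then Some (if P (pad K rs f) then fst F + 1 else fst F + 2, map (\<lambda>i. (rs ! i, Stay)) [0..<K])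
       else None),
     accepting = {fst F + 1} \<rparr>"

lemma wf_to_tm:
  assumes "fok K (Suc (CARD('a) + ax)) F" "0 < K"
  shows "wf_tm (to_tm K ax F f P :: 'a::finite tm)"
proof -
  let ?M = "to_tm K ax F f P :: 'a tm"
  have ax: "auxs ?M = ax" by (simp add: to_tm_def)
  have "q' < states ?M \<and> length as = tapes ?M \<and> fst ` set as \<subseteq> alphabet ?M"
    if q: "q < states ?M" and l: "length rs = tapes ?M" "set rs \<subseteq> alphabet ?M" and d: "delta ?M q rs = Some (q', as)"
    for q rs q' as
  proof -
    have lK: "length rs = K" using l(1) by (simp add: to_tm_def)
    have rs: "pad K rs i < Suc (CARD('a) + ax)" for i
    proof (cases "i < K")
      case True
      then have "rs ! i \<in> alphabet ?M" using l(2) lK nth_mem by blast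
      then show ?thesis using True by (simp add: pad_def alphabet_code ax)
    qed (simp add: pad_def)
    consider "q < fst F" | "q = fst F" using d by (auto simp: to_tm_def split: if_splits)
    then show ?thesis
    proof cases
      case 1
      then have "fst (snd F q (pad K rs)) \<le> fst F" "\<forall>i. fst (snd (snd F q (pad K rs)) i) < Suc (CARD('a) + ax)"
        using assms(1) rs unfolding fok_def by blast+
      then show ?thesis using 1 d by (auto simp: to_tm_def alphabet_code)
    next
      case 2
      then have "as = map (\<lambda>i. (rs ! i, Stay)) [0..<K]" "q' < states ?M" using d by (auto simp: to_tm_def split: if_splits)
      moreover have "rs ! i \<in> alphabet ?M" if "i < K" for i using that l(2) lK nth_mem by blast
      ultimately show ?thesis by (auto simp: to_tm_def)
    qed
  qed
  moreover have "0 < tapes ?M" "0 < states ?M" using assms(2) by (simp_all add: to_tm_def)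
  ultimately show ?thesis unfolding wf_tm_def by blast
qed

definition unenc :: "nat \<Rightarrow> ntapes \<Rightarrow> 'a::finite tape list" where
  "unenc K T = map (\<lambda>i. (\<lambda>p. dcd (fst (T i) p), snd (T i))) [0..<K]"

lemma pad_unenc:
  assumes "\<And>i. K \<le> i \<Longrightarrow> T i = blank"
  shows "pad K (map read_tape (unenc K T :: 'a::finite tape list)) = rd T"
proof
  fix i
  show "pad K (map read_tape (unenc K T :: 'a::finite tape list)) i = rd T i"
  proof (cases "i < K")
    case True
    then show ?thesis by (simp add: pad_def unenc_def read_tape_def rd_def)
  next
    case False
    then show ?thesis using assms[of i] by (simp add: pad_def rd_def blank_def)
  qed
qed

lemma to_tm_step:
  assumes "fok K A F" "\<And>i. K \<le> i \<Longrightarrow> T i = blank" "q < fst F" and s: "fstep F (q, T) = (q', T')"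
  shows "tm_step (to_tm K ax F f P :: 'a::finite tm) (q, unenc K T) = (q', unenc K T')"
    "\<And>i. K \<le> i \<Longrightarrow> T' i = blank"
proof -
  have s': "q' = fst (snd F q (rd T))" "T' = apply_acts (snd (snd F q (rd T))) T"
    using s assms(3) by (simp_all add: fstep_def)
  show "tm_step (to_tm K ax F f P :: 'a::finite tm) (q, unenc K T) = (q', unenc K T')"
  proof -
    let ?as = "snd (snd F q (rd T))"
    have "delta (to_tm K ax F f P :: 'a tm) q (map read_tape (unenc K T)) =
        Some (q', map (\<lambda>i. (dcd (fst (?as i)), snd (?as i))) [0..<K])"
      using assms(3) pad_unenc[OF assms(2), where ?'a = 'a] by (simp add: to_tm_def s')
    moreover have "map2 act (map (\<lambda>i. (dcd (fst (?as i)), snd (?as i))) [0..<K]) (unenc K T) = (unenc K T' :: 'a tape list)"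
      by (rule nth_equalityI) (auto simp: unenc_def act_def apply_acts_def nact_def s')
    ultimately show ?thesis by (simp add: tm_step_def)
  qed
  fix i assume i: "K \<le> i"
  then have "snd (snd F q (rd T)) i = (rd T i, Stay)" using assms(1,3) unfolding fok_def by blast
  then have "T' i = T i" by (simp add: s' apply_acts_def)
  then show "T' i = blank" using assms(2)[OF i] by simp
qed

lemma to_tm_decides:
  assumes F: "fok K A F" and "0 < K" "f < K" and e: "exec F (ini x) t T"
  shows "decides_within (to_tm K ax F f P :: 'a::finite tm) x (Suc t) (P (rd T f))"
proof -
  let ?M = "to_tm K ax F f P :: 'a tm"
  have init: "init_config ?M x = (0, unenc K (ini x))"
  proof -
    have d: "dcd (wcont x p) = fst (input_tape x) p" for p
      by (simp add: wcont_def input_tape_def del: code.simps(2))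
    have e: "input_tape [] = (\<lambda>_. Blank :: 'a symb, 0)" by (auto simp: input_tape_def)
    have "input_tape x # replicate (K - 1) (input_tape []) = (unenc K (ini x) :: 'a tape list)"
    proof (rule nth_equalityI)
      fix i assume "i < length (input_tape x # replicate (K - 1) (input_tape []))"
      then have i: "i < K" using \<open>0 < K\<close> by simp
      show "(input_tape x # replicate (K - 1) (input_tape [])) ! i = (unenc K (ini x) :: 'a tape list) ! i"
      proof (cases i)
        case 0
        then show ?thesis using i d by (simp add: unenc_def ini_def) (simp add: input_tape_def)
      next
        case (Suc j)
        then show ?thesis using i by (simp add: unenc_def ini_def e blank_def)
      qed
    qed (use \<open>0 < K\<close> in \<open>simp add: unenc_def\<close>)
    then show ?thesis by (simp add: init_config_def to_tm_def)
  qed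
  \<comment> \<open>The fragment idles in its exit state whereas the machine proceeds from there to
    its verdict. So the machine is compared with the fragment at a possibly earlier time
    \<open>v\<close>.\<close>
  have *: "\<exists>q' T'. (fstep F ^^ u) (0, ini x) = (q', T') \<and> (\<forall>i\<ge>K. T' i = blank) \<and>
     (\<exists>v\<le>u. run ?M x v = (q', unenc K T'))" for u
  proof (induction u)
    case 0
    show ?case using \<open>0 < K\<close> init by (auto simp: run_def ini_def)
  next
    case (Suc u)
    then obtain q' T' v where h: "(fstep F ^^ u) (0, ini x) = (q', T')" "\<forall>i\<ge>K. T' i = blank"
      "v \<le> u" "run ?M x v = (q', unenc K T')" by blast
    show ?case
    proof (cases "q' < fst F")
      case True
      obtain q2 T2 where s: "fstep F (q', T') = (q2, T2)" by fastforce
      have "run ?M x (Suc v) = (q2, unenc K T2)" "\<forall>i\<ge>K. T2 i = blank"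
        using to_tm_step(1)[OF F _ True s, where f = f and P = P and ax = ax] to_tm_step(2)[OF F _ True s] h by (simp_all add: run_def)
      then show ?thesis using s h(1,3) by auto
    next
      case False
      then have "fstep F (q', T') = (q', T')" by (simp add: fstep_def)
      then show ?thesis using h by (auto intro: le_SucI)
    qed
  qed
  obtain u where u: "u \<le> t" "(fstep F ^^ u) (0, ini x) = (fst F, T)" using e unfolding exec_def reach_def by blast
  obtain v where "v \<le> u" "run ?M x v = (fst F, unenc K T)" and T: "\<forall>i\<ge>K. T i = blank"
    using *[of u] unfolding u(2) by auto
  then have v: "v \<le> t" "run ?M x v = (fst F, unenc K T)" "\<forall>i\<ge>K. T i = blank" using u(1) by auto
  have p: "pad K (map read_tape (unenc K T :: 'a tape list)) f = rd T f" using pad_unenc[of K T] v(3) by metis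
  have r: "fst (run ?M x (Suc v)) = (if P (rd T f) then fst F + 1 else fst F + 2)"
    using v(2) p by (simp add: run_def tm_step_def) (simp add: to_tm_def)
  have h: "halted ?M (run ?M x (Suc v))" using r by (simp add: halted_def to_tm_def)
  have "run ?M x (Suc v + k) = run ?M x (Suc v)" for k
    by (induction k) (use h in \<open>auto simp: run_def tm_step_def halted_def\<close>)
  from this[of "t - v"] v(1) have "run ?M x (Suc t) = run ?M x (Suc v)" by simp
  then show ?thesis unfolding decides_within_def using h r by (simp add: to_tm_def)
qed

section \<open>Head tracking\<close>

definition mark :: "int \<Rightarrow> nat" where "mark p = (if p = 0 then 1 else 0)"

text \<open>Tape \<open>P\<close> holds the distance of head \<open>\<tau>\<close> from cell 0, and tape \<open>P + 1\<close> the side.\<close>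

definition track :: "nat \<Rightarrow> nat \<Rightarrow> frag \<Rightarrow> frag" where
  "track \<tau> P F = (fst F, \<lambda>q rs. let r = snd F q rs; m = snd (snd r \<tau>) in
     (fst r, (snd r)
       (P := (rs P, if m = Stay then Stay else if rs P = 1 \<or> (m = Rightwards \<longleftrightarrow> rs (Suc P) = 0) then Rightwards else Leftwards),
        Suc P := (if rs P = 1 \<and> m \<noteq> Stay then of_bool (m = Leftwards) else rs (Suc P), Stay))))"

definition tracks :: "nat \<Rightarrow> nat \<Rightarrow> ntapes \<Rightarrow> ntapes \<Rightarrow> bool" where
  "tracks \<tau> P T U \<longleftrightarrow> (\<forall>i. i \<noteq> P \<longrightarrow> i \<noteq> Suc P \<longrightarrow> U i = T i) \<and> U P = (mark, \<bar>snd (T \<tau>)\<bar>) \<and>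
     snd (U (Suc P)) = 0 \<and> (snd (T \<tau>) \<noteq> 0 \<longrightarrow> fst (U (Suc P)) 0 = of_bool (snd (T \<tau>) < 0))"

lemma track_step:
  assumes indep: "\<And>q rs rs'. (\<And>i. i \<noteq> P \<Longrightarrow> i \<noteq> Suc P \<Longrightarrow> rs i = rs' i) \<Longrightarrow>
      fst (snd F q rs) = fst (snd F q rs') \<and>
      (\<forall>i. i \<noteq> P \<longrightarrow> i \<noteq> Suc P \<longrightarrow> snd (snd F q rs) i = snd (snd F q rs') i)"
    and \<tau>: "\<tau> \<noteq> P" "\<tau> \<noteq> Suc P" and tr: "tracks \<tau> P T U" and q: "q < fst F"
    and s: "fstep F (q, T) = (q', T')"
  shows "\<exists>U'. fstep (track \<tau> P F) (q, U) = (q', U') \<and> tracks \<tau> P T' U' \<and> \<bar>snd (T' \<tau>)\<bar> \<le> \<bar>snd (T \<tau>)\<bar> + 1"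
proof -
  define r where "r = snd F q (rd T)"
  define r' where "r' = snd F q (rd U)"
  have U: "U i = T i" if "i \<noteq> P" "i \<noteq> Suc P" for i using tr that unfolding tracks_def by blast
  have rr: "fst r' = fst r" "\<And>i. i \<noteq> P \<Longrightarrow> i \<noteq> Suc P \<Longrightarrow> snd r' i = snd r i"
    unfolding r_def r'_def using indep[of "rd U" "rd T" q] U by (auto simp: rd_def)
  define m where "m = snd (snd r \<tau>)"
  have m': "snd (snd r' \<tau>) = m" using rr(2) \<tau> by (simp add: m_def)
  define h where "h = snd (T \<tau>)"
  have s': "q' = fst r" "T' = apply_acts (snd r) T" using s q by (simp_all add: fstep_def r_def)
  have h': "snd (T' \<tau>) = h + offset m" by (simp add: s' apply_acts_def nact_def m_def h_def)
  define U' where "U' = snd (fstep (track \<tau> P F) (q, U))"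
  have e: "fstep (track \<tau> P F) (q, U) = (q', U')"
    using q by (simp add: fstep_def track_def Let_def r'_def[symmetric] rr s' U'_def)
  have UP: "U P = (mark, \<bar>h\<bar>)" "snd (U (Suc P)) = 0" "h \<noteq> 0 \<Longrightarrow> fst (U (Suc P)) 0 = of_bool (h < 0)"
    using tr unfolding tracks_def h_def by auto
  have rP: "rd U P = of_bool (h = 0)" by (simp add: rd_def UP mark_def)
  have rSP: "rd U (Suc P) = fst (U (Suc P)) 0" by (simp add: rd_def UP)
  have U'x: "U' i = T' i" if "i \<noteq> P" "i \<noteq> Suc P" for i
    using q that by (simp add: U'_def fstep_def track_def Let_def r'_def[symmetric] s' apply_acts_def rr U)
  have U'P: "U' P = nact (rd U P, if m = Stay then Stay else if rd U P = 1 \<or> (m = Rightwards \<longleftrightarrow> rd U (Suc P) = 0)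
      then Rightwards else Leftwards) (U P)"
    using q by (simp add: U'_def fstep_def track_def Let_def r'_def[symmetric] apply_acts_def m')
  have U'SP: "U' (Suc P) = nact (if rd U P = 1 \<and> m \<noteq> Stay then of_bool (m = Leftwards) else rd U (Suc P), Stay) (U (Suc P))"
    using q by (simp add: U'_def fstep_def track_def Let_def r'_def[symmetric] apply_acts_def m')
  have mk: "mark(\<bar>h\<bar> := rd U P) = mark" unfolding rP by (auto simp: mark_def)
  have "tracks \<tau> P T' U'"
    unfolding tracks_def
  proof (intro conjI allI impI)
    show "U' i = T' i" if "i \<noteq> P" "i \<noteq> Suc P" for i by (rule U'x[OF that])
    show "U' P = (mark, \<bar>snd (T' \<tau>)\<bar>)"
      unfolding h' U'P nact_def UP(1) fst_conv snd_conv mk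
      using UP(3) rSP rP by (cases m) (auto simp: offset_def)
    show "snd (U' (Suc P)) = 0" unfolding U'SP nact_def by (simp add: UP offset_def)
    show "fst (U' (Suc P)) 0 = of_bool (snd (T' \<tau>) < 0)" if "snd (T' \<tau>) \<noteq> 0"
      using that unfolding h' U'SP nact_def using UP(2,3) rSP rP by (cases m) (auto simp: offset_def)
  qed
  moreover have "\<bar>snd (T' \<tau>)\<bar> \<le> \<bar>snd (T \<tau>)\<bar> + 1" unfolding h' h_def by (cases m) (auto simp: offset_def)
  ultimately show ?thesis using e by blast
qed

lemma exec_track:
  assumes indep: "\<And>q rs rs'. (\<And>i. i \<noteq> P \<Longrightarrow> i \<noteq> Suc P \<Longrightarrow> rs i = rs' i) \<Longrightarrow>
      fst (snd F q rs) = fst (snd F q rs') \<and>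
      (\<forall>i. i \<noteq> P \<longrightarrow> i \<noteq> Suc P \<longrightarrow> snd (snd F q rs) i = snd (snd F q rs') i)"
    and \<tau>: "\<tau> \<noteq> P" "\<tau> \<noteq> Suc P" and tr: "tracks \<tau> P T U" and e: "exec F T t T'"
  shows "\<exists>U'. exec (track \<tau> P F) U t U' \<and> tracks \<tau> P T' U' \<and> \<bar>snd (T' \<tau>)\<bar> \<le> \<bar>snd (T \<tau>)\<bar> + int t"
proof -
  have *: "\<exists>U'. (fstep (track \<tau> P F) ^^ u) (0, U) = (fst ((fstep F ^^ u) (0, T)), U') \<and>
      tracks \<tau> P (snd ((fstep F ^^ u) (0, T))) U' \<and> \<bar>snd (snd ((fstep F ^^ u) (0, T)) \<tau>)\<bar> \<le> \<bar>snd (T \<tau>)\<bar> + int u" for u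
  proof (induction u)
    case 0
    then show ?case using tr by auto
  next
    case (Suc u)
    obtain q' T' where c: "(fstep F ^^ u) (0, T) = (q', T')" by fastforce
    obtain U' where U': "(fstep (track \<tau> P F) ^^ u) (0, U) = (q', U')" "tracks \<tau> P T' U'"
      "\<bar>snd (T' \<tau>)\<bar> \<le> \<bar>snd (T \<tau>)\<bar> + int u" using Suc.IH c by auto
    show ?case
    proof (cases "q' < fst F")
      case True
      obtain q2 T2 where s: "fstep F (q', T') = (q2, T2)" by fastforce
      from track_step[OF indep \<tau> U'(2) True s] obtain U2 where
        "fstep (track \<tau> P F) (q', U') = (q2, U2)" "tracks \<tau> P T2 U2" "\<bar>snd (T2 \<tau>)\<bar> \<le> \<bar>snd (T' \<tau>)\<bar> + 1"
        by blast
      then show ?thesis using c s U' by auto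
    next
      case False
      then have "fstep F (q', T') = (q', T')" "fstep (track \<tau> P F) (q', U') = (q', U')"
        by (simp_all add: fstep_def track_def)
      then show ?thesis using c U' by auto
    qed
  qed
  obtain u where u: "u \<le> t" "(fstep F ^^ u) (0, T) = (fst F, T')" using e unfolding exec_def reach_def by blast
  from *[of u] u obtain U' where "(fstep (track \<tau> P F) ^^ u) (0, U) = (fst F, U')" "tracks \<tau> P T' U'"
    "\<bar>snd (T' \<tau>)\<bar> \<le> \<bar>snd (T \<tau>)\<bar> + int t" by auto
  then show ?thesis using u(1) unfolding exec_def reach_def by (auto simp: track_def)
qed

lemma fok_track: "fok K A F \<Longrightarrow> Suc P < K \<Longrightarrow> 2 \<le> A \<Longrightarrow> fok K A (track \<tau> P F)"
  unfolding fok_def track_def Let_def by auto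

definition rewind :: "nat \<Rightarrow> nat \<Rightarrow> frag" where
  "rewind \<tau> P = whlF (\<lambda>rs. rs P \<noteq> 1) (prim (\<lambda>rs i.
     if i = \<tau> then (rs i, if rs (Suc P) = 1 then Rightwards else Leftwards)
     else if i = P then (rs i, Leftwards) else (rs i, Stay)))"

lemma fok_rewind: "\<tau> < K \<Longrightarrow> P < K \<Longrightarrow> fok K A (rewind \<tau> P)"
  unfolding rewind_def by (intro fok_whl fok_prim) auto

lemma exec_rewind:
  assumes "\<tau> \<noteq> P" "\<tau> \<noteq> Suc P"
  shows "U P = (mark, int n) \<Longrightarrow> \<bar>snd (U \<tau>)\<bar> = int n \<Longrightarrow> snd (U (Suc P)) = 0 \<Longrightarrow>
    (snd (U \<tau>) \<noteq> 0 \<longrightarrow> fst (U (Suc P)) 0 = of_bool (snd (U \<tau>) < 0)) \<Longrightarrow>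
    exec (rewind \<tau> P) U (2 * n + 1) (U(\<tau> := (fst (U \<tau>), 0), P := (mark, 0)))"
proof (induction n arbitrary: U)
  case 0
  then have e: "U(\<tau> := (fst (U \<tau>), 0), P := (mark, 0)) = U"
    by (auto simp: fun_eq_iff prod_eq_iff)
  have "exec (rewind \<tau> P) U 1 U" unfolding rewind_def
    by (rule exec_whl_done) (use 0 in \<open>simp add: rd_def mark_def\<close>)
  then show ?case unfolding e by (rule exec_mono) simp
next
  case (Suc n)
  define h where "h = snd (U \<tau>)"
  have h: "\<bar>h\<bar> = int (Suc n)" using Suc.prems(2) by (simp add: h_def)
  have rSP: "rd U (Suc P) = of_bool (h < 0)" using Suc.prems(3,4) h by (auto simp: rd_def h_def)
  have rP: "rd U P = 0" using Suc.prems(1) by (simp add: rd_def mark_def)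
  define f where "f = (\<lambda>rs i. if i = \<tau> then (rs i :: nat, if rs (Suc P) = 1 then Rightwards else Leftwards)
     else if i = P then (rs i, Leftwards) else (rs i, Stay))"
  define U1 where "U1 = apply_acts (f (rd U)) U"
  have U1: "U1 = U(\<tau> := (fst (U \<tau>), h - sgn h), P := (mark, int n))"
  proof
    fix i
    show "U1 i = (U(\<tau> := (fst (U \<tau>), h - sgn h), P := (mark, int n))) i"
      using assms h rSP Suc.prems(1) unfolding U1_def f_def
      by (auto simp: apply_acts_def nact_def h_def rd_def mark_def offset_def sgn_if)
  qed
  have "exec (rewind \<tau> P) U1 (2 * n + 1) (U1(\<tau> := (fst (U1 \<tau>), 0), P := (mark, 0)))"
    by (rule Suc.IH) (use assms h Suc.prems(3,4) in \<open>auto simp: U1 h_def[symmetric] sgn_if\<close>)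
  moreover have "U1(\<tau> := (fst (U1 \<tau>), 0), P := (mark, 0)) = U(\<tau> := (fst (U \<tau>), 0), P := (mark, 0))"
    using assms by (auto simp: U1)
  ultimately have "exec (rewind \<tau> P) U (Suc (1 + (2 * n + 1))) (U(\<tau> := (fst (U \<tau>), 0), P := (mark, 0)))"
    unfolding rewind_def f_def[symmetric]
    using exec_whl_step[of "\<lambda>rs. rs P \<noteq> 1" U "prim f" 1 U1] exec_prim[of f U] rP by (simp add: U1_def)
  then show ?case by (rule exec_mono) simp
qed

definition shiftF :: "nat \<Rightarrow> move \<Rightarrow> frag" where
  "shiftF \<tau> m = prim (\<lambda>rs i. (rs i, if i = \<tau> then m else Stay))"

lemma exec_shift: "U' = U(\<tau> := (fst (U \<tau>), snd (U \<tau>) + offset m)) \<Longrightarrow> exec (shiftF \<tau> m) U 1 U'"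
proof -
  have "apply_acts (\<lambda>i. (rd U i, if i = \<tau> then m else Stay)) U = U(\<tau> := (fst (U \<tau>), snd (U \<tau>) + offset m))"
    by (auto simp: apply_acts_def nact_def rd_def offset_def)
  then show "U' = U(\<tau> := (fst (U \<tau>), snd (U \<tau>) + offset m)) \<Longrightarrow> exec (shiftF \<tau> m) U 1 U'"
    unfolding shiftF_def using exec_prim[of "\<lambda>rs i. (rs i, if i = \<tau> then m else Stay)" U] by simp
qed

text \<open>An emitted word contains no blank and is preceded by one, so its start is found by
  scanning to the left; no tracking of the head is involved here.\<close>

definition rewout :: "nat \<Rightarrow> frag" where
  "rewout \<tau> = seqF (shiftF \<tau> Leftwards) (seqF (whlF (\<lambda>rs. rs \<tau> \<noteq> 0) (shiftF \<tau> Leftwards)) (shiftF \<tau> Rightwards))"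

lemma fok_rewout: "\<tau> < K \<Longrightarrow> fok K A (rewout \<tau>)"
  unfolding rewout_def shiftF_def by (intro fok_seq fok_whl fok_prim) auto

lemma exec_rewout:
  assumes "U \<tau> = (c, int n)" "\<And>i. i < n \<Longrightarrow> c (int i) \<noteq> 0" "c (-1) = 0"
  shows "exec (rewout \<tau>) U (2 * n + 3) (U(\<tau> := (c, 0)))"
proof -
  have *: "exec (whlF (\<lambda>rs. rs \<tau> \<noteq> 0) (shiftF \<tau> Leftwards)) (U(\<tau> := (c, int k - 1))) (2 * k + 1) (U(\<tau> := (c, -1)))"
    if "k \<le> n" for k
    using that
  proof (induction k)
    case 0
    have "exec (whlF (\<lambda>rs. rs \<tau> \<noteq> 0) (shiftF \<tau> Leftwards)) (U(\<tau> := (c, -1))) 1 (U(\<tau> := (c, -1)))"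
      by (rule exec_whl_done) (use assms(3) in \<open>simp add: rd_def\<close>)
    then show ?case by (simp del: fun_upd_apply)
  next
    case (Suc k)
    have "exec (whlF (\<lambda>rs. rs \<tau> \<noteq> 0) (shiftF \<tau> Leftwards)) (U(\<tau> := (c, int (Suc k) - 1))) (Suc (1 + (2 * k + 1))) (U(\<tau> := (c, -1)))"
    proof (rule exec_whl_step[where T' = "U(\<tau> := (c, int k - 1))"])
      show "rd (U(\<tau> := (c, int (Suc k) - 1))) \<tau> \<noteq> 0" using Suc.prems assms(2)[of k] by (simp add: rd_def)
      show "exec (shiftF \<tau> Leftwards) (U(\<tau> := (c, int (Suc k) - 1))) 1 (U(\<tau> := (c, int k - 1)))"
        by (rule exec_shift) (simp add: offset_def)
      show "exec (whlF (\<lambda>rs. rs \<tau> \<noteq> 0) (shiftF \<tau> Leftwards)) (U(\<tau> := (c, int k - 1))) (2 * k + 1) (U(\<tau> := (c, -1)))"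
        by (rule Suc.IH) (use Suc.prems in simp)
    qed
    then show ?case by (rule exec_mono) simp
  qed
  have "exec (rewout \<tau>) U (1 + ((2 * n + 1) + 1)) (U(\<tau> := (c, 0)))"
    unfolding rewout_def
    by (rule exec_seq[OF exec_shift exec_seq[OF *[of n] exec_shift]]) (use assms(1) in \<open>auto simp: offset_def\<close>)
  then show ?thesis by (simp add: numeral_3_eq_3)
qed

section \<open>Producing a word\<close>

text \<open>\<open>Emit\<close> has a fixed symbol, so emitting the value of a register is unrolled
  into a case distinction on its \<open>k + 1\<close> possible values.\<close>

fun emitv :: "nat \<Rightarrow> nat \<Rightarrow> cprog" where
  "emitv a 0 = Emit a"
| "emitv a (Suc k) = Cond (Pos 5) (Seq (Dec 5) (emitv (Suc a) k)) (Emit a)"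

lemma exle_emitv: "s 5 \<le> k \<Longrightarrow> exle X y (emitv a k) (s, out) (2 * k + 1) (s(5 := 0), out @ [a + s 5])"
proof (induction k arbitrary: a s)
  case 0
  then have "s(5 := 0) = s" by auto
  then show ?case using 0 exle_Emit[of X y a s out] by simp
next
  case (Suc k)
  show ?case
  proof (cases "s 5 = 0")
    case True
    then have e: "s(5 := 0) = s" by auto
    show ?thesis
      by (rule exle_mono[of _ _ _ _ "Suc 1"]) (use True e exle_CondF[of X y "Pos 5", OF _ exle_Emit[of X y a s out]] in auto)
  next
    case False
    let ?s = "s(5 := s 5 - 1)"
    have "exle X y (emitv (Suc a) k) (?s, out) (2 * k + 1) (s(5 := 0), out @ [a + s 5])"
    proof -
      have "?s 5 \<le> k" "Suc a + ?s 5 = a + s 5" using Suc.prems False by auto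
      then show ?thesis using Suc.IH[of ?s "Suc a"] by (metis fun_upd_upd)
    qed
    moreover have "exle X y (Dec 5) (s, out) 1 (?s, out)" by (rule exle_Dec) (use False in auto)
    ultimately have "exle X y (emitv a (Suc k)) (s, out) (Suc (1 + (2 * k + 1))) (s(5 := 0), out @ [a + s 5])"
      unfolding emitv.simps by (intro exle_CondT exle_Seq) (use False in auto)
    then show ?thesis by (rule exle_mono) simp
  qed
qed

text \<open>A word is produced from a random access description, its length and the symbol at a
  given position; no symbol depends on how the previous ones were computed. The only variable is the
  position, in register 3, to which all environment variables are mapped; hence the constant
  environments.\<close>

lemma word_prog:
  assumes L: "pc L" and sy: "pc sy"
  shows "\<exists>p c. \<forall>X y S. 2 \<le> S \<longrightarrow> snd X \<le> S \<longrightarrow> (\<forall>i<L X y (\<lambda>_. 0). sy X y (\<lambda>_. i) \<le> K) \<longrightarrow>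
    exle X y p ((\<lambda>_. 0)(2 := snd X), []) (S ^ c)
      ((\<lambda>_. 0)(2 := snd X), map (\<lambda>i. sy X y (\<lambda>_. i)) [0..<L X y (\<lambda>_. 0)])"
proof -
  have l1: "layout (\<lambda>_. 3) 4 5" "layout (\<lambda>_. 3) 5 6" by (auto simp: layout_def)
  obtain p1 c1 vL where p1: "computes p1 L (\<lambda>_. 3) 4 5 c1" and vL: "\<And>S X y e. bnd S X e \<Longrightarrow> L X y e \<le> S ^ vL"
    using L l1(1) unfolding pc_def pb_def by blast
  obtain p2 c2 where p2: "computes p2 sy (\<lambda>_. 3) 5 6 c2"
    using sy l1(2) unfolding pc_def by blast
  define U where "U = (\<lambda>S::nat. S + S ^ vL)"
  define B where "B = (\<lambda>S. U S ^ c2 + ((2 * K + 1) + (1 + 1)))"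
  define TT where "TT = (\<lambda>S. S ^ c1 + ((S ^ vL * Suc (B S) + 1) + (2 * S ^ vL + 1)))"
  have "polyb TT" unfolding TT_def B_def U_def by (intro polyb_intros)
  then obtain c where c: "\<And>S. 2 \<le> S \<Longrightarrow> TT S \<le> S ^ c" unfolding polyb_def by blast
  define body where "body = Seq p2 (Seq (emitv 0 K) (Seq (Inc 3) (Dec 4)))"
  define p where "p = Seq p1 (Seq (Loop (Pos 4) body) (clear 3))"
  have "exle X y p ((\<lambda>_. 0)(2 := snd X), []) (S ^ c)
      ((\<lambda>_. 0)(2 := snd X), map (\<lambda>i. sy X y (\<lambda>_. i)) [0..<L X y (\<lambda>_. 0)])"
    if S: "2 \<le> S" "snd X \<le> S" and sb: "\<forall>i<L X y (\<lambda>_. 0). sy X y (\<lambda>_. i) \<le> K" for X y S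
  proof -
    define N where "N = L X y (\<lambda>_. 0)"
    define s0 where "s0 = ((\<lambda>_. 0)(2 := snd X) :: nat \<Rightarrow> nat)"
    have N: "N \<le> S ^ vL" unfolding N_def by (rule vL) (use S in \<open>auto simp: bnd_def\<close>)
    have 1: "exle X y p1 (s0, []) (S ^ c1) (s0(4 := N), [])"
    proof -
      have "bnd S X s0" using S by (auto simp: bnd_def s0_def)
      from p1[unfolded computes_def, rule_format, OF this, of y "[]"] show ?thesis
        by (simp add: s0_def N_def)
    qed
    define st where "st = (\<lambda>i. (s0(3 := i, 4 := N - i), map (\<lambda>i. sy X y (\<lambda>_. i)) [0..<i]))"
    have step: "exle X y body (st i) (B S) (st (Suc i))" if i: "i < N" for i
    proof -
      let ?s = "s0(3 := i, 4 := N - i)" and ?o = "map (\<lambda>i. sy X y (\<lambda>_. i)) [0..<i]"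
      have "?s k \<le> U S" for k using S N i unfolding U_def s0_def by auto
      then have b: "bnd (U S) X ?s" using S unfolding bnd_def U_def by auto
      have a1: "exle X y p2 (?s, ?o) (U S ^ c2) (?s(5 := sy X y (\<lambda>_. i)), ?o)"
        using p2[unfolded computes_def, rule_format, OF b, of y ?o] by (simp add: s0_def)
      have a2: "exle X y (emitv 0 K) (?s(5 := sy X y (\<lambda>_. i)), ?o) (2 * K + 1) (?s, ?o @ [sy X y (\<lambda>_. i)])"
      proof -
        have "?s(5 := 0) = ?s" by (auto simp: s0_def)
        then show ?thesis
          using exle_emitv[of "?s(5 := sy X y (\<lambda>_. i))" K X y 0 ?o] sb i by (simp add: N_def)
      qed
      have a3: "exle X y (Inc 3) (?s, ?o @ [sy X y (\<lambda>_. i)]) 1 (?s(3 := Suc i), ?o @ [sy X y (\<lambda>_. i)])"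
        by (rule exle_Inc) auto
      have a4: "exle X y (Dec 4) (?s(3 := Suc i), ?o @ [sy X y (\<lambda>_. i)]) 1 (st (Suc i))"
        unfolding st_def using i by (auto intro!: exle_Dec[unfolded One_nat_def])
      have "st i = (?s, ?o)" by (simp add: st_def)
      then show ?thesis unfolding body_def B_def
        using exle_Seq[OF a1 exle_Seq[OF a2 exle_Seq[OF a3 a4]]] by simp
    qed
    have 2: "exle X y (Loop (Pos 4) body) (st 0) (N * Suc (B S) + 1) (st N)"
      by (rule exle_countdown) (use step in \<open>auto simp: st_def\<close>)
    have st0: "st 0 = (s0(4 := N), [])" by (auto simp: st_def s0_def)
    have 3: "exle X y (clear 3) (st N) (2 * N + 1) (s0, map (\<lambda>i. sy X y (\<lambda>_. i)) [0..<N])"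
      unfolding st_def by (rule exle_mono[OF exle_clear]) (auto simp: s0_def)
    have "exle X y p (s0, []) (S ^ c1 + ((N * Suc (B S) + 1) + (2 * N + 1))) (s0, map (\<lambda>i. sy X y (\<lambda>_. i)) [0..<N])"
      unfolding p_def by (rule exle_Seq[OF 1 exle_Seq[OF 2[unfolded st0] 3]])
    moreover have "S ^ c1 + ((N * Suc (B S) + 1) + (2 * N + 1)) \<le> TT S"
      unfolding TT_def using N by (intro add_mono mult_le_mono) auto
    ultimately show ?thesis using c[OF S(1)] unfolding s0_def N_def by (meson exle_mono order_trans)
  qed
  then show ?thesis by blast
qed

lemma val_prog:
  assumes "pc D"
  shows "\<exists>p c. \<forall>X y S. 2 \<le> S \<longrightarrow> snd X \<le> S \<longrightarrow>
    exle X y p ((\<lambda>_. 0)(2 := snd X), []) (S ^ c) ((\<lambda>_. 0)(2 := snd X, 4 := D X y (\<lambda>_. 0)), [])"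
proof -
  have "layout (\<lambda>_. 3) 4 5" by (auto simp: layout_def)
  then obtain p c where p: "computes p D (\<lambda>_. 3) 4 5 c" using assms unfolding pc_def by blast
  have "exle X y p ((\<lambda>_. 0)(2 := snd X), []) (S ^ c) ((\<lambda>_. 0)(2 := snd X, 4 := D X y (\<lambda>_. 0)), [])"
    if "2 \<le> S" "snd X \<le> S" for X y S
  proof -
    have "bnd S X ((\<lambda>_. 0)(2 := snd X))" using that by (auto simp: bnd_def)
    from p[unfolded computes_def, rule_format, OF this, of y "[]"] show ?thesis by simp
  qed
  then show ?thesis by blast
qed

section \<open>Preprocessing and postprocessing of a Turing machine\<close>

definition inp_of :: "'a::finite list \<Rightarrow> inp" where
  "inp_of x = (\<lambda>i. wcont x (int i), length x)"

definition init_regs :: "nat \<Rightarrow> nat \<Rightarrow> frag" where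
  "init_regs L nr = prim (\<lambda>rs i. if i = Suc L \<or> L + 5 \<le> i \<and> i < L + 5 + nr then (1, Stay) else (rs i, Stay))"

text \<open>Tape 0 holds the input \<open>x\<close>, tapes \<open>1\<close> to \<open>L\<close> belong to \<open>M\<close>, tapes \<open>L + 1\<close> and \<open>L + 2\<close>
  track the head on the output tape \<open>L\<close>, tape \<open>L + 3\<close> receives the verdict of \<open>M\<close>,
  tape \<open>L + 4\<close> is unused, and the counters follow.\<close>

definition prepare :: "'b::finite tm \<Rightarrow> nat \<Rightarrow> cprog \<Rightarrow> frag" where
  "prepare M nr p = (let L = tapes M; cpl = tape_layout.cpl (L + 4) (Suc 0) (L + 5) in
     seqF (init_regs L nr) (seqF (whlF (\<lambda>rs. rs 0 \<noteq> 0) (cpl (Seq (Inc 0) (Inc 2))))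
     (seqF (cpl (clear 0)) (seqF (cpl p) (seqF (rewout 1)
     (seqF (track L (Suc L) (embM M 1 (L + 3))) (rewind L (Suc L))))))))"

definition good_tapes :: "'b::finite tm \<Rightarrow> nat \<Rightarrow> 'a::finite list \<Rightarrow> 'b config \<Rightarrow> ntapes \<Rightarrow> bool" where
  "good_tapes M nr x c T \<longleftrightarrow> T 0 = (wcont x, 0) \<and>
     T (tapes M) = (\<lambda>p. code (fst (last (snd c)) p), 0) \<and> T (tapes M + 4) = blank \<and>
     rd T (tapes M + 3) = of_bool (fst c \<in> accepting M) \<and>
     (\<forall>j<nr. T (tapes M + 5 + j) = (mark, if j = 2 then int (length x) else 0))"

lemma mark_alt: "mark = (\<lambda>p. if p = 0 then 1 else 0)"
  by (rule ext) (simp add: mark_def)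

lemma exec_prepare:
  assumes M: "wf_tm (M :: 'b::finite tm)" and nr: "5 \<le> nr" "regs p \<subseteq> {..<nr}"
    and p: "exle (inp_of x) (\<lambda>_. 0) p ((\<lambda>_. 0)(2 := length x), []) t1
       ((\<lambda>_. 0)(2 := length (x :: 'a::finite list)), map (\<lambda>i. code (Sym (z ! i))) [0..<length z])"
    and h: "halted M (run M z t)"
  shows "\<exists>T. exec (prepare M nr p) (ini x) (5 * length x + t1 + 2 * length z + 3 * t + 20) T \<and> good_tapes M nr x (run M z t) T"
proof -
  define L where "L = tapes M"
  define n where "n = length x"
  have L: "0 < L" using M by (simp add: wf_tm_def L_def)
  interpret l: tape_layout "L + 4" "Suc 0" "L + 5" nr
    by standard (use L nr in auto)
  define T1 where "T1 = (\<lambda>i. if i = 0 then (wcont x, 0) else if i = Suc L \<or> L + 5 \<le> i \<and> i < L + 5 + nr then (mark, 0) else blank)"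
  have 1: "exec (init_regs L nr) (ini x) 1 T1"
  proof -
    have "apply_acts (\<lambda>i. if i = Suc L \<or> L + 5 \<le> i \<and> i < L + 5 + nr then (1, Stay) else (rd (ini x) i, Stay)) (ini x) = T1"
      by (auto simp: apply_acts_def nact_def T1_def ini_def blank_def mark_def rd_def offset_def fun_eq_iff)
    then show ?thesis unfolding init_regs_def
      using exec_prim[of "\<lambda>rs i. if i = Suc L \<or> L + 5 \<le> i \<and> i < L + 5 + nr then (1, Stay) else (rs i, Stay)" "ini x"] by simp
  qed
  have X: "fst (inp_of x) p = fst (T1 0) (int p)" "(\<lambda>_. 0) p = fst (T1 (L + 4)) (int p)" for p
    by (simp_all add: inp_of_def T1_def blank_def)
  define st where "st = (\<lambda>k. ((\<lambda>_. 0)(0 := k, 2 := k) :: nat \<Rightarrow> nat, [] :: nat list))"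
  have T1: "l.rep T1 (st 0) = T1"
    using L by (auto simp: l.rep_def st_def T1_def blank_def mark_alt fun_eq_iff)
  \<comment> \<open>Register 0 drags the head on the input along, so the loop stops at the first
    blank, with the length of the input in register 2.\<close>
  have 2: "exec (whlF (\<lambda>rs. rs 0 \<noteq> 0) (l.cpl (Seq (Inc 0) (Inc 2)))) (l.rep T1 (st (n - k))) (3 * k + 1) (l.rep T1 (st n))"
    if "k \<le> n" for k using that
  proof (induction k)
    case 0
    have "\<not> rd (l.rep T1 (st n)) 0 \<noteq> 0" by (simp add: rd_def l.rep_def st_def T1_def wcont_def n_def)
    from exec_whl_done[of "\<lambda>rs. rs 0 \<noteq> 0", OF this] show ?case by simp
  next
    case (Suc k)
    have s: "n - k = Suc (n - Suc k)" using Suc.prems by simp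
    have "exle (inp_of x) (\<lambda>_. 0) (Seq (Inc 0) (Inc 2)) (st (n - Suc k)) (1 + 1) (st (n - k))"
      unfolding st_def s by (rule exle_Seq[OF exle_Inc[OF refl] exle_Inc]) auto
    then have "exec (l.cpl (Seq (Inc 0) (Inc 2))) (l.rep T1 (st (n - Suc k))) (1 + 1) (l.rep T1 (st (n - k)))"
      by (rule l.exec_cpl_le[OF X]) (use nr in auto)
    moreover have "rd (l.rep T1 (st (n - Suc k))) 0 \<noteq> 0"
      using Suc.prems by (simp add: rd_def l.rep_def st_def T1_def wcont_def n_def)
    ultimately have "exec (whlF (\<lambda>rs. rs 0 \<noteq> 0) (l.cpl (Seq (Inc 0) (Inc 2)))) (l.rep T1 (st (n - Suc k))) (Suc (1 + 1 + (3 * k + 1))) (l.rep T1 (st n))"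
      using Suc.IH Suc.prems by (intro exec_whl_step[where T' = "l.rep T1 (st (n - k))"]) auto
    then show ?case by (rule exec_mono) simp
  qed
  define s0 where "s0 = ((\<lambda>_. 0)(2 := n) :: nat \<Rightarrow> nat)"
  define w where "w = map (\<lambda>i. code (Sym (z ! i))) [0..<length z]"
  have "exle (inp_of x) (\<lambda>_. 0) (clear 0) (st n) (2 * n + 1) (s0, [])"
    unfolding st_def by (rule exle_mono[OF exle_clear]) (auto simp: s0_def)
  then have 3: "exec (l.cpl (clear 0)) (l.rep T1 (st n)) (2 * n + 1) (l.rep T1 (s0, []))"
    by (rule l.exec_cpl_le[OF X]) (use nr in auto)
  have 4: "exec (l.cpl p) (l.rep T1 (s0, [])) t1 (l.rep T1 (s0, w))"
    by (rule l.exec_cpl_le[OF X]) (use p nr in \<open>auto simp: s0_def w_def n_def\<close>)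
  define T2 where "T2 = (l.rep T1 (s0, w))(1 := (wcont z, 0))"
  have w1: "l.rep T1 (s0, w) 1 = (wcont z, int (length z))"
    using L by (auto simp: l.rep_def w_def T1_def blank_def wcont_def fun_eq_iff)
  have 5: "exec (rewout 1) (l.rep T1 (s0, w)) (2 * length z + 3) T2"
    unfolding T2_def by (rule exec_rewout[where \<tau> = 1 and U = "l.rep T1 (s0, w)", OF w1]) (auto simp: wcont_def)
  define T3 where "T3 = (\<lambda>i. if i = 0 then (wcont x, 0) else if i = Suc L then (mark, 0)
     else if L + 5 \<le> i \<and> i < L + 5 + nr then (mark, int (s0 (i - (L + 5)))) else blank)"
  have T2: "T2 = put 1 (snd (init_config M z)) T3"
  proof
    fix i
    show "T2 i = put 1 (snd (init_config M z)) T3 i"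
    proof (cases "1 \<le> i \<and> i < 1 + L")
      case True
      have "put 1 (snd (init_config M z)) T3 i = (if i = 1 then (wcont z, 0) else blank)"
        using True L by (auto simp: put_def init_config_def L_def[symmetric] nth_Cons' enc_input) (auto simp: wcont_def blank_def)
      moreover have "T2 i = (if i = 1 then (wcont z, 0) else blank)"
        using True by (auto simp: T2_def l.rep_def T1_def)
      ultimately show ?thesis by simp
    next
      case False
      then have "put 1 (snd (init_config M z)) T3 i = T3 i"
        using L by (auto simp: put_def init_config_def L_def[symmetric])
      moreover have "T2 i = T3 i"
        using False L by (auto simp: T2_def T3_def l.rep_def T1_def s0_def blank_def mark_alt)
      ultimately show ?thesis by simp
    qed
  qed
  define c where "c = run M z t"
  define T4 where "T4 = put 1 (snd c) (T3(L + 3 := ((fst (T3 (L + 3)))(snd (T3 (L + 3)) := of_bool (fst c \<in> accepting M)), snd (T3 (L + 3)))))"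
  have emb: "exec (embM M 1 (L + 3)) T2 (Suc t) T4"
    unfolding T2 T4_def c_def using exec_embM[OF M h, of 1 "L + 3" T3] by (simp add: L_def)
  have lc: "length (snd c) = L" using okcfg_run[OF M, of z t] by (simp add: okcfg_def c_def L_def)
  have tr: "tracks L (Suc L) T2 T2"
    using L by (auto simp: tracks_def T2 put_def init_config_def L_def[symmetric] T3_def nth_Cons' enc_input blank_def)
  have indep: "fst (snd (embM M 1 (L + 3)) q rs) = fst (snd (embM M 1 (L + 3)) q rs') \<and>
      (\<forall>i. i \<noteq> Suc L \<longrightarrow> i \<noteq> Suc (Suc L) \<longrightarrow> snd (snd (embM M 1 (L + 3)) q rs) i = snd (snd (embM M 1 (L + 3)) q rs') i)"
    if "\<And>i. i \<noteq> Suc L \<Longrightarrow> i \<noteq> Suc (Suc L) \<Longrightarrow> rs i = rs' i" for q rs rs'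
  proof -
    define ss where "ss = map (\<lambda>j. dcd (rs (1 + j)) :: 'b symb) [0..<tapes M]"
    have ss': "ss = map (\<lambda>j. dcd (rs' (1 + j))) [0..<tapes M]"
      unfolding ss_def using that by (auto simp: L_def)
    define G where "G = (\<lambda>rs. if set ss \<subseteq> alphabet M then
       (case delta M q ss of
          None \<Rightarrow> (states M, \<lambda>i. (if i = L + 3 then of_bool (q \<in> accepting M) else rs i, Stay))
        | Some (q', as) \<Rightarrow> (q', \<lambda>i. if 1 \<le> i \<and> i < 1 + tapes M
             then (code (fst (as ! (i - 1))), snd (as ! (i - 1))) else (rs i, Stay)))
     else (states M, stay rs))"
    have "snd (embM M 1 (L + 3)) q rs = G rs" "snd (embM M 1 (L + 3)) q rs' = G rs'"
      unfolding embM_def Let_def snd_conv ss_def[symmetric] ss'[symmetric] G_def by (rule refl)+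
    moreover have "fst (G rs) = fst (G rs') \<and> (\<forall>i. i \<noteq> Suc L \<longrightarrow> i \<noteq> Suc (Suc L) \<longrightarrow> snd (G rs) i = snd (G rs') i)"
    proof (cases "set ss \<subseteq> alphabet M")
      case True
      then show ?thesis using that by (cases "delta M q ss") (auto simp: G_def)
    next
      case False
      then show ?thesis using that by (simp add: G_def stay_def)
    qed
    ultimately show ?thesis by simp
  qed
  from exec_track[where F = "embM M 1 (L + 3)" and \<tau> = L and P = "Suc L", OF indep _ _ tr emb]
  obtain T5 where 6: "exec (track L (Suc L) (embM M 1 (L + 3))) T2 (Suc t) T5"
    and tr5: "tracks L (Suc L) T4 T5" and d: "\<bar>snd (T4 L)\<bar> \<le> \<bar>snd (T2 L)\<bar> + int (Suc t)" by auto
  have "snd (T2 L) = 0"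
    using L by (auto simp: T2 put_def init_config_def L_def[symmetric] nth_Cons' enc_input)
  then have d: "\<bar>snd (T4 L)\<bar> \<le> int (Suc t)" using d by simp
  define T6 where "T6 = T5(L := (fst (T5 L), 0), Suc L := (mark, 0))"
  have "exec (rewind L (Suc L)) T5 (2 * nat \<bar>snd (T4 L)\<bar> + 1) T6"
    unfolding T6_def by (rule exec_rewind) (use tr5 in \<open>auto simp: tracks_def\<close>)
  \<comment> \<open>In \<open>t + 1\<close> steps the head moves at most \<open>t + 1\<close> cells
    away, and each cell costs a test and a move on the way back. Together with the simulation this
    gives the factor 3 in the time bounds.\<close>
  then have 7: "exec (rewind L (Suc L)) T5 (2 * Suc t + 1) T6" by (rule exec_mono) (use d nat_mono[OF d] in simp)
  have "exec (prepare M nr p) (ini x) (1 + ((3 * n + 1) + ((2 * n + 1) + (t1 + ((2 * length z + 3) + (Suc t + (2 * Suc t + 1))))))) T6"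
    unfolding prepare_def Let_def L_def[symmetric]
    by (rule exec_seq[OF 1 exec_seq[OF _ exec_seq[OF 3 exec_seq[OF 4 exec_seq[OF 5 exec_seq[OF 6 7]]]]]])
      (use 2[of n] T1 in simp)
  then have "exec (prepare M nr p) (ini x) (5 * length x + t1 + 2 * length z + 3 * t + 20) T6"
    by (rule exec_mono) (simp add: n_def)
  moreover have "good_tapes M nr x c T6"
  proof -
    have T6: "T6 i = T4 i" if "i \<noteq> L" "i \<noteq> Suc L" "i \<noteq> Suc (Suc L)" for i
      using tr5 that by (auto simp: T6_def tracks_def)
    have "T5 L = T4 L" using tr5 by (auto simp: tracks_def)
    moreover have "T4 L = enc_tape (last (snd c))"
    proof -
      have "snd c \<noteq> []" using lc L by auto
      then show ?thesis using lc L by (simp add: T4_def put_def last_conv_nth)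
    qed
    ultimately have "T6 L = (\<lambda>p. code (fst (last (snd c)) p), 0)" by (simp add: T6_def enc_tape_def)
    moreover have "T6 0 = (wcont x, 0)" "T6 (L + 4) = blank" "rd T6 (L + 3) = of_bool (fst c \<in> accepting M)"
      using L lc by (auto simp: T6 T4_def put_def T3_def rd_def blank_def)
    moreover have "T6 (L + 5 + j) = (mark, if j = 2 then int (length x) else 0)" if "j < nr" for j
      using that lc by (auto simp: T6 T4_def put_def T3_def s0_def n_def)
    ultimately show ?thesis by (simp add: good_tapes_def L_def)
  qed
  ultimately show ?thesis unfolding c_def by blast
qed

lemma fok_prepare:
  assumes "wf_tm (M :: 'b::finite tm)" "5 \<le> nr" "regs p \<subseteq> {..<nr}" "emits p \<subseteq> {..<A}"
    "Suc (CARD('b) + auxs M) \<le> A" "2 \<le> A"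
  shows "fok (tapes M + 5 + nr) A (prepare M nr p)"
proof -
  have L: "0 < tapes M" using assms(1) by (simp add: wf_tm_def)
  interpret l: tape_layout "tapes M + 4" "Suc 0" "tapes M + 5" nr
    by standard (use L assms in auto)
  show ?thesis unfolding prepare_def Let_def
    by (intro fok_seq fok_whl fok_rewout fok_rewind fok_track fok_embM l.fok_cpl)
      (use assms L in \<open>auto simp: init_regs_def intro!: fok_prim\<close>)
qed

definition pc_word :: "('a::finite list \<Rightarrow> 'b::finite list) \<Rightarrow> bool" where
  "pc_word z \<longleftrightarrow> (\<exists>L sy. pc L \<and> pc sy \<and> (\<forall>x. L (inp_of x) (\<lambda>_. 0) (\<lambda>_. 0) = length (z x)) \<and>
     (\<forall>x i. i < length (z x) \<longrightarrow> sy (inp_of x) (\<lambda>_. 0) (\<lambda>_. i) = code (Sym (z x ! i))))"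

lemma pc_wordE:
  assumes "pc_word (z :: 'a::finite list \<Rightarrow> 'b::finite list)"
  shows "\<exists>p c. \<forall>x. exle (inp_of x) (\<lambda>_. 0) p ((\<lambda>_. 0)(2 := length x), []) ((length x + 2) ^ c)
       ((\<lambda>_. 0)(2 := length x), map (\<lambda>i. code (Sym (z x ! i))) [0..<length (z x)]) \<and>
       length (z x) \<le> (length x + 2) ^ c"
proof -
  obtain L sy where L: "pc L" "\<And>x. L (inp_of x) (\<lambda>_. 0) (\<lambda>_. 0) = length (z x)" and sy: "pc sy"
     "\<And>x i. i < length (z x) \<Longrightarrow> sy (inp_of x) (\<lambda>_. 0) (\<lambda>_. i) = code (Sym (z x ! i))"
    using assms unfolding pc_word_def by blast
  have K: "code (Sym a) \<le> CARD('b)" for a :: 'b using idx_less[of a] by simp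
  obtain vL where vL: "\<And>S X y e. bnd S X e \<Longrightarrow> L X y e \<le> S ^ vL"
    using pc_pb[OF L(1)] unfolding pb_def by blast
  obtain p c where p: "\<And>X y S. 2 \<le> S \<Longrightarrow> snd X \<le> S \<Longrightarrow> (\<forall>i<L X y (\<lambda>_. 0). sy X y (\<lambda>_. i) \<le> CARD('b)) \<Longrightarrow>
    exle X y p ((\<lambda>_. 0)(2 := snd X), []) (S ^ c)
      ((\<lambda>_. 0)(2 := snd X), map (\<lambda>i. sy X y (\<lambda>_. i)) [0..<L X y (\<lambda>_. 0)])"
    using word_prog[OF L(1) sy(1), of "CARD('b)"] by blast
  have "exle (inp_of x) (\<lambda>_. 0) p ((\<lambda>_. 0)(2 := length x), []) ((length x + 2) ^ (c + vL))
       ((\<lambda>_. 0)(2 := length x), map (\<lambda>i. code (Sym (z x ! i))) [0..<length (z x)])" for x :: "'a list"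
  proof -
    have a: "map (\<lambda>i. sy (inp_of x) (\<lambda>_. 0) (\<lambda>_. i)) [0..<length (z x)] = map (\<lambda>i. code (Sym (z x ! i))) [0..<length (z x)]"
      using sy(2) by auto
    have b: "exle (inp_of x) (\<lambda>_. 0) p ((\<lambda>_. 0)(2 := snd (inp_of x)), []) ((length x + 2) ^ c)
      ((\<lambda>_. 0)(2 := snd (inp_of x)), map (\<lambda>i. sy (inp_of x) (\<lambda>_. 0) (\<lambda>_. i)) [0..<L (inp_of x) (\<lambda>_. 0) (\<lambda>_. 0)])"
      by (rule p) (use sy(2) K L(2) in \<open>auto simp: inp_of_def simp del: code.simps\<close>)
    have s: "snd (inp_of x) = length x" by (simp add: inp_of_def)
    have "(length x + 2) ^ c \<le> (length x + 2) ^ (c + vL)" by (rule power_increasing) auto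
    with b show ?thesis unfolding L(2) s a by (rule exle_mono)
  qed
  moreover have "length (z x) \<le> (length x + 2) ^ (c + vL)" for x
  proof -
    have "length (z x) \<le> (length x + 2) ^ vL"
      using vL[of "length x + 2" "inp_of x" "\<lambda>_. 0" "\<lambda>_. 0"] L(2) by (simp add: bnd_def inp_of_def)
    also have "\<dots> \<le> (length x + 2) ^ (c + vL)" by (rule power_increasing) auto
    finally show ?thesis .
  qed
  ultimately show ?thesis by blast
qed

lemma finite_bound: "finite A \<Longrightarrow> \<exists>m. A \<subseteq> {..<m :: nat}"
  unfolding finite_nat_set_iff_bounded by blast

text \<open>\<open>M\<close> is simulated until it halts, without a clock. Its running time occurs
  only in the analysis, so time bounds need not be computable.\<close>

theorem reduce_decision:
  assumes M: "wf_tm (M :: 'b::finite tm)" and z: "pc_word (z :: 'a::finite list \<Rightarrow> 'b list)"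
  shows "\<exists>(M' :: 'a tm) C. wf_tm M' \<and> (\<forall>x t. halted M (run M (z x) t) \<longrightarrow>
     decides_within M' x ((length x + 2) ^ C + 3 * t) (fst (run M (z x) t) \<in> accepting M))"
proof -
  obtain p c where p: "\<And>x. exle (inp_of x) (\<lambda>_. 0) p ((\<lambda>_. 0)(2 := length x), []) ((length x + 2) ^ c)
       ((\<lambda>_. 0)(2 := length x), map (\<lambda>i. code (Sym (z x ! i))) [0..<length (z x)])"
    and lz: "\<And>x. length (z x) \<le> (length x + 2) ^ c"
    using pc_wordE[OF z] by blast
  obtain m1 m2 where m: "regs p \<subseteq> {..<m1}" "emits p \<subseteq> {..<m2}"
    using finite_bound[OF finite_regs] finite_bound[OF finite_emits] by metis
  define nr where "nr = m1 + 5"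
  define ax where "ax = CARD('b) + auxs M + m2 + 2"
  define K where "K = tapes M + 5 + nr"
  let ?F = "prepare M nr p"
  let ?M = "to_tm K ax ?F (tapes M + 3) (\<lambda>s. s = 1) :: 'a tm"
  have F: "fok K (Suc (CARD('a) + ax)) ?F"
    unfolding K_def by (rule fok_prepare) (use M m in \<open>auto simp: nr_def ax_def\<close>)
  have "polyb (\<lambda>S. 5 * S + S ^ c + 2 * S ^ c + 20 + 1)" by (intro polyb_intros)
  then obtain C where C: "\<And>S :: nat. 2 \<le> S \<Longrightarrow> 5 * S + S ^ c + 2 * S ^ c + 20 + 1 \<le> S ^ C"
    unfolding polyb_def by blast
  have "decides_within ?M x ((length x + 2) ^ C + 3 * t) (fst (run M (z x) t) \<in> accepting M)"
    if h: "halted M (run M (z x) t)" for x t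
  proof -
    obtain T where T: "exec ?F (ini x) (5 * length x + (length x + 2) ^ c + 2 * length (z x) + 3 * t + 20) T"
      "good_tapes M nr x (run M (z x) t) T"
    proof -
      have "5 \<le> nr" "regs p \<subseteq> {..<nr}" using m by (auto simp: nr_def)
      from exec_prepare[OF M this p h] show thesis using that by blast
    qed
    have "5 * length x + (length x + 2) ^ c + 2 * length (z x) + 20 + 1 \<le> (length x + 2) ^ C"
      using C[of "length x + 2"] lz[of x] by simp
    then have "exec ?F (ini x) ((length x + 2) ^ C + 3 * t - 1) T"
      by (intro exec_mono[OF T(1)]) linarith
    from to_tm_decides[OF F _ _ this, of "tapes M + 3" ax "\<lambda>s. s = 1"] T(2)
    have "decides_within ?M x (Suc ((length x + 2) ^ C + 3 * t - 1)) (fst (run M (z x) t) \<in> accepting M)"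
      by (cases "fst (run M (z x) t) \<in> accepting M") (simp_all add: good_tapes_def K_def)
    moreover have "0 < (length x + 2) ^ C" by simp
    ultimately show ?thesis by simp
  qed
  moreover have "wf_tm ?M" by (rule wf_to_tm[OF F]) (simp add: K_def)
  ultimately show ?thesis by blast
qed

text \<open>Here the content of the output tape is evaluated further by \<open>D\<close>, which sees
  the original input and that tape; the value 0 means acceptance.\<close>

theorem reduce_search:
  assumes M: "wf_tm (M :: 'b::finite tm)" and z: "pc_word (z :: 'a::finite list \<Rightarrow> 'b list)" and D: "pc D"
  shows "\<exists>(M' :: 'a tm) C. wf_tm M' \<and> (\<forall>x t. halted M (run M (z x) t) \<longrightarrow>
     decides_within M' x ((length x + 2) ^ C + 3 * t)
       (D (inp_of x) (\<lambda>i. code (fst (last (snd (run M (z x) t))) (int i))) (\<lambda>_. 0) = 0))"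
proof -
  obtain p c where p: "\<And>x. exle (inp_of x) (\<lambda>_. 0) p ((\<lambda>_. 0)(2 := length x), []) ((length x + 2) ^ c)
       ((\<lambda>_. 0)(2 := length x), map (\<lambda>i. code (Sym (z x ! i))) [0..<length (z x)])"
    and lz: "\<And>x. length (z x) \<le> (length x + 2) ^ c"
    using pc_wordE[OF z] by blast
  obtain p' c' where p': "\<And>X y S. 2 \<le> S \<Longrightarrow> snd X \<le> S \<Longrightarrow>
    exle X y p' ((\<lambda>_. 0)(2 := snd X), []) (S ^ c') ((\<lambda>_. 0)(2 := snd X, 4 := D X y (\<lambda>_. 0)), [])"
    using val_prog[OF D] by blast
  obtain m1 m2 where m: "regs p \<subseteq> {..<m1}" "emits p \<subseteq> {..<m2}"
    using finite_bound[OF finite_regs] finite_bound[OF finite_emits] by metis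
  obtain m1' m2' where m': "regs p' \<subseteq> {..<m1'}" "emits p' \<subseteq> {..<m2'}"
    using finite_bound[OF finite_regs] finite_bound[OF finite_emits] by metis
  define nr where "nr = m1 + m1' + 5"
  define ax where "ax = CARD('b) + auxs M + m2 + m2' + 2"
  define L where "L = tapes M"
  define K where "K = L + 5 + nr"
  have L: "0 < L" using M by (simp add: wf_tm_def L_def)
  interpret l: tape_layout L "L + 4" "L + 5" nr
    by standard (use L nr_def in auto)
  define F where "F = seqF (prepare M nr p) (l.cpl p')"
  let ?M = "to_tm K ax F (L + 5 + 4) (\<lambda>s. s = 1) :: 'a tm"
  have F: "fok K (Suc (CARD('a) + ax)) F"
    unfolding K_def F_def L_def
    by (intro fok_seq fok_prepare l.fok_cpl[unfolded L_def]) (use M m m' in \<open>auto simp: nr_def ax_def\<close>)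
  have "polyb (\<lambda>S. 5 * S + S ^ c + 2 * S ^ c + 20 + S ^ c' + 1)" by (intro polyb_intros)
  then obtain C where C: "\<And>S :: nat. 2 \<le> S \<Longrightarrow> 5 * S + S ^ c + 2 * S ^ c + 20 + S ^ c' + 1 \<le> S ^ C"
    unfolding polyb_def by blast
  have "decides_within ?M x ((length x + 2) ^ C + 3 * t)
       (D (inp_of x) (\<lambda>i. code (fst (last (snd (run M (z x) t))) (int i))) (\<lambda>_. 0) = 0)"
    if h: "halted M (run M (z x) t)" for x t
  proof -
    obtain T where T: "exec (prepare M nr p) (ini x) (5 * length x + (length x + 2) ^ c + 2 * length (z x) + 3 * t + 20) T"
      "good_tapes M nr x (run M (z x) t) T"
    proof -
      have "5 \<le> nr" "regs p \<subseteq> {..<nr}" using m by (auto simp: nr_def)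
      from exec_prepare[OF M this p h] show thesis using that by blast
    qed
    define y where "y = (\<lambda>i. code (fst (last (snd (run M (z x) t))) (int i)))"
    define s0 where "s0 = ((\<lambda>_. 0)(2 := length x) :: nat \<Rightarrow> nat)"
    have g: "T 0 = (wcont x, 0)" "T L = (\<lambda>p. code (fst (last (snd (run M (z x) t))) p), 0)" "T (L + 4) = blank"
      "\<And>j. j < nr \<Longrightarrow> T (L + 5 + j) = (mark, if j = 2 then int (length x) else 0)"
      using T(2) by (auto simp: good_tapes_def L_def)
    have "l.rep T (s0, []) = T"
    proof
      fix i show "l.rep T (s0, []) i = T i"
      proof (cases "L + 5 \<le> i \<and> i < L + 5 + nr")
        case True
        then have "i = L + 5 + (i - (L + 5))" "i - (L + 5) < nr" by auto
        then obtain j where "i = L + 5 + j" "j < nr" by blast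
        then show ?thesis using g(4)[of j] L by (simp add: l.rep_def s0_def mark_alt)
      next
        case False
        then show ?thesis using g(1-3) by (auto simp: l.rep_def s0_def blank_def)
      qed
    qed
    moreover have "exec (l.cpl p') (l.rep T (s0, [])) ((length x + 2) ^ c') (l.rep T (s0(4 := D (inp_of x) y (\<lambda>_. 0)), []))"
      by (rule l.exec_cpl_le[of "inp_of x" _ y])
        (use p'[of "length x + 2" "inp_of x" y] m' in \<open>auto simp: inp_of_def g y_def s0_def nr_def\<close>)
    ultimately have e: "exec F (ini x) ((5 * length x + (length x + 2) ^ c + 2 * length (z x) + 3 * t + 20) + (length x + 2) ^ c')
      (l.rep T (s0(4 := D (inp_of x) y (\<lambda>_. 0)), []))"
      unfolding F_def using T(1) by (auto intro: exec_seq)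
    have "5 * length x + (length x + 2) ^ c + 2 * length (z x) + 20 + (length x + 2) ^ c' + 1 \<le> (length x + 2) ^ C"
      using C[of "length x + 2"] lz[of x] by simp
    then have "exec F (ini x) ((length x + 2) ^ C + 3 * t - 1) (l.rep T (s0(4 := D (inp_of x) y (\<lambda>_. 0)), []))"
      by (intro exec_mono[OF e]) linarith
    from to_tm_decides[OF F _ _ this, of "L + 5 + 4" ax "\<lambda>s. s = 1"]
    have "decides_within ?M x (Suc ((length x + 2) ^ C + 3 * t - 1))
      (rd (l.rep T (s0(4 := D (inp_of x) y (\<lambda>_. 0)), [])) (L + 5 + 4) = 1)"
      by (simp add: K_def nr_def)
    \<comment> \<open>Tape \<open>L + 5 + 4\<close> is register 4, the result register. Its head
      reads the mark 1 in cell 0 exactly when the register is 0.\<close>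
    moreover have "(rd (l.rep T (s0(4 := D (inp_of x) y (\<lambda>_. 0)), [])) (L + 5 + 4) = 1) = (D (inp_of x) y (\<lambda>_. 0) = 0)"
      unfolding rd_def l.rep_def using L by (simp add: nr_def)
    ultimately have "decides_within ?M x (Suc ((length x + 2) ^ C + 3 * t - 1)) (D (inp_of x) y (\<lambda>_. 0) = 0)"
      by simp
    moreover have "0 < (length x + 2) ^ C" by simp
    ultimately show ?thesis by (simp add: y_def)
  qed
  moreover have "wf_tm ?M" by (rule wf_to_tm[OF F]) (simp add: K_def)
  ultimately show ?thesis by blast
qed

section \<open>Weights and tensor products of codes\<close>

definition wt :: "nat \<Rightarrow> (nat \<Rightarrow> 'q::zero) \<Rightarrow> nat" where
  "wt n f = (\<Sum>i<n. of_bool (f i \<noteq> 0))"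

definition mv :: "nat \<Rightarrow> (nat \<Rightarrow> nat \<Rightarrow> 'q::comm_ring_1) \<Rightarrow> (nat \<Rightarrow> 'q) \<Rightarrow> nat \<Rightarrow> 'q" where
  "mv d A y i = (\<Sum>j<d. A i j * y j)"

definition nz :: "nat \<Rightarrow> (nat \<Rightarrow> 'q::zero) \<Rightarrow> bool" where
  "nz d y \<longleftrightarrow> (\<exists>j<d. y j \<noteq> 0)"

definition mindist :: "nat \<Rightarrow> nat \<Rightarrow> (nat \<Rightarrow> nat \<Rightarrow> 'q::comm_ring_1) \<Rightarrow> nat \<Rightarrow> bool" where
  "mindist n d A \<delta> \<longleftrightarrow> (\<forall>y. nz d y \<longrightarrow> \<delta> \<le> wt n (mv d A y))"

definition kron :: "nat \<Rightarrow> nat \<Rightarrow> (nat \<Rightarrow> nat \<Rightarrow> 'q::comm_ring_1) \<Rightarrow> (nat \<Rightarrow> nat \<Rightarrow> 'q) \<Rightarrow> nat \<Rightarrow> nat \<Rightarrow> 'q" where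
  "kron n d A B i j = A (i div n) (j div d) * B (i mod n) (j mod d)"

lemma div_mod_idx: "j < b \<Longrightarrow> (i * b + j) div b = i" "j < b \<Longrightarrow> (i * b + j) mod b = (j :: nat)"
  by auto

lemma sum_div_mod: "(\<Sum>i<a * b. f i) = (\<Sum>i<a. \<Sum>j<b. f (i * b + j))" for f :: "nat \<Rightarrow> 'c::comm_monoid_add"
proof -
  have "(\<Sum>j<b. f (i * b + j)) = sum f {i * b..<i * b + b}" for i
    using sum.shift_bounds_nat_ivl[of f 0 "i * b" b] by (simp add: atLeast0LessThan add.commute)
  then show ?thesis using sum.nat_group[of f b a] by simp
qed

lemma idx_less_mult: "i < a \<Longrightarrow> j < b \<Longrightarrow> i * b + j < a * (b :: nat)"
proof -
  assume "i < a" "j < b"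
  then have "i * b + j < Suc i * b" by simp
  also have "\<dots> \<le> a * b" using \<open>i < a\<close> by (intro mult_le_mono1) simp
  finally show ?thesis .
qed

lemma wt_cong: "(\<And>i. i < n \<Longrightarrow> f i = g i) \<Longrightarrow> wt n f = wt n g"
  unfolding wt_def by (intro sum.cong) auto

lemma wt_mult: "wt (a * b) f = (\<Sum>i<a. wt b (\<lambda>j. f (i * b + j)))"
  unfolding wt_def by (rule sum_div_mod)

lemma mv_kron:
  assumes "i2 < n2"
  shows "mv (d1 * d2) (kron n2 d2 A B) y (i1 * n2 + i2) =
    (\<Sum>j2<d2. B i2 j2 * (\<Sum>j1<d1. A i1 j1 * y (j1 * d2 + j2)))"
proof -
  have "mv (d1 * d2) (kron n2 d2 A B) y (i1 * n2 + i2) =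
     (\<Sum>j1<d1. \<Sum>j2<d2. A i1 j1 * B i2 j2 * y (j1 * d2 + j2))"
    unfolding mv_def sum_div_mod kron_def div_mod_idx[OF assms]
    by (intro sum.cong refl) (simp add: div_mod_idx)
  also have "\<dots> = (\<Sum>j2<d2. \<Sum>j1<d1. A i1 j1 * B i2 j2 * y (j1 * d2 + j2))" by (rule sum.swap)
  finally show ?thesis by (simp add: sum_distrib_left mult_ac)
qed

text \<open>Regard \<open>y\<close> as a d1 x d2 matrix Y. Block \<open>i\<close> of the encoding is
  row \<open>i\<close> of the product A Y, encoded by B. So each nonzero row contributes at least
  \<open>b\<close>.\<close>

lemma wt_kron_ge:
  assumes B: "mindist n2 d2 B b"
    and R: "R \<subseteq> {..<n1}" "\<And>i. i \<in> R \<Longrightarrow> nz d2 (\<lambda>j2. \<Sum>j1<d1. A i j1 * y (j1 * d2 + j2))"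
  shows "card R * b \<le> wt (n1 * n2) (mv (d1 * d2) (kron n2 d2 A B) y)"
proof -
  have "card R * b \<le> (\<Sum>i\<in>R. wt n2 (mv d2 B (\<lambda>j2. \<Sum>j1<d1. A i j1 * y (j1 * d2 + j2))))"
    using sum_bounded_below[of R b] B R(2) unfolding mindist_def by force
  also have "\<dots> = (\<Sum>i\<in>R. wt n2 (\<lambda>i2. mv (d1 * d2) (kron n2 d2 A B) y (i * n2 + i2)))"
    by (intro sum.cong refl wt_cong) (simp add: mv_kron, simp add: mv_def)
  also have "\<dots> \<le> (\<Sum>i<n1. wt n2 (\<lambda>i2. mv (d1 * d2) (kron n2 d2 A B) y (i * n2 + i2)))"
    using R(1) by (intro sum_mono2) auto
  finally show ?thesis by (simp add: wt_mult)
qed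

lemma wt_card: "wt n f = card {i. i < n \<and> f i \<noteq> 0}"
  unfolding wt_def by (simp add: sum_of_bool_eq Int_def)

text \<open>A nonzero column of the coefficient matrix is encoded by A with weight at least
  \<open>a\<close>, so that many rows are nonzero, and \<open>wt_kron_ge\<close> applies.\<close>

lemma kron_dist:
  assumes A: "mindist n1 d1 A a" and B: "mindist n2 d2 B b"
  shows "mindist (n1 * n2) (d1 * d2) (kron n2 d2 A B) (a * b)"
  unfolding mindist_def
proof (intro allI impI)
  fix y :: "nat \<Rightarrow> 'a" assume "nz (d1 * d2) y"
  then obtain j where j: "j < d1 * d2" "y j \<noteq> 0" unfolding nz_def by blast
  define j2 where "j2 = j mod d2"
  have d2: "0 < d2" using j(1) by (cases d2) auto
  have j2: "j2 < d2" using d2 by (simp add: j2_def)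
  have "j div d2 < d1" using j(1) by (simp add: less_mult_imp_div_less)
  moreover have "y (j div d2 * d2 + j2) \<noteq> 0" using j(2) by (simp add: j2_def)
  ultimately have "nz d1 (\<lambda>j1. y (j1 * d2 + j2))" unfolding nz_def by blast
  then have "a \<le> card {i. i < n1 \<and> mv d1 A (\<lambda>j1. y (j1 * d2 + j2)) i \<noteq> 0}"
    using A unfolding mindist_def wt_card by blast
  then have "a * b \<le> card {i. i < n1 \<and> mv d1 A (\<lambda>j1. y (j1 * d2 + j2)) i \<noteq> 0} * b" by simp
  also have "\<dots> \<le> wt (n1 * n2) (mv (d1 * d2) (kron n2 d2 A B) y)"
    by (rule wt_kron_ge[OF B]) (use j2 in \<open>auto simp: nz_def mv_def\<close>)
  finally show "a * b \<le> wt (n1 * n2) (mv (d1 * d2) (kron n2 d2 A B) y)" .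
qed

lemma kron_rank1:
  fixes A B :: "nat \<Rightarrow> nat \<Rightarrow> 'q::field"
  shows "wt (n1 * n2) (mv (d1 * d2) (kron n2 d2 A B) (\<lambda>j. u (j div d2) * v (j mod d2))) =
    wt n1 (mv d1 A u) * wt n2 (mv d2 B v)"
proof -
  have "mv (d1 * d2) (kron n2 d2 A B) (\<lambda>j. u (j div d2) * v (j mod d2)) (i1 * n2 + i2) =
      mv d1 A u i1 * mv d2 B v i2" if "i2 < n2" for i1 i2
  proof -
    have "mv (d1 * d2) (kron n2 d2 A B) (\<lambda>j. u (j div d2) * v (j mod d2)) (i1 * n2 + i2) =
      (\<Sum>j2<d2. \<Sum>j1<d1. (B i2 j2 * v j2) * (A i1 j1 * u j1))"
      unfolding mv_kron[OF that] sum_distrib_left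
      by (intro sum.cong refl) (simp add: div_mod_idx)
    then show ?thesis unfolding mv_def sum_product[symmetric] by (simp add: mult.commute)
  qed
  then have "wt (n1 * n2) (mv (d1 * d2) (kron n2 d2 A B) (\<lambda>j. u (j div d2) * v (j mod d2))) =
     (\<Sum>i<n1. \<Sum>j<n2. of_bool (mv d1 A u i \<noteq> 0) * of_bool (mv d2 B v j \<noteq> 0))"
    unfolding wt_mult unfolding wt_def by (intro sum.cong refl) (simp flip: of_bool_conj)
  then show ?thesis by (simp only: wt_def sum_product)
qed

fun tens :: "nat \<Rightarrow> nat \<Rightarrow> (nat \<Rightarrow> nat \<Rightarrow> 'q::comm_ring_1) \<Rightarrow> nat \<Rightarrow> nat \<Rightarrow> nat \<Rightarrow> 'q" where
  "tens n d A 0 = (\<lambda>i j. 1)"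
| "tens n d A (Suc t) = kron (n ^ t) (d ^ t) A (tens n d A t)"

lemma tens_dist: "mindist n d (A :: nat \<Rightarrow> nat \<Rightarrow> 'q::field) a \<Longrightarrow> mindist (n ^ t) (d ^ t) (tens n d A t) (a ^ t)"
proof (induction t)
  case 0
  then show ?case by (auto simp: mindist_def nz_def wt_def mv_def)
next
  case (Suc t)
  then show ?case using kron_dist[of n d A a] by simp
qed

lemma tens_weight:
  fixes A :: "nat \<Rightarrow> nat \<Rightarrow> 'q::field"
  assumes "nz d y"
  shows "\<exists>y'. nz (d ^ t) y' \<and> wt (n ^ t) (mv (d ^ t) (tens n d A t) y') = wt n (mv d A y) ^ t"
proof (induction t)
  case 0
  show ?case by (rule exI[of _ "\<lambda>_. 1"]) (auto simp: nz_def wt_def mv_def)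
next
  case (Suc t)
  then obtain y' where y': "nz (d ^ t) y'" "wt (n ^ t) (mv (d ^ t) (tens n d A t) y') = wt n (mv d A y) ^ t" by blast
  obtain j j' where j: "j < d" "y j \<noteq> 0" "j' < d ^ t" "y' j' \<noteq> 0" using assms y'(1) unfolding nz_def by blast
  let ?y = "\<lambda>j. y (j div d ^ t) * y' (j mod d ^ t)"
  have "?y (j * d ^ t + j') \<noteq> 0" using j by (simp add: div_mod_idx)
  moreover have "j * d ^ t + j' < d * d ^ t" by (rule idx_less_mult[OF j(1,3)])
  ultimately have "nz (d ^ Suc t) ?y" unfolding nz_def power_Suc by blast
  moreover have "wt (n ^ Suc t) (mv (d ^ Suc t) (tens n d A (Suc t)) ?y) = wt n (mv d A y) ^ Suc t"
    using kron_rank1[of n "n ^ t" d "d ^ t" A "tens n d A t" y y'] y'(2) by simp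
  ultimately show ?case by blast
qed

section \<open>Value distributions\<close>

definition cnt :: "nat \<Rightarrow> (nat \<Rightarrow> 'q) \<Rightarrow> 'q \<Rightarrow> nat" where
  "cnt N f c = (\<Sum>i<N. of_bool (f i = c))"

text \<open>\<open>f\<close> takes the value 0 on \<open>Z\<close> of the \<open>N\<close> positions and is equidistributed on the others.\<close>

definition unif :: "nat \<Rightarrow> nat \<Rightarrow> (nat \<Rightarrow> 'q::{finite,field}) \<Rightarrow> bool" where
  "unif N Z f \<longleftrightarrow> (\<forall>c. CARD('q) * cnt N f c + Z = N + (if c = 0 then CARD('q) * Z else 0))"

lemma cnt_cong: "(\<And>i. i < N \<Longrightarrow> f i = g i) \<Longrightarrow> cnt N f c = cnt N g c"
  unfolding cnt_def by (intro sum.cong) auto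

lemma unif_cong: "(\<And>i. i < N \<Longrightarrow> f i = g i) \<Longrightarrow> unif N Z f = unif N Z g"
  unfolding unif_def using cnt_cong[of N f g] by simp

lemma sum_value: "finite A \<Longrightarrow> a \<in> A \<Longrightarrow> (\<Sum>c\<in>A. of_bool (a = c) * g c) = (g a :: 'c::semiring_1)"
  using sum.delta[of A a g] by (simp add: of_bool_def if_distrib[of "\<lambda>x. x * _"] cong: if_cong)

text \<open>In a sum of two independent values one uniform summand makes the sum uniform; what
  remains is the product of the two zero parts. Technically the counts are a constant plus a
  multiple of the delta at 0, a form that is preserved by convolution. Counts are multiplied by the
  field size to avoid division.\<close>

lemma unif_conv:
  fixes f g :: "nat \<Rightarrow> 'q::{finite,field}"
  assumes "unif N Z f" "unif N' Z' g"
  shows "unif (N * N') (Z * Z') (\<lambda>i. f (i div N') + g (i mod N'))"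
  unfolding unif_def
proof
  fix c :: 'q
  let ?q = "int CARD('q)"
  have q: "0 < ?q" by simp
  have f: "?q * int (cnt N f c) = int N - int Z + of_bool (c = 0) * (?q * int Z)" for c
    using assms(1)[unfolded unif_def, rule_format, of c] by (auto simp: of_bool_def simp flip: of_nat_mult of_nat_add)
  have g: "?q * int (cnt N' g c) = int N' - int Z' + of_bool (c = 0) * (?q * int Z')" for c
    using assms(2)[unfolded unif_def, rule_format, of c] by (auto simp: of_bool_def simp flip: of_nat_mult of_nat_add)
  have "cnt (N * N') (\<lambda>i. f (i div N') + g (i mod N')) c = (\<Sum>i<N. \<Sum>j<N'. of_bool (f i + g j = c))"
    unfolding cnt_def sum_div_mod by (intro sum.cong refl) (simp add: div_mod_idx)
  also have "\<dots> = (\<Sum>i<N. cnt N' g (c - f i))"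
    unfolding cnt_def by (intro sum.cong refl) (simp add: algebra_simps)
  also have "\<dots> = (\<Sum>i<N. \<Sum>c'\<in>UNIV. of_bool (f i = c') * cnt N' g (c - c'))"
    by (simp add: sum_value)
  also have "\<dots> = (\<Sum>c'\<in>UNIV. cnt N f c' * cnt N' g (c - c'))"
    by (subst sum.swap) (simp add: cnt_def sum_distrib_right)
  finally have "?q * (?q * int (cnt (N * N') (\<lambda>i. f (i div N') + g (i mod N')) c)) =
     (\<Sum>c'\<in>UNIV. (?q * int (cnt N f c')) * (?q * int (cnt N' g (c - c'))))"
    by (simp add: sum_distrib_left mult_ac)
  also have "\<dots> = (\<Sum>c'\<in>UNIV. (int N - int Z) * (int N' - int Z') + of_bool (0 = c') * ((?q * int Z) * (int N' - int Z'))
      + of_bool (c = c') * ((int N - int Z) * (?q * int Z')) + of_bool (0 = c') * (of_bool (c = c') * (?q * int Z * (?q * int Z'))))"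
    unfolding f g by (intro sum.cong refl) (auto simp: algebra_simps)
  also have "\<dots> = ?q * ((int N - int Z) * (int N' - int Z')) + (?q * int Z) * (int N' - int Z')
     + (int N - int Z) * (?q * int Z') + of_bool (c = 0) * (?q * int Z * (?q * int Z'))"
    by (simp add: sum.distrib sum_value)
  also have "\<dots> = ?q * (int N * int N' - int Z * int Z' + of_bool (c = 0) * (?q * (int Z * int Z')))"
    by (simp add: algebra_simps)
  finally have "?q * int (cnt (N * N') (\<lambda>i. f (i div N') + g (i mod N')) c) =
     int N * int N' - int Z * int Z' + of_bool (c = 0) * (?q * (int Z * int Z'))"
    using q by (simp only: mult_cancel_left) linarith
  then have "int (CARD('q) * cnt (N * N') (\<lambda>i. f (i div N') + g (i mod N')) c + Z * Z') =
     int (N * N' + (if c = 0 then CARD('q) * (Z * Z') else 0))"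
    by (cases "c = 0") simp_all
  then show "CARD('q) * cnt (N * N') (\<lambda>i. f (i div N') + g (i mod N')) c + Z * Z' =
     N * N' + (if c = 0 then CARD('q) * (Z * Z') else 0)"
    by (simp only: of_nat_eq_iff)
qed

lemma unif_blocks:
  fixes f :: "nat \<Rightarrow> nat \<Rightarrow> 'q::{finite,field}"
  assumes "\<And>s. s < K \<Longrightarrow> unif N (Z s) (f s)"
  shows "unif (K * N) (\<Sum>s<K. Z s) (\<lambda>i. f (i div N) (i mod N))"
  unfolding unif_def
proof
  fix c :: 'q
  have "cnt (K * N) (\<lambda>i. f (i div N) (i mod N)) c = (\<Sum>s<K. cnt N (f s) c)"
    unfolding cnt_def sum_div_mod by (intro sum.cong refl) (simp add: div_mod_idx)
  then have "CARD('q) * cnt (K * N) (\<lambda>i. f (i div N) (i mod N)) c + (\<Sum>s<K. Z s) =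
     (\<Sum>s<K. CARD('q) * cnt N (f s) c + Z s)"
    by (simp add: sum_distrib_left sum.distrib)
  also have "\<dots> = (\<Sum>s<K. N + (if c = 0 then CARD('q) * Z s else 0))"
    using assms unfolding unif_def by (intro sum.cong refl) auto
  also have "\<dots> = K * N + (if c = 0 then CARD('q) * (\<Sum>s<K. Z s) else 0)"
    by (simp add: sum.distrib sum_distrib_left)
  finally show "CARD('q) * cnt (K * N) (\<lambda>i. f (i div N) (i mod N)) c + (\<Sum>s<K. Z s) =
     K * N + (if c = 0 then CARD('q) * (\<Sum>s<K. Z s) else 0)" .
qed

lemma unif_wt:
  fixes f :: "nat \<Rightarrow> 'q::{finite,field}"
  assumes "unif N Z f"
  shows "int CARD('q) * int (wt N f) = (int CARD('q) - 1) * (int N - int Z)"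
proof -
  have "wt N f + cnt N f 0 = (\<Sum>i<N. of_bool (f i \<noteq> 0) + of_bool (f i = 0))"
    unfolding wt_def cnt_def by (simp only: sum.distrib)
  also have "\<dots> = (\<Sum>i<N. 1)" by (intro sum.cong) auto
  finally have w: "int (wt N f) = int N - int (cnt N f 0)" by (simp flip: of_nat_add)
  have "CARD('q) * cnt N f 0 + Z = N + CARD('q) * Z"
    using assms unfolding unif_def by auto
  then have "int CARD('q) * int (cnt N f 0) + int Z = int N + int CARD('q) * int Z"
    by (simp flip: of_nat_mult of_nat_add)
  then show ?thesis unfolding w by (simp add: algebra_simps)
qed

definition fe :: "nat \<Rightarrow> 'q::finite" where
  "fe = inv_into UNIV idx"

lemma fe_idx [simp]: "fe (idx x) = x"
  unfolding fe_def using bij_betw_inv_into_left[OF bij_idx, of x] by simp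

lemma idx_fe [simp]: "n < CARD('q) \<Longrightarrow> idx (fe n :: 'q::finite) = n"
  unfolding fe_def using bij_betw_inv_into_right[OF bij_idx] by auto

lemma unif_scale: "unif CARD('q) (if b = 0 then CARD('q) else 0) (\<lambda>c. fe c * b :: 'q::{finite,field})"
proof -
  have "cnt CARD('q) (\<lambda>c. fe c * b) v = 1" if "b \<noteq> 0" for v
  proof -
    have "(fe c * b = v) = (c = idx (v / b))" if "c < CARD('q)" for c
    proof -
      have "(fe c * b = v) = (fe c = v / b)" using \<open>b \<noteq> 0\<close> by (auto simp: field_simps)
      also have "\<dots> = (c = idx (v / b))" using that by (metis fe_idx idx_fe)
      finally show ?thesis .
    qed
    then have "cnt CARD('q) (\<lambda>c. fe c * b) v = (\<Sum>c<CARD('q). of_bool (idx (v / b) = c) * 1)"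
      unfolding cnt_def by (intro sum.cong refl) auto
    then show ?thesis by (simp only: sum_value[of _ _ "\<lambda>_. 1 :: nat"] finite_lessThan lessThan_iff idx_less)
  qed
  then show ?thesis by (auto simp: unif_def cnt_def)
qed

text \<open>The Hadamard code: the base q digits of \<open>c\<close> are the coefficients of a
  linear form that is applied to \<open>b\<close>.\<close>

definition had :: "(nat \<Rightarrow> 'q::{finite,field}) \<Rightarrow> nat \<Rightarrow> nat \<Rightarrow> 'q" where
  "had b J c = (\<Sum>j<J. fe (c div CARD('q) ^ j mod CARD('q)) * b j)"

lemma had_Suc:
  assumes "c < CARD('q) ^ Suc J"
  shows "had (b :: nat \<Rightarrow> 'q::{finite,field}) (Suc J) c = fe (c div CARD('q) ^ J) * b J + had b J (c mod CARD('q) ^ J)"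
proof -
  let ?q = "CARD('q)"
  have "c div ?q ^ J < ?q" using assms by (simp add: less_mult_imp_div_less mult.commute)
  moreover have e: "c mod ?q ^ J div ?q ^ j mod ?q = c div ?q ^ j mod ?q" if "j < J" for j
  proof -
    have J: "J = j + Suc (J - Suc j)" using that by simp
    have "c mod ?q ^ J div ?q ^ j = c mod (?q ^ j * ?q ^ (J - j)) div ?q ^ j"
      using that by (simp flip: power_add)
    also have "\<dots> = c div ?q ^ j mod ?q ^ (J - j)" by (simp add: mod_mult2_eq)
    finally show ?thesis using that by (simp add: mod_mod_cancel)
  qed
  moreover have "(\<Sum>j<J. fe (c mod ?q ^ J div ?q ^ j mod ?q) * b j) = (\<Sum>j<J. fe (c div ?q ^ j mod ?q) * b j)"
    by (intro sum.cong refl) (simp add: e)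
  ultimately show ?thesis unfolding had_def by simp
qed

text \<open>A random linear form is equidistributed on a nonzero vector and vanishes on the zero
  vector. The coordinates are added one at a time by \<open>unif_conv\<close>.\<close>

lemma unif_had: "unif (CARD('q) ^ J) (if \<forall>j<J. b j = 0 then CARD('q) ^ J else 0) (had (b :: nat \<Rightarrow> 'q::{finite,field}) J)"
proof (induction J)
  case 0
  show ?case by (auto simp: unif_def cnt_def had_def)
next
  case (Suc J)
  let ?q = "CARD('q)"
  have "unif (?q * ?q ^ J) ((if b J = 0 then ?q else 0) * (if \<forall>j<J. b j = 0 then ?q ^ J else 0))
     (\<lambda>i. fe (i div ?q ^ J) * b J + had b J (i mod ?q ^ J))"
    by (rule unif_conv[OF unif_scale Suc])
  then have "unif (?q ^ Suc J) ((if b J = 0 then ?q else 0) * (if \<forall>j<J. b j = 0 then ?q ^ J else 0)) (had b (Suc J))"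
    by (subst unif_cong[OF had_Suc]) auto
  moreover have "(if b J = 0 then ?q else 0) * (if \<forall>j<J. b j = 0 then ?q ^ J else 0) =
    (if \<forall>j<Suc J. b j = 0 then ?q ^ Suc J else 0)" by (auto simp: less_Suc_eq)
  ultimately show ?case by simp
qed

section \<open>A balanced code\<close>

text \<open>For a random seed \<open>(u, v)\<close> the events \<open>(u * i + v) mod Q < W\<close> have probability \<open>W / Q\<close>, and
  for \<open>i \<noteq> k\<close> they are almost independent as soon as \<open>W\<close> exceeds \<open>\<bar>i - k\<bar>\<close>, even though \<open>Q\<close> is
  not a prime. So if \<open>W / Q\<close> is about the inverse of the number of relevant \<open>i\<close>, with constant
  probability exactly one of them is hit.\<close>

definition hit :: "nat \<Rightarrow> nat \<Rightarrow> nat \<Rightarrow> nat \<Rightarrow> nat \<Rightarrow> nat" where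
  "hit Q W u v i = of_bool ((u * i + v) mod Q < W)"

lemma sum_shift_mod:
  fixes g :: "nat \<Rightarrow> nat"
  assumes "0 < Q"
  shows "(\<Sum>v<Q. g ((a + v) mod Q)) = (\<Sum>v<Q. g v)"
proof (rule sum.reindex_bij_witness[of _ "\<lambda>v. (v + (Q - a mod Q)) mod Q" "\<lambda>v. (a + v) mod Q"])
  fix v assume v: "v \<in> {..<Q}"
  have a: "a mod Q \<le> Q" using assms by (simp add: less_imp_le)
  have "((a + v) mod Q + (Q - a mod Q)) mod Q = ((a mod Q + v) + (Q - a mod Q)) mod Q"
    by (metis mod_add_left_eq)
  also have "a mod Q + v + (Q - a mod Q) = v + Q" using a by simp
  finally show "((a + v) mod Q + (Q - a mod Q)) mod Q = v" using v by simp
  have "(a + (v + (Q - a mod Q)) mod Q) mod Q = (a mod Q + (v + (Q - a mod Q))) mod Q"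
    by (metis mod_add_left_eq mod_add_right_eq)
  also have "a mod Q + (v + (Q - a mod Q)) = v + Q" using a by simp
  finally show "(a + (v + (Q - a mod Q)) mod Q) mod Q = v" using v by simp
qed (use assms in auto)

lemma sum_below: "(W :: nat) \<le> Q \<Longrightarrow> (\<Sum>v<Q. of_bool (v < W) * g v) = (\<Sum>v<W. g v :: nat)"
proof -
  assume "W \<le> Q"
  then have "(\<Sum>v<W. of_bool (v < W) * g v) = (\<Sum>v<Q. of_bool (v < W) * g v)"
    by (intro sum.mono_neutral_left) auto
  then show ?thesis by simp
qed

lemma sum_hit: "0 < Q \<Longrightarrow> W \<le> Q \<Longrightarrow> (\<Sum>u<Q. \<Sum>v<Q. hit Q W u v i) = Q * W"
  unfolding hit_def using sum_shift_mod[of Q "\<lambda>x. of_bool (x < W)"] sum_below[of W Q "\<lambda>_. 1"] by simp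

text \<open>The progression wraps around the modulus at most \<Delta> times. Within each of these at
  most \<Delta> + 1 rounds it visits at most (W - 1) div \<Delta> + 1 points below \<open>W\<close>,
  since consecutive points are \<Delta> apart. \<open>h\<close> records the round and the slot of
  length \<Delta>.\<close>

lemma count_progression:
  fixes \<Delta> W Q x :: nat
  assumes D: "0 < \<Delta>" "\<Delta> < W" and W: "W \<le> Q" and x: "x < W"
  shows "(\<Sum>u<Q. of_bool ((x + u * \<Delta>) mod Q < W)) \<le> 3 * W"
proof -
  define S where "S = {u. u < Q \<and> (x + u * \<Delta>) mod Q < W}"
  define h where "h = (\<lambda>u. ((x + u * \<Delta>) div Q, (x + u * \<Delta>) mod Q div \<Delta>))"
  have Q: "0 < Q" using W x by simp
  have "inj_on h S"
  proof (rule inj_onI)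
    fix u u' assume h: "h u = h u'"
    define m where "m = x + u * \<Delta>"
    define m' where "m' = x + u' * \<Delta>"
    have *: "m div Q = m' div Q" "m mod Q div \<Delta> = m' mod Q div \<Delta>" using h unfolding h_def m_def m'_def by auto
    have diff_rest: "int k - int k' = int r - int r'" if "k = c + r" "k' = c + r'" for k c r k' r' :: nat
      using that by simp
    have "int m - int m' = int (m mod Q) - int (m' mod Q)"
      by (rule diff_rest[of _ "m' div Q * Q"]) (metis *(1) div_mult_mod_eq)+
    also have "\<dots> = int (m mod Q mod \<Delta>) - int (m' mod Q mod \<Delta>)"
      by (rule diff_rest[of _ "m' mod Q div \<Delta> * \<Delta>"]) (metis *(2) div_mult_mod_eq)+
    finally have "\<bar>int m - int m'\<bar> < int \<Delta>"
      using D(1) mod_less_divisor[of \<Delta> "m mod Q"] mod_less_divisor[of \<Delta> "m' mod Q"] by linarith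
    moreover have "int m - int m' = (int u - int u') * int \<Delta>" unfolding m_def m'_def by (simp add: algebra_simps)
    ultimately have "\<bar>int u - int u'\<bar> * int \<Delta> < 1 * int \<Delta>" by (simp add: abs_mult)
    then have "\<bar>int u - int u'\<bar> < 1" by (subst (asm) mult_less_cancel_right_pos) (use D(1) in auto)
    then show "u = u'" by linarith
  qed
  moreover have "h ` S \<subseteq> {..\<Delta>} \<times> {..(W - 1) div \<Delta>}"
  proof (rule image_subsetI)
    fix u assume u: "u \<in> S"
    have "u * \<Delta> \<le> (Q - 1) * \<Delta>" using u unfolding S_def by (intro mult_le_mono1) auto
    then have "x + u * \<Delta> < Q + Q * \<Delta>" using x W Q by (simp add: diff_mult_distrib)
    then have "(x + u * \<Delta>) div Q < Suc \<Delta>" by (intro less_mult_imp_div_less) (simp add: mult.commute)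
    moreover have "(x + u * \<Delta>) mod Q div \<Delta> \<le> (W - 1) div \<Delta>" using u unfolding S_def by (intro div_le_mono) auto
    ultimately show "h u \<in> {..\<Delta>} \<times> {..(W - 1) div \<Delta>}" unfolding h_def by auto
  qed
  ultimately have "card S \<le> card ({..\<Delta>} \<times> {..(W - 1) div \<Delta>})" by (intro card_inj_on_le[of h]) auto
  also have "\<dots> = Suc \<Delta> * Suc ((W - 1) div \<Delta>)" by simp
  also have "\<dots> = \<Delta> * ((W - 1) div \<Delta>) + (W - 1) div \<Delta> + \<Delta> + 1" by simp
  also have "\<dots> \<le> (W - 1) + (W - 1) + W + 1"
    using D by (intro add_mono) (auto intro: div_le_dividend)
  also have "\<dots> \<le> 3 * W" using x by simp
  finally show ?thesis unfolding S_def by (simp add: sum_of_bool_eq Int_def)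
qed

text \<open>For fixed \<open>u\<close> the residue x of u * i + v is equidistributed in
  \<open>v\<close>, and k hits iff x + u * (k - i) falls below \<open>W\<close> modulo
  \<open>Q\<close>. As k - i is less than \<open>n\<close> and so than \<open>W\<close>, the
  progression bound applies; no inverse of k - i modulo \<open>Q\<close> is involved.\<close>

lemma sum_hit_pair:
  assumes ik: "i < k" "k < n" and W: "n \<le> W" "W \<le> Q"
  shows "(\<Sum>u<Q. \<Sum>v<Q. hit Q W u v i * hit Q W u v k) \<le> 3 * W * W"
proof -
  have Q: "0 < Q" using assms by simp
  define \<Delta> where "\<Delta> = k - i"
  have "(\<Sum>v<Q. hit Q W u v i * hit Q W u v k) = (\<Sum>x<W. of_bool ((x + u * \<Delta>) mod Q < W))" for u
  proof -
    have "hit Q W u v k = of_bool (((u * i + v) mod Q + u * \<Delta>) mod Q < W)" for v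
    proof -
      have "u * k + v = (u * i + v) + u * \<Delta>" using ik by (simp add: \<Delta>_def algebra_simps)
      then show ?thesis by (simp only: hit_def mod_add_left_eq)
    qed
    then have "(\<Sum>v<Q. hit Q W u v i * hit Q W u v k) =
       (\<Sum>v<Q. (\<lambda>x. of_bool (x < W) * of_bool ((x + u * \<Delta>) mod Q < W)) ((u * i + v) mod Q))"
      by (simp add: hit_def[of _ _ _ _ i])
    also have "\<dots> = (\<Sum>x<Q. of_bool (x < W) * of_bool ((x + u * \<Delta>) mod Q < W))"
      by (rule sum_shift_mod[OF Q])
    also have "\<dots> = (\<Sum>x<W. of_bool ((x + u * \<Delta>) mod Q < W))" by (rule sum_below[OF W(2)])
    finally show ?thesis .
  qed
  then have "(\<Sum>u<Q. \<Sum>v<Q. hit Q W u v i * hit Q W u v k) = (\<Sum>x<W. \<Sum>u<Q. of_bool ((x + u * \<Delta>) mod Q < W))"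
    by (simp only:) (rule sum.swap)
  also have "\<dots> \<le> (\<Sum>x<W. 3 * W)"
    by (intro sum_mono count_progression) (use assms in \<open>auto simp: \<Delta>_def\<close>)
  finally show ?thesis by (simp add: mult_ac)
qed

text \<open>Second moment method. The indicator of X = 1 is at least 2 X - X^2. With p = card S * W
  / Q the mean of X is p and that of X^2 at most p + 3 p^2, so the probability is at least p (1 - 3
  p). As 1/12 < p and p is at most 1/6, this exceeds 1/24.\<close>

lemma isolate:
  assumes S: "S \<subseteq> {..<n}" and W: "n \<le> W" "W \<le> Q" and s: "6 * card S * W \<le> Q" "Q < 12 * card S * W"
  shows "int (Q * Q) < 24 * (\<Sum>u<Q. \<Sum>v<Q. of_bool ((\<Sum>i\<in>S. hit Q W u v i) = 1))"
proof -
  have fin: "finite S" using S finite_subset by blast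
  have Q: "0 < Q" using s by (cases Q) auto
  define h where "h = (\<lambda>u v i. int (hit Q W u v i))"
  define X where "X = (\<lambda>u v. \<Sum>i\<in>S. h u v i)"
  let ?s = "int (card S)" and ?W = "int W" and ?Q = "int Q"
  have h2: "h u v i * h u v i = h u v i" for u v i by (simp add: h_def hit_def)
  have 1: "(\<Sum>u<Q. \<Sum>v<Q. X u v) = ?s * (?Q * ?W)"
  proof -
    have "(\<Sum>u<Q. \<Sum>v<Q. X u v) = (\<Sum>i\<in>S. \<Sum>u<Q. \<Sum>v<Q. h u v i)"
      unfolding X_def by (simp only: sum.swap[of _ S "{..<Q}"])
    also have "\<dots> = (\<Sum>i\<in>S. int (\<Sum>u<Q. \<Sum>v<Q. hit Q W u v i))" by (simp add: h_def)
    finally show ?thesis by (simp only: sum_hit[OF Q W(2)]) simp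
  qed
  have 2: "(\<Sum>u<Q. \<Sum>v<Q. X u v * X u v) \<le> ?s * (?Q * ?W) + ?s * (?s * (3 * ?W * ?W))"
  proof -
    have p: "(\<Sum>u<Q. \<Sum>v<Q. h u v i * h u v k) \<le> of_bool (i = k) * (?Q * ?W) + 3 * ?W * ?W"
      if "i \<in> S" "k \<in> S" for i k
    proof (cases "i = k")
      case True
      have "(\<Sum>u<Q. \<Sum>v<Q. h u v i * h u v k) = int (\<Sum>u<Q. \<Sum>v<Q. hit Q W u v i)"
        unfolding True h2 by (simp add: h_def)
      then show ?thesis unfolding sum_hit[OF Q W(2)] using True by simp
    next
      case False
      have "(\<Sum>u<Q. \<Sum>v<Q. h u v i * h u v k) = int (\<Sum>u<Q. \<Sum>v<Q. hit Q W u v (min i k) * hit Q W u v (max i k))"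
        by (auto simp: h_def min_def max_def mult.commute)
      also have "\<dots> \<le> int (3 * W * W)"
        using sum_hit_pair[of "min i k" "max i k" n W Q] False that S W
        by (intro zle_int[THEN iffD2]) (auto simp: min_def max_def)
      finally show ?thesis using False by simp
    qed
    have "(\<Sum>u<Q. \<Sum>v<Q. X u v * X u v) = (\<Sum>i\<in>S. \<Sum>k\<in>S. \<Sum>u<Q. \<Sum>v<Q. h u v i * h u v k)"
      unfolding X_def sum_product by (simp only: sum.swap[of _ S "{..<Q}"])
    also have "\<dots> \<le> (\<Sum>i\<in>S. \<Sum>k\<in>S. of_bool (i = k) * (?Q * ?W) + 3 * ?W * ?W)"
      by (intro sum_mono p)
    also have "\<dots> = (\<Sum>i\<in>S. ?Q * ?W + ?s * (3 * ?W * ?W))"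
      using fin by (intro sum.cong refl) (simp add: sum.distrib sum_value)
    finally show ?thesis by (simp add: algebra_simps)
  qed
  have pt: "2 * X u v - X u v * X u v \<le> of_bool ((\<Sum>i\<in>S. hit Q W u v i) = 1)" for u v
  proof -
    define z where "z = (\<Sum>i\<in>S. hit Q W u v i)"
    have X: "X u v = int z" by (simp add: X_def h_def z_def)
    have "2 * z - z * z \<le> of_bool (z = 1)" if "0 \<le> z" for z :: int
    proof -
      have "z * (2 - z) \<le> 0" if "z \<noteq> 1"
        using that \<open>0 \<le> z\<close> by (cases "z = 0") (auto simp: mult_le_0_iff)
      then show ?thesis by (auto simp: algebra_simps)
    qed
    from this[of "int z"] show ?thesis unfolding X z_def[symmetric] by simp
  qed
  have "2 * (?s * (?Q * ?W)) - (?s * (?Q * ?W) + ?s * (?s * (3 * ?W * ?W))) \<le>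
     2 * (\<Sum>u<Q. \<Sum>v<Q. X u v) - (\<Sum>u<Q. \<Sum>v<Q. X u v * X u v)" using 2 unfolding 1 by linarith
  also have "\<dots> = (\<Sum>u<Q. \<Sum>v<Q. 2 * X u v - X u v * X u v)" by (simp add: sum_subtractf sum_distrib_left)
  also have "\<dots> \<le> (\<Sum>u<Q. \<Sum>v<Q. of_bool ((\<Sum>i\<in>S. hit Q W u v i) = 1))" by (intro sum_mono pt)
  finally have 3: "?s * ?W * (?Q - 3 * (?s * ?W)) \<le> (\<Sum>u<Q. \<Sum>v<Q. of_bool ((\<Sum>i\<in>S. hit Q W u v i) = 1))"
    by (simp add: algebra_simps)
  have s': "6 * (?s * ?W) \<le> ?Q" "?Q < 12 * (?s * ?W)"
  proof -
    have "6 * (?s * ?W) = int (6 * card S * W)" "12 * (?s * ?W) = int (12 * card S * W)" by simp_all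
    then show "6 * (?s * ?W) \<le> ?Q" "?Q < 12 * (?s * ?W)" using s by (simp_all only: of_nat_le_iff of_nat_less_iff)
  qed
  have "?Q * ?Q < (12 * (?s * ?W)) * ?Q" using s'(2) Q by (intro mult_strict_right_mono) auto
  also have "\<dots> \<le> (12 * (?s * ?W)) * (2 * (?Q - 3 * (?s * ?W)))"
    using s' Q by (intro mult_left_mono) auto
  also have "\<dots> = 24 * (?s * ?W * (?Q - 3 * (?s * ?W)))" by simp
  also have "\<dots> \<le> 24 * (\<Sum>u<Q. \<Sum>v<Q. of_bool ((\<Sum>i\<in>S. hit Q W u v i) = 1))" using 3 by simp
  finally show ?thesis by simp
qed

text \<open>Seeds are coded as \<open>u * Q + v\<close>, and \<open>j\<close> selects the scale \<open>W = Q / 2 ^ j\<close>.\<close>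

definition bit :: "nat \<Rightarrow> nat \<Rightarrow> nat \<Rightarrow> nat \<Rightarrow> nat" where
  "bit Q s j i = hit Q (Q div 2 ^ j) (s div Q) (s mod Q) i"

text \<open>At the right scale \<open>isolate\<close> applies to the support of \<open>a\<close>. A
  seed that hits exactly one element of the support makes the corresponding form equal to a single
  nonzero coefficient, so it is not bad.\<close>

lemma bad_seeds:
  fixes a :: "nat \<Rightarrow> 'q::{finite,field}"
  assumes a: "nz n a" and n: "n \<le> 2 ^ m" and Q: "Q = 2 ^ (2 * m + 3)"
  shows "24 * (\<Sum>s<Q * Q. of_bool (\<forall>j<m + 4. mv n (\<lambda>_ i. of_nat (bit Q s j i)) a 0 = 0)) \<le> 23 * (Q * Q)"
proof -
  define S where "S = {i. i < n \<and> a i \<noteq> 0}"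
  have fin: "finite S" by (simp add: S_def)
  have S: "S \<subseteq> {..<n}" "0 < card S" using a fin unfolding nz_def S_def by (auto simp: card_gt_0_iff)
  have cS: "card S \<le> n" using card_mono[OF _ S(1)] by simp
  \<comment> \<open>With the least such power of two, card S / 2^j lies between 1/12 and 1/6 as
    \<open>isolate\<close> demands. Then 2^j < 12 * 2^m, so m + 4 scales suffice, and Q = 2^(2m + 3)
    leaves a window of length at least 2^m, hence at least \<open>n\<close>.\<close>
  define j where "j = (LEAST j. 6 * card S \<le> 2 ^ j)"
  have ex: "6 * card S \<le> 2 ^ (6 * card S)" using less_exp[of "6 * card S"] by simp
  have j1: "6 * card S \<le> 2 ^ j" unfolding j_def by (rule LeastI[of "\<lambda>j. 6 * card S \<le> 2 ^ j", OF ex])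
  have j0: "j \<noteq> 0" using j1 S(2) by (cases j) auto
  have "\<not> 6 * card S \<le> 2 ^ (j - 1)" unfolding j_def by (rule not_less_Least) (use j0 j_def in simp)
  then have "2 * 2 ^ (j - 1) < 2 * (6 * card S)" by simp
  then have j2: "2 ^ j < 12 * card S" using j0 by (simp flip: power_Suc)
  have "(2::nat) ^ j < 2 ^ (m + 4)" using j2 cS n by (simp add: power_add)
  then have jm: "j < m + 4" by simp
  define W where "W = Q div 2 ^ j"
  have W: "W = 2 ^ (2 * m + 3 - j)" unfolding W_def Q using jm by (simp add: power_diff)
  have QW: "W * 2 ^ j = Q" unfolding W Q using jm by (simp flip: power_add)
  have nW: "n \<le> W" unfolding W by (rule order_trans[OF n power_increasing]) (use jm in auto)
  have WQ: "W \<le> Q" unfolding W_def by simp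
  have Q0: "0 < Q" by (simp add: Q)
  have W0: "0 < W" by (simp add: W)
  have s1: "6 * card S * W \<le> Q" using mult_le_mono1[OF j1, of W] QW by (simp add: mult.commute)
  have s2: "Q < 12 * card S * W" using mult_strict_right_mono[OF j2 W0] QW by (simp add: mult.commute)
  define iso where "iso = (\<lambda>u v. (\<Sum>i\<in>S. hit Q W u v i) = 1)"
  have I: "int (Q * Q) < 24 * (\<Sum>u<Q. \<Sum>v<Q. of_bool (iso u v))"
    unfolding iso_def by (rule isolate[OF S(1) nW WQ s1 s2])
  define bad where "bad = (\<lambda>s. \<forall>j<m + 4. mv n (\<lambda>_ i. of_nat (bit Q s j i)) a 0 = 0)"
  have "\<not> bad (u * Q + v)" if vQ: "v < Q" and iso: "iso u v" for u v
  proof -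
    obtain i where i: "i \<in> S" "hit Q W u v i = 1" "\<And>k. k \<in> S \<Longrightarrow> k \<noteq> i \<Longrightarrow> hit Q W u v k = 0"
    proof -
      have "(\<Sum>i\<in>S. hit Q W u v i) \<noteq> 0" using iso unfolding iso_def by simp
      then obtain i where i: "i \<in> S" "hit Q W u v i \<noteq> 0" by (meson sum.neutral)
      then have hi: "hit Q W u v i = 1" by (simp add: hit_def)
      have "(\<Sum>k\<in>S - {i}. hit Q W u v k) = 0"
        using iso sum.remove[OF fin i(1), of "hit Q W u v"] hi unfolding iso_def by simp
      then have "hit Q W u v k = 0" if "k \<in> S" "k \<noteq> i" for k using that fin by auto
      then show thesis using that i(1) hi by blast
    qed
    have b: "bit Q (u * Q + v) j k = hit Q W u v k" for k
      unfolding bit_def W_def[symmetric] div_mod_idx[OF vQ] ..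
    have "mv n (\<lambda>_ i. of_nat (bit Q (u * Q + v) j i)) a 0 = (\<Sum>k<n. of_bool (i = k) * a k)"
      unfolding mv_def b
    proof (intro sum.cong refl)
      fix k assume k: "k \<in> {..<n}"
      show "of_nat (hit Q W u v k) * a k = of_bool (i = k) * a k"
        using i k by (cases "a k = 0"; cases "k = i") (auto simp: S_def)
    qed
    also have "\<dots> = a i" using i(1) S(1) by (intro sum_value) auto
    finally have "mv n (\<lambda>_ i. of_nat (bit Q (u * Q + v) j i)) a 0 \<noteq> 0" using i(1) by (simp add: S_def)
    then show ?thesis unfolding bad_def using jm by blast
  qed
  then have "of_bool (bad (u * Q + v)) + of_bool (iso u v) \<le> (1 :: int)" if "v < Q" for u v
    using that by (cases "iso u v") auto
  then have "(\<Sum>u<Q. \<Sum>v<Q. of_bool (bad (u * Q + v)) + of_bool (iso u v)) \<le> (\<Sum>u<Q. \<Sum>v<Q. 1 :: int)"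
    by (intro sum_mono) auto
  then have "(\<Sum>u<Q. \<Sum>v<Q. of_bool (bad (u * Q + v))) + (\<Sum>u<Q. \<Sum>v<Q. of_bool (iso u v)) \<le> int (Q * Q)"
    by (simp only: sum.distrib) simp
  then have "24 * (\<Sum>u<Q. \<Sum>v<Q. of_bool (bad (u * Q + v))) \<le> 23 * int (Q * Q)" using I by linarith
  moreover have "(\<Sum>u<Q. \<Sum>v<Q. of_bool (bad (u * Q + v))) = int (\<Sum>s<Q * Q. of_bool (bad s))"
    unfolding sum_div_mod by simp
  ultimately have "int (24 * (\<Sum>s<Q * Q. of_bool (bad s))) \<le> int (23 * (Q * Q))" by simp
  then show ?thesis unfolding bad_def by (simp only: zle_int)
qed

text \<open>A row is a seed together with a Hadamard position. The seed yields \<open>J\<close>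
  forms with coefficients 0 and 1, which are then combined at random: the block of a seed is
  equidistributed if one of its forms is nonzero, and zero otherwise.\<close>

definition gen1 :: "nat \<Rightarrow> nat \<Rightarrow> nat \<Rightarrow> nat \<Rightarrow> 'q::{finite,field}" where
  "gen1 Q J r i = had (\<lambda>j. of_nat (bit Q (r div CARD('q) ^ J) j i)) J (r mod CARD('q) ^ J)"

text \<open>Rows of \<open>gen\<close> are sums of \<open>D\<close> independently chosen rows of \<open>gen1\<close>.\<close>

fun gen :: "nat \<Rightarrow> nat \<Rightarrow> nat \<Rightarrow> nat \<Rightarrow> nat \<Rightarrow> 'q::{finite,field}" where
  "gen Q J 0 r i = 0"
| "gen Q J (Suc D) r i = gen1 Q J (r div (Q * Q * CARD('q) ^ J) ^ D) i + gen Q J D (r mod (Q * Q * CARD('q) ^ J) ^ D) i"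

lemma mv_had: "(\<Sum>i<n. had (\<lambda>j. B j i) J c * a i) = had (\<lambda>j. \<Sum>i<n. B j i * (a i :: 'q::{finite,field})) J c"
  unfolding had_def sum_distrib_left sum_distrib_right by (subst sum.swap) (simp add: mult.assoc)

lemma unif_gen1:
  fixes a :: "nat \<Rightarrow> 'q::{finite,field}"
  shows "unif (Q * Q * CARD('q) ^ J)
    (\<Sum>s<Q * Q. if \<forall>j<J. mv n (\<lambda>_ i. of_nat (bit Q s j i)) a 0 = 0 then CARD('q) ^ J else 0) (mv n (gen1 Q J) a)"
proof -
  have "mv n (gen1 Q J) a = (\<lambda>r. had (\<lambda>j. mv n (\<lambda>_ i. of_nat (bit Q (r div CARD('q) ^ J) j i)) a 0) J (r mod CARD('q) ^ J))"
    unfolding mv_def gen1_def mv_had ..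
  then show ?thesis by (simp only:) (rule unif_blocks[OF unif_had])
qed

lemma unif_gen:
  fixes a :: "nat \<Rightarrow> 'q::{finite,field}"
  assumes "unif (Q * Q * CARD('q) ^ J) Z (mv n (gen1 Q J) a)"
  shows "unif ((Q * Q * CARD('q) ^ J) ^ D) (Z ^ D) (mv n (gen Q J D) a)"
proof (induction D)
  case 0
  show ?case by (auto simp: unif_def cnt_def mv_def)
next
  case (Suc D)
  have "mv n (gen Q J (Suc D)) a = (\<lambda>r. mv n (gen1 Q J) a (r div (Q * Q * CARD('q) ^ J) ^ D) + mv n (gen Q J D) a (r mod (Q * Q * CARD('q) ^ J) ^ D))"
    by (simp add: mv_def fun_eq_iff sum.distrib algebra_simps)
  then show ?case using unif_conv[OF assms Suc] by (simp only: power_Suc)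
qed

text \<open>At most 23/24 of the rows of \<open>gen1\<close> belong to the zero part. In a sum of
  \<open>D\<close> independent rows this happens to all summands at once, in at most the fraction
  (23/24)^D, which is at most 1/E. The other rows are nonzero with frequency 1 - 1/q.\<close>

lemma gen_weight:
  fixes a :: "nat \<Rightarrow> 'q::{finite,field}"
  assumes n: "n \<le> 2 ^ m" and Q: "Q = 2 ^ (2 * m + 3)" and E: "E * 23 ^ D \<le> 24 ^ D"
  defines "N \<equiv> (Q * Q * CARD('q) ^ (m + 4)) ^ D"
  shows "int CARD('q) * int (wt N (mv n (gen Q (m + 4) D) a)) \<le> (int CARD('q) - 1) * int N"
    and "nz n a \<Longrightarrow> (int CARD('q) - 1) * ((int E - 1) * int N) \<le> int E * (int CARD('q) * int (wt N (mv n (gen Q (m + 4) D) a)))"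
proof -
  let ?q = "CARD('q)"
  define Z where "Z = (\<Sum>s<Q * Q. if \<forall>j<m + 4. mv n (\<lambda>_ i. of_nat (bit Q s j i)) a 0 = 0 then ?q ^ (m + 4) else 0)"
  have w: "int ?q * int (wt N (mv n (gen Q (m + 4) D) a)) = (int ?q - 1) * (int N - int (Z ^ D))"
    unfolding N_def Z_def by (rule unif_wt[OF unif_gen[OF unif_gen1]])
  have q: "0 \<le> int ?q - 1" using zero_less_card_finite[where ?'a = 'q] by linarith
  show "int ?q * int (wt N (mv n (gen Q (m + 4) D) a)) \<le> (int ?q - 1) * int N"
    unfolding w using q by (intro mult_left_mono) auto
  assume a: "nz n a"
  have "Z = ?q ^ (m + 4) * (\<Sum>s<Q * Q. of_bool (\<forall>j<m + 4. mv n (\<lambda>_ i. of_nat (bit Q s j i)) a 0 = 0))"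
    unfolding Z_def sum_distrib_left by (intro sum.cong) auto
  then have "24 * Z = ?q ^ (m + 4) * (24 * (\<Sum>s<Q * Q. of_bool (\<forall>j<m + 4. mv n (\<lambda>_ i. of_nat (bit Q s j i)) a 0 = 0)))"
    by (simp only: mult_ac)
  also have "\<dots> \<le> ?q ^ (m + 4) * (23 * (Q * Q))" by (intro mult_le_mono2 bad_seeds[OF a n Q])
  also have "\<dots> = 23 * (Q * Q * ?q ^ (m + 4))" by (simp only: mult_ac)
  finally have "(24 * Z) ^ D \<le> (23 * (Q * Q * ?q ^ (m + 4))) ^ D" by (intro power_mono) auto
  then have 1: "24 ^ D * Z ^ D \<le> 23 ^ D * N" by (simp only: power_mult_distrib N_def)
  have "24 ^ D * (E * Z ^ D) = E * (24 ^ D * Z ^ D)" by simp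
  also have "\<dots> \<le> E * (23 ^ D * N)" using 1 by (rule mult_le_mono2)
  also have "\<dots> = (E * 23 ^ D) * N" by simp
  also have "\<dots> \<le> 24 ^ D * N" using E by (rule mult_le_mono1)
  finally have "E * Z ^ D \<le> N" by simp
  then have "int E * int (Z ^ D) \<le> int N" by (simp only: of_nat_mult[symmetric] of_nat_le_iff)
  then have "(int ?q - 1) * ((int E - 1) * int N) \<le> (int ?q - 1) * (int E * int N - int E * int (Z ^ D))"
    using q by (intro mult_left_mono) (simp_all add: algebra_simps)
  also have "\<dots> = int E * ((int ?q - 1) * (int N - int (Z ^ D)))" by (simp add: algebra_simps)
  finally show "(int ?q - 1) * ((int E - 1) * int N) \<le> int E * (int ?q * int (wt N (mv n (gen Q (m + 4) D) a)))"
    unfolding w .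
qed

section \<open>Matrices of rank at least two are heavy\<close>

lemma count_line:
  fixes a b :: "'q::{finite,field}"
  assumes "a \<noteq> 0 \<or> b \<noteq> 0"
  shows "(\<Sum>l\<in>UNIV. \<Sum>k\<in>UNIV. of_bool (l * a + k * b \<noteq> 0)) = CARD('q) * (CARD('q) - 1)"
proof -
  have *: "(\<Sum>k\<in>UNIV. of_bool (x + k * b \<noteq> 0)) = CARD('q) - 1" if "b \<noteq> 0" for x b :: 'q
  proof -
    have "{k. x + k * b \<noteq> 0} = UNIV - {- x / b}" using that by (auto simp: field_simps add_eq_0_iff)
    then show ?thesis by (simp add: sum_of_bool_eq card_Diff_singleton)
  qed
  show ?thesis
  proof (cases "b = 0")
    case False
    then show ?thesis by (simp only: *[OF False]) simp
  next
    case True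
    then have a: "a \<noteq> 0" using assms by simp
    have "(\<Sum>l\<in>UNIV. \<Sum>k\<in>UNIV. of_bool (l * a + k * b \<noteq> 0)) = (\<Sum>k\<in>(UNIV::'q set). \<Sum>l\<in>UNIV. of_bool (k * b + l * a \<noteq> 0) :: nat)"
      by (subst sum.swap) (simp only: add.commute)
    then show ?thesis by (simp only: *[OF a]) simp
  qed
qed

text \<open>A bound for the second generalized Hamming weight. Each of the q^2 - 1 nonzero
  combinations of \<open>u\<close> and \<open>v\<close> has weight at least \<open>w\<close>, and a
  position of the joint support is nonzero in exactly q (q - 1) of them. Averaging gives the factor
  (q + 1) / q.\<close>

lemma indep_support:
  fixes A :: "nat \<Rightarrow> nat \<Rightarrow> 'q::{finite,field}"
  assumes d: "mindist N n A w"
    and indep: "\<And>l k. l \<noteq> 0 \<or> k \<noteq> 0 \<Longrightarrow> nz n (\<lambda>j. l * u j + k * v j)"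
  shows "(CARD('q) + 1) * w \<le> CARD('q) * card {r. r < N \<and> (mv n A u r \<noteq> 0 \<or> mv n A v r \<noteq> 0)}"
proof -
  let ?q = "CARD('q)"
  define R where "R = {r. r < N \<and> (mv n A u r \<noteq> 0 \<or> mv n A v r \<noteq> 0)}"
  define Wt where "Wt = (\<lambda>l k. wt N (\<lambda>r. l * mv n A u r + k * mv n A v r))"
  have lin: "mv n A (\<lambda>j. l * u j + k * v j) r = l * mv n A u r + k * mv n A v r" for l k r
    unfolding mv_def by (simp add: sum.distrib sum_distrib_left algebra_simps)
  have low: "of_bool (l \<noteq> 0 \<or> k \<noteq> 0) * w \<le> Wt l k" for l k
  proof (cases "l \<noteq> 0 \<or> k \<noteq> 0")
    case True
    then have "w \<le> wt N (mv n A (\<lambda>j. l * u j + k * v j))" using d indep unfolding mindist_def by blast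
    moreover have "mv n A (\<lambda>j. l * u j + k * v j) = (\<lambda>r. l * mv n A u r + k * mv n A v r)" by (rule ext) (rule lin)
    ultimately show ?thesis unfolding Wt_def by simp
  qed simp
  have c: "(\<Sum>l\<in>(UNIV::'q set). \<Sum>k\<in>(UNIV::'q set). of_bool (l \<noteq> 0 \<or> k \<noteq> 0)) = ?q * ?q - 1"
  proof -
    have "(\<Sum>l\<in>(UNIV::'q set). \<Sum>k\<in>(UNIV::'q set). of_bool (l \<noteq> 0 \<or> k \<noteq> 0)) =
       (\<Sum>x\<in>(UNIV :: ('q \<times> 'q) set). of_bool (x \<noteq> (0, 0)))"
      unfolding UNIV_Times_UNIV[symmetric] sum.cartesian_product by (intro sum.cong) auto
    also have "\<dots> = card (UNIV - {(0, 0) :: 'q \<times> 'q})"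
    proof -
      have "{x :: 'q \<times> 'q. x \<noteq> (0, 0)} = UNIV - {(0, 0)}" by blast
      then show ?thesis by (simp add: sum_of_bool_eq)
    qed
    finally show ?thesis by (simp add: card_Diff_singleton card_prod)
  qed
  have "(?q * ?q - 1) * w \<le> (\<Sum>l\<in>UNIV. \<Sum>k\<in>UNIV. Wt l k)"
    unfolding c[symmetric] sum_distrib_right by (intro sum_mono low)
  also have "\<dots> = (\<Sum>r<N. \<Sum>l\<in>UNIV. \<Sum>k\<in>UNIV. of_bool (l * mv n A u r + k * mv n A v r \<noteq> 0))"
    unfolding Wt_def wt_def by (simp only: sum.swap[of _ _ "{..<N}"])
  also have "\<dots> = (\<Sum>r<N. of_bool (r \<in> R) * (?q * (?q - 1)))"
  proof (intro sum.cong refl)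
    fix r assume "r \<in> {..<N}"
    then show "(\<Sum>l\<in>UNIV. \<Sum>k\<in>UNIV. of_bool (l * mv n A u r + k * mv n A v r \<noteq> 0)) = of_bool (r \<in> R) * (?q * (?q - 1))"
      using count_line[of "mv n A u r" "mv n A v r"] by (cases "r \<in> R") (auto simp: R_def)
  qed
  also have "\<dots> = card R * (?q * (?q - 1))"
  proof -
    have "{..<N} \<inter> {r. r \<in> R} = R" unfolding R_def by auto
    then show ?thesis unfolding sum_distrib_right[symmetric] by (simp add: sum_of_bool_eq)
  qed
  finally have "(?q * ?q - 1) * w \<le> card R * (?q * (?q - 1))" .
  moreover have "?q * ?q - 1 = (?q - 1) * (?q + 1)" by (simp add: algebra_simps)
  ultimately have "(?q - 1) * ((?q + 1) * w) \<le> (?q - 1) * (?q * card R)" by (simp only: mult_ac)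
  moreover have "0 < ?q - 1"
  proof -
    have "card {0, 1 :: 'q} \<le> ?q" by (rule card_mono) auto
    then show ?thesis by simp
  qed
  ultimately show ?thesis unfolding R_def by (simp only: mult_le_cancel1)
qed

lemma card_field_ge2: "2 \<le> CARD('q::{finite,field})"
proof -
  have "card {0, 1 :: 'q} \<le> CARD('q)" by (rule card_mono) auto
  then show ?thesis by simp
qed

text \<open>Read \<open>y\<close> as an n x n matrix. Either some column is independent of a fixed
  nonzero column \<open>a\<close>, or all columns are multiples of it; if there is no nonzero
  column, the matrix is a product for trivial reasons.\<close>

lemma rank_cases:
  fixes y :: "nat \<Rightarrow> 'q::field"
  obtains (indep) a b where "a < n" "b < n"
      "\<And>l k. l \<noteq> 0 \<or> k \<noteq> 0 \<Longrightarrow> nz n (\<lambda>j. l * y (j * n + a) + k * y (j * n + b))"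
  | (rank1) u v where "\<And>i j. i < n \<Longrightarrow> j < n \<Longrightarrow> y (i * n + j) = u i * v j"
proof (cases "\<exists>a<n. nz n (\<lambda>j. y (j * n + a))")
  case False
  then have "y (i * n + j) = 0 * 0" if "i < n" "j < n" for i j using that unfolding nz_def by auto
  then show thesis using rank1[of "\<lambda>_. 0" "\<lambda>_. 0"] by blast
next
  case True
  then obtain a where a: "a < n" "nz n (\<lambda>j. y (j * n + a))" by blast
  show thesis
  proof (cases "\<exists>b<n. \<forall>l k. l \<noteq> 0 \<or> k \<noteq> 0 \<longrightarrow> nz n (\<lambda>j. l * y (j * n + a) + k * y (j * n + b))")
    case True
    then show thesis using indep a(1) by blast
  next
    case False
    have "\<exists>c. \<forall>j<n. y (j * n + b) = y (j * n + a) * c" if "b < n" for b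
    proof -
      obtain l k where lk: "l \<noteq> 0 \<or> k \<noteq> 0" "\<not> nz n (\<lambda>j. l * y (j * n + a) + k * y (j * n + b))"
        using False \<open>b < n\<close> by blast
      have z: "l * y (j * n + a) + k * y (j * n + b) = 0" if "j < n" for j using lk(2) that unfolding nz_def by blast
      have k: "k \<noteq> 0"
      proof
        assume "k = 0"
        then have "y (j * n + a) = 0" if "j < n" for j using z[OF that] lk(1) by simp
        then show False using a(2) unfolding nz_def by blast
      qed
      have "y (j * n + b) = y (j * n + a) * (- l / k)" if "j < n" for j
        using z[OF that] k by (simp add: field_simps eq_neg_iff_add_eq_0)
      then show ?thesis by blast
    qed
    then obtain v where "\<And>b j. b < n \<Longrightarrow> j < n \<Longrightarrow> y (j * n + b) = y (j * n + a) * v b" by metis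
    then show thesis using rank1[of "\<lambda>j. y (j * n + a)" v] by blast
  qed
qed

text \<open>Two independent columns enlarge the number of nonzero rows after the first encoding by
  the factor (q + 1) / q, and each of these rows contributes \<open>w\<close> under the second
  one.\<close>

lemma indep_weight:
  fixes A :: "nat \<Rightarrow> nat \<Rightarrow> 'q::{finite,field}"
  assumes d: "mindist N n A w" and ab: "a < n" "b < n"
    and indep: "\<And>l k. l \<noteq> 0 \<or> k \<noteq> 0 \<Longrightarrow> nz n (\<lambda>j. l * y (j * n + a) + k * y (j * n + b))"
  shows "(CARD('q) + 1) * (w * w) \<le> CARD('q) * wt (N * N) (mv (n * n) (kron N n A A) y)"
proof -
  define R where "R = {r. r < N \<and> (mv n A (\<lambda>j. y (j * n + a)) r \<noteq> 0 \<or> mv n A (\<lambda>j. y (j * n + b)) r \<noteq> 0)}"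
  have "(CARD('q) + 1) * w \<le> CARD('q) * card R" unfolding R_def by (rule indep_support[OF d indep])
  then have "(CARD('q) + 1) * w * w \<le> CARD('q) * card R * w" by (rule mult_le_mono1)
  moreover have "card R * w \<le> wt (N * N) (mv (n * n) (kron N n A A) y)"
    by (rule wt_kron_ge[OF d]) (use ab in \<open>auto simp: R_def nz_def mv_def\<close>)
  then have "CARD('q) * (card R * w) \<le> CARD('q) * wt (N * N) (mv (n * n) (kron N n A A) y)" by (rule mult_le_mono2)
  ultimately show ?thesis by (simp only: mult.assoc)
qed

section \<open>Low rank approximation and minimum distance\<close>

text \<open>Pigeonhole: there are q^d vectors but only q^k images, and the difference of two vectors
  with the same image is in the kernel.\<close>

lemma kernel_vector:
  fixes V :: "nat \<Rightarrow> nat \<Rightarrow> 'q::{finite,field}"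
  assumes "k < d"
  shows "\<exists>y. nz d y \<and> (\<forall>l<k. (\<Sum>j<d. V l j * y j) = 0)"
proof -
  let ?D = "PiE {..<d} (\<lambda>_. UNIV :: 'q set)" and ?K = "PiE {..<k} (\<lambda>_. UNIV :: 'q set)"
  define h where "h = (\<lambda>y. restrict (\<lambda>l. \<Sum>j<d. V l j * y j) {..<k})"
  have "card ?K < card ?D"
    using assms card_field_ge2[where ?'q = 'q] by (simp add: card_PiE power_strict_increasing)
  moreover have "h ` ?D \<subseteq> ?K" by (rule image_subsetI) (simp add: h_def restrict_PiE_iff)
  moreover have "finite ?K" by (rule finite_PiE) auto
  ultimately have "\<not> inj_on h ?D" using card_inj_on_le[of h ?D ?K] by linarith
  then obtain y z where yz: "y \<in> ?D" "z \<in> ?D" "h y = h z" "y \<noteq> z" unfolding inj_on_def by blast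
  have "\<exists>j<d. y j \<noteq> z j"
  proof (rule ccontr)
    assume "\<not> (\<exists>j<d. y j \<noteq> z j)"
    then have "y = z" using yz(1,2) by (intro PiE_ext) auto
    then show False using yz(4) by simp
  qed
  then have "nz d (\<lambda>j. y j - z j)" by (auto simp: nz_def)
  moreover have "(\<Sum>j<d. V l j * (y j - z j)) = 0" if "l < k" for l
    using fun_cong[OF yz(3), of l] that by (simp add: h_def algebra_simps sum_subtractf)
  ultimately show ?thesis by blast
qed

text \<open>A kernel vector of \<open>V\<close> is also one of \<open>U * V\<close>, so A and the
  error matrix agree on it. Every nonzero entry of that image requires a nonzero entry of the error
  in the same row.\<close>

lemma l0_norm_lower:
  fixes A :: "nat \<Rightarrow> nat \<Rightarrow> 'q::{finite,field}"
  assumes d: "mindist n d A w" and k: "k < d" and U: "U \<in> carrier_mat n k" and V: "V \<in> carrier_mat k d"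
  shows "w \<le> l0_norm (mat n d (\<lambda>(i, j). A i j) - U * V)"
proof -
  define E where "E = mat n d (\<lambda>(i, j). A i j) - U * V"
  obtain y where y: "nz d y" "\<And>l. l < k \<Longrightarrow> (\<Sum>j<d. V $$ (l, j) * y j) = 0"
    using kernel_vector[OF k, of "\<lambda>l j. V $$ (l, j)"] by blast
  have E: "E $$ (i, j) = A i j - (\<Sum>l<k. U $$ (i, l) * V $$ (l, j))" if "i < n" "j < d" for i j
    using that U V by (simp add: E_def scalar_prod_def atLeast0LessThan)
  have Ey: "mv d A y i = (\<Sum>j<d. E $$ (i, j) * y j)" if i: "i < n" for i
  proof -
    have "(\<Sum>j<d. (\<Sum>l<k. U $$ (i, l) * V $$ (l, j)) * y j) = (\<Sum>l<k. U $$ (i, l) * (\<Sum>j<d. V $$ (l, j) * y j))"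
      unfolding sum_distrib_left sum_distrib_right by (subst sum.swap) (simp add: mult.assoc)
    also have "\<dots> = 0" using y(2) by simp
    finally show ?thesis using i by (simp add: mv_def E algebra_simps sum_subtractf)
  qed
  define nzs where "nzs = {(i, j). i < n \<and> j < d \<and> E $$ (i, j) \<noteq> 0}"
  have fin: "finite nzs" by (rule finite_subset[of _ "{..<n} \<times> {..<d}"]) (auto simp: nzs_def)
  have "{i. i < n \<and> mv d A y i \<noteq> 0} \<subseteq> fst ` nzs"
  proof
    fix i assume i: "i \<in> {i. i < n \<and> mv d A y i \<noteq> 0}"
    then have "(\<Sum>j<d. E $$ (i, j) * y j) \<noteq> 0" using Ey[of i] by simp
    then obtain j where "j \<in> {..<d}" "E $$ (i, j) * y j \<noteq> 0" by (rule sum.not_neutral_contains_not_neutral)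
    then have "(i, j) \<in> nzs" using i by (auto simp: nzs_def)
    then show "i \<in> fst ` nzs" by force
  qed
  then have "card {i. i < n \<and> mv d A y i \<noteq> 0} \<le> card (fst ` nzs)" by (rule card_mono[OF finite_imageI[OF fin]])
  also have "\<dots> \<le> card nzs" by (rule card_image_le[OF fin])
  finally have "wt n (mv d A y) \<le> card nzs" unfolding wt_card .
  moreover have "w \<le> wt n (mv d A y)" using d y(1) unfolding mindist_def by blast
  moreover have "l0_norm E = card nzs" using U V by (simp add: l0_norm_def nzs_def E_def)
  ultimately show ?thesis unfolding E_def by simp
qed

text \<open>The relation \<open>y\<close> is solved for a column j0 with a nonzero coefficient. The
  remaining columns form \<open>U\<close> and are reproduced exactly; column j0 becomes the
  combination that \<open>y\<close> prescribes, with error A y divided by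
  \<open>y j0\<close>.\<close>

lemma l0_opt_upper:
  fixes A :: "nat \<Rightarrow> nat \<Rightarrow> 'q::{finite,field}"
  assumes y: "nz d y"
  shows "l0_opt (d - 1) (mat n d (\<lambda>(i, j). A i j)) \<le> wt n (mv d A y)"
proof -
  obtain j0 where j0: "j0 < d" "y j0 \<noteq> 0" using y unfolding nz_def by blast
  define sk where "sk = (\<lambda>l. if l < j0 then l else Suc l)"
  have sk: "bij_betw sk {..<d - 1} ({..<d} - {j0})"
    by (rule bij_betw_byWitness[where f' = "\<lambda>j. if j < j0 then j else j - 1"]) (use j0 in \<open>auto simp: sk_def\<close>)
  define U where "U = mat n (d - 1) (\<lambda>(i, l). A i (sk l))"
  define V where "V = mat (d - 1) d (\<lambda>(l, j). if j = j0 then - y (sk l) / y j0 else of_bool (sk l = j))"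
  define M where "M = mat n d (\<lambda>(i, j). A i j)"
  have U: "U \<in> carrier_mat n (d - 1)" and V: "V \<in> carrier_mat (d - 1) d" by (auto simp: U_def V_def)
  have UV: "(U * V) $$ (i, j) = (\<Sum>j'\<in>{..<d} - {j0}. A i j' * (if j = j0 then - y j' / y j0 else of_bool (j' = j)))"
    if "i < n" "j < d" for i j
  proof -
    have "(U * V) $$ (i, j) = (\<Sum>l<d - 1. A i (sk l) * (if j = j0 then - y (sk l) / y j0 else of_bool (sk l = j)))"
      using that by (simp add: U_def V_def scalar_prod_def atLeast0LessThan)
    then show ?thesis
      using sum.reindex_bij_betw[OF sk, of "\<lambda>j'. A i j' * (if j = j0 then - y j' / y j0 else of_bool (j' = j))"] by simp
  qed
  have other: "(M - U * V) $$ (i, j) = 0" if "i < n" "j < d" "j \<noteq> j0" for i j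
  proof -
    have "(U * V) $$ (i, j) = (\<Sum>j'\<in>{..<d} - {j0}. of_bool (j = j') * A i j')"
      unfolding UV[OF that(1,2)] using that(3) by (intro sum.cong) auto
    also have "\<dots> = A i j" using that by (intro sum_value) auto
    finally show ?thesis using that by (simp add: M_def U_def V_def)
  qed
  have col: "(M - U * V) $$ (i, j0) = mv d A y i / y j0" if "i < n" for i
  proof -
    have "(U * V) $$ (i, j0) = - (\<Sum>j'\<in>{..<d} - {j0}. A i j' * y j') / y j0"
      unfolding UV[OF that j0(1)] by (simp add: sum_divide_distrib sum_negf)
    moreover have "mv d A y i = A i j0 * y j0 + (\<Sum>j'\<in>{..<d} - {j0}. A i j' * y j')"
      unfolding mv_def using j0(1) by (simp add: sum.remove)
    ultimately show ?thesis using that j0 by (simp add: M_def U_def V_def field_simps)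
  qed
  have "{(i, j). i < n \<and> j < d \<and> (M - U * V) $$ (i, j) \<noteq> 0} \<subseteq> (\<lambda>i. (i, j0)) ` {i. i < n \<and> mv d A y i \<noteq> 0}"
  proof (clarify, goal_cases)
    case (1 i j)
    then have "j = j0" using other by blast
    then show ?case using 1 col[of i] by auto
  qed
  then have "l0_norm (M - U * V) \<le> wt n (mv d A y)"
    unfolding wt_card l0_norm_def
    by (intro order_trans[OF card_mono card_image_le[of "{i. i < n \<and> mv d A y i \<noteq> 0}" "\<lambda>i. (i, j0)"]]) (auto simp: U_def V_def)
  moreover have "l0_opt (d - 1) M \<le> l0_norm (M - U * V)"
    unfolding l0_opt_def
    by (rule order_trans[OF cINF_lower[of _ _ "(U, V)"]]) (use U V in \<open>auto simp: M_def\<close>)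
  ultimately show ?thesis unfolding M_def by simp
qed

section \<open>Constraint satisfaction as a system of equations for a tensor\<close>

text \<open>\<open>n\<close> cells with values below \<open>g\<close>; constraint \<open>j\<close> forbids that all four cells \<open>cl j p\<close> have the
  values \<open>vl j p\<close>.\<close>

definition csp_sat :: "nat \<Rightarrow> nat \<Rightarrow> nat \<Rightarrow> (nat \<Rightarrow> nat \<Rightarrow> nat) \<Rightarrow> (nat \<Rightarrow> nat \<Rightarrow> nat) \<Rightarrow> bool" where
  "csp_sat n g m cl vl \<longleftrightarrow> (\<exists>v. (\<forall>c<n. v c < g) \<and> (\<forall>j<m. \<exists>p<4. v (cl j p) \<noteq> vl j p))"

definition csp_wf :: "nat \<Rightarrow> nat \<Rightarrow> nat \<Rightarrow> (nat \<Rightarrow> nat \<Rightarrow> nat) \<Rightarrow> (nat \<Rightarrow> nat \<Rightarrow> nat) \<Rightarrow> bool" where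
  "csp_wf n g m cl vl \<longleftrightarrow> 0 < g \<and> (\<forall>j<m. \<forall>p<4. cl j p < n \<and> vl j p < g)"

definition dig :: "nat \<Rightarrow> nat \<Rightarrow> nat \<Rightarrow> nat" where
  "dig b c p = c div b ^ p mod b"

definition tup :: "nat \<Rightarrow> nat \<Rightarrow> nat \<Rightarrow> nat \<Rightarrow> nat \<Rightarrow> nat" where
  "tup b i j k l = ((i * b + j) * b + k) * b + l"

text \<open>The unknowns are the entries of the fourth tensor power of a vector \<open>z\<close> with \<open>z 0 = 1\<close> and
  with \<open>z (ind g c v) = 1\<close> iff cell \<open>c\<close> has the value \<open>v\<close>. As \<open>z\<close> is a 0-1 vector, an entry only depends on
  its set of nonzero indices.\<close>

definition ind :: "nat \<Rightarrow> nat \<Rightarrow> nat \<Rightarrow> nat" where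
  "ind g c v = Suc (c * g + v)"

definition same :: "nat \<Rightarrow> nat \<Rightarrow> nat \<Rightarrow> bool" where
  "same b c c' \<longleftrightarrow> (\<forall>p<4. dig b c p = 0 \<or> (\<exists>p'<4. dig b c p = dig b c' p')) \<and>
     (\<forall>p<4. dig b c' p = 0 \<or> (\<exists>p'<4. dig b c' p = dig b c p'))"

definition base :: "nat \<Rightarrow> nat \<Rightarrow> nat" where
  "base n g = Suc (n * g)"

definition cdim :: "nat \<Rightarrow> nat \<Rightarrow> nat" where
  "cdim n g = base n g * base n g * (base n g * base n g)"

text \<open>The three ranges of \<open>k\<close>: entries with the same nonzero indices agree; the
  indicators of a cell sum up to the homogenizing entry; a forbidden pattern has product 0. An index
  i below the base is at the same time the tuple (0, 0, 0, i), so the second kind of equation reads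
  z off the tensor directly.\<close>

definition con :: "nat \<Rightarrow> nat \<Rightarrow> (nat \<Rightarrow> nat \<Rightarrow> nat) \<Rightarrow> (nat \<Rightarrow> nat \<Rightarrow> nat) \<Rightarrow> nat \<Rightarrow> nat \<Rightarrow> 'q::comm_ring_1" where
  "con n g cl vl k c = (let b = base n g; d = cdim n g; s = d * d in
     if k < s then (if same b (k div d) (k mod d) then of_bool (k div d = c) - of_bool (k mod d = c) else 0)
     else if k < s + n then of_bool (ind g (k - s) 0 \<le> c \<and> c < ind g (Suc (k - s)) 0) - of_bool (0 = c)
     else of_bool (tup b (ind g (cl (k - s - n) 0) (vl (k - s - n) 0)) (ind g (cl (k - s - n) 1) (vl (k - s - n) 1))
            (ind g (cl (k - s - n) 2) (vl (k - s - n) 2)) (ind g (cl (k - s - n) 3) (vl (k - s - n) 3)) = c))"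

definition ncon :: "nat \<Rightarrow> nat \<Rightarrow> nat \<Rightarrow> nat" where
  "ncon n g m = cdim n g * cdim n g + n + m"

lemma all4: "(\<forall>p<4::nat. P p) \<longleftrightarrow> P 0 \<and> P 1 \<and> P 2 \<and> P 3"
  by (auto simp: less_Suc_eq numeral_eq_Suc)

lemma ex4: "(\<exists>p<4::nat. P p) \<longleftrightarrow> P 0 \<or> P 1 \<or> P 2 \<or> P 3"
  by (auto simp: less_Suc_eq numeral_eq_Suc)

lemma tup_alt: "tup b i j k l = (i * b + j) * (b * b) + (k * b + l)"
  by (simp add: tup_def algebra_simps)

lemma dig_tup:
  assumes "i < b" "j < b" "k < b" "l < b"
  shows "dig b (tup b i j k l) 0 = l" "dig b (tup b i j k l) 1 = k"
    "dig b (tup b i j k l) 2 = j" "dig b (tup b i j k l) 3 = i"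
proof -
  have b: "b ^ 2 = b * b" "b ^ 3 = b * (b * b)" by (simp_all add: power2_eq_square power3_eq_cube)
  have *: "tup b i j k l div b = (i * b + j) * b + k" using assms by (simp add: tup_def)
  show "dig b (tup b i j k l) 0 = l" "dig b (tup b i j k l) 1 = k"
    "dig b (tup b i j k l) 2 = j" "dig b (tup b i j k l) 3 = i"
    using assms by (simp_all add: dig_def b div_mult2_eq *) (simp add: tup_def)
qed

lemma tup_less:
  assumes "i < b" "j < b" "k < b" "l < b"
  shows "tup b i j k l < b * b * (b * b)"
  unfolding tup_alt by (intro idx_less_mult assms)

lemma ind_less: "c < n \<Longrightarrow> v < g \<Longrightarrow> ind g c v < base n g"
  unfolding ind_def base_def using idx_less_mult[of c n v g] by simp

lemma same_tup:
  assumes "i < b" "j < b" "k < b" "l < b" "i' < b" "j' < b" "k' < b" "l' < b"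
    and "insert 0 {i, j, k, l} = insert 0 {i', j', k', l'}"
  shows "same b (tup b i j k l) (tup b i' j' k' l')"
proof -
  have *: "\<forall>x\<in>A. x = 0 \<or> x \<in> B" if "insert 0 A = insert 0 B" for A B :: "nat set" using that by auto
  have 1: "x = 0 \<or> x = l' \<or> x = k' \<or> x = j' \<or> x = i'" if "x \<in> {i, j, k, l}" for x
    using *[OF assms(9), rule_format, OF that] by blast
  have 2: "x = 0 \<or> x = l \<or> x = k \<or> x = j \<or> x = i" if "x \<in> {i', j', k', l'}" for x
    using *[OF assms(9)[symmetric], rule_format, OF that] by blast
  show ?thesis unfolding same_def all4 ex4 dig_tup[OF assms(1-4)] dig_tup[OF assms(5-8)]
    by (intro conjI 1 2) simp_all
qed

lemma con_sum_same:
  fixes X :: "nat \<Rightarrow> 'q::field"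
  assumes "c < cdim n g" "c' < cdim n g" "same (base n g) c c'"
  shows "(\<Sum>e<cdim n g. con n g cl vl (c * cdim n g + c') e * X e) = X c - X c'"
proof -
  have "c * cdim n g + c' < cdim n g * cdim n g" by (rule idx_less_mult[OF assms(1,2)])
  then have "con n g cl vl (c * cdim n g + c') e * X e = of_bool (c = e) * X e - of_bool (c' = e) * X e" for e
    using assms by (simp add: con_def Let_def div_mod_idx left_diff_distrib)
  then show ?thesis using assms by (simp add: sum_subtractf sum_value)
qed

lemma con_sum_cell:
  fixes X :: "nat \<Rightarrow> 'q::field"
  assumes "c < n"
  shows "(\<Sum>e<cdim n g. con n g cl vl (cdim n g * cdim n g + c) e * X e) = (\<Sum>v<g. X (ind g c v)) - X 0"
proof -
  have b: "0 < base n g" by (simp add: base_def)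
  have "ind g (Suc c) 0 \<le> base n g"
    using assms mult_le_mono1[of "Suc c" n g] by (simp add: ind_def base_def)
  also have "\<dots> \<le> cdim n g" using b by (simp add: cdim_def)
  finally have le: "ind g (Suc c) 0 \<le> cdim n g" .
  have "con n g cl vl (cdim n g * cdim n g + c) e * X e =
      of_bool (ind g c 0 \<le> e \<and> e < ind g (Suc c) 0) * X e - of_bool (0 = e) * X e" for e
    using assms by (simp add: con_def Let_def left_diff_distrib)
  moreover have "(\<Sum>e<cdim n g. of_bool (ind g c 0 \<le> e \<and> e < ind g (Suc c) 0) * X e) = (\<Sum>e\<in>{ind g c 0..<ind g (Suc c) 0}. X e)"
    using le by (intro sum.mono_neutral_cong_right) auto
  moreover have "(\<Sum>e\<in>{ind g c 0..<ind g (Suc c) 0}. X e) = (\<Sum>v<g. X (ind g c v))"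
    using sum.shift_bounds_nat_ivl[of X 0 "ind g c 0" g] by (simp add: ind_def atLeast0LessThan algebra_simps)
  ultimately show ?thesis using b by (simp add: sum_subtractf sum_value cdim_def)
qed

lemma con_sum_tuple:
  fixes X :: "nat \<Rightarrow> 'q::field"
  assumes wf: "csp_wf n g m cl vl" and j: "j < m"
  shows "(\<Sum>e<cdim n g. con n g cl vl (cdim n g * cdim n g + n + j) e * X e) =
    X (tup (base n g) (ind g (cl j 0) (vl j 0)) (ind g (cl j 1) (vl j 1)) (ind g (cl j 2) (vl j 2)) (ind g (cl j 3) (vl j 3)))"
    (is "_ = X ?t")
proof -
  have "con n g cl vl (cdim n g * cdim n g + n + j) e = (of_bool (?t = e) :: 'q)" for e
    by (simp add: con_def Let_def)
  moreover have "?t < cdim n g" unfolding cdim_def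
    using wf j unfolding csp_wf_def by (intro tup_less ind_less) auto
  ultimately show ?thesis by (simp only: sum_value finite_lessThan lessThan_iff)
qed

text \<open>By the factorization, \<kappa> T i j k l = T i j 0 0 * T 0 0 k l. Since only the set of
  nonzero indices matters, pairs can be split further through T 0 i 0 j, and T becomes \<kappa>
  times the fourth power of z. Comparing T 0 i 0 i with T 0 0 0 i shows that z is idempotent, so its
  entries are 0 or 1.\<close>

lemma con_sound:
  fixes X :: "nat \<Rightarrow> 'q::field" and n g :: nat
  defines "b \<equiv> base n g"
  assumes wf: "csp_wf n g m cl vl" and nz: "nz (cdim n g) X"
    and con: "\<And>k. k < ncon n g m \<Longrightarrow> (\<Sum>e<cdim n g. con n g cl vl k e * X e) = 0"
    and fac: "\<And>i j. i < b * b \<Longrightarrow> j < b * b \<Longrightarrow> X (i * (b * b) + j) = u i * v j"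
  shows "csp_sat n g m cl vl"
proof -
  define T where "T = (\<lambda>i j k l. X (tup b i j k l))"
  define U where "U = (\<lambda>i j. u (i * b + j))"
  define V where "V = (\<lambda>i j. v (i * b + j))"
  have b0: "0 < b" by (simp add: b_def base_def)
  have d: "cdim n g = b * b * (b * b)" by (simp add: cdim_def b_def)
  have T: "T i j k l = U i j * V k l" if "i < b" "j < b" "k < b" "l < b" for i j k l
    unfolding T_def U_def V_def tup_alt using that by (intro fac idx_less_mult)
  have inv: "T i j k l = T i' j' k' l'"
    if "i < b" "j < b" "k < b" "l < b" "i' < b" "j' < b" "k' < b" "l' < b"
      "insert 0 {i, j, k, l} = insert 0 {i', j', k', l'}" for i j k l i' j' k' l'
  proof -
    let ?c = "tup b i j k l" and ?c' = "tup b i' j' k' l'"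
    have c: "?c < cdim n g" "?c' < cdim n g" unfolding d using that by (auto intro: tup_less)
    have "?c * cdim n g + ?c' < ncon n g m" using idx_less_mult[OF c] by (simp add: ncon_def)
    moreover have "same (base n g) ?c ?c'" using same_tup[OF that] unfolding b_def .
    ultimately have "X ?c - X ?c' = 0" using con con_sum_same[OF c, of cl vl X] by metis
    then show ?thesis by (simp add: T_def b_def)
  qed
  define \<kappa> where "\<kappa> = T 0 0 0 0"
  obtain c where c: "c < cdim n g" "X c \<noteq> 0" using nz unfolding nz_def by blast
  have kap: "\<kappa> \<noteq> 0"
  proof
    assume k0: "\<kappa> = 0"
    define i j k l where "i = c div (b * b) div b" "j = c div (b * b) mod b" "k = c mod (b * b) div b" "l = c mod (b * b) mod b"
    have cb: "c div (b * b) < b * b" "c mod (b * b) < b * b"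
      using c(1) b0 unfolding d by (auto intro: less_mult_imp_div_less)
    have lt: "i < b" "j < b" "k < b" "l < b"
      using cb b0 by (auto simp: i_j_k_l_def intro: less_mult_imp_div_less)
    have "tup b i j k l = c" unfolding tup_alt i_j_k_l_def by (simp only: div_mult_mod_eq)
    then have nz: "T i j k l \<noteq> 0" using c(2) by (simp add: T_def)
    have 1: "U i j \<noteq> 0" "V k l \<noteq> 0" using nz T[OF lt] by auto
    have "T i j k l = T k l i j" by (rule inv) (use lt in auto)
    then have "V i j \<noteq> 0" using nz T[OF lt(3,4,1,2)] by auto
    moreover have "T i j i j = T i j 0 0" "T i j i j = T 0 0 i j" by (rule inv; use lt b0 in auto)+
    ultimately have "U 0 0 \<noteq> 0" "V 0 0 \<noteq> 0" using 1 T lt b0 by auto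
    then show False using k0 T b0 by (simp add: \<kappa>_def)
  qed
  define z where "z = (\<lambda>i. T 0 0 0 i / \<kappa>)"
  have z0: "z 0 = 1" using kap by (simp add: z_def \<kappa>_def)
  have split: "\<kappa> * T i j k l = T i j 0 0 * T 0 0 k l" if "i < b" "j < b" "k < b" "l < b" for i j k l
    using T[OF that] T[OF that(1,2) b0 b0] T[OF b0 b0 that(3,4)] T[OF b0 b0 b0 b0] by (simp add: \<kappa>_def)
  have T2: "T 0 i 0 j = \<kappa> * (z i * z j)" if "i < b" "j < b" for i j
  proof -
    have "T 0 i 0 0 = T 0 0 0 i" by (rule inv) (use that b0 in auto)
    then have "\<kappa> * T 0 i 0 j = T 0 0 0 i * T 0 0 0 j" using split[OF b0 that(1) b0 that(2)] by simp
    then show ?thesis using kap by (simp add: z_def field_simps)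
  qed
  have T2': "T i j 0 0 = \<kappa> * (z i * z j)" "T 0 0 i j = \<kappa> * (z i * z j)" if "i < b" "j < b" for i j
  proof -
    have "T i j 0 0 = T 0 i 0 j" "T 0 0 i j = T 0 i 0 j" by (rule inv; use that b0 in auto)+
    then show "T i j 0 0 = \<kappa> * (z i * z j)" "T 0 0 i j = \<kappa> * (z i * z j)" using T2[OF that] by simp_all
  qed
  have T4: "T i j k l = \<kappa> * (z i * z j * z k * z l)" if "i < b" "j < b" "k < b" "l < b" for i j k l
    using split[OF that] T2'(1)[OF that(1,2)] T2'(2)[OF that(3,4)] kap by (simp add: mult_ac)
  have z01: "z i = 0 \<or> z i = 1" if "i < b" for i
  proof -
    have "T 0 i 0 i = T 0 0 0 i" by (rule inv) (use that b0 in auto)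
    then have "\<kappa> * (z i * z i) = \<kappa> * z i" using T2[OF that that] kap by (simp add: z_def)
    then have "z i * (z i - 1) = 0" using kap by (simp add: algebra_simps)
    then show ?thesis by auto
  qed
  have "\<exists>w<g. z (ind g c w) = 1" if c: "c < n" for c
  proof -
    have "cdim n g * cdim n g + c < ncon n g m" using c by (simp add: ncon_def)
    from con[OF this] have "(\<Sum>w<g. X (ind g c w)) = X 0" by (simp add: con_sum_cell[OF c])
    moreover have "X (ind g c w) = \<kappa> * z (ind g c w)" for w using kap by (simp add: z_def T_def tup_def)
    moreover have "X 0 = \<kappa>" by (simp add: \<kappa>_def T_def tup_def)
    ultimately have "(\<Sum>w<g. z (ind g c w)) = 1" using kap by (simp flip: sum_distrib_left)
    then obtain w where "w \<in> {..<g}" "z (ind g c w) \<noteq> 0"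
      by (metis sum.not_neutral_contains_not_neutral zero_neq_one)
    then show ?thesis using z01[of "ind g c w"] ind_less[OF c, of w g] by (auto simp: b_def)
  qed
  \<comment> \<open>In characteristic p several indicators of a cell may be 1, as their number is
    only known modulo p. Any choice will do: a forbidden pattern with all four indicators 1 would
    make a vanishing entry equal to \<kappa>.\<close>
  then obtain w where w: "\<And>c. c < n \<Longrightarrow> w c < g" "\<And>c. c < n \<Longrightarrow> z (ind g c (w c)) = 1" by metis
  have "\<exists>p<4. w (cl j p) \<noteq> vl j p" if j: "j < m" for j
  proof (rule ccontr)
    assume "\<not> (\<exists>p<4. w (cl j p) \<noteq> vl j p)"
    then have e: "w (cl j p) = vl j p" if "p < 4" for p using that by blast
    have wfj: "cl j p < n" "vl j p < g" if "p < 4" for p using wf j that unfolding csp_wf_def by auto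
    have z1: "z (ind g (cl j p) (vl j p)) = 1" "ind g (cl j p) (vl j p) < b" if "p < 4" for p
      using w(2)[OF wfj(1)[OF that]] e[OF that] ind_less[OF wfj[OF that]] by (auto simp: b_def)
    have "cdim n g * cdim n g + n + j < ncon n g m" using j by (simp add: ncon_def)
    from con[OF this] have "T (ind g (cl j 0) (vl j 0)) (ind g (cl j 1) (vl j 1)) (ind g (cl j 2) (vl j 2)) (ind g (cl j 3) (vl j 3)) = 0"
      by (simp add: con_sum_tuple[OF wf j] T_def b_def)
    moreover have "T (ind g (cl j 0) (vl j 0)) (ind g (cl j 1) (vl j 1)) (ind g (cl j 2) (vl j 2)) (ind g (cl j 3) (vl j 3)) = \<kappa>"
      using z1[of 0] z1[of 1] z1[of 2] z1[of 3] by (subst T4) auto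
    ultimately show False using kap by simp
  qed
  then show ?thesis unfolding csp_sat_def using w(1) by blast
qed

lemma con_complete:
  fixes n g :: nat
  defines "b \<equiv> base n g"
  assumes wf: "csp_wf n g m cl vl" and sat: "csp_sat n g m cl vl"
  shows "\<exists>Y :: nat \<Rightarrow> 'q::field. nz (cdim n g) (\<lambda>c. Y (c div (b * b)) * Y (c mod (b * b))) \<and>
    (\<forall>k<ncon n g m. (\<Sum>e<cdim n g. con n g cl vl k e * (Y (e div (b * b)) * Y (e mod (b * b)))) = 0)"
proof -
  obtain v where v: "\<And>c. c < n \<Longrightarrow> v c < g" "\<And>j. j < m \<Longrightarrow> \<exists>p<4. v (cl j p) \<noteq> vl j p"
    using sat unfolding csp_sat_def by blast
  have b0: "0 < b" by (simp add: b_def base_def)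
  have d: "cdim n g = b * b * (b * b)" by (simp add: cdim_def b_def)
  have g0: "0 < g" using wf by (simp add: csp_wf_def)
  define z where "z = (\<lambda>i. i = 0 \<or> v ((i - 1) div g) = (i - 1) mod g)"
  define Y where "Y = (\<lambda>i. of_bool (z (i div b mod b) \<and> z (i mod b)) :: 'q)"
  define X where "X = (\<lambda>c. of_bool (\<forall>p<4. z (dig b c p)) :: 'q)"
  have XY: "Y (c div (b * b)) * Y (c mod (b * b)) = X c" for c
  proof -
    have "b ^ 3 = b * b * b" "b ^ 2 = b * b" by (simp_all add: power3_eq_cube power2_eq_square)
    moreover have "c mod (b * b) div b mod b = c div b mod b" using b0 by (simp add: mod_mult2_eq)
    moreover have "c mod (b * b) mod b = c mod b" by (simp add: mod_mult2_eq)
    ultimately show ?thesis unfolding X_def Y_def all4 dig_def by (auto simp: div_mult2_eq)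
  qed
  have zind: "z (ind g c w) \<longleftrightarrow> v c = w" if "w < g" for c w
    using that g0 by (simp add: z_def ind_def)
  have z0: "z 0" by (simp add: z_def)
  have Xtup: "X (tup b i j k l) = of_bool (z i \<and> z j \<and> z k \<and> z l)" if "i < b" "j < b" "k < b" "l < b" for i j k l
    unfolding X_def all4 dig_tup[OF that] by (auto intro: arg_cong[of _ _ of_bool])
  have Xl: "X l = of_bool (z l)" if "l < b" for l
    using Xtup[OF b0 b0 b0 that] z0 by (simp add: tup_def)
  have Xsame: "X c = X c'" if "same b c c'" for c c'
  proof -
    have "(\<forall>p<4. z (dig b c p)) \<longleftrightarrow> (\<forall>p<4. z (dig b c' p))" using that z0 unfolding same_def by metis
    then show ?thesis unfolding X_def by simp
  qed
  have "(\<Sum>e<cdim n g. con n g cl vl k e * X e) = 0" if k: "k < ncon n g m" for k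
  proof -
    let ?d = "cdim n g"
    have d0: "0 < ?d" using b0 by (simp add: d)
    consider "k < ?d * ?d" "same b (k div ?d) (k mod ?d)" | "k < ?d * ?d" "\<not> same b (k div ?d) (k mod ?d)"
      | c where "k = ?d * ?d + c" "c < n" | j where "k = ?d * ?d + n + j" "j < m"
    proof -
      have "k < ?d * ?d \<or> (\<exists>c. k = ?d * ?d + c \<and> c < n) \<or> (\<exists>j. k = ?d * ?d + n + j \<and> j < m)"
        using k unfolding ncon_def by presburger
      then show ?thesis using that by blast
    qed
    then show ?thesis
    proof cases
      case 1
      have "k div ?d < ?d" "k mod ?d < ?d" using 1(1) d0 by (auto intro: less_mult_imp_div_less)
      from con_sum_same[OF this 1(2)[unfolded b_def], of cl vl X] Xsame[OF 1(2)] show ?thesis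
        unfolding div_mult_mod_eq by simp
    next
      case 2
      then show ?thesis by (simp add: con_def Let_def b_def)
    next
      case 3
      have "(\<Sum>w<g. X (ind g c w)) = (\<Sum>w<g. of_bool (v c = w) * 1)"
        using ind_less[OF 3(2), of _ g] by (intro sum.cong refl) (simp add: Xl b_def zind)
      also have "\<dots> = 1" using v(1)[OF 3(2)] by (subst sum_value) auto
      finally show ?thesis unfolding 3(1) con_sum_cell[OF 3(2)] using Xl[OF b0] z0 by simp
    next
      case 4
      have wfj: "cl j p < n" "vl j p < g" if "p < 4" for p using wf 4 that unfolding csp_wf_def by auto
      have lt: "ind g (cl j p) (vl j p) < b" if "p < 4" for p unfolding b_def by (rule ind_less) (use wfj that in auto)
      have "\<not> (\<forall>p<4. z (ind g (cl j p) (vl j p)))" using v(2)[OF 4(2)] wfj zind by blast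
      then have "X (tup b (ind g (cl j 0) (vl j 0)) (ind g (cl j 1) (vl j 1)) (ind g (cl j 2) (vl j 2)) (ind g (cl j 3) (vl j 3))) = 0"
        unfolding all4 by (subst Xtup) (use lt in auto)
      then show ?thesis unfolding 4(1) con_sum_tuple[OF wf 4(2)] by (simp add: b_def)
    qed
  qed
  moreover have "nz (cdim n g) X" unfolding nz_def
    by (rule exI[of _ 0]) (use b0 z0 Xl[OF b0] d in auto)
  ultimately show ?thesis unfolding XY[symmetric] by blast
qed

section \<open>The gap\<close>

text \<open>The rows of the tensor square come first, then N * N copies of each equation, so that a
  single violated equation costs as much as the full length of the tensor square.\<close>

definition gapmat :: "nat \<Rightarrow> nat \<Rightarrow> (nat \<Rightarrow> nat \<Rightarrow> nat) \<Rightarrow> (nat \<Rightarrow> nat \<Rightarrow> nat) \<Rightarrow> nat \<Rightarrow> (nat \<Rightarrow> nat \<Rightarrow> 'q::field) \<Rightarrow> nat \<Rightarrow> nat \<Rightarrow> 'q" where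
  "gapmat n g cl vl N G i j = (if i < N * N then kron N (base n g * base n g) G G i j
     else con n g cl vl (i div (N * N) - 1) j)"

lemma wt_gapmat:
  "wt (Suc M * (N * N)) (mv d (gapmat n g cl vl N G) y) =
    wt (N * N) (mv d (kron N (base n g * base n g) G G) y) + N * N * (\<Sum>k<M. of_bool ((\<Sum>e<d. con n g cl vl k e * y e) \<noteq> 0))"
proof -
  have "wt (N * N) (\<lambda>j. mv d (gapmat n g cl vl N G) y (Suc k * (N * N) + j)) =
      N * N * of_bool ((\<Sum>e<d. con n g cl vl k e * y e) \<noteq> 0)" for k
  proof -
    have "wt (N * N) (\<lambda>j. mv d (gapmat n g cl vl N G) y (Suc k * (N * N) + j)) =
       wt (N * N) (\<lambda>j. \<Sum>e<d. con n g cl vl k e * y e)"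
    proof (rule wt_cong)
      fix i assume "i < N * N"
      then have "(Suc k * (N * N) + i) div (N * N) = Suc k" by (rule div_mod_idx)
      then have "\<not> Suc k * (N * N) + i < N * N" "(Suc k * (N * N) + i) div (N * N) - 1 = k" by auto
      then show "mv d (gapmat n g cl vl N G) y (Suc k * (N * N) + i) = (\<Sum>e<d. con n g cl vl k e * y e)"
        by (simp only: mv_def gapmat_def if_False)
    qed
    then show ?thesis by (simp add: wt_def)
  qed
  moreover have "wt (N * N) (\<lambda>j. mv d (gapmat n g cl vl N G) y (0 * (N * N) + j)) =
     wt (N * N) (mv d (kron N (base n g * base n g) G G) y)"
    by (rule wt_cong) (simp add: mv_def gapmat_def)
  ultimately show ?thesis unfolding wt_mult sum.lessThan_Suc_shift by (simp add: sum_distrib_left)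
qed

lemma gap_yes:
  fixes G :: "nat \<Rightarrow> nat \<Rightarrow> 'q::{finite,field}"
  assumes G: "\<And>a. int CARD('q) * int (wt N (mv (base n g * base n g) G a)) \<le> (int CARD('q) - 1) * int N"
    and wf: "csp_wf n g m cl vl" and sat: "csp_sat n g m cl vl"
  shows "\<exists>y. nz (cdim n g) y \<and>
    CARD('q)\<^sup>2 * wt (Suc (ncon n g m) * (N * N)) (mv (cdim n g) (gapmat n g cl vl N G) y) \<le> ((CARD('q) - 1) * N)\<^sup>2"
proof -
  define b where "b = base n g"
  obtain Y :: "nat \<Rightarrow> 'q" where Y: "nz (cdim n g) (\<lambda>c. Y (c div (b * b)) * Y (c mod (b * b)))"
    "\<forall>k<ncon n g m. (\<Sum>e<cdim n g. con n g cl vl k e * (Y (e div (b * b)) * Y (e mod (b * b)))) = 0"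
    using con_complete[OF wf sat] unfolding b_def by blast
  let ?y = "\<lambda>c. Y (c div (b * b)) * Y (c mod (b * b))"
  have "wt (Suc (ncon n g m) * (N * N)) (mv (cdim n g) (gapmat n g cl vl N G) ?y) = wt N (mv (b * b) G Y) * wt N (mv (b * b) G Y)"
    unfolding wt_gapmat using Y(2) kron_rank1[of N N "b * b" "b * b" G G Y Y] by (simp add: cdim_def b_def)
  moreover have "CARD('q) * wt N (mv (b * b) G Y) \<le> (CARD('q) - 1) * N"
  proof -
    have "int CARD('q) - 1 = int (CARD('q) - 1)" using card_field_ge2[where ?'q = 'q] by simp
    then have "int (CARD('q) * wt N (mv (b * b) G Y)) \<le> int ((CARD('q) - 1) * N)"
      using G[of Y] unfolding b_def[symmetric] by simp
    then show ?thesis by (simp only: of_nat_le_iff)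
  qed
  then have "(CARD('q) * wt N (mv (b * b) G Y))\<^sup>2 \<le> ((CARD('q) - 1) * N)\<^sup>2" by (intro power_mono) auto
  ultimately show ?thesis using Y(1) by (intro exI[of _ ?y]) (simp add: power_mult_distrib power2_eq_square[of "wt _ _"])
qed

text \<open>A violated equation costs N^2, more than required. Otherwise \<open>con_sound\<close>
  excludes rank one, and the bound for independent columns gives (1 + 1/q) w^2, where the minimum
  weight w is at least (1 - 1/E) (1 - 1/q) N.\<close>

lemma gap_no:
  fixes G :: "nat \<Rightarrow> nat \<Rightarrow> 'q::{finite,field}"
  defines "q \<equiv> CARD('q)"
  defines "E \<equiv> 4 * (q + 1)"
  assumes G: "\<And>a. nz (base n g * base n g) a \<Longrightarrow>
      (int q - 1) * ((int E - 1) * int N) \<le> int E * (int q * int (wt N (mv (base n g * base n g) G a)))"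
    and wf: "csp_wf n g m cl vl" and unsat: "\<not> csp_sat n g m cl vl" and y: "nz (cdim n g) y"
  shows "(2 * q + 1) * ((q - 1) * N)\<^sup>2 \<le> 2 * q ^ 3 * wt (Suc (ncon n g m) * (N * N)) (mv (cdim n g) (gapmat n g cl vl N G) y)"
proof -
  define b where "b = base n g"
  let ?W = "wt (Suc (ncon n g m) * (N * N)) (mv (cdim n g) (gapmat n g cl vl N G) y)"
  have q2: "2 \<le> q" unfolding q_def by (rule card_field_ge2)
  obtain q' where q': "q = Suc (Suc q')" using q2 by (metis Suc_le_D numeral_2_eq_2 Suc_le_mono)
  show ?thesis
  proof (cases "\<forall>k<ncon n g m. (\<Sum>e<cdim n g. con n g cl vl k e * y e) = 0")
    case False
    then obtain k where k: "k < ncon n g m" "(\<Sum>e<cdim n g. con n g cl vl k e * y e) \<noteq> 0" by blast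
    have "(1::nat) = of_bool ((\<Sum>e<cdim n g. con n g cl vl k e * y e) \<noteq> 0)" using k(2) by simp
    also have "\<dots> \<le> (\<Sum>k<ncon n g m. of_bool ((\<Sum>e<cdim n g. con n g cl vl k e * y e) \<noteq> 0))"
      by (rule member_le_sum) (use k in auto)
    finally have "N * N * 1 \<le> N * N * (\<Sum>k<ncon n g m. of_bool ((\<Sum>e<cdim n g. con n g cl vl k e * y e) \<noteq> 0))"
      by (rule mult_le_mono2)
    then have "N\<^sup>2 \<le> ?W" unfolding wt_gapmat power2_eq_square by linarith
    then have "2 * q ^ 3 * N\<^sup>2 \<le> 2 * q ^ 3 * ?W" by (rule mult_le_mono2)
    moreover have "(2 * q + 1) * (q - 1)\<^sup>2 \<le> 2 * q ^ 3"
      unfolding q' by (simp add: power2_eq_square power3_eq_cube algebra_simps)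
    then have "(2 * q + 1) * (q - 1)\<^sup>2 * N\<^sup>2 \<le> 2 * q ^ 3 * N\<^sup>2" by (rule mult_le_mono1)
    moreover have "(2 * q + 1) * ((q - 1) * N)\<^sup>2 = (2 * q + 1) * (q - 1)\<^sup>2 * N\<^sup>2"
      by (simp only: power_mult_distrib mult.assoc)
    ultimately show ?thesis by linarith
  next
    case True
    have W: "?W = wt (N * N) (mv (b * b * (b * b)) (kron N (b * b) G G) y)"
      unfolding wt_gapmat using True by (simp add: cdim_def b_def)
    obtain a a' where a: "a < b * b" "a' < b * b"
      "\<And>l k. l \<noteq> 0 \<or> k \<noteq> 0 \<Longrightarrow> nz (b * b) (\<lambda>j. l * y (j * (b * b) + a) + k * y (j * (b * b) + a'))"
    proof (cases rule: rank_cases[of "b * b" y])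
      case (indep a a')
      then show thesis using that by blast
    next
      case (rank1 u v)
      then have "csp_sat n g m cl vl" using con_sound[OF wf y, of u v] True unfolding b_def by blast
      then show thesis using unsat by simp
    qed
    \<comment> \<open>The exact minimum weight is attained by some vector, so the scaled inequality
      for weights transfers to it without rounding.\<close>
    have "\<exists>w. mindist N (b * b) G w \<and> (\<exists>a. nz (b * b) a \<and> wt N (mv (b * b) G a) = w)"
    proof -
      define P where "P = (\<lambda>w. \<exists>a. nz (b * b) a \<and> wt N (mv (b * b) G a) = w)"
      have "nz (b * b) (\<lambda>_. 1 :: 'q)" unfolding nz_def using a(1) by auto
      then have "P (wt N (mv (b * b) G (\<lambda>_. 1)))" unfolding P_def by blast
      then have "P (LEAST w. P w)" by (rule LeastI)
      moreover have "mindist N (b * b) G (LEAST w. P w)"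
        unfolding mindist_def by (intro allI impI Least_le) (auto simp: P_def)
      ultimately show ?thesis unfolding P_def by blast
    qed
    then obtain w where w: "mindist N (b * b) G w" "(int q - 1) * ((int E - 1) * int N) \<le> int E * (int q * int w)"
      using G unfolding b_def by blast
    have iw: "(int q + 1) * (int w * int w) \<le> int q * int ?W"
    proof -
      have "int ((q + 1) * (w * w)) \<le> int (q * ?W)"
        using indep_weight[OF w(1) a, folded q_def] unfolding W by (simp only: of_nat_le_iff)
      then show ?thesis by (simp add: algebra_simps)
    qed
    have E0: "0 < int E" by (simp add: E_def)
    have "0 \<le> (int q - 1) * ((int E - 1) * int N)" using q2 by (simp add: E_def)
    then have "((int q - 1) * ((int E - 1) * int N))\<^sup>2 \<le> (int E * (int q * int w))\<^sup>2"
      by (intro power_mono w(2))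
    then have "(int q + 1) * ((int q - 1) * ((int E - 1) * int N))\<^sup>2 \<le> (int q + 1) * (int E * (int q * int w))\<^sup>2"
      by (intro mult_left_mono) auto
    also have "\<dots> = (int E)\<^sup>2 * (int q)\<^sup>2 * ((int q + 1) * (int w * int w))"
      by (simp add: power2_eq_square algebra_simps)
    also have "\<dots> \<le> (int E)\<^sup>2 * (int q)\<^sup>2 * (int q * int ?W)" by (intro mult_left_mono iw) auto
    finally have 1: "(int q + 1) * ((int q - 1) * ((int E - 1) * int N))\<^sup>2 \<le> (int E)\<^sup>2 * ((int q) ^ 3 * int ?W)"
      by (simp add: power2_eq_square power3_eq_cube mult_ac)
    \<comment> \<open>The origin of E = 4 (q + 1): then (1 - 1/E)^2 is at least 1 - 1/(2 (q + 1)) =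
      (2q + 1) / (2 (q + 1)), and multiplied by (q + 1) / q this is 1 + 1/(2q).\<close>
    have "(2 * int q + 1) * (int E)\<^sup>2 \<le> 2 * ((int q + 1) * (int E - 1)\<^sup>2)"
      unfolding E_def by (simp add: power2_eq_square algebra_simps)
    then have "((int q - 1) * int N)\<^sup>2 * ((2 * int q + 1) * (int E)\<^sup>2) \<le> ((int q - 1) * int N)\<^sup>2 * (2 * ((int q + 1) * (int E - 1)\<^sup>2))"
      by (intro mult_left_mono) auto
    also have "\<dots> = 2 * ((int q + 1) * ((int q - 1) * ((int E - 1) * int N))\<^sup>2)" by (simp add: power_mult_distrib mult_ac)
    also have "\<dots> \<le> 2 * ((int E)\<^sup>2 * ((int q) ^ 3 * int ?W))" using 1 by simp
    finally have "(int E)\<^sup>2 * ((2 * int q + 1) * ((int q - 1) * int N)\<^sup>2) \<le> (int E)\<^sup>2 * (2 * (int q) ^ 3 * int ?W)"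
      by (simp add: mult_ac)
    then have "(2 * int q + 1) * ((int q - 1) * int N)\<^sup>2 \<le> 2 * (int q) ^ 3 * int ?W"
      using E0 by (subst (asm) mult_le_cancel_left_pos) auto
    moreover have "int q - 1 = int (q - 1)" using q2 by simp
    ultimately have "int ((2 * q + 1) * ((q - 1) * N)\<^sup>2) \<le> int (2 * q ^ 3 * ?W)"
      by (simp only: of_nat_mult of_nat_add of_nat_power of_nat_numeral of_nat_1)
    then show ?thesis by (simp only: of_nat_le_iff)
  qed
qed

text \<open>Any \<open>U * V\<close> of the given rank has at least the error of the minimum
  distance of the tensor power, which is large in the unsatisfiable case. In the satisfiable case
  the optimum is at most the t-th power of a small weight, and \<open>t\<close> is such that
  \<alpha> is less than ((2q + 1) / (2q))^t; only this direction uses the approximation guarantee.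
  The inequality is multiplied out so that integers are compared.\<close>

theorem l0_decides:
  fixes G :: "nat \<Rightarrow> nat \<Rightarrow> 'q::{finite,field}" and \<alpha> :: real
  defines "q \<equiv> CARD('q)"
  defines "E \<equiv> 4 * (q + 1)"
  assumes G1: "\<And>a. int q * int (wt N (mv (base n g * base n g) G a)) \<le> (int q - 1) * int N"
    and G2: "\<And>a. nz (base n g * base n g) a \<Longrightarrow>
      (int q - 1) * ((int E - 1) * int N) \<le> int E * (int q * int (wt N (mv (base n g * base n g) G a)))"
    and wf: "csp_wf n g m cl vl" and N: "0 < N" and \<alpha>: "0 \<le> \<alpha>" "\<alpha> * real (2 * q) ^ t < real (2 * q + 1) ^ t"
    and R: "R = Suc (ncon n g m) * (N * N)"
    and M: "M = mat (R ^ t) (cdim n g ^ t) (\<lambda>(i, j). tens R (cdim n g) (gapmat n g cl vl N G) t i j)"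
    and sol: "l0_approx_solution \<alpha> (cdim n g ^ t - 1) M U V"
  shows "csp_sat n g m cl vl \<longleftrightarrow>
    (2 * q ^ 3) ^ t * l0_norm (M - U * V) < ((2 * q + 1) * ((q - 1) * N)\<^sup>2) ^ t"
proof -
  let ?d = "cdim n g" and ?A = "gapmat n g cl vl N G"
  define S where "S = ((q - 1) * N)\<^sup>2"
  have q2: "2 \<le> q" unfolding q_def by (rule card_field_ge2)
  have S0: "0 < S" unfolding S_def using q2 N by simp
  have d0: "0 < ?d" by (simp add: cdim_def base_def)
  have UV: "U \<in> carrier_mat (R ^ t) (?d ^ t - 1)" "V \<in> carrier_mat (?d ^ t - 1) (?d ^ t)"
    and le: "real (l0_norm (M - U * V)) \<le> \<alpha> * real (l0_opt (?d ^ t - 1) M)"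
    using sol unfolding l0_approx_solution_def M by auto
  show ?thesis
  proof
    assume "csp_sat n g m cl vl"
    from gap_yes[OF G1[unfolded q_def] wf this]
    obtain y where y: "nz ?d y" "q\<^sup>2 * wt R (mv ?d ?A y) \<le> S"
      unfolding R S_def q_def by blast
    obtain y' where y': "nz (?d ^ t) y'" "wt (R ^ t) (mv (?d ^ t) (tens R ?d ?A t) y') = wt R (mv ?d ?A y) ^ t"
      using tens_weight[OF y(1), of t R ?A] by blast
    have "l0_opt (?d ^ t - 1) M \<le> wt R (mv ?d ?A y) ^ t"
      using l0_opt_upper[OF y'(1), of "R ^ t" "tens R ?d ?A t"] unfolding y'(2) M .
    then have "\<alpha> * real (l0_opt (?d ^ t - 1) M) \<le> \<alpha> * real (wt R (mv ?d ?A y) ^ t)"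
      using \<alpha>(1) by (intro mult_left_mono) (simp_all only: of_nat_le_iff)
    with le have "real (l0_norm (M - U * V)) \<le> \<alpha> * real (wt R (mv ?d ?A y) ^ t)" by linarith
    then have "real ((2 * q ^ 3) ^ t) * real (l0_norm (M - U * V)) \<le> real ((2 * q ^ 3) ^ t) * (\<alpha> * real (wt R (mv ?d ?A y) ^ t))"
      by (intro mult_left_mono) auto
    also have "\<dots> = \<alpha> * real (2 * q) ^ t * real ((q\<^sup>2 * wt R (mv ?d ?A y)) ^ t)"
      by (simp add: power_mult_distrib power2_eq_square power3_eq_cube mult_ac)
    also have "\<dots> \<le> \<alpha> * real (2 * q) ^ t * real (S ^ t)"
      using \<alpha>(1) y(2) by (intro mult_left_mono) (auto simp del: of_nat_power simp: power_mono)
    also have "\<dots> < real (2 * q + 1) ^ t * real (S ^ t)"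
      using \<alpha>(2) S0 by (intro mult_strict_right_mono) auto
    also have "\<dots> = real (((2 * q + 1) * S) ^ t)" by (simp only: of_nat_power of_nat_mult power_mult_distrib)
    finally have "real ((2 * q ^ 3) ^ t * l0_norm (M - U * V)) < real (((2 * q + 1) * S) ^ t)"
      by (simp only: of_nat_mult)
    then show "(2 * q ^ 3) ^ t * l0_norm (M - U * V) < ((2 * q + 1) * ((q - 1) * N)\<^sup>2) ^ t"
      unfolding S_def by (simp only: of_nat_less_iff)
  next
    assume lt: "(2 * q ^ 3) ^ t * l0_norm (M - U * V) < ((2 * q + 1) * ((q - 1) * N)\<^sup>2) ^ t"
    show "csp_sat n g m cl vl"
    proof (rule ccontr)
      assume unsat: "\<not> csp_sat n g m cl vl"
      define P where "P = (\<lambda>w. \<exists>y. nz ?d y \<and> wt R (mv ?d ?A y) = w)"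
      have "nz ?d (\<lambda>_. 1 :: 'q)" unfolding nz_def using d0 by auto
      then have "P (wt R (mv ?d ?A (\<lambda>_. 1)))" unfolding P_def by blast
      then have "P (LEAST w. P w)" by (rule LeastI)
      then obtain y where y: "nz ?d y" "wt R (mv ?d ?A y) = (LEAST w. P w)" unfolding P_def by blast
      have "mindist R ?d ?A (LEAST w. P w)"
        unfolding mindist_def by (intro allI impI Least_le) (auto simp: P_def)
      then have "mindist (R ^ t) (?d ^ t) (tens R ?d ?A t) ((LEAST w. P w) ^ t)" by (rule tens_dist)
      moreover have "?d ^ t - 1 < ?d ^ t" using d0 by simp
      ultimately have "(LEAST w. P w) ^ t \<le> l0_norm (M - U * V)"
        unfolding M by (rule l0_norm_lower[OF _ _ UV])
      then have "(2 * q ^ 3) ^ t * (LEAST w. P w) ^ t \<le> (2 * q ^ 3) ^ t * l0_norm (M - U * V)" by (rule mult_le_mono2)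
      moreover have "(2 * q + 1) * S \<le> 2 * q ^ 3 * (LEAST w. P w)"
        using gap_no[OF G2[unfolded E_def q_def] wf unsat y(1)] y(2) unfolding S_def q_def R by simp
      then have "((2 * q + 1) * S) ^ t \<le> (2 * q ^ 3 * (LEAST w. P w)) ^ t" by (intro power_mono) auto
      ultimately show False using lt unfolding S_def power_mult_distrib[of "2 * q ^ 3"] by linarith
    qed
  qed
qed

section \<open>Computing the entries\<close>

lemma pc_tab2:
  assumes f: "pc f" and g: "pc g"
  shows "pc (\<lambda>X y e. if f X y e < K then (if g X y e < K' then T (f X y e) (g X y e) else 0) else 0)"
  by (rule pc_fin[where f = "\<lambda>a X y e. if g X y e < K' then T a (g X y e) else 0", OF f])
    (rule pc_fin[where f = "\<lambda>b X y e. T _ b", OF g pc_const])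

definition pcq :: "(inp \<Rightarrow> (nat \<Rightarrow> nat) \<Rightarrow> env \<Rightarrow> 'q::finite) \<Rightarrow> bool" where
  "pcq f \<longleftrightarrow> pc (\<lambda>X y e. idx (f X y e))"

text \<open>An operation on a finite type is a table on the numbers of its elements; no field
  arithmetic has to be programmed.\<close>

lemma pcq_op:
  fixes f g :: "inp \<Rightarrow> (nat \<Rightarrow> nat) \<Rightarrow> env \<Rightarrow> 'q::finite"
  assumes "pcq f" "pcq g"
  shows "pcq (\<lambda>X y e. H (f X y e) (g X y e) :: 'q)"
  unfolding pcq_def
  using pc_tab2[OF assms[unfolded pcq_def], of "CARD('q)" "CARD('q)" "\<lambda>a b. idx (H (fe a) (fe b))"]
  by (simp add: idx_less)

lemma pcq_const: "pcq (\<lambda>X y e. c)"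
  unfolding pcq_def by (rule pc_const)

lemma pcq_add: "pcq f \<Longrightarrow> pcq g \<Longrightarrow> pcq (\<lambda>X y e. f X y e + g X y e)"
  by (rule pcq_op)

lemma pcq_mult: "pcq f \<Longrightarrow> pcq g \<Longrightarrow> pcq (\<lambda>X y e. f X y e * g X y e)"
  by (rule pcq_op)

lemma pcq_diff: "pcq f \<Longrightarrow> pcq g \<Longrightarrow> pcq (\<lambda>X y e. f X y e - g X y e)"
  by (rule pcq_op)

lemma pcq_if:
  assumes "pcb P" "pcq f" "pcq g"
  shows "pcq (\<lambda>X y e. if P X y e then f X y e else g X y e)"
  unfolding pcq_def if_distrib[of idx] by (intro pc_if assms[unfolded pcq_def] assms(1))

lemma pcq_of_bool: assumes "pcb P" shows "pcq (\<lambda>X y e. of_bool (P X y e) :: 'q::{finite,zero_neq_one})"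
  unfolding of_bool_def by (intro pcq_if pcq_const assms)

lemma pcq_fe:
  assumes "pc f" "\<And>X y e. f X y e < CARD('q)"
  shows "pcq (\<lambda>X y e. fe (f X y e) :: 'q::finite)"
  unfolding pcq_def using assms by simp

lemma pcq_rename: "pcq f \<Longrightarrow> pcq (\<lambda>X y e. f X y (\<lambda>k. e (\<pi> k)))"
  unfolding pcq_def by (rule pc_rename)

lemma pcb_qeq:
  assumes "pcq f" "pcq g"
  shows "pcb (\<lambda>X y e. f X y e = g X y e)"
  using pcb_eq[OF assms[unfolded pcq_def]] by (simp add: idx_inj)

lemma pcq_sum:
  fixes f :: "inp \<Rightarrow> (nat \<Rightarrow> nat) \<Rightarrow> nat \<Rightarrow> env \<Rightarrow> 'q::{finite,field}"
  assumes f: "pcq (\<lambda>X y e. f X y (e 0) (\<lambda>k. e (Suc k)))" and n: "pc n"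
  shows "pcq (\<lambda>X y e. \<Sum>i<n X y e. f X y i e)"
proof -
  let ?q = "CARD('q)"
  let ?T = "\<lambda>a b. if a < ?q then (if b < ?q then idx (fe a + fe b :: 'q) else 0) else 0"
  have r: "rec_nat (idx (0 :: 'q)) (\<lambda>i acc. ?T acc (idx (h i))) v = idx (\<Sum>i<v. h i)" for v :: nat and h :: "nat \<Rightarrow> 'q"
    by (induction v) (auto simp: idx_less)
  have f': "pc (\<lambda>X y e. idx (f X y (e 0) (\<lambda>k. e (k + 2))))"
    using pcq_rename[OF f, of "\<lambda>k. case k of 0 \<Rightarrow> 0 | Suc k \<Rightarrow> k + 2"] unfolding pcq_def by simp
  have "pc (\<lambda>X y e. rec_nat (idx (0 :: 'q)) (\<lambda>i acc. ?T acc (idx (f X y i e))) (n X y e))"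
  proof (rule pc_rec[where T = "\<lambda>S. ?q"])
    show "pc (\<lambda>X y e. ?T (e 1) (idx (f X y (e 0) (\<lambda>k. e (k + 2)))))"
      by (rule pc_tab2[OF pc_var f'])
    fix S X y e i
    show "rec_nat (idx (0 :: 'q)) (\<lambda>i acc. ?T acc (idx (f X y i e))) i \<le> ?q"
      unfolding r by (simp add: idx_less less_imp_le)
  qed (use n in \<open>auto intro: polyb_intros pc_const\<close>)
  then show ?thesis unfolding r pcq_def .
qed

lemma pcq_finsum:
  fixes f :: "'c \<Rightarrow> inp \<Rightarrow> (nat \<Rightarrow> nat) \<Rightarrow> env \<Rightarrow> 'q::{finite,field}"
  assumes "finite A" "\<And>a. a \<in> A \<Longrightarrow> pcq (f a)"
  shows "pcq (\<lambda>X y e. \<Sum>a\<in>A. f a X y e)"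
  using assms
proof (induction A rule: finite_induct)
  case empty
  then show ?case by (simp add: pcq_const)
next
  case (insert a A)
  then have "pcq (\<lambda>X y e. f a X y e + (\<Sum>a\<in>A. f a X y e))" by (intro pcq_add) auto
  then show ?case using insert by simp
qed

lemmas pcq_intros = pcq_const pcq_add pcq_mult pcq_diff pcq_if pcq_of_bool pcq_sum

text \<open>Powers, truncated at \<open>c + 1\<close> to keep them polynomial.\<close>

lemma rec_power: "0 < b \<Longrightarrow> rec_nat 1 (\<lambda>i acc. if b * acc < Suc c then b * acc else Suc c) k = min (b ^ k) (Suc c)" for b c :: nat
proof (induction k)
  case (Suc k)
  show ?case
  proof (cases "b ^ k \<le> Suc c")
    case True
    then show ?thesis using Suc by (simp add: min_def)
  next
    case False
    moreover have "b ^ k \<le> b * b ^ k" using Suc.prems by simp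
    then have "\<not> b * b ^ k \<le> Suc c" using False by linarith
    moreover have "1 * Suc c \<le> b * Suc c" using Suc.prems by (intro mult_le_mono1) simp
    ultimately show ?thesis using Suc by (simp add: min_def)
  qed
qed simp

lemma pc_min_power:
  assumes "pc k" "pc c" "0 < b"
  shows "pc (\<lambda>X y e. min (b ^ k X y e) (Suc (c X y e)))"
proof -
  obtain v where v: "\<And>S X y e. bnd S X e \<Longrightarrow> c X y e \<le> S ^ v" using pbE[OF pc_pb[OF assms(2)]] by metis
  have "pc (\<lambda>X y e. rec_nat 1 (\<lambda>i acc. if b * acc < Suc (c X y e) then b * acc else Suc (c X y e)) (k X y e))"
  proof (rule pc_rec[where T = "\<lambda>S. Suc (S ^ v)"])
    show "pc (\<lambda>X y e. if b * e 1 < Suc (c X y (\<lambda>k. e (k + 2))) then b * e 1 else Suc (c X y (\<lambda>k. e (k + 2))))"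
      by (intro pc_intros pc_rename[OF assms(2)])
    fix S X y e i assume "bnd S X e"
    then show "rec_nat 1 (\<lambda>i acc. if b * acc < Suc (c X y e) then b * acc else Suc (c X y e)) i \<le> Suc (S ^ v)"
      unfolding rec_power[OF assms(3)] using v[of S X e y] by simp
  qed (use assms in \<open>auto intro: polyb_intros pc_const[of 1, simplified]\<close>)
  then show ?thesis unfolding rec_power[OF assms(3)] .
qed

text \<open>A divisor larger than the dividend can be truncated to the dividend plus one, as the
  quotient is 0 in both cases. So exponentially large powers never have to be stored.\<close>

lemma pc_div_power:
  assumes "pc f" "pc k" "2 \<le> b"
  shows "pc (\<lambda>X y e. f X y e div b ^ k X y e)"
proof -
  have "pc (\<lambda>X y e. f X y e div min (b ^ k X y e) (Suc (f X y e)))"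
    using assms by (intro pc_div pc_min_power) auto
  moreover have "a div min c (Suc a) = a div c" for a c :: nat by (cases "c \<le> Suc a") (auto simp: min_def)
  ultimately show ?thesis by simp
qed

text \<open>The binary logarithm rounded up, written as a bounded sum.\<close>

definition lg :: "nat \<Rightarrow> nat" where
  "lg a = (\<Sum>i<a. of_bool (2 ^ i < a))"

lemma lg_set: "{i. i < a \<and> 2 ^ i < a} = {..<lg a}"
proof -
  obtain m where m: "{i. i < a \<and> 2 ^ i < a} = {..<m}"
  proof -
    define m where "m = (LEAST m. a \<le> 2 ^ m)"
    have "a \<le> 2 ^ a" using less_exp[of a] by simp
    then have 1: "a \<le> 2 ^ m" unfolding m_def by (rule LeastI)
    have "2 ^ i < a \<longleftrightarrow> i < m" for i
    proof
      show "i < m" if "2 ^ i < a"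
      proof (rule ccontr)
        assume "\<not> i < m"
        then have "(2::nat) ^ m \<le> 2 ^ i" by (intro power_increasing) auto
        then show False using that 1 by linarith
      qed
      show "2 ^ i < a" if "i < m" using not_less_Least[of i "\<lambda>m. a \<le> 2 ^ m"] that unfolding m_def by simp
    qed
    moreover have "i < a" if "2 ^ i < a" for i using that less_exp[of i] by linarith
    ultimately have "{i. i < a \<and> 2 ^ i < a} = {..<m}" by auto
    then show thesis by (rule that)
  qed
  have "lg a = card {i. i < a \<and> 2 ^ i < a}" unfolding lg_def by (simp add: sum_of_bool_eq Int_def)
  then show ?thesis unfolding m by simp
qed

lemma lg_ge: "a \<le> 2 ^ lg a"
proof (rule ccontr)
  assume a: "\<not> a \<le> 2 ^ lg a"
  then have "lg a < a" using less_exp[of "lg a"] by linarith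
  then have "lg a \<in> {i. i < a \<and> 2 ^ i < a}" using a by simp
  then show False unfolding lg_set by simp
qed

lemma lg_le: "2 ^ lg a \<le> 2 * a + 1"
proof (cases "lg a")
  case (Suc k)
  then have "k \<in> {i. i < a \<and> 2 ^ i < a}" unfolding lg_set by simp
  then show ?thesis using Suc by simp
qed simp

lemma pc_lg:
  assumes "pc f"
  shows "pc (\<lambda>X y e. lg (f X y e))"
proof -
  have "pc (\<lambda>X y e. \<Sum>i<f X y e. of_bool (min (2 ^ i) (Suc (f X y e)) < f X y e))"
    by (intro pc_sum pc_of_bool pcb_less pc_min_power pc_var pc_rename[OF assms] assms) simp
  moreover have "(min (2 ^ i) (Suc a) < a) = (2 ^ i < a)" for i a :: nat by auto
  ultimately show ?thesis unfolding lg_def by simp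
qed

text \<open>As q is at most 2^q and 2^lg is linear in its argument, the power is bounded by an
  explicit polynomial, and truncating it there changes nothing.\<close>

lemma pc_power_lg:
  assumes f: "pc f" and q: "0 < q"
  shows "pc (\<lambda>X y e. q ^ (a * lg (f X y e) + b))"
proof -
  have "q \<le> 2 ^ q" using less_exp[of q] by simp
  then have "q ^ (a * lg u + b) \<le> (2 ^ q) ^ (a * lg u + b)" for u by (rule power_mono) simp
  also have "(2 ^ q) ^ (a * lg u + b) = (2 ^ lg u) ^ (q * a) * (2 ^ (q * b) :: nat)" for u :: nat
    by (simp only: power_mult[symmetric] power_add[symmetric]) (simp add: algebra_simps)
  also have "(2 ^ lg u) ^ (q * a) * 2 ^ (q * b) \<le> (2 * u + 1) ^ (q * a) * 2 ^ (q * b)" for u :: nat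
    by (intro mult_le_mono1 power_mono lg_le) simp
  finally have le: "q ^ (a * lg u + b) \<le> (2 * u + 1) ^ (q * a) * 2 ^ (q * b)" for u .
  have "pc (\<lambda>X y e. min (q ^ (a * lg (f X y e) + b)) (Suc ((2 * f X y e + 1) ^ (q * a) * 2 ^ (q * b))))"
    by (rule pc_min_power[OF _ _ q]) (intro pc_intros pc_lg f)+
  moreover have "min (q ^ (a * lg u + b)) (Suc ((2 * u + 1) ^ (q * a) * 2 ^ (q * b))) = q ^ (a * lg u + b)" for u
    using le[of u] by simp
  ultimately show ?thesis by simp
qed

lemma pc_bit:
  assumes "pc Q" "pc s" "pc j" "pc i"
  shows "pc (\<lambda>X y e. bit (Q X y e) (s X y e) (j X y e) (i X y e))"
  unfolding bit_def hit_def by (intro pc_intros pc_div_power assms) simp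

definition Qof :: "nat \<Rightarrow> nat" where "Qof a = 2 ^ (2 * lg a + 3)"

lemma pc_Qof: "pc f \<Longrightarrow> pc (\<lambda>X y e. Qof (f X y e))"
  unfolding Qof_def by (rule pc_power_lg) auto

definition code_mat :: "nat \<Rightarrow> nat \<Rightarrow> nat \<Rightarrow> nat \<Rightarrow> 'q::{finite,field}" where
  "code_mat D a = gen (Qof a) (lg a + 4) D"

definition code_rows :: "'q::{finite,field} itself \<Rightarrow> nat \<Rightarrow> nat \<Rightarrow> nat" where
  "code_rows _ D a = (Qof a * Qof a * CARD('q) ^ (lg a + 4)) ^ D"

lemma pc_qpow: assumes "pc f" shows "pc (\<lambda>X y e. CARD('q::{finite,field}) ^ (lg (f X y e) + 4))"
  using pc_power_lg[OF assms, of "CARD('q)" 1 4] by simp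

lemma pc_code_rows: assumes "pc f" shows "pc (\<lambda>X y e. code_rows TYPE('q::{finite,field}) D (f X y e))"
  unfolding code_rows_def by (intro pc_intros pc_Qof pc_qpow assms)

lemma pcq_gen1:
  assumes a: "pc a" and r: "pc r" and i: "pc i"
  shows "pcq (\<lambda>X y e. gen1 (Qof (a X y e)) (lg (a X y e) + 4) (r X y e) (i X y e) :: 'q::{finite,field})"
proof -
  let ?q = "CARD('q)"
  have *: "pcq (\<lambda>X y e. \<Sum>j<lg (a X y e) + 4. fe (r X y e mod ?q ^ (lg (a X y e) + 4) div ?q ^ j mod ?q) *
     (if bit (Qof (a X y e)) (r X y e div ?q ^ (lg (a X y e) + 4)) j (i X y e) = 1 then 1 else 0 :: 'q))"
    by (intro pcq_sum pcq_mult pcq_fe pcq_if pcq_const pcb_eq pc_bit pc_div_power pc_mod pc_div pc_qpow pc_Qof pc_lg pc_add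
        pc_const pc_var pc_rename[OF a] pc_rename[OF r] pc_rename[OF i] a)
      (auto simp: card_field_ge2)
  have b: "(if bit Q s j i = 1 then 1 else 0 :: 'q) = of_nat (bit Q s j i)" for Q s j i
    by (simp add: bit_def hit_def)
  show ?thesis using * unfolding b gen1_def had_def .
qed

lemma pcq_code_mat:
  assumes a: "pc a"
  shows "pc r \<Longrightarrow> pc i \<Longrightarrow> pcq (\<lambda>X y e. code_mat D (a X y e) (r X y e) (i X y e) :: 'q::{finite,field})"
  unfolding code_mat_def
proof (induction D arbitrary: r)
  case 0
  then show ?case by (simp add: pcq_const)
next
  case (Suc D)
  have "pc (\<lambda>X y e. (Qof (a X y e) * Qof (a X y e) * CARD('q) ^ (lg (a X y e) + 4)) ^ D)"
    by (intro pc_intros pc_Qof pc_qpow a)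
  then show ?case using Suc.prems unfolding gen.simps
    by (intro pcq_add pcq_gen1 Suc.IH pc_div pc_mod a)
qed

lemma pc_base: "pc n \<Longrightarrow> pc (\<lambda>X y e. base (n X y e) g)"
  unfolding base_def by (intro pc_intros)

lemma pc_cdim: "pc n \<Longrightarrow> pc (\<lambda>X y e. cdim (n X y e) g)"
  unfolding cdim_def by (intro pc_intros pc_base)

lemma pcb_same:
  assumes "pc b" "pc c" "pc c'"
  shows "pcb (\<lambda>X y e. same (b X y e) (c X y e) (c' X y e))"
  unfolding same_def dig_def all4 ex4 by (intro pc_intros assms)

lemma pc_ind: "pc c \<Longrightarrow> pc v \<Longrightarrow> pc (\<lambda>X y e. ind g (c X y e) (v X y e))"
  unfolding ind_def by (intro pc_intros)

text \<open>Problems that are computed from an input word by counter programs. The locale is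
  instantiated by the tableau of a verifier and by 3-SAT. The number of values per cell is a
  constant, while cells and constraints grow with the input.\<close>

locale csp_family =
  fixes nf mf :: "inp \<Rightarrow> nat" and g :: nat and cl vl :: "inp \<Rightarrow> nat \<Rightarrow> nat \<Rightarrow> nat"
  assumes pc_n: "pc (\<lambda>X y e. nf X)" and pc_m: "pc (\<lambda>X y e. mf X)"
    and pc_cl: "\<And>p. p < 4 \<Longrightarrow> pc (\<lambda>X y e. cl X (e 0) p)"
    and pc_vl: "\<And>p. p < 4 \<Longrightarrow> pc (\<lambda>X y e. vl X (e 0) p)"
    and n_pos: "\<And>X. 0 < nf X" and g_pos: "0 < g"
begin

lemma pc_cl': "p < 4 \<Longrightarrow> pc f \<Longrightarrow> pc (\<lambda>X y e. cl X (f X y e) p)"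
  by (rule pc_comp1[where F = "\<lambda>X y j. cl X j p", OF pc_cl])

lemma pc_vl': "p < 4 \<Longrightarrow> pc f \<Longrightarrow> pc (\<lambda>X y e. vl X (f X y e) p)"
  by (rule pc_comp1[where F = "\<lambda>X y j. vl X j p", OF pc_vl])

lemma pcq_con:
  assumes "pc k" "pc c"
  shows "pcq (\<lambda>X y e. con (nf X) g (cl X) (vl X) (k X y e) (c X y e) :: 'q::{finite,field})"
  unfolding con_def Let_def tup_def
  by (intro pcq_intros pcb_same pc_intros pc_base pc_cdim pc_ind pc_cl' pc_vl' pc_n assms) simp_all

definition Nf :: "'q::{finite,field} itself \<Rightarrow> nat \<Rightarrow> inp \<Rightarrow> nat" where
  "Nf _ D X = code_rows TYPE('q) D (base (nf X) g * base (nf X) g)"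

lemma pc_Nf: "pc (\<lambda>X y e. Nf TYPE('q::{finite,field}) D X)"
  unfolding Nf_def by (intro pc_code_rows pc_mult pc_base pc_n)

definition Gf :: "nat \<Rightarrow> inp \<Rightarrow> nat \<Rightarrow> nat \<Rightarrow> 'q::{finite,field}" where
  "Gf D X = gapmat (nf X) g (cl X) (vl X) (Nf TYPE('q) D X) (code_mat D (base (nf X) g * base (nf X) g))"

lemma pcq_Gf: "pc i \<Longrightarrow> pc j \<Longrightarrow> pcq (\<lambda>X y e. Gf D X (i X y e) (j X y e) :: 'q::{finite,field})"
  unfolding Gf_def gapmat_def kron_def
  by (intro pcq_intros pcq_code_mat pcq_con pc_intros pc_Nf pc_base pc_n)

definition Rf :: "'q::{finite,field} itself \<Rightarrow> nat \<Rightarrow> inp \<Rightarrow> nat" where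
  "Rf _ D X = Suc (ncon (nf X) g (mf X)) * (Nf TYPE('q) D X * Nf TYPE('q) D X)"

lemma pc_Rf: "pc (\<lambda>X y e. Rf TYPE('q::{finite,field}) D X)"
  unfolding Rf_def ncon_def by (intro pc_intros pc_Nf pc_cdim pc_n pc_m)

definition Tf :: "nat \<Rightarrow> nat \<Rightarrow> inp \<Rightarrow> nat \<Rightarrow> nat \<Rightarrow> 'q::{finite,field}" where
  "Tf D t X = tens (Rf TYPE('q) D X) (cdim (nf X) g) (Gf D X) t"

lemma pcq_Tf: "pc i \<Longrightarrow> pc j \<Longrightarrow> pcq (\<lambda>X y e. Tf D t X (i X y e) (j X y e) :: 'q::{finite,field})"
  unfolding Tf_def
proof (induction t arbitrary: i j)
  case 0
  then show ?case by (simp add: pcq_const)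
next
  case (Suc t)
  then show ?case unfolding tens.simps kron_def
    by (intro pcq_mult pcq_Gf Suc.IH pc_div pc_mod pc_power pc_Rf pc_cdim pc_n)
qed

definition nrows :: "'q::{finite,field} itself \<Rightarrow> nat \<Rightarrow> nat \<Rightarrow> inp \<Rightarrow> nat" where
  "nrows _ D t X = Rf TYPE('q) D X ^ t"

definition ncols :: "nat \<Rightarrow> inp \<Rightarrow> nat" where
  "ncols t X = cdim (nf X) g ^ t"

lemma pc_rows: "pc (\<lambda>X y e. nrows TYPE('q::{finite,field}) D t X)"
  unfolding nrows_def by (intro pc_power pc_Rf)

lemma pc_cols: "pc (\<lambda>X y e. ncols t X)"
  unfolding ncols_def by (intro pc_power pc_cdim pc_n)

definition inst_mat :: "nat \<Rightarrow> nat \<Rightarrow> inp \<Rightarrow> 'q::{finite,field} mat" where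
  "inst_mat D t X = mat (nrows TYPE('q) D t X) (ncols t X) (\<lambda>(i, j). Tf D t X i j)"

lemma inst_decides:
  fixes U V :: "'q::{finite,field} mat"
  assumes wf: "csp_wf (nf X) g (mf X) (cl X) (vl X)"
    and E: "4 * (CARD('q) + 1) * 23 ^ D \<le> 24 ^ D"
    and \<alpha>: "0 \<le> \<alpha>" "\<alpha> * real (2 * CARD('q)) ^ t < real (2 * CARD('q) + 1) ^ t"
    and sol: "l0_approx_solution \<alpha> (ncols t X - 1) (inst_mat D t X) U V"
  shows "csp_sat (nf X) g (mf X) (cl X) (vl X) \<longleftrightarrow>
    (2 * CARD('q) ^ 3) ^ t * l0_norm (inst_mat D t X - U * V) < ((2 * CARD('q) + 1) * ((CARD('q) - 1) * Nf TYPE('q) D X)\<^sup>2) ^ t"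
proof -
  let ?a = "base (nf X) g * base (nf X) g"
  have N: "Nf TYPE('q) D X = (Qof ?a * Qof ?a * CARD('q) ^ (lg ?a + 4)) ^ D"
    by (simp add: Nf_def code_rows_def)
  have w1: "int CARD('q) * int (wt (Nf TYPE('q) D X) (mv ?a (code_mat D ?a) a)) \<le> (int CARD('q) - 1) * int (Nf TYPE('q) D X)"
    for a :: "nat \<Rightarrow> 'q"
    unfolding N code_mat_def by (rule gen_weight(1)[OF lg_ge Qof_def E])
  have w2: "(int CARD('q) - 1) * ((int (4 * (CARD('q) + 1)) - 1) * int (Nf TYPE('q) D X)) \<le>
      int (4 * (CARD('q) + 1)) * (int CARD('q) * int (wt (Nf TYPE('q) D X) (mv ?a (code_mat D ?a) a)))"
    if "nz ?a a" for a :: "nat \<Rightarrow> 'q"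
    unfolding N code_mat_def by (rule gen_weight(2)[OF lg_ge Qof_def E that])
  show ?thesis
  proof (rule l0_decides[where G = "code_mat D ?a" and R = "Rf TYPE('q) D X", OF _ _ wf _ \<alpha>])
    show "0 < Nf TYPE('q) D X" by (simp add: N Qof_def)
    show "l0_approx_solution \<alpha> (cdim (nf X) g ^ t - 1) (inst_mat D t X) U V" using sol by (simp add: ncols_def)
    show "(inst_mat D t X :: 'q mat) = mat (Rf TYPE('q) D X ^ t) (cdim (nf X) g ^ t)
      (\<lambda>(i, j). tens (Rf TYPE('q) D X) (cdim (nf X) g) (gapmat (nf X) g (cl X) (vl X) (Nf TYPE('q) D X) (code_mat D ?a)) t i j)"
      by (simp add: inst_mat_def Tf_def Gf_def nrows_def ncols_def)
  qed (rule w1 w2 Rf_def | assumption)+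
qed

text \<open>The approximation problem admits only matrices with at least as many rows as
  columns.\<close>

lemma cols_rows: "ncols t X \<le> nrows TYPE('q::{finite,field}) D t X"
proof -
  have "0 < Nf TYPE('q) D X" by (simp add: Nf_def code_rows_def Qof_def)
  moreover have "cdim (nf X) g \<le> Suc (ncon (nf X) g (mf X))"
    using le_square[of "cdim (nf X) g"] unfolding ncon_def by linarith
  ultimately have "cdim (nf X) g * 1 \<le> Rf TYPE('q) D X" unfolding Rf_def by (intro mult_le_mono) auto
  then show ?thesis unfolding ncols_def nrows_def by (intro power_mono) auto
qed

text \<open>The target rank is the number of columns minus one and has to be positive.\<close>

lemma cols_ge2: "0 < t \<Longrightarrow> 2 \<le> ncols t X"
proof -
  assume t: "0 < t"
  have "2 \<le> base (nf X) g" using n_pos[of X] g_pos by (simp add: base_def)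
  then have "2 * 1 \<le> base (nf X) g * (base (nf X) g * (base (nf X) g * base (nf X) g))" by (intro mult_le_mono) auto
  then have "2 \<le> cdim (nf X) g" by (simp add: cdim_def mult.assoc)
  also have "\<dots> \<le> cdim (nf X) g ^ t" using t \<open>2 \<le> cdim (nf X) g\<close> by (intro self_le_power) auto
  finally show ?thesis by (simp add: ncols_def)
qed

end

section \<open>From an approximation algorithm to a decision procedure\<close>

lemma concat_blocks:
  assumes "\<And>i. i < n \<Longrightarrow> length (f i) = L"
  shows "length (concat (map f [0..<n])) = n * L"
    "\<And>i j. i < n \<Longrightarrow> j < L \<Longrightarrow> concat (map f [0..<n]) ! (i * L + j) = f i ! j"
proof -
  have "length (concat (map f [0..<n])) = n * L \<and>
    (\<forall>i j. i < n \<longrightarrow> j < L \<longrightarrow> concat (map f [0..<n]) ! (i * L + j) = f i ! j)"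
    using assms
  proof (induction n)
    case (Suc n)
    then have IH: "length (concat (map f [0..<n])) = n * L"
      "\<And>i j. i < n \<Longrightarrow> j < L \<Longrightarrow> concat (map f [0..<n]) ! (i * L + j) = f i ! j" by auto
    have "concat (map f [0..<Suc n]) ! (i * L + j) = f i ! j" if "i < Suc n" "j < L" for i j
    proof (cases "i = n")
      case True
      then show ?thesis by (simp add: nth_append IH(1))
    next
      case False
      then have "i < n" using that by simp
      then show ?thesis using idx_less_mult[of i n j L] that by (simp add: nth_append IH)
    qed
    then show ?case using IH(1) Suc.prems[of n] by simp
  qed simp
  then show "length (concat (map f [0..<n])) = n * L"
    "\<And>i j. i < n \<Longrightarrow> j < L \<Longrightarrow> concat (map f [0..<n]) ! (i * L + j) = f i ! j" by auto
qed

lemma length_mat_word: "length (mat_word A) = dim_row A * (dim_col A + 1)"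
  unfolding mat_word_def by (rule concat_blocks(1)) simp

lemma nth_mat_word:
  assumes "i < dim_row A" "j < dim_col A + 1"
  shows "mat_word A ! (i * (dim_col A + 1) + j) = (if j < dim_col A then Some (A $$ (i, j)) else None)"
  unfolding mat_word_def
  by (subst concat_blocks(2)[where L = "dim_col A + 1"]) (use assms in \<open>auto simp: nth_append\<close>)

lemma nth_mat_word':
  assumes "p < length (mat_word A)"
  shows "mat_word A ! p = (if p mod (dim_col A + 1) < dim_col A
    then Some (A $$ (p div (dim_col A + 1), p mod (dim_col A + 1))) else None)"
proof -
  have "p div (dim_col A + 1) < dim_row A"
    using assms unfolding length_mat_word by (rule less_mult_imp_div_less)
  from nth_mat_word[OF this, of "p mod (dim_col A + 1)"] show ?thesis
    unfolding div_mult_mod_eq by simp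
qed

lemma l0_norm_sum:
  "A \<in> carrier_mat n d \<Longrightarrow> l0_norm A = (\<Sum>i<n. \<Sum>j<d. of_bool (A $$ (i, j) \<noteq> 0))"
proof -
  assume A: "A \<in> carrier_mat n d"
  have "(\<Sum>i<n. \<Sum>j<d. of_bool (A $$ (i, j) \<noteq> 0)) = (\<Sum>x\<in>{..<n} \<times> {..<d}. of_bool (A $$ x \<noteq> 0) :: nat)"
    by (simp only: sum.cartesian_product) (intro sum.cong, auto)
  also have "\<dots> = card (({..<n} \<times> {..<d}) \<inter> {x. A $$ x \<noteq> 0})"
    by (subst sum_of_bool_eq) auto
  also have "({..<n} \<times> {..<d}) \<inter> {x. A $$ x \<noteq> 0} = {(i, j). i < dim_row A \<and> j < dim_col A \<and> A $$ (i, j) \<noteq> 0}"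
    using A by auto
  finally show ?thesis by (simp add: l0_norm_def)
qed

section \<open>Reading the factors off the output tape\<close>

definition rdq :: "(nat \<Rightarrow> nat) \<Rightarrow> nat \<Rightarrow> 'q::{finite,field}" where
  "rdq y p = (\<Sum>a\<in>UNIV. if y p = code (Sym (Some a)) then a else 0)"

lemma rdq_code: "y p = code (Sym (Some a)) \<Longrightarrow> rdq y p = (a :: 'q::{finite,field})"
proof -
  assume y: "y p = code (Sym (Some a))"
  have "rdq y p = (\<Sum>b\<in>UNIV. of_bool (a = b) * b)"
    unfolding rdq_def y by (intro sum.cong refl) (auto simp del: code.simps)
  then show ?thesis by (simp only: sum_value finite_UNIV UNIV_I finite)
qed

lemma pcq_rdq: "pc p \<Longrightarrow> pcq (\<lambda>X y e. rdq y (p X y e) :: 'q::{finite,field})"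
  unfolding rdq_def by (intro pcq_finsum pcq_if pcq_const pcb_word1) auto

lemma pc_fcode:
  assumes "pcq f"
  shows "pc (\<lambda>X y e. code (Sym (Some (f X y e :: 'q::finite))))"
proof -
  have "pc (\<lambda>X y e. if idx (f X y e) < CARD('q) then code (Sym (Some (fe (idx (f X y e)) :: 'q))) else 0)"
    by (rule pc_fin[where f = "\<lambda>n X y e. code (Sym (Some (fe n :: 'q)))", OF assms[unfolded pcq_def] pc_const])
  then show ?thesis by (simp add: idx_less del: code.simps)
qed

lemma exists_amplification:
  fixes \<alpha> :: real
  shows "\<exists>t. \<alpha> * real (2 * CARD('q::finite)) ^ t < real (2 * CARD('q) + 1) ^ t"
proof -
  let ?q = "real CARD('q)"
  have q0: "0 < ?q" by simp
  obtain t where "\<alpha> < (1 + 1 / (2 * ?q)) ^ t" using real_arch_pow[of "1 + 1 / (2 * ?q)" \<alpha>] q0 by auto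
  also have "(1 + 1 / (2 * ?q)) = real (2 * CARD('q) + 1) / real (2 * CARD('q))" using q0 by (simp add: field_simps)
  finally have "\<alpha> * real (2 * CARD('q)) ^ t < real (2 * CARD('q) + 1) ^ t"
    using q0 by (simp add: power_divide field_simps)
  then show ?thesis ..
qed

context csp_family
begin

lemma pc_word_inst:
  "pc_word (\<lambda>x :: 'a::finite list. instance_word (ncols t (inp_of x) - 1) (inst_mat D t (inp_of x) :: 'q::{finite,field} mat))"
  unfolding pc_word_def
proof (intro exI conjI allI impI)
  let ?L = "\<lambda>(X :: inp) (y :: nat \<Rightarrow> nat) (e :: env). (ncols t X - 1) + nrows TYPE('q) D t X * (ncols t X + 1)"
  let ?p = "\<lambda>(X :: inp) (e :: env). e 0 - (ncols t X - 1)"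
  let ?sy = "\<lambda>(X :: inp) (y :: nat \<Rightarrow> nat) (e :: env). if e 0 < ncols t X - 1 then code (Sym (None :: 'q option))
     else if ?p X e mod (ncols t X + 1) < ncols t X
       then code (Sym (Some (Tf D t X (?p X e div (ncols t X + 1)) (?p X e mod (ncols t X + 1)) :: 'q)))
     else code (Sym (None :: 'q option))"
  show "pc ?L" by (intro pc_intros pc_cols pc_rows)
  show "pc ?sy" by (intro pc_intros pc_cols pc_fcode pcq_Tf)
  fix x :: "'a list"
  let ?X = "inp_of x"
  let ?M = "inst_mat D t ?X :: 'q mat"
  have d: "dim_row ?M = nrows TYPE('q) D t ?X" "dim_col ?M = ncols t ?X" by (simp_all add: inst_mat_def)
  have len: "length (instance_word (ncols t ?X - 1) ?M) = (ncols t ?X - 1) + nrows TYPE('q) D t ?X * (ncols t ?X + 1)"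
    by (simp add: instance_word_def length_mat_word d)
  show "?L ?X (\<lambda>_. 0) (\<lambda>_. 0) = length (instance_word (ncols t ?X - 1) ?M)" unfolding len ..
  fix i assume i: "i < length (instance_word (ncols t ?X - 1) ?M)"
  show "?sy ?X (\<lambda>_. 0) (\<lambda>_. i) = code (Sym (instance_word (ncols t ?X - 1) ?M ! i))"
  proof (cases "i < ncols t ?X - 1")
    case True
    then show ?thesis by (simp add: instance_word_def nth_append del: code.simps)
  next
    case False
    define p where "p = i - (ncols t ?X - 1)"
    have p: "p < length (mat_word ?M)" using False i unfolding len p_def length_mat_word d by simp
    have "p div (ncols t ?X + 1) < nrows TYPE('q) D t ?X"
      using p unfolding length_mat_word d by (rule less_mult_imp_div_less)
    then have "mat_word ?M ! p = (if p mod (ncols t ?X + 1) < ncols t ?X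
        then Some (Tf D t ?X (p div (ncols t ?X + 1)) (p mod (ncols t ?X + 1))) else None)"
      using nth_mat_word'[OF p] unfolding d by (cases "p mod (ncols t ?X + 1) < ncols t ?X") (simp_all add: inst_mat_def)
    moreover have "instance_word (ncols t ?X - 1) ?M ! i = mat_word ?M ! p"
      using False by (simp add: instance_word_def nth_append p_def)
    ultimately show ?thesis using False unfolding p_def[symmetric]
      by (cases "p mod (ncols t ?X + 1) < ncols t ?X") (simp_all only: if_True if_False)
  qed
qed

text \<open>The norm of the error, computed from the output word. With d columns, a row of
  \<open>U\<close> occupies d - 1 entries and a terminator, so its rows have length d; those of
  \<open>V\<close> have length d + 1 and start after the n * d symbols of \<open>U\<close>.\<close>

definition nrm :: "'q::{finite,field} itself \<Rightarrow> nat \<Rightarrow> nat \<Rightarrow> inp \<Rightarrow> (nat \<Rightarrow> nat) \<Rightarrow> nat" where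
  "nrm _ D t X y = (\<Sum>i<nrows TYPE('q) D t X. \<Sum>j<ncols t X. of_bool (\<not> (Tf D t X i j :: 'q) =
     (\<Sum>l<ncols t X - 1. rdq y (i * ncols t X + l) * rdq y (nrows TYPE('q) D t X * ncols t X + (l * (ncols t X + 1) + j)))))"

definition reject :: "'q::{finite,field} itself \<Rightarrow> nat \<Rightarrow> nat \<Rightarrow> inp \<Rightarrow> (nat \<Rightarrow> nat) \<Rightarrow> bool" where
  "reject _ D t X y \<longleftrightarrow> \<not> (2 * CARD('q) ^ 3) ^ t * nrm TYPE('q) D t X y < ((2 * CARD('q) + 1) * ((CARD('q) - 1) * Nf TYPE('q) D X)\<^sup>2) ^ t"

lemma pcb_reject: "pcb (\<lambda>X y e. reject TYPE('q::{finite,field}) D t X y)"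
  unfolding reject_def nrm_def
  by (intro pc_intros pcb_qeq pcq_Tf pcq_sum pcq_mult pcq_rdq pc_rows pc_cols pc_Nf)

lemma nrm_eq:
  fixes U V :: "'q::{finite,field} mat"
  assumes U: "U \<in> carrier_mat (nrows TYPE('q) D t X) (ncols t X - 1)" and V: "V \<in> carrier_mat (ncols t X - 1) (ncols t X)"
    and c: "0 < ncols t X"
    and y: "\<And>i. i < length (mat_word U @ mat_word V) \<Longrightarrow> y i = code (Sym ((mat_word U @ mat_word V) ! i))"
  shows "nrm TYPE('q) D t X y = l0_norm (inst_mat D t X - U * V)"
proof -
  let ?n = "nrows TYPE('q) D t X" and ?d = "ncols t X"
  have c1: "?d - 1 + 1 = ?d" using c by simp
  have lU: "length (mat_word U) = ?n * ?d" using U c1 by (simp add: length_mat_word)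
  have lV: "length (mat_word V) = (?d - 1) * (?d + 1)" using V by (simp add: length_mat_word)
  have rU: "rdq y (i * ?d + l) = U $$ (i, l)" if "i < ?n" "l < ?d - 1" for i l
  proof (rule rdq_code)
    have lt: "i * ?d + l < ?n * ?d" by (rule idx_less_mult) (use that in auto)
    have "(mat_word U @ mat_word V) ! (i * ?d + l) = Some (U $$ (i, l))"
      using nth_mat_word[of i U l] that U lt lU c1 by (simp add: nth_append)
    then show "y (i * ?d + l) = code (Sym (Some (U $$ (i, l))))" using y[of "i * ?d + l"] lt lU by (simp del: code.simps)
  qed
  have rV: "rdq y (?n * ?d + (l * (?d + 1) + j)) = V $$ (l, j)" if "l < ?d - 1" "j < ?d" for l j
  proof (rule rdq_code)
    have lt: "l * (?d + 1) + j < (?d - 1) * (?d + 1)" by (rule idx_less_mult) (use that in auto)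
    have "(mat_word U @ mat_word V) ! (?n * ?d + (l * (?d + 1) + j)) = Some (V $$ (l, j))"
      using nth_mat_word[of l V j] that V lU by (simp add: nth_append)
    then show "y (?n * ?d + (l * (?d + 1) + j)) = code (Sym (Some (V $$ (l, j))))"
      using y[of "?n * ?d + (l * (?d + 1) + j)"] lt lU lV by (simp del: code.simps)
  qed
  have car: "inst_mat D t X - U * V \<in> carrier_mat ?n ?d" using U V by (auto simp: inst_mat_def)
  show ?thesis unfolding nrm_def l0_norm_sum[OF car]
  proof (intro sum.cong refl)
    fix i j assume i: "i \<in> {..<?n}" and j: "j \<in> {..<?d}"
    have "(\<Sum>l<?d - 1. rdq y (i * ?d + l) * rdq y (?n * ?d + (l * (?d + 1) + j))) = (\<Sum>l<?d - 1. U $$ (i, l) * V $$ (l, j))"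
      using i j by (intro sum.cong refl) (simp add: rU rV[simplified])
    moreover have "(inst_mat D t X - U * V) $$ (i, j) = Tf D t X i j - (\<Sum>l<?d - 1. U $$ (i, l) * V $$ (l, j))"
      using i j U V by (simp add: inst_mat_def scalar_prod_def atLeast0LessThan)
    ultimately show "of_bool (\<not> (Tf D t X i j :: 'q) =
        (\<Sum>l<?d - 1. rdq y (i * ?d + l) * rdq y (?n * ?d + (l * (?d + 1) + j)))) =
        of_bool ((inst_mat D t X - U * V) $$ (i, j) \<noteq> 0)" by simp
  qed
qed

text \<open>The time bound \<open>T\<close> is left abstract, so that both conclusions follow from
  this statement. \<tau>' is the running time of \<open>M\<close> on the constructed matrix, which
  has n rows. \<open>D\<close> is chosen with 4 (q + 1) * 23^D at most 24^D, which is the balance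
  required by the gap.\<close>

theorem reduce_csp:
  fixes M :: "'q::{finite,field} option tm"
  assumes M: "l0_approx_in_time \<alpha> M T" and \<alpha>: "1 < \<alpha>"
    and t: "\<alpha> * real (2 * CARD('q)) ^ t < real (2 * CARD('q) + 1) ^ t"
  shows "\<exists>(M' :: 'a::finite tm) C. wf_tm M' \<and>
    (\<forall>x. csp_wf (nf (inp_of x)) g (mf (inp_of x)) (cl (inp_of x)) (vl (inp_of x)) \<longrightarrow>
      (\<exists>n \<tau> \<tau>'. n \<le> (length x + 2) ^ C \<and> real \<tau>' \<le> T n (ncols t (inp_of x) - 1) \<and> \<tau> \<le> (length x + 2) ^ C + 3 * \<tau>' \<and>
        decides_within M' x \<tau> (csp_sat (nf (inp_of x)) g (mf (inp_of x)) (cl (inp_of x)) (vl (inp_of x)))))"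
proof -
  have t0: "0 < t" using t \<alpha> by (cases t) auto
  obtain D where "real (4 * (CARD('q) + 1)) < (24 / 23) ^ D" using real_arch_pow[of "24 / 23 :: real"] by auto
  then have "real (4 * (CARD('q) + 1)) * 23 ^ D < 24 ^ D" by (simp add: power_divide field_simps)
  then have "real (4 * (CARD('q) + 1) * 23 ^ D) < real (24 ^ D)" by simp
  then have D: "4 * (CARD('q) + 1) * 23 ^ D \<le> 24 ^ D" by (simp only: of_nat_less_iff less_imp_le)
  define z where "z = (\<lambda>x :: 'a list. instance_word (ncols t (inp_of x) - 1) (inst_mat D t (inp_of x) :: 'q mat))"
  have zw: "pc_word z" unfolding z_def by (rule pc_word_inst)
  have wfM: "wf_tm M" using M unfolding l0_approx_in_time_def by blast
  obtain M' :: "'a tm" and C where M': "wf_tm M'" "\<And>x \<tau>. halted M (run M (z x) \<tau>) \<Longrightarrow>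
     decides_within M' x ((length x + 2) ^ C + 3 * \<tau>)
       (of_bool (reject TYPE('q) D t (inp_of x) (\<lambda>i. code (fst (last (snd (run M (z x) \<tau>))) (int i)))) = (0 :: nat))"
    using reduce_search[OF wfM zw pc_of_bool[OF pcb_reject[where ?'q = 'q and D = D and t = t]]] by blast
  obtain C' where C': "\<And>S X y e. bnd S X e \<Longrightarrow> nrows TYPE('q) D t X \<le> S ^ C'"
    using pbE[OF pc_pb[OF pc_rows[where ?'q = 'q]]] by metis
  have "\<exists>n \<tau> \<tau>'. n \<le> (length x + 2) ^ (C + C') \<and> real \<tau>' \<le> T n (ncols t (inp_of x) - 1) \<and>
      \<tau> \<le> (length x + 2) ^ (C + C') + 3 * \<tau>' \<and>
      decides_within M' x \<tau> (csp_sat (nf (inp_of x)) g (mf (inp_of x)) (cl (inp_of x)) (vl (inp_of x)))"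
    if wf: "csp_wf (nf (inp_of x)) g (mf (inp_of x)) (cl (inp_of x)) (vl (inp_of x))" for x :: "'a list"
  proof -
    let ?X = "inp_of x"
    let ?n = "nrows TYPE('q) D t ?X" and ?d = "ncols t ?X"
    let ?A = "inst_mat D t ?X :: 'q mat"
    have d2: "2 \<le> ?d" by (rule cols_ge2[OF t0])
    have A: "?A \<in> carrier_mat ?n ?d" by (simp add: inst_mat_def)
    have cr: "?d \<le> ?n" by (rule cols_rows)
    have k: "1 \<le> ?d - 1" "?d - 1 \<le> ?d" using d2 by auto
    obtain \<tau> U V where \<tau>: "real \<tau> \<le> T ?n (?d - 1)" and out: "outputs_within M (z x) \<tau> (mat_word U @ mat_word V)"
      and sol: "l0_approx_solution \<alpha> (?d - 1) ?A U V"
      using M A cr k unfolding l0_approx_in_time_def z_def by blast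
    define y where "y = (\<lambda>i. code (fst (last (snd (run M (z x) \<tau>))) (int i)))"
    have h: "halted M (run M (z x) \<tau>)" using out unfolding outputs_within_def by blast
    have y: "y i = code (Sym ((mat_word U @ mat_word V) ! i))" if "i < length (mat_word U @ mat_word V)" for i
      using out that unfolding outputs_within_def Let_def y_def by metis
    have UV: "U \<in> carrier_mat ?n (?d - 1)" "V \<in> carrier_mat (?d - 1) ?d"
      using sol A unfolding l0_approx_solution_def by auto
    have "nrm TYPE('q) D t ?X y = l0_norm (?A - U * V)"
      by (rule nrm_eq[OF UV]) (use d2 y in auto)
    then have "csp_sat (nf ?X) g (mf ?X) (cl ?X) (vl ?X) = (\<not> reject TYPE('q) D t ?X y)"
      using inst_decides[OF wf D _ t sol] \<alpha> unfolding reject_def by simp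
    then have "decides_within M' x ((length x + 2) ^ C + 3 * \<tau>) (csp_sat (nf ?X) g (mf ?X) (cl ?X) (vl ?X))"
      using M'(2)[OF h] unfolding y_def by simp
    moreover have "?n \<le> (length x + 2) ^ C'"
      by (rule C'[of _ _ "\<lambda>_. 0"]) (simp add: bnd_def inp_of_def)
    then have "?n \<le> (length x + 2) ^ (C + C')"
      by (rule order_trans) (simp add: power_increasing)
    moreover have "(length x + 2) ^ C \<le> (length x + 2) ^ (C + C')" by (rule power_increasing) auto
    ultimately show ?thesis using \<tau> by (metis add_le_mono1)
  qed
  then show ?thesis using M'(1) by blast
qed

end

section \<open>Tableaux\<close>

text \<open>A tile describes one position at one time: the state, the symbols read on all tapes (both are the same for all
  positions), which heads are here, and which symbols are here.\<close>

type_synonym tile = "nat \<times> nat list \<times> bool list \<times> nat list"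

locale tableau =
  fixes F :: frag and K A fl :: nat
  assumes F: "fok K A F" and fl: "fl < K" and A: "2 \<le> A"
begin

definition rsf :: "nat list \<Rightarrow> nat \<Rightarrow> nat" where
  "rsf rs i = (if i < K then rs ! i else 0)"

text \<open>The exit state idles, so a tableau of fixed height also describes a computation that
  ends earlier.\<close>

definition nxt :: "nat \<Rightarrow> nat list \<Rightarrow> nat \<times> acts" where
  "nxt q rs = (if q < fst F then snd F q (rsf rs) else (q, \<lambda>i. (rsf rs i, Stay)))"

definition tile :: "nat \<times> ntapes \<Rightarrow> int \<Rightarrow> tile" where
  "tile c p = (fst c, map (rd (snd c)) [0..<K], map (\<lambda>i. snd (snd c i) = p) [0..<K], map (\<lambda>i. fst (snd c i) p) [0..<K])"

definition tiles :: "tile set" where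
  "tiles = {..fst F} \<times> {rs. set rs \<subseteq> {..<A} \<and> length rs = K} \<times> {hs. set hs \<subseteq> UNIV \<and> length hs = K} \<times> {ss. set ss \<subseteq> {..<A} \<and> length ss = K}"

lemma finite_tiles: "finite tiles"
  unfolding tiles_def by (intro finite_cartesian_product finite_lists_length_eq) auto

definition okc :: "nat \<times> ntapes \<Rightarrow> bool" where
  "okc c \<longleftrightarrow> fst c \<le> fst F \<and> (\<forall>i\<ge>K. snd c i = blank) \<and> (\<forall>i p. fst (snd c i) p < A)"

lemma tile_in: "okc c \<Longrightarrow> tile c p \<in> tiles"
  unfolding okc_def tile_def tiles_def rd_def by auto

lemma fstep_nxt:
  assumes "okc c"
  shows "fstep F c = (fst (nxt (fst c) (map (rd (snd c)) [0..<K])), apply_acts (snd (nxt (fst c) (map (rd (snd c)) [0..<K]))) (snd c))"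
proof -
  have r: "rsf (map (rd (snd c)) [0..<K]) = rd (snd c)"
  proof
    fix i show "rsf (map (rd (snd c)) [0..<K]) i = rd (snd c) i"
      using assms by (cases "i < K") (auto simp: rsf_def okc_def rd_def blank_def)
  qed
  have "apply_acts (\<lambda>i. (rd (snd c) i, Stay)) (snd c) = snd c" by (simp add: apply_acts_def)
  then show ?thesis by (simp add: fstep_def nxt_def r prod_eq_iff)
qed

lemma okc_step:
  assumes "okc c"
  shows "okc (fstep F c)"
proof (cases "fst c < fst F")
  case True
  have rd: "rd (snd c) i < A" for i using assms by (auto simp: okc_def rd_def)
  have *: "fst (snd F (fst c) (rd (snd c))) \<le> fst F" "\<And>i. K \<le> i \<Longrightarrow> snd (snd F (fst c) (rd (snd c))) i = (rd (snd c) i, Stay)"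
    "\<And>i. fst (snd (snd F (fst c) (rd (snd c))) i) < A"
    using F True rd unfolding fok_def by blast+
  have f: "fstep F c = (fst (snd F (fst c) (rd (snd c))), apply_acts (snd (snd F (fst c) (rd (snd c)))) (snd c))"
    using True by (simp add: fstep_def)
  show ?thesis unfolding okc_def f fst_conv snd_conv
  proof (intro conjI allI impI)
    show "apply_acts (snd (snd F (fst c) (rd (snd c)))) (snd c) i = blank" if "K \<le> i" for i
    proof -
      have "apply_acts (snd (snd F (fst c) (rd (snd c)))) (snd c) i = snd c i"
        unfolding apply_acts_def *(2)[OF that] by (rule nact_stay)
      then show ?thesis using assms that by (simp add: okc_def)
    qed
    show "fst (apply_acts (snd (snd F (fst c) (rd (snd c)))) (snd c) i) p < A" for i p
      using *(3)[of i] assms by (simp add: apply_acts_def nact_def okc_def)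
  qed (rule *(1))
next
  case False
  then show ?thesis using assms by (simp add: fstep_def)
qed

lemma head_step: "\<bar>snd (snd (fstep F c) i)\<bar> \<le> \<bar>snd (snd c i)\<bar> + 1"
  by (auto simp: fstep_def apply_acts_def nact_def offset_def split: move.split)

text \<open>Tiles \<open>a\<close>, \<open>b\<close>, \<open>c\<close> are adjacent, and \<open>d\<close> succeeds \<open>b\<close>. Only horizontal agreement forces the guessed read
  symbols to be right.\<close>

definition window :: "tile \<Rightarrow> tile \<Rightarrow> tile \<Rightarrow> tile \<Rightarrow> bool" where
  "window a b c d = (case (a, b, c, d) of ((qa, ra, ha, sa), (qb, rb, hb, sb), (qc, rc, hc, sc), (qd, r4, h4, sd)) \<Rightarrow>
     qa = qb \<and> ra = rb \<and> qc = qb \<and> rc = rb \<and> qd = fst (nxt qb rb) \<and>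
     (\<forall>i<K. (ha ! i \<longrightarrow> sa ! i = ra ! i) \<and> (hb ! i \<longrightarrow> sb ! i = rb ! i) \<and> (hc ! i \<longrightarrow> sc ! i = rc ! i) \<and>
       sd ! i = (if hb ! i then fst (snd (nxt qb rb) i) else sb ! i) \<and>
       h4 ! i = (case snd (snd (nxt qb rb) i) of Stay \<Rightarrow> hb ! i | Rightwards \<Rightarrow> ha ! i | Leftwards \<Rightarrow> hc ! i)))"

definition noheads :: "tile \<Rightarrow> bool" where
  "noheads a \<longleftrightarrow> (\<forall>i<K. \<not> fst (snd (snd a)) ! i)"

definition accept :: "tile \<Rightarrow> bool" where
  "accept a \<longleftrightarrow> fst a = fst F \<and> (fst (snd (snd a)) ! fl \<longrightarrow> snd (snd (snd a)) ! fl = 1)"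

text \<open>The regions of the initial tape 0: 0 stands for blank, 1 and 2 for the input symbols, 3 for the separator, and 4 for
  the witness, which extends up to its first blank.\<close>

definition region_ok :: "nat \<Rightarrow> nat \<Rightarrow> bool" where
  "region_ok r s = (if r = 1 then s = code (Sym (Some True)) else if r = 2 then s = code (Sym (Some False))
     else if r = 3 then s = code (Sym (None :: bool option))
     else if r = 4 then s = 0 \<or> s = code (Sym (Some True)) \<or> s = code (Sym (Some False)) else s = 0)"

definition initial :: "nat \<Rightarrow> bool \<Rightarrow> tile \<Rightarrow> tile \<Rightarrow> bool" where
  "initial r h b c \<longleftrightarrow> fst b = 0 \<and> (\<forall>i<K. fst (snd (snd b)) ! i = h) \<and> region_ok r (snd (snd (snd b)) ! 0) \<and>
     (\<forall>i<K. 0 < i \<longrightarrow> snd (snd (snd b)) ! i = 0) \<and>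
     (r = 4 \<longrightarrow> snd (snd (snd b)) ! 0 = 0 \<longrightarrow> snd (snd (snd c)) ! 0 = 0)"

text \<open>\<open>z\<close> and \<open>f\<close> mark the first and the last time step,
  \<open>e\<close> and \<open>e'\<close> the left and the right edge; \<open>r\<close> is the region
  of the tile \<open>b\<close> on the initial tape and \<open>h\<close> says whether the heads start
  there.\<close>

definition good :: "bool \<Rightarrow> bool \<Rightarrow> bool \<Rightarrow> bool \<Rightarrow> nat \<Rightarrow> bool \<Rightarrow> tile \<Rightarrow> tile \<Rightarrow> tile \<Rightarrow> tile \<Rightarrow> bool" where
  "good z e e' f r h a b c d \<longleftrightarrow> window a b c d \<and> (e \<longrightarrow> noheads a) \<and> (e' \<longrightarrow> noheads c) \<and>
     (f \<longrightarrow> accept d) \<and> (z \<longrightarrow> initial r h b c)"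

lemma window_tile:
  assumes "okc c"
  shows "window (tile c (p - 1)) (tile c p) (tile c (p + 1)) (tile (fstep F c) p)"
  unfolding window_def tile_def fstep_nxt[OF assms]
  by (auto simp: apply_acts_def nact_def rd_def offset_def split: move.split)

text \<open>\<open>sees c a p\<close>: the tile \<open>a\<close> agrees with configuration \<open>c\<close> at position \<open>p\<close>, except perhaps for the read symbols.\<close>

definition sees :: "nat \<times> ntapes \<Rightarrow> tile \<Rightarrow> int \<Rightarrow> bool" where
  "sees c a p \<longleftrightarrow> fst a = fst c \<and> (\<forall>i<K. fst (snd (snd a)) ! i = (snd (snd c i) = p) \<and> snd (snd (snd a)) ! i = fst (snd c i) p)"

lemma window_sees:
  assumes ok: "okc c" and w: "window a b e d" and b: "sees c b p" and r: "fst (snd b) = map (rd (snd c)) [0..<K]"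
    and a: "\<And>i. i < K \<Longrightarrow> fst (snd (snd a)) ! i = (snd (snd c i) = p - 1)"
    and e: "\<And>i. i < K \<Longrightarrow> fst (snd (snd e)) ! i = (snd (snd c i) = p + 1)"
  shows "sees (fstep F c) d p"
proof -
  obtain qa ra ha sa qb rb hb sb qc rc hc sc qd r4 h4 sd where
    t: "a = (qa, ra, ha, sa)" "b = (qb, rb, hb, sb)" "e = (qc, rc, hc, sc)" "d = (qd, r4, h4, sd)"
    by (metis prod.exhaust)
  have rb: "rb = map (rd (snd c)) [0..<K]" "qb = fst c" using r b by (simp_all add: t sees_def)
  show ?thesis
    using w b a e unfolding sees_def fstep_nxt[OF ok] t window_def rb
    by (auto simp: apply_acts_def nact_def offset_def split: move.split)
qed

text \<open>Columns 0 to 2B + 2 stand for the positions -B - 1 to B + 1. In B steps no head can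
  leave the range from -B to B, so the outermost columns are free of heads.\<close>

definition pos :: "nat \<Rightarrow> nat \<Rightarrow> int" where
  "pos B p = int p - int (Suc B)"

definition fits :: "nat \<Rightarrow> (nat \<Rightarrow> nat) \<Rightarrow> (nat \<Rightarrow> nat \<Rightarrow> tile) \<Rightarrow> bool" where
  "fits B r \<gamma> \<longleftrightarrow> (\<forall>t<B. \<forall>p<2 * B + 1. good (t = 0) (p = 0) (p = 2 * B) (Suc t = B) (r (Suc p)) (p = B)
     (\<gamma> t p) (\<gamma> t (Suc p)) (\<gamma> t (Suc (Suc p))) (\<gamma> (Suc t) (Suc p)))"

lemma run_ok:
  assumes "okc c0" "\<And>i. snd (snd c0 i) = 0"
  shows "okc ((fstep F ^^ t) c0)" "\<bar>snd (snd ((fstep F ^^ t) c0) i)\<bar> \<le> int t"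
proof -
  have "okc ((fstep F ^^ t) c0) \<and> \<bar>snd (snd ((fstep F ^^ t) c0) i)\<bar> \<le> int t"
  proof (induction t)
    case 0
    then show ?case using assms by simp
  next
    case (Suc t)
    then show ?case using okc_step[of "(fstep F ^^ t) c0"] head_step[of "(fstep F ^^ t) c0" i] by auto
  qed
  then show "okc ((fstep F ^^ t) c0)" "\<bar>snd (snd ((fstep F ^^ t) c0) i)\<bar> \<le> int t" by auto
qed

lemma fits_complete:
  fixes c0 :: "nat \<times> ntapes"
  assumes c0: "okc c0" "\<And>i. snd (snd c0 i) = 0" "fst c0 = 0"
    and init: "\<And>i p. 0 < i \<Longrightarrow> fst (snd c0 i) p = 0"
    and reg: "\<And>p. p \<le> 2 * B \<Longrightarrow> region_ok (r (Suc p)) (fst (snd c0 0) (pos B (Suc p)))"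
    and mono: "\<And>p. p \<le> 2 * B \<Longrightarrow> r (Suc p) = 4 \<Longrightarrow> fst (snd c0 0) (pos B (Suc p)) = 0 \<Longrightarrow> fst (snd c0 0) (pos B (Suc (Suc p))) = 0"
    and acc: "(fstep F ^^ B) c0 = (fst F, T)" "rd T fl = 1"
  shows "fits B r (\<lambda>t p. tile ((fstep F ^^ t) c0) (pos B p))"
  unfolding fits_def
proof (intro allI impI)
  fix t p assume t: "t < B" and p: "p < 2 * B + 1"
  define c where "c = (fstep F ^^ t) c0"
  have ok: "okc c" and hd: "\<bar>snd (snd c i)\<bar> \<le> int t" for i using run_ok[OF c0(1,2)] by (auto simp: c_def)
  have ps: "pos B p = pos B (Suc p) - 1" "pos B (Suc (Suc p)) = pos B (Suc p) + 1" by (simp_all add: pos_def)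
  have st: "(fstep F ^^ Suc t) c0 = fstep F c" by (simp add: c_def)
  have K0: "0 < K" using fl by simp
  show "good (t = 0) (p = 0) (p = 2 * B) (Suc t = B) (r (Suc p)) (p = B)
       (tile ((fstep F ^^ t) c0) (pos B p)) (tile ((fstep F ^^ t) c0) (pos B (Suc p)))
       (tile ((fstep F ^^ t) c0) (pos B (Suc (Suc p)))) (tile ((fstep F ^^ Suc t) c0) (pos B (Suc p)))"
    unfolding good_def st c_def[symmetric] ps
  proof (intro conjI impI)
    show "window (tile c (pos B (Suc p) - 1)) (tile c (pos B (Suc p))) (tile c (pos B (Suc p) + 1)) (tile (fstep F c) (pos B (Suc p)))"
      by (rule window_tile[OF ok])
    show "noheads (tile c (pos B (Suc p) - 1))" if p0: "p = 0"
    proof -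
      have "snd (snd c i) \<noteq> pos B (Suc p) - 1" for i using hd[of i] t p0 by (auto simp: pos_def)
      then show ?thesis by (simp add: noheads_def tile_def)
    qed
    show "noheads (tile c (pos B (Suc p) + 1))" if p0: "p = 2 * B"
    proof -
      have "snd (snd c i) \<noteq> pos B (Suc p) + 1" for i using hd[of i] t p0 by (auto simp: pos_def)
      then show ?thesis by (simp add: noheads_def tile_def)
    qed
    show "accept (tile (fstep F c) (pos B (Suc p)))" if "Suc t = B"
    proof -
      have "fstep F c = (fst F, T)" using acc(1) that st by simp
      then show ?thesis using acc(2) fl by (auto simp: accept_def tile_def rd_def)
    qed
    show "initial (r (Suc p)) (p = B) (tile c (pos B (Suc p))) (tile c (pos B (Suc p) + 1))" if t0: "t = 0"
    proof -
      have c: "c = c0" by (simp add: c_def t0)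
      show ?thesis
        using c0 init reg[of p] mono[of p] p K0 ps(2)
        by (auto simp: initial_def tile_def c pos_def algebra_simps)
    qed
  qed
qed

text \<open>By induction on time each row agrees with the configuration. The read symbols in a row
  are guesses, but all its tiles share them and the tile under a head ties that guess to the actual
  symbol; every head lies within the tableau.\<close>

lemma fits_sound:
  fixes c0 :: "nat \<times> ntapes"
  assumes fit: "fits B r \<gamma>" and B: "0 < B"
    and len: "\<And>t p. t \<le> B \<Longrightarrow> p \<le> 2 * B + 2 \<Longrightarrow> length (fst (snd (\<gamma> t p))) = K"
    and c0: "okc c0" "\<And>i. snd (snd c0 i) = 0" "fst c0 = 0"
    and init: "\<And>i p. 0 < i \<Longrightarrow> fst (snd c0 i) p = 0"
    and tape0: "\<And>p. p \<le> 2 * B \<Longrightarrow> snd (snd (snd (\<gamma> 0 (Suc p)))) ! 0 = fst (snd c0 0) (pos B (Suc p))"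
  shows "fst ((fstep F ^^ B) c0) = fst F \<and> rd (snd ((fstep F ^^ B) c0)) fl = 1"
proof -
  define c where "c = (\<lambda>t. (fstep F ^^ t) c0)"
  have ok: "okc (c t)" and hd: "\<bar>snd (snd (c t) i)\<bar> \<le> int t" for t i using run_ok[OF c0(1,2)] by (auto simp: c_def)
  have g: "good (t = 0) (p = 0) (p = 2 * B) (Suc t = B) (r (Suc p)) (p = B)
     (\<gamma> t p) (\<gamma> t (Suc p)) (\<gamma> t (Suc (Suc p))) (\<gamma> (Suc t) (Suc p))" if "t < B" "p \<le> 2 * B" for t p
    using fit that unfolding fits_def by simp
  have K0: "0 < K" using fl by simp
  have *: "\<forall>p\<le>2 * B. sees (c t) (\<gamma> t (Suc p)) (pos B (Suc p))" if "t \<le> B" for t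
    using that
  proof (induction t)
    case 0
    show ?case
    proof (intro allI impI)
      fix p assume p: "p \<le> 2 * B"
      have i: "initial (r (Suc p)) (p = B) (\<gamma> 0 (Suc p)) (\<gamma> 0 (Suc (Suc p)))" using g[OF B p] by (simp add: good_def)
      have "(snd (snd (c 0) i) = pos B (Suc p)) = (p = B)" for i using c0(2) by (auto simp: c_def pos_def)
      then show "sees (c 0) (\<gamma> 0 (Suc p)) (pos B (Suc p))"
      proof -
        have "snd (snd (snd (\<gamma> 0 (Suc p)))) ! i = fst (snd (c 0) i) (pos B (Suc p))" if "i < K" for i
          using i init tape0[OF p] that unfolding initial_def by (cases "i = 0") (auto simp: c_def)
        moreover have "fst (snd (snd (\<gamma> 0 (Suc p)))) ! i = (p = B)" if "i < K" for i
          using i that by (simp add: initial_def)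
        moreover have "fst (\<gamma> 0 (Suc p)) = fst (c 0)" using i c0(3) by (simp add: initial_def c_def)
        ultimately show ?thesis using \<open>\<And>i. (snd (snd (c 0) i) = pos B (Suc p)) = (p = B)\<close> by (simp add: sees_def)
      qed
    qed
  next
    case (Suc t)
    then have t: "t < B" and IH: "\<And>p. p \<le> 2 * B \<Longrightarrow> sees (c t) (\<gamma> t (Suc p)) (pos B (Suc p))" by auto
    have w: "window (\<gamma> t p) (\<gamma> t (Suc p)) (\<gamma> t (Suc (Suc p))) (\<gamma> (Suc t) (Suc p))" if "p \<le> 2 * B" for p
      using g[OF t that] by (simp add: good_def)
    have eq: "fst (snd (\<gamma> t p)) = fst (snd (\<gamma> t 0))" if "p \<le> 2 * B + 2" for p using that
    proof (induction p)
      case (Suc p)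
      show ?case
      proof (cases "p \<le> 2 * B")
        case True
        have "fst (snd (\<gamma> t (Suc p))) = fst (snd (\<gamma> t p))" using w[OF True] by (auto simp: window_def split: prod.splits)
        then show ?thesis using Suc by simp
      next
        case False
        then have p: "p = Suc (2 * B)" using Suc.prems by simp
        have "fst (snd (\<gamma> t (Suc (Suc (2 * B))))) = fst (snd (\<gamma> t (Suc (2 * B))))"
          using w[of "2 * B"] by (auto simp: window_def split: prod.splits)
        then show ?thesis using Suc p by simp
      qed
    qed simp
    \<comment> \<open>The column p' of head \<open>i\<close> confirms component \<open>i\<close> of
      the guess, and \<open>eq\<close> carries this to all columns.\<close>
    have reads: "fst (snd (\<gamma> t p)) = map (rd (snd (c t))) [0..<K]" if p: "p \<le> 2 * B + 2" for p
    proof (rule nth_equalityI)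
      show "length (fst (snd (\<gamma> t p))) = length (map (rd (snd (c t))) [0..<K])" using len[of t p] t p by simp
      fix i assume "i < length (fst (snd (\<gamma> t p)))"
      then have i: "i < K" using len[of t p] t p by simp
      define p' where "p' = nat (snd (snd (c t) i) + int B)"
      have p': "p' \<le> 2 * B" "pos B (Suc p') = snd (snd (c t) i)" using hd[of t i] t by (auto simp: p'_def pos_def)
      have "fst (snd (snd (\<gamma> t (Suc p')))) ! i" "snd (snd (snd (\<gamma> t (Suc p')))) ! i = rd (snd (c t)) i"
        using IH[OF p'(1)] i p'(2) by (auto simp: sees_def rd_def)
      moreover have "fst (snd (snd (\<gamma> t (Suc p')))) ! i \<longrightarrow> snd (snd (snd (\<gamma> t (Suc p')))) ! i = fst (snd (\<gamma> t (Suc p'))) ! i"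
        using w[OF p'(1)] i by (auto simp: window_def split: prod.splits)
      ultimately have "fst (snd (\<gamma> t (Suc p'))) ! i = rd (snd (c t)) i" by simp
      then show "fst (snd (\<gamma> t p)) ! i = map (rd (snd (c t))) [0..<K] ! i"
        using eq[OF p] eq[of "Suc p'"] p' i by simp
    qed
    show ?case
    proof (intro allI impI)
      fix p assume p: "p \<le> 2 * B"
      have "sees (fstep F (c t)) (\<gamma> (Suc t) (Suc p)) (pos B (Suc p))"
      proof (rule window_sees[OF ok w[OF p] IH[OF p] reads])
        fix i assume i: "i < K"
        show "fst (snd (snd (\<gamma> t p))) ! i = (snd (snd (c t) i) = pos B (Suc p) - 1)"
        proof (cases p)
          case 0
          have "noheads (\<gamma> t 0)" using g[OF t, of 0] by (simp add: good_def)
          moreover have "snd (snd (c t) i) \<noteq> pos B (Suc p) - 1" using hd[of t i] t 0 by (auto simp: pos_def)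
          ultimately show ?thesis using i 0 by (simp add: noheads_def)
        next
          case (Suc p')
          then show ?thesis using IH[of p'] p i by (simp add: sees_def pos_def)
        qed
        show "fst (snd (snd (\<gamma> t (Suc (Suc p))))) ! i = (snd (snd (c t) i) = pos B (Suc p) + 1)"
        proof (cases "p = 2 * B")
          case True
          have "noheads (\<gamma> t (Suc (Suc p)))" using g[OF t p] True by (simp add: good_def)
          moreover have "snd (snd (c t) i) \<noteq> pos B (Suc p) + 1" using hd[of t i] t True by (auto simp: pos_def)
          ultimately show ?thesis using i by (simp add: noheads_def)
        next
          case False
          then show ?thesis using IH[of "Suc p"] p i by (simp add: sees_def pos_def algebra_simps)
        qed
      qed (use p in simp)
      then show "sees (c (Suc t)) (\<gamma> (Suc t) (Suc p)) (pos B (Suc p))" by (simp add: c_def)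
    qed
  qed
  define p where "p = nat (snd (snd (c B) fl) + int B)"
  have p: "p \<le> 2 * B" "pos B (Suc p) = snd (snd (c B) fl)" using hd[of B fl] by (auto simp: p_def pos_def)
  have "Suc (B - 1) = B" using B by simp
  \<comment> \<open>\<open>accept\<close> restricts the verdict only where the head of tape
    \<open>fl\<close> stands, so it is used in that column.\<close>
  then have "accept (\<gamma> B (Suc p))" using g[of "B - 1" p] B p(1) by (simp add: good_def)
  then show ?thesis using *[of B] p fl unfolding accept_def sees_def c_def by (auto simp: rd_def)
qed

end

section \<open>NP as constraint satisfaction\<close>

lemma put_init: "wf_tm M \<Longrightarrow> put 0 (snd (init_config M y)) (\<lambda>_. blank) = ini y"
  by (auto simp: put_def init_config_def ini_def wf_tm_def nth_Cons' enc_input fun_eq_iff)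
    (auto simp: wcont_def blank_def)

lemma decides_mono:
  assumes "decides_within M x t b" "t \<le> t'"
  shows "decides_within M x t' b"
proof -
  have h: "halted M (run M x t)" using assms(1) unfolding decides_within_def by simp
  have "run M x (t + k) = run M x t" for k
    by (induction k) (use h in \<open>auto simp: run_def tm_step_def halted_def\<close>)
  from this[of "t' - t"] assms show ?thesis unfolding decides_within_def by simp
qed

lemma fstep_fix: "(fstep F ^^ k) (fst F, T) = (fst F, T)"
  by (induction k) (auto simp: fstep_def)

lemma run_embM:
  assumes M: "wf_tm M" and d: "decides_within M y t b" and t: "t < B"
  shows "\<exists>T. (fstep (embM M 0 (tapes M)) ^^ B) (0, ini y) = (fst (embM M 0 (tapes M)), T) \<and> rd T (tapes M) = of_bool b"
proof -
  let ?F = "embM M 0 (tapes M)"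
  have h: "halted M (run M y t)" and acc: "fst (run M y t) \<in> accepting M \<longleftrightarrow> b" using d unfolding decides_within_def by auto
  define T where "T = put 0 (snd (run M y t)) ((\<lambda>_. blank)(tapes M := ((fst blank)(snd blank := of_bool (fst (run M y t) \<in> accepting M)), snd blank)))"
  have "exec ?F (ini y) (Suc t) T"
    unfolding T_def using exec_embM[OF M h, of 0 "tapes M" "\<lambda>_. blank"] unfolding put_init[OF M] by simp
  then obtain t' where t': "t' \<le> Suc t" "(fstep ?F ^^ t') (0, ini y) = (fst ?F, T)" unfolding exec_def reach_def by blast
  have "(fstep ?F ^^ ((B - t') + t')) (0, ini y) = (fst ?F, T)"
    unfolding funpow_add comp_def t'(2) by (rule fstep_fix)
  moreover have "(B - t') + t' = B" using t' t by simp
  moreover have "length (snd (run M y t)) = tapes M" using okcfg_run[OF M] by (simp add: okcfg_def)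
  then have "rd T (tapes M) = of_bool b" using acc by (simp add: T_def put_def rd_def blank_def)
  ultimately show ?thesis by auto
qed

locale verifier =
  fixes V :: "bool option tm" and Lang :: "bool option list set" and c cw :: nat
  assumes V: "wf_tm V" and dec: "\<And>y. decides_within V y (c * length y ^ c + c) (y \<in> Lang)"
begin

definition "A = Suc (CARD(bool option) + auxs V) + 2"

sublocale tableau "embM V 0 (tapes V)" "Suc (tapes V)" A "tapes V"
  by standard (auto simp: A_def intro!: fok_embM V)

text \<open>\<open>bw\<close> bounds the length of a witness and \<open>ym\<close> that of the
  verifier's input. \<open>B\<close> bounds both the running time and the distance from cell 0, so
  it exceeds the time bound for inputs of length \<open>ym\<close> as well as \<open>ym\<close>
  itself.\<close>

definition "bw l = cw * l ^ cw + cw"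
definition "ym l = l + 1 + bw l"
definition "B l = c * ym l ^ c + c + ym l + 2"

definition region :: "inp \<Rightarrow> nat \<Rightarrow> nat" where
  "region X p = (if p < Suc (B (snd X)) then 0
     else if p - Suc (B (snd X)) < snd X then (if fst X (p - Suc (B (snd X))) = code (Sym True) then 1 else 2)
     else if p - Suc (B (snd X)) = snd X then 3 else if p - Suc (B (snd X)) < ym (snd X) then 4 else 0)"

definition "g = card tiles"

definition tl :: "nat \<Rightarrow> tile" where
  "tl = (SOME h. bij_betw h {0..<g} tiles)"

lemma bij_tl: "bij_betw tl {0..<g} tiles"
  unfolding tl_def g_def by (rule someI_ex[OF ex_bij_betw_nat_finite[OF finite_tiles]])

lemma tl_in: "a < g \<Longrightarrow> tl a \<in> tiles"
  using bij_tl by (auto simp: bij_betw_def)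

lemma g_ge2: "2 \<le> g"
proof -
  let ?K = "Suc (tapes V)"
  have "{(0, replicate ?K 0, replicate ?K True, replicate ?K 0), (0, replicate ?K 0, replicate ?K False, replicate ?K 0)} \<subseteq> tiles"
    unfolding tiles_def by (auto simp: A_def)
  from card_mono[OF finite_tiles this] show ?thesis by (simp add: g_def)
qed

text \<open>A constraint number is composed of a time step, a position and a pattern of four tile
  numbers, as (t * (2B + 1) + p) * g^4 + pattern.\<close>

definition dg :: "nat \<Rightarrow> nat \<Rightarrow> nat" where
  "dg j i = j mod g ^ 4 div g ^ i mod g"

definition tm :: "inp \<Rightarrow> nat \<Rightarrow> nat" where
  "tm X j = j div g ^ 4 div (2 * B (snd X) + 1)"

definition ps :: "inp \<Rightarrow> nat \<Rightarrow> nat" where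
  "ps X j = j div g ^ 4 mod (2 * B (snd X) + 1)"

definition bad :: "inp \<Rightarrow> nat \<Rightarrow> bool" where
  "bad X j \<longleftrightarrow> \<not> good (tm X j = 0) (ps X j = 0) (ps X j = 2 * B (snd X)) (Suc (tm X j) = B (snd X))
     (region X (Suc (ps X j))) (ps X j = B (snd X)) (tl (dg j 0)) (tl (dg j 1)) (tl (dg j 2)) (tl (dg j 3))"

definition wd :: "inp \<Rightarrow> nat" where "wd X = 2 * B (snd X) + 3"

definition nf :: "inp \<Rightarrow> nat" where "nf X = Suc (B (snd X)) * wd X"

definition mf :: "inp \<Rightarrow> nat" where "mf X = B (snd X) * (2 * B (snd X) + 1) * g ^ 4"

text \<open>A pattern that is not bad yields a vacuous constraint: cell 0 cannot have both values 0 and 1.\<close>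

definition cl :: "inp \<Rightarrow> nat \<Rightarrow> nat \<Rightarrow> nat" where
  "cl X j i = (if bad X j then (if i < 3 then tm X j * wd X + (ps X j + i) else Suc (tm X j) * wd X + Suc (ps X j)) else 0)"

definition vl :: "inp \<Rightarrow> nat \<Rightarrow> nat \<Rightarrow> nat" where
  "vl X j i = (if bad X j then dg j i else of_bool (i = 1))"

lemma dg_less: "dg j i < g"
  using g_ge2 by (simp add: dg_def)

lemma B_pos: "0 < B l"
  by (simp add: B_def)

lemma ps_less: "ps X j < 2 * B (snd X) + 1"
  by (simp add: ps_def)

lemma tm_less: "j < mf X \<Longrightarrow> tm X j < B (snd X)"
  unfolding mf_def tm_def by (intro less_mult_imp_div_less)

lemma wf: "csp_wf (nf X) g (mf X) (cl X) (vl X)"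
  unfolding csp_wf_def
proof (intro conjI allI impI)
  fix j i :: nat assume j: "j < mf X" and i: "i < 4"
  have t: "tm X j < B (snd X)" by (rule tm_less[OF j])
  show "cl X j i < nf X"
  proof (cases "bad X j")
    case True
    have "tm X j * wd X + (ps X j + i) < nf X" if "i < 3"
      unfolding nf_def by (rule idx_less_mult) (use t ps_less[of X j] that in \<open>auto simp: wd_def\<close>)
    moreover have "Suc (tm X j) * wd X + Suc (ps X j) < nf X"
      unfolding nf_def by (rule idx_less_mult) (use t ps_less[of X j] in \<open>auto simp: wd_def\<close>)
    ultimately show ?thesis using True by (simp add: cl_def)
  qed (simp add: cl_def nf_def wd_def)
  show "vl X j i < g" using dg_less[of j i] g_ge2 by (simp add: vl_def)
qed (use g_ge2 in simp)

text \<open>The local condition concerns four tiles, which is where the four cells of a constraint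
  come from: every bad pattern at every place is forbidden separately.\<close>

lemma csp_iff:
  "csp_sat (nf X) g (mf X) (cl X) (vl X) \<longleftrightarrow>
    (\<exists>\<gamma>. (\<forall>t p. t \<le> B (snd X) \<longrightarrow> p \<le> 2 * B (snd X) + 2 \<longrightarrow> \<gamma> t p \<in> tiles) \<and> fits (B (snd X)) (region X) \<gamma>)"
proof
  let ?B = "B (snd X)"
  assume "csp_sat (nf X) g (mf X) (cl X) (vl X)"
  then obtain v where v: "\<And>c. c < nf X \<Longrightarrow> v c < g" "\<And>j. j < mf X \<Longrightarrow> \<exists>p<4. v (cl X j p) \<noteq> vl X j p"
    unfolding csp_sat_def by blast
  define \<gamma> where "\<gamma> = (\<lambda>t p. tl (v (t * wd X + p)))"
  have vg: "v (t * wd X + p) < g" if "t \<le> ?B" "p \<le> 2 * ?B + 2" for t p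
    by (rule v(1), unfold nf_def, rule idx_less_mult) (use that in \<open>auto simp: wd_def\<close>)
  have "fits ?B (region X) \<gamma>"
    unfolding fits_def
  proof (intro allI impI, rule ccontr)
    fix t p assume t: "t < ?B" and p: "p < 2 * ?B + 1"
      and ng: "\<not> good (t = 0) (p = 0) (p = 2 * ?B) (Suc t = ?B) (region X (Suc p)) (p = ?B)
        (\<gamma> t p) (\<gamma> t (Suc p)) (\<gamma> t (Suc (Suc p))) (\<gamma> (Suc t) (Suc p))"
    define a0 a1 a2 a3 where "a0 = v (t * wd X + p)" "a1 = v (t * wd X + Suc p)" "a2 = v (t * wd X + Suc (Suc p))"
      "a3 = v (Suc t * wd X + Suc p)"
    have a: "a0 < g" "a1 < g" "a2 < g" "a3 < g"
      unfolding a0_a1_a2_a3_def using t p by (intro vg; simp)+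
    define pat where "pat = tup g a3 a2 a1 a0"
    have pat: "pat < g ^ 4" using tup_less[OF a(4,3,2,1)] by (simp add: pat_def power4_eq_xxxx mult.assoc)
    define j where "j = (t * (2 * ?B + 1) + p) * g ^ 4 + pat"
    have jd: "j div g ^ 4 = t * (2 * ?B + 1) + p" "j mod g ^ 4 = pat" unfolding j_def by (rule div_mod_idx[OF pat])+
    have tp: "tm X j = t" "ps X j = p" unfolding tm_def ps_def jd using div_mod_idx[OF p] by auto
    have d: "dg j i = dig g pat i" for i by (simp add: dg_def dig_def jd)
    have ds: "dg j 0 = a0" "dg j 1 = a1" "dg j 2 = a2" "dg j 3 = a3"
      unfolding d pat_def using dig_tup[OF a(4,3,2,1)] by auto
    have bad: "bad X j" using ng unfolding bad_def tp ds \<gamma>_def a0_a1_a2_a3_def .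
    have "j < mf X" unfolding j_def mf_def using t p pat by (intro idx_less_mult)
    then obtain i where "i < 4" "v (cl X j i) \<noteq> vl X j i" using v(2) by blast
    moreover have "\<forall>i<4. v (cl X j i) = vl X j i"
      unfolding all4 using bad ds by (simp add: cl_def vl_def tp a0_a1_a2_a3_def)
    ultimately show False by blast
  qed
  moreover have "\<forall>t p. t \<le> ?B \<longrightarrow> p \<le> 2 * ?B + 2 \<longrightarrow> \<gamma> t p \<in> tiles" unfolding \<gamma>_def using vg tl_in by blast
  ultimately show "\<exists>\<gamma>. (\<forall>t p. t \<le> ?B \<longrightarrow> p \<le> 2 * ?B + 2 \<longrightarrow> \<gamma> t p \<in> tiles) \<and> fits ?B (region X) \<gamma>" by blast
next
  let ?B = "B (snd X)"
  assume "\<exists>\<gamma>. (\<forall>t p. t \<le> ?B \<longrightarrow> p \<le> 2 * ?B + 2 \<longrightarrow> \<gamma> t p \<in> tiles) \<and> fits ?B (region X) \<gamma>"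
  then obtain \<gamma> where \<gamma>: "\<And>t p. t \<le> ?B \<Longrightarrow> p \<le> 2 * ?B + 2 \<Longrightarrow> \<gamma> t p \<in> tiles" "fits ?B (region X) \<gamma>" by blast
  define lt where "lt = inv_into {0..<g} tl"
  have lt: "lt a < g" "tl (lt a) = a" if "a \<in> tiles" for a
    using bij_tl that inv_into_into[of a tl "{0..<g}"] f_inv_into_f[of a tl "{0..<g}"]
    by (auto simp: lt_def bij_betw_def)
  define v where "v = (\<lambda>c. lt (\<gamma> (c div wd X) (c mod wd X)))"
  have wd0: "0 < wd X" by (simp add: wd_def)
  have vv: "v (t * wd X + p) = lt (\<gamma> t p)" if "p \<le> 2 * ?B + 2" for t p
  proof -
    have "p < wd X" using that by (simp add: wd_def)
    then show ?thesis by (simp add: v_def div_mod_idx)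
  qed
  have "v c < g" if "c < nf X" for c
  proof -
    have "c div wd X < Suc ?B" using that unfolding nf_def by (rule less_mult_imp_div_less)
    moreover have "c mod wd X \<le> 2 * ?B + 2"
      using mod_less_divisor[OF wd0, of c] unfolding wd_def by linarith
    ultimately show ?thesis unfolding v_def by (intro lt(1) \<gamma>(1)) linarith+
  qed
  moreover have "\<exists>p<4. v (cl X j p) \<noteq> vl X j p" if j: "j < mf X" for j
  proof (cases "bad X j")
    case False
    then have "cl X j 0 = 0" "cl X j 1 = 0" "vl X j 0 = 0" "vl X j 1 = 1" by (auto simp: cl_def vl_def)
    then show ?thesis unfolding ex4 by (cases "v 0 = 0") auto
  next
    case True
    have t: "tm X j < ?B" by (rule tm_less[OF j])
    have p: "ps X j < 2 * ?B + 1" by (rule ps_less)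
    show ?thesis
    proof (rule ccontr)
      assume "\<not> ?thesis"
      then have e: "v (cl X j i) = dg j i" if "i < 4" for i using that True by (auto simp: vl_def)
      have tll: "tl (lt (\<gamma> t p)) = \<gamma> t p" if "t \<le> ?B" "p \<le> 2 * ?B + 2" for t p using lt(2) \<gamma>(1) that by blast
      have "\<gamma> (tm X j) (ps X j) = tl (dg j 0)"
        using e[of 0] True vv[of "ps X j" "tm X j"] tll[of "tm X j" "ps X j"] t p by (simp add: cl_def)
      moreover have "\<gamma> (tm X j) (Suc (ps X j)) = tl (dg j 1)"
        using e[of 1] True vv[of "Suc (ps X j)" "tm X j"] tll[of "tm X j" "Suc (ps X j)"] t p by (simp add: cl_def)
      moreover have "\<gamma> (tm X j) (Suc (Suc (ps X j))) = tl (dg j 2)"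
        using e[of 2] True vv[of "Suc (Suc (ps X j))" "tm X j"] tll[of "tm X j" "Suc (Suc (ps X j))"] t p by (simp add: cl_def)
      moreover have "\<gamma> (Suc (tm X j)) (Suc (ps X j)) = tl (dg j 3)"
        using e[of 3] True vv[of "Suc (ps X j)" "Suc (tm X j)"] tll[of "Suc (tm X j)" "Suc (ps X j)"] t p by (simp add: cl_def)
      ultimately show False using True \<gamma>(2) t p unfolding bad_def fits_def by metis
    qed
  qed
  ultimately show "csp_sat (nf X) g (mf X) (cl X) (vl X)" unfolding csp_sat_def by blast
qed

end

context verifier
begin

lemma okc_ini:
  fixes y :: "bool option list"
  shows "okc (0, ini y)"
proof -
  have "wcont y p < A" for p
    using idx_less[of "y ! nat p"] unfolding A_def wcont_def by simp
  then show ?thesis unfolding okc_def by (auto simp: ini_def blank_def A_def)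
qed

lemma length_pair: "length (pair_word x w) = length x + 1 + length w"
  by (simp add: pair_word_def)

lemma nth_pair:
  "pair_word x w ! i = (if i < length x then Some (x ! i) else if i = length x then None else Some (w ! (i - Suc (length x))))"
  if "i < length (pair_word x w)"
  using that by (auto simp: pair_word_def nth_append nth_Cons')

lemma B_bound: "m \<le> ym l \<Longrightarrow> c * m ^ c + c < B l"
proof -
  assume "m \<le> ym l"
  then have "c * m ^ c \<le> c * ym l ^ c" by (intro mult_le_mono2 power_mono) auto
  then show ?thesis unfolding B_def by linarith
qed

text \<open>Apart from the guessed reads, which are forced, the only freedom in a tableau is the
  witness region of its first row. The height exceeds the verifier's running time on all admissible
  pairs, so a fitting tableau amounts to a witness.\<close>

lemma accepts_iff:
  fixes x :: "bool list"
  shows "(\<exists>\<gamma>. (\<forall>t p. t \<le> B (length x) \<longrightarrow> p \<le> 2 * B (length x) + 2 \<longrightarrow> \<gamma> t p \<in> tiles) \<and>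
      fits (B (length x)) (region (inp_of x)) \<gamma>) \<longleftrightarrow>
    (\<exists>w. length w \<le> bw (length x) \<and> pair_word x w \<in> Lang)"
proof
  let ?l = "length x" and ?F = "embM V 0 (tapes V)"
  let ?B = "B ?l"
  let ?r = "region (inp_of x)"
  have X: "snd (inp_of x) = ?l" "\<And>i. fst (inp_of x) i = wcont x (int i)" by (simp_all add: inp_of_def)
  {
    assume "\<exists>w. length w \<le> bw ?l \<and> pair_word x w \<in> Lang"
    then obtain w where w: "length w \<le> bw ?l" "pair_word x w \<in> Lang" by blast
    define y where "y = pair_word x w"
    have ly: "length y \<le> ym ?l" using w(1) by (simp add: y_def length_pair ym_def)
    obtain T where T: "(fstep ?F ^^ ?B) (0, ini y) = (fst ?F, T)" "rd T (tapes V) = 1"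
      using run_embM[OF V dec[of y] B_bound[OF ly]] w(2) by (auto simp: y_def)
    have ps: "pos ?B (Suc p) = int p - int ?B" for p by (simp add: pos_def)
    have t0: "fst (snd (0, ini y) 0) q = wcont y q" for q by (simp add: ini_def)
    have Bym: "ym ?l + 2 \<le> ?B" by (simp add: B_def)
    have "fits ?B ?r (\<lambda>t p. tile ((fstep ?F ^^ t) (0, ini y)) (pos ?B p))"
    proof (rule fits_complete[OF okc_ini _ _ _ _ _ T])
      fix p assume p: "p \<le> 2 * ?B"
      show "region_ok (?r (Suc p)) (fst (snd (0, ini y) 0) (pos ?B (Suc p)))"
      proof (cases "p < ?B")
        case True
        then show ?thesis unfolding t0 ps by (simp add: region_def X region_ok_def wcont_def)
      next
        case False
        define i where "i = p - ?B"
        have pi: "int p - int ?B = int i" "Suc p - Suc ?B = i" "\<not> Suc p < Suc ?B" using False by (auto simp: i_def)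
        have wy: "wcont y (int i) = (if i < length y then code (Sym (y ! i)) else 0)" by (simp add: wcont_def)
        have wx: "wcont x (int i) = (if i < ?l then code (Sym (x ! i)) else 0)" by (simp add: wcont_def)
        have rp: "?r (Suc p) = (if i < ?l then if x ! i then 1 else 2 else if i = ?l then 3 else if i < ym ?l then 4 else 0)"
          unfolding region_def X pi(2) using pi(3) by (simp add: wx idx_inj)
        consider "i < ?l" | "i = ?l" | "?l < i" "i < length y" | "length y \<le> i" "?l < i" by linarith
        then show ?thesis unfolding t0 ps pi(1) wy rp
        proof cases
          case 1
          then have "i < length y" "y ! i = Some (x ! i)" by (simp_all add: y_def length_pair nth_pair)
          then show "region_ok (if i < ?l then if x ! i then 1 else 2 else if i = ?l then 3 else if i < ym ?l then 4 else 0)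
            (if i < length y then code (Sym (y ! i)) else 0)" using 1
            by (cases "x ! i") (simp_all add: region_ok_def del: code.simps)
        next
          case 2
          then have "i < length y" "y ! i = None" by (simp_all add: y_def length_pair nth_pair)
          then show "region_ok (if i < ?l then if x ! i then 1 else 2 else if i = ?l then 3 else if i < ym ?l then 4 else 0)
            (if i < length y then code (Sym (y ! i)) else 0)" using 2
            by (simp add: region_ok_def del: code.simps)
        next
          case 3
          then have "y ! i = Some (w ! (i - Suc ?l))" by (simp add: y_def nth_pair)
          then show "region_ok (if i < ?l then if x ! i then 1 else 2 else if i = ?l then 3 else if i < ym ?l then 4 else 0)
            (if i < length y then code (Sym (y ! i)) else 0)" using 3 ly
            by (cases "w ! (i - Suc ?l)") (simp_all add: region_ok_def del: code.simps)
        next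
          case 4
          then show "region_ok (if i < ?l then if x ! i then 1 else 2 else if i = ?l then 3 else if i < ym ?l then 4 else 0)
            (if i < length y then code (Sym (y ! i)) else 0)" by (simp add: region_ok_def)
        qed
      qed
      show "fst (snd (0, ini y) 0) (pos ?B (Suc (Suc p))) = 0"
        if r: "?r (Suc p) = 4" and z: "fst (snd (0, ini y) 0) (pos ?B (Suc p)) = 0"
      proof -
        have "?B \<le> p" using r by (auto simp: region_def X split: if_splits)
        then show ?thesis using z unfolding t0 ps by (auto simp: wcont_def split: if_splits)
      qed
    qed (auto simp: ini_def blank_def)
    then show "\<exists>\<gamma>. (\<forall>t p. t \<le> ?B \<longrightarrow> p \<le> 2 * ?B + 2 \<longrightarrow> \<gamma> t p \<in> tiles) \<and> fits ?B ?r \<gamma>"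
    proof (intro exI[of _ "\<lambda>t p. tile ((fstep ?F ^^ t) (0, ini y)) (pos ?B p)"] conjI allI impI)
      show "tile ((fstep ?F ^^ t) (0, ini y)) (pos ?B p) \<in> tiles" for t p
        by (rule tile_in[OF run_ok(1)[OF okc_ini]]) (simp add: ini_def blank_def)
    qed
  }
  {
    assume "\<exists>\<gamma>. (\<forall>t p. t \<le> ?B \<longrightarrow> p \<le> 2 * ?B + 2 \<longrightarrow> \<gamma> t p \<in> tiles) \<and> fits ?B ?r \<gamma>"
    then obtain \<gamma> where \<gamma>: "\<And>t p. t \<le> ?B \<Longrightarrow> p \<le> 2 * ?B + 2 \<Longrightarrow> \<gamma> t p \<in> tiles" "fits ?B ?r \<gamma>" by blast
    define s where "s = (\<lambda>i. snd (snd (snd (\<gamma> 0 (Suc (?B + i))))) ! 0)"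
    have ini: "initial (?r (Suc p)) (p = ?B) (\<gamma> 0 (Suc p)) (\<gamma> 0 (Suc (Suc p)))" if "p \<le> 2 * ?B" for p
      using \<gamma>(2) that B_pos[of ?l] unfolding fits_def good_def by (metis Suc_eq_plus1 less_Suc_eq_le)
    have s_ok: "region_ok (?r (Suc (?B + i))) (s i)" if "i \<le> ?B" for i
      using ini[of "?B + i"] that by (simp add: initial_def s_def)
    have s_mono: "s (Suc i) = 0" if "i \<le> ?B" "?r (Suc (?B + i)) = 4" "s i = 0" for i
      using ini[of "?B + i"] that by (simp add: initial_def s_def)
    have r: "?r (Suc (?B + i)) = (if i < ?l then if x ! i then 1 else 2 else if i = ?l then 3 else if i < ym ?l then 4 else 0)" for i
      by (auto simp: region_def X wcont_def idx_inj)
    \<comment> \<open>The witness ends at the first blank of its region; the second disjunct covers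
      a witness that fills the region. From \<open>len\<close> on everything is blank, first by the
      rule for blanks inside the region, then because no symbol is allowed beyond it.\<close>
    define len where "len = (LEAST i. s (?l + 1 + i) = 0 \<or> bw ?l \<le> i)"
    have len: "s (?l + 1 + len) = 0 \<or> bw ?l \<le> len" unfolding len_def by (rule LeastI[of _ "bw ?l"]) simp
    have len_le: "len \<le> bw ?l" unfolding len_def by (rule Least_le) simp
    have before: "s (?l + 1 + i) \<noteq> 0" if "i < len" for i using not_less_Least[OF that[unfolded len_def]] by simp
    have Bym: "ym ?l + 2 \<le> ?B" by (simp add: B_def)
    have after: "s (?l + 1 + i) = 0" if "len \<le> i" "?l + 1 + i \<le> ?B" for i
      using that
    proof (induction i)
      case 0
      show ?case
      proof (cases "s (?l + 1) = 0")
        case False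
        then have "bw ?l \<le> 0" using len 0 by simp
        then show ?thesis using s_ok[of "?l + 1", unfolded r] 0 by (simp add: ym_def region_ok_def)
      qed simp
    next
      case (Suc i)
      show ?case
      proof (cases "Suc i < bw ?l")
        case True
        then have r4: "?r (Suc (?B + (?l + 1 + i))) = 4" unfolding r by (simp add: ym_def)
        have "s (?l + 1 + i) = 0 \<or> len = Suc i"
          using Suc by (cases "len = Suc i") auto
        then show ?thesis
        proof
          assume "s (?l + 1 + i) = 0"
          then show ?thesis using s_mono[OF _ r4] Suc.prems by simp
        next
          assume "len = Suc i"
          then show ?thesis using len True by simp
        qed
      next
        case False
        then show ?thesis using s_ok[of "?l + 1 + Suc i", unfolded r] Suc.prems by (simp add: ym_def region_ok_def)
      qed
    qed
    define w where "w = map (\<lambda>i. s (?l + 1 + i) = code (Sym (Some True))) [0..<len]"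
    define y where "y = pair_word x w"
    have lw: "length w = len" by (simp add: w_def)
    have ly: "length y = ?l + 1 + len" by (simp add: y_def length_pair lw)
    have s_y: "s i = wcont y (int i)" if i: "i \<le> ?B" for i
    proof -
      consider "i < ?l" | "i = ?l" | "?l < i" "i < length y" | "length y \<le> i" "?l < i" by linarith
      then show ?thesis
      proof cases
        case 1
        then have "i < length y" "y ! i = Some (x ! i)" by (simp_all add: y_def length_pair nth_pair)
        then show ?thesis using s_ok[OF i, unfolded r] 1 by (simp add: region_ok_def wcont_def del: code.simps split: if_splits)
      next
        case 2
        then have "i < length y" "y ! i = None" by (simp_all add: y_def length_pair nth_pair)
        then show ?thesis using s_ok[OF i, unfolded r] 2 by (simp add: region_ok_def wcont_def del: code.simps)
      next
        case 3
        define k where "k = i - Suc ?l"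
        have k: "i = ?l + 1 + k" "k < len" using 3 ly by (auto simp: k_def)
        have "y ! i = Some (w ! k)" using 3 by (simp add: y_def nth_pair k_def)
        moreover have "i < ym ?l" using k len_le by (simp add: ym_def)
        then have "s i = code (Sym (Some True)) \<or> s i = code (Sym (Some False))"
          using s_ok[OF i, unfolded r] before[OF k(2)] 3 k(1) by (simp add: region_ok_def del: code.simps)
        moreover have "w ! k = (s i = code (Sym (Some True)))" using k by (simp add: w_def del: code.simps)
        ultimately show ?thesis using 3 by (auto simp: wcont_def simp del: code.simps)
      next
        case 4
        define k where "k = i - Suc ?l"
        have k: "i = ?l + 1 + k" "len \<le> k" using 4 ly by (auto simp: k_def)
        then have "s i = 0" using after[of k] i by simp
        then show ?thesis using 4 by (simp add: wcont_def)
      qed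
    qed
    have "fst ((fstep ?F ^^ ?B) (0, ini y)) = fst ?F \<and> rd (snd ((fstep ?F ^^ ?B) (0, ini y))) (tapes V) = 1"
    proof (rule fits_sound[OF \<gamma>(2) B_pos _ okc_ini])
      show "length (fst (snd (\<gamma> t p))) = Suc (tapes V)" if "t \<le> ?B" "p \<le> 2 * ?B + 2" for t p
        using \<gamma>(1)[OF that] by (auto simp: tiles_def)
      fix p assume p: "p \<le> 2 * ?B"
      show "snd (snd (snd (\<gamma> 0 (Suc p)))) ! 0 = fst (snd (0, ini y) 0) (pos ?B (Suc p))"
      proof (cases "p < ?B")
        case True
        then show ?thesis using ini[OF p] by (simp add: initial_def region_def X region_ok_def ini_def wcont_def pos_def)
      next
        case False
        then show ?thesis using s_y[of "p - ?B"] p by (simp add: s_def ini_def pos_def of_nat_diff)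
      qed
    qed (auto simp: ini_def blank_def)
    moreover have "length y \<le> ym ?l" using ly len_le by (simp add: ym_def)
    then obtain T where "(fstep ?F ^^ ?B) (0, ini y) = (fst ?F, T)" "rd T (tapes V) = of_bool (y \<in> Lang)"
      using run_embM[OF V dec[of y] B_bound] by blast
    ultimately have "y \<in> Lang" by (cases "y \<in> Lang") auto
    then show "\<exists>w. length w \<le> bw ?l \<and> pair_word x w \<in> Lang" using lw len_le unfolding y_def by blast
  }
qed

lemma pc_B: "pc (\<lambda>X y e. B (snd X))"
  unfolding B_def ym_def bw_def by (intro pc_intros)

lemma pc_ym: "pc (\<lambda>X y e. ym (snd X))"
  unfolding ym_def bw_def by (intro pc_intros)

lemma pc_wd: "pc (\<lambda>X y e. wd X)"
  unfolding wd_def by (intro pc_intros pc_B)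

lemma pc_region: "pc f \<Longrightarrow> pc (\<lambda>X y e. region X (f X y e))"
  unfolding region_def by (intro pc_intros pc_B pc_ym)

lemma pc_tm: "pc f \<Longrightarrow> pc (\<lambda>X y e. tm X (f X y e))"
  unfolding tm_def by (intro pc_intros pc_B)

lemma pc_ps: "pc f \<Longrightarrow> pc (\<lambda>X y e. ps X (f X y e))"
  unfolding ps_def by (intro pc_intros pc_B)

lemma pc_dg: "pc f \<Longrightarrow> pc (\<lambda>X y e. dg (f X y e) i)"
  unfolding dg_def by (intro pc_intros)

lemma pcb_case_bool:
  assumes "pcb P" "\<And>b. pcb (f b)"
  shows "pcb (\<lambda>X y e. f (P X y e) X y e)"
  using pcb_fin[OF assms(1), of "\<lambda>b X y e. of_bool (f b X y e)"] assms(2) unfolding pcb_def by simp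

lemma pcb_case_nat:
  assumes "pc h" "\<And>X y e. h X y e < K" "\<And>a. pcb (f a)"
  shows "pcb (\<lambda>X y e. f (h X y e) X y e)"
  using pc_fin'[OF assms(1), of K "\<lambda>b X y e. of_bool (f b X y e)"] assms(2,3) unfolding pcb_def by simp

text \<open>\<open>good\<close> itself is never programmed. Each of its ten arguments ranges over a
  finite set that is independent of the input, so ten nested case distinctions turn it into
  constants; only the arguments are computed.\<close>

lemma pcb_bad:
  assumes f: "pc f"
  shows "pcb (\<lambda>X y e. bad X (f X y e))"
proof -
  have "pcb (\<lambda>X y e. good (tm X (f X y e) = 0) (ps X (f X y e) = 0) (ps X (f X y e) = 2 * B (snd X)) (Suc (tm X (f X y e)) = B (snd X))
     (region X (Suc (ps X (f X y e)))) (ps X (f X y e) = B (snd X)) (tl (dg (f X y e) 0)) (tl (dg (f X y e) 1)) (tl (dg (f X y e) 2)) (tl (dg (f X y e) 3)))"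
    apply (rule pcb_case_bool[where P = "\<lambda>X y e. tm X (f X y e) = 0" and
          f = "\<lambda>b1 X y e. good b1 (ps X (f X y e) = 0) (ps X (f X y e) = 2 * B (snd X)) (Suc (tm X (f X y e)) = B (snd X))
     (region X (Suc (ps X (f X y e)))) (ps X (f X y e) = B (snd X)) (tl (dg (f X y e) 0)) (tl (dg (f X y e) 1)) (tl (dg (f X y e) 2)) (tl (dg (f X y e) 3))"])
     apply (intro pc_intros pc_tm f)
    apply (rule pcb_case_bool[where P = "\<lambda>X y e. ps X (f X y e) = 0" and
          f = "\<lambda>b2 X y e. good _ b2 (ps X (f X y e) = 2 * B (snd X)) (Suc (tm X (f X y e)) = B (snd X))
     (region X (Suc (ps X (f X y e)))) (ps X (f X y e) = B (snd X)) (tl (dg (f X y e) 0)) (tl (dg (f X y e) 1)) (tl (dg (f X y e) 2)) (tl (dg (f X y e) 3))"])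
     apply (intro pc_intros pc_ps f)
    apply (rule pcb_case_bool[where P = "\<lambda>X y e. ps X (f X y e) = 2 * B (snd X)" and
          f = "\<lambda>b3 X y e. good _ _ b3 (Suc (tm X (f X y e)) = B (snd X))
     (region X (Suc (ps X (f X y e)))) (ps X (f X y e) = B (snd X)) (tl (dg (f X y e) 0)) (tl (dg (f X y e) 1)) (tl (dg (f X y e) 2)) (tl (dg (f X y e) 3))"])
     apply (intro pc_intros pc_ps pc_B f)
    apply (rule pcb_case_bool[where P = "\<lambda>X y e. Suc (tm X (f X y e)) = B (snd X)" and
          f = "\<lambda>b4 X y e. good _ _ _ b4
     (region X (Suc (ps X (f X y e)))) (ps X (f X y e) = B (snd X)) (tl (dg (f X y e) 0)) (tl (dg (f X y e) 1)) (tl (dg (f X y e) 2)) (tl (dg (f X y e) 3))"])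
     apply (intro pc_intros pc_tm pc_B f)
    apply (rule pcb_case_nat[where h = "\<lambda>X y e. region X (Suc (ps X (f X y e)))" and K = 5 and
          f = "\<lambda>b5 X y e. good _ _ _ _ b5 (ps X (f X y e) = B (snd X)) (tl (dg (f X y e) 0)) (tl (dg (f X y e) 1)) (tl (dg (f X y e) 2)) (tl (dg (f X y e) 3))"])
      apply (intro pc_region pc_Suc pc_ps f)
     apply (simp add: region_def)
    apply (rule pcb_case_bool[where P = "\<lambda>X y e. ps X (f X y e) = B (snd X)" and
          f = "\<lambda>b6 X y e. good _ _ _ _ _ b6 (tl (dg (f X y e) 0)) (tl (dg (f X y e) 1)) (tl (dg (f X y e) 2)) (tl (dg (f X y e) 3))"])
     apply (intro pc_intros pc_ps pc_B f)
    apply (rule pcb_case_nat[where h = "\<lambda>X y e. dg (f X y e) 0" and K = g and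
          f = "\<lambda>a X y e. good _ _ _ _ _ _ (tl a) (tl (dg (f X y e) 1)) (tl (dg (f X y e) 2)) (tl (dg (f X y e) 3))", OF pc_dg[OF f] dg_less])
    apply (rule pcb_case_nat[where h = "\<lambda>X y e. dg (f X y e) 1" and K = g and
          f = "\<lambda>a X y e. good _ _ _ _ _ _ _ (tl a) (tl (dg (f X y e) 2)) (tl (dg (f X y e) 3))", OF pc_dg[OF f] dg_less])
    apply (rule pcb_case_nat[where h = "\<lambda>X y e. dg (f X y e) 2" and K = g and
          f = "\<lambda>a X y e. good _ _ _ _ _ _ _ _ (tl a) (tl (dg (f X y e) 3))", OF pc_dg[OF f] dg_less])
    apply (rule pcb_case_nat[where h = "\<lambda>X y e. dg (f X y e) 3" and K = g and
          f = "\<lambda>a X y e. good _ _ _ _ _ _ _ _ _ (tl a)", OF pc_dg[OF f] dg_less])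
    apply (rule pcb_const)
    done
  then show ?thesis unfolding bad_def by (rule pcb_not)
qed

sublocale fam: csp_family nf mf g cl vl
proof
  show "pc (\<lambda>X y e. nf X)" unfolding nf_def by (intro pc_intros pc_B pc_wd)
  show "pc (\<lambda>X y e. mf X)" unfolding mf_def by (intro pc_intros pc_B)
  show "pc (\<lambda>X y e. cl X (e 0) p)" for p
    unfolding cl_def by (intro pc_intros pcb_bad pc_tm pc_ps pc_wd)
  show "pc (\<lambda>X y e. vl X (e 0) p)" for p
    unfolding vl_def by (intro pc_intros pcb_bad pc_dg)
  show "0 < nf X" for X by (simp add: nf_def wd_def)
  show "0 < g" using g_ge2 by simp
qed

lemma csp_lang: "csp_sat (nf (inp_of x)) g (mf (inp_of x)) (cl (inp_of x)) (vl (inp_of x)) \<longleftrightarrow>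
    (\<exists>w. length w \<le> bw (length x) \<and> pair_word x w \<in> Lang)"
  using csp_iff[of "inp_of x"] accepts_iff[of x] by (simp add: inp_of_def)

end

section \<open>3-SAT as constraint satisfaction\<close>

definition ended :: "inp \<Rightarrow> nat \<Rightarrow> bool" where
  "ended X i \<longleftrightarrow> fst X i = code (Sym (Some True)) \<or> fst X i = code (Sym (Some False))"

definition n_ends :: "inp \<Rightarrow> nat \<Rightarrow> nat" where
  "n_ends X m = (\<Sum>i<m. of_bool (ended X i))"

text \<open>\<open>posn X k\<close> is the position of the \<open>k\<close>-th terminating symbol, counted from 0.\<close>

definition posn :: "inp \<Rightarrow> nat \<Rightarrow> nat" where
  "posn X k = (\<Sum>i<snd X. of_bool (n_ends X (Suc i) \<le> k))"

text \<open>Variables are unary, so the index is the number of ticks between two consecutive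
  terminators. Literal 0 of the word is the number of variables.\<close>

definition lvar :: "inp \<Rightarrow> nat \<Rightarrow> nat" where
  "lvar X k = posn X k - (if k = 0 then 0 else Suc (posn X (k - 1)))"

text \<open>The value of the variable that falsifies the literal, that is, the value to be
  forbidden.\<close>

definition lneg :: "inp \<Rightarrow> nat \<Rightarrow> nat" where
  "lneg X k = of_bool (fst X (posn X k) \<noteq> code (Sym (Some True)))"

text \<open>One cell more than variables keeps the number of cells positive. Constraints have four
  cells, so the third literal of a clause is used twice (\<open>min p 2\<close>), and the leading 1
  skips the number of variables.\<close>

definition nf3 :: "inp \<Rightarrow> nat" where "nf3 X = Suc (lvar X 0)"
definition mf3 :: "inp \<Rightarrow> nat" where "mf3 X = (n_ends X (snd X) - 1) div 3"
definition cl3 :: "inp \<Rightarrow> nat \<Rightarrow> nat \<Rightarrow> nat" where "cl3 X j p = lvar X (1 + (j * 3 + min p 2))"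
definition vl3 :: "inp \<Rightarrow> nat \<Rightarrow> nat \<Rightarrow> nat" where "vl3 X j p = lneg X (1 + (j * 3 + min p 2))"

lemma pc_n_ends: "pc f \<Longrightarrow> pc (\<lambda>X y e. n_ends X (f X y e))"
  unfolding n_ends_def ended_def by (intro pc_intros)

lemma pc_posn: "pc f \<Longrightarrow> pc (\<lambda>X y e. posn X (f X y e))"
proof -
  have "pc (\<lambda>X y e. posn X (e 0))"
    unfolding posn_def by (intro pc_intros pc_n_ends)
  then show "pc f \<Longrightarrow> pc (\<lambda>X y e. posn X (f X y e))" by (rule pc_comp1[where F = "\<lambda>X y j. posn X j"])
qed

lemma pc_lvar: "pc f \<Longrightarrow> pc (\<lambda>X y e. lvar X (f X y e))"
  unfolding lvar_def by (intro pc_intros pc_posn)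

lemma pc_lneg: "pc f \<Longrightarrow> pc (\<lambda>X y e. lneg X (f X y e))"
  unfolding lneg_def by (intro pc_intros pc_posn)

interpretation sat3: csp_family nf3 mf3 2 cl3 vl3
proof
  show "pc (\<lambda>X y e. nf3 X)" unfolding nf3_def by (intro pc_intros pc_lvar)
  show "pc (\<lambda>X y e. mf3 X)" unfolding mf3_def by (intro pc_intros pc_n_ends)
  show "pc (\<lambda>X y e. cl3 X (e 0) p)" for p unfolding cl3_def by (intro pc_intros pc_lvar)
  show "pc (\<lambda>X y e. vl3 X (e 0) p)" for p unfolding vl3_def by (intro pc_intros pc_lneg)
qed (simp_all add: nf3_def)

lemma n_ends_filter:
  fixes x :: "bool option list"
  shows "m \<le> length x \<Longrightarrow> n_ends (inp_of x) m = length (filter (\<lambda>s. s \<noteq> None) (take m x))"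
proof (induction m)
  case (Suc m)
  have "ended (inp_of x) m \<longleftrightarrow> x ! m \<noteq> None"
    using Suc.prems by (cases "x ! m") (auto simp: ended_def inp_of_def wcont_def idx_inj)
  then show ?case using Suc by (simp add: n_ends_def take_Suc_conv_app_nth)
qed (simp add: n_ends_def)

lemma filter_lits: "length (filter (\<lambda>s. s \<noteq> None) (concat (map lit_word ls))) = length ls"
  by (induction ls) (auto simp: lit_word_def)

text \<open>\<open>posn\<close> counts the positions up to and including which at most
  \<open>k\<close> terminators occur. These are exactly the positions before terminator number
  \<open>k\<close>, since the prefix \<open>u\<close> contains \<open>k\<close> terminators.\<close>

lemma
  assumes k: "k < length ls"
  defines "x \<equiv> concat (map lit_word ls)"
  shows posn_lits: "posn (inp_of x) k = length (concat (map lit_word (take k ls))) + fst (ls ! k)"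
    and nth_posn: "x ! posn (inp_of x) k = Some (snd (ls ! k))"
    and posn_less: "posn (inp_of x) k < length x"
proof -
  define u where "u = concat (map lit_word (take k ls)) @ replicate (fst (ls ! k)) None"
  define r where "r = concat (map lit_word (drop (Suc k) ls))"
  have "ls = take k ls @ ls ! k # drop (Suc k) ls" by (rule id_take_nth_drop[OF k])
  then have "x = concat (map lit_word (take k ls @ ls ! k # drop (Suc k) ls))" unfolding x_def by simp
  then have x: "x = u @ Some (snd (ls ! k)) # r" by (simp add: u_def r_def lit_word_def)
  have fu: "length (filter (\<lambda>s. s \<noteq> None) u) = k" using k by (simp add: u_def filter_lits del: not_None_eq)
  have "(n_ends (inp_of x) (Suc i) \<le> k) = (i < length u)" if "i < length x" for i
  proof (cases "i < length u")
    case True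
    have "length (filter (\<lambda>s. s \<noteq> None) (take (Suc i) u)) \<le> length (filter (\<lambda>s. s \<noteq> None) (take (Suc i) u @ drop (Suc i) u))"
      unfolding filter_append by simp
    then show ?thesis using True that fu n_ends_filter[of "Suc i" x] by (simp add: x)
  next
    case False
    then have "take (Suc i) x = u @ Some (snd (ls ! k)) # take (i - length u) r"
      by (simp add: x take_Cons' Suc_diff_le)
    then show ?thesis using False that fu n_ends_filter[of "Suc i" x] by simp
  qed
  then have "posn (inp_of x) k = (\<Sum>i<length x. of_bool (i < length u))"
    unfolding posn_def by (simp add: inp_of_def)
  also have "\<dots> = card ({..<length x} \<inter> {i. i < length u})" by simp
  also have "{..<length x} \<inter> {i. i < length u} = {..<length u}" by (auto simp: x)
  finally have p: "posn (inp_of x) k = length u" by simp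
  show "posn (inp_of x) k = length (concat (map lit_word (take k ls))) + fst (ls ! k)" unfolding p by (simp add: u_def)
  show "x ! posn (inp_of x) k = Some (snd (ls ! k))" unfolding p by (simp add: x)
  show "posn (inp_of x) k < length x" unfolding p by (simp add: x)
qed

lemma lvar_lits:
  assumes k: "k < length ls"
  shows "lvar (inp_of (concat (map lit_word ls))) k = fst (ls ! k)"
proof (cases k)
  case 0
  then show ?thesis using posn_lits[OF k] by (simp add: lvar_def)
next
  case (Suc j)
  then have j: "j < length ls" using k by simp
  have "length (concat (map lit_word (take k ls))) = Suc (posn (inp_of (concat (map lit_word ls))) j)"
    unfolding Suc take_Suc_conv_app_nth[OF j] posn_lits[OF j] by (simp add: lit_word_def)
  then show ?thesis using posn_lits[OF k] Suc by (simp add: lvar_def)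
qed

lemma lneg_lits:
  assumes k: "k < length ls"
  shows "lneg (inp_of (concat (map lit_word ls))) k = of_bool (\<not> snd (ls ! k))"
  using nth_posn[OF k] posn_less[OF k] by (cases "snd (ls ! k)") (auto simp: lneg_def inp_of_def wcont_def idx_inj)

definition lits :: "nat \<Rightarrow> clause3 list \<Rightarrow> literal list" where
  "lits n F = (n, True) # concat (map clause_lits F)"

lemma length_clause_lits: "length (clause_lits C) = 3"
  by (cases C) (simp add: clause_lits_def)

lemma
  shows length_lits: "length (lits n F) = Suc (length F * 3)"
    and nth_lits: "j < length F \<Longrightarrow> p < 3 \<Longrightarrow> lits n F ! (1 + (j * 3 + p)) = clause_lits (F ! j) ! p"
proof -
  have m: "map clause_lits F = map (\<lambda>i. clause_lits (F ! i)) [0..<length F]"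
    by (rule nth_equalityI) simp_all
  note b = concat_blocks[of "length F" "\<lambda>i. clause_lits (F ! i)" 3, OF length_clause_lits, folded m]
  show "length (lits n F) = Suc (length F * 3)" unfolding lits_def using b(1) by simp
  show "lits n F ! (1 + (j * 3 + p)) = clause_lits (F ! j) ! p" if "j < length F" "p < 3"
    unfolding lits_def using b(2)[OF that] by simp
qed

lemma cnf_word_lits: "cnf_word n F = concat (map lit_word (lits n F))"
  by (simp add: cnf_word_def lits_def)

lemma
  fixes n F
  defines "X \<equiv> inp_of (cnf_word n F)"
  shows nf3_cnf: "nf3 X = Suc n" and mf3_cnf: "mf3 X = length F"
    and cl3_cnf: "j < length F \<Longrightarrow> cl3 X j p = fst (clause_lits (F ! j) ! min p 2)"
    and vl3_cnf: "j < length F \<Longrightarrow> vl3 X j p = of_bool (\<not> snd (clause_lits (F ! j) ! min p 2))"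
proof -
  show "nf3 X = Suc n" unfolding nf3_def X_def cnf_word_lits using lvar_lits[of 0 "lits n F"] by (simp add: lits_def)
  have "snd X = length (cnf_word n F)" by (simp add: X_def inp_of_def)
  then have "n_ends X (snd X) = length (lits n F)" unfolding X_def by (simp add: n_ends_filter cnf_word_lits filter_lits del: not_None_eq)
  then show "mf3 X = length F" unfolding mf3_def by (simp add: length_lits)
  assume j: "j < length F"
  have k: "1 + (j * 3 + min p 2) < length (lits n F)"
    unfolding length_lits using idx_less_mult[of j "length F" "min p 2" 3] j by simp
  show "cl3 X j p = fst (clause_lits (F ! j) ! min p 2)"
    unfolding cl3_def X_def cnf_word_lits lvar_lits[OF k] by (subst nth_lits[OF j]) auto
  show "vl3 X j p = of_bool (\<not> snd (clause_lits (F ! j) ! min p 2))"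
    unfolding vl3_def X_def cnf_word_lits lneg_lits[OF k] by (subst nth_lits[OF j]) auto
qed

lemma clause_lits_ex: "(\<exists>l\<in>set (clause_lits C). P l) \<longleftrightarrow> (\<exists>p<4. P (clause_lits C ! min p 2))"
  unfolding ex4 by (cases C) (auto simp: clause_lits_def)

lemma csp_wf3:
  assumes "cnf3_on n F"
  shows "csp_wf (nf3 (inp_of (cnf_word n F))) 2 (mf3 (inp_of (cnf_word n F))) (cl3 (inp_of (cnf_word n F))) (vl3 (inp_of (cnf_word n F)))"
proof -
  have "fst (clause_lits (F ! j) ! min p 2) < n" if "j < length F" for j p
  proof -
    have "clause_lits (F ! j) ! min p 2 \<in> set (clause_lits (F ! j))" by (rule nth_mem) (simp add: length_clause_lits)
    then show ?thesis using assms nth_mem[OF that] unfolding cnf3_on_def by blast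
  qed
  then show ?thesis unfolding csp_wf_def by (auto simp: nf3_cnf mf3_cnf cl3_cnf vl3_cnf intro: less_SucI)
qed

lemma csp_sat3:
  assumes F: "cnf3_on n F"
  shows "csp_sat (nf3 (inp_of (cnf_word n F))) 2 (mf3 (inp_of (cnf_word n F))) (cl3 (inp_of (cnf_word n F))) (vl3 (inp_of (cnf_word n F)))
    \<longleftrightarrow> satisfiable F"
proof
  let ?l = "\<lambda>j p. clause_lits (F ! j) ! min p 2"
  have S: "satisfiable F \<longleftrightarrow> (\<exists>v. \<forall>j<length F. \<exists>p<4. v (fst (?l j p)) = snd (?l j p))"
    unfolding satisfiable_def clause_lits_ex by (simp add: all_set_conv_all_nth)
  {
    assume "csp_sat (nf3 (inp_of (cnf_word n F))) 2 (mf3 (inp_of (cnf_word n F))) (cl3 (inp_of (cnf_word n F))) (vl3 (inp_of (cnf_word n F)))"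
    then obtain v :: "nat \<Rightarrow> nat" where v: "\<forall>c<Suc n. v c < 2" "\<forall>j<length F. \<exists>p<4. v (fst (?l j p)) \<noteq> of_bool (\<not> snd (?l j p))"
      unfolding csp_sat_def nf3_cnf mf3_cnf by (auto simp: cl3_cnf vl3_cnf)
    have "\<exists>p<4. (v (fst (?l j p)) = 1) = snd (?l j p)" if j: "j < length F" for j
    proof -
      obtain p where p: "p < 4" "v (fst (?l j p)) \<noteq> of_bool (\<not> snd (?l j p))" using v(2) j by blast
      have "?l j p \<in> set (clause_lits (F ! j))" by (rule nth_mem) (simp add: length_clause_lits)
      then have "fst (?l j p) < Suc n" using F nth_mem[OF j] unfolding cnf3_on_def by (blast intro: less_SucI)
      then have "v (fst (?l j p)) < 2" using v(1) by blast
      then show ?thesis using p by (intro exI[of _ p]) (cases "snd (?l j p)"; auto)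
    qed
    then show "satisfiable F" unfolding S by (intro exI[of _ "\<lambda>i. v i = 1"]) blast
  }
  {
    assume "satisfiable F"
    then obtain v where "\<forall>j<length F. \<exists>p<4. v (fst (?l j p)) = snd (?l j p)" unfolding S by blast
    then have "\<forall>j<length F. \<exists>p<4. of_bool (v (fst (?l j p))) \<noteq> (of_bool (\<not> snd (?l j p)) :: nat)" by auto
    then show "csp_sat (nf3 (inp_of (cnf_word n F))) 2 (mf3 (inp_of (cnf_word n F))) (cl3 (inp_of (cnf_word n F))) (vl3 (inp_of (cnf_word n F)))"
      unfolding csp_sat_def nf3_cnf mf3_cnf by (intro exI[of _ "\<lambda>i. of_bool (v i)"]) (simp add: cl3_cnf vl3_cnf)
  }
qed

section \<open>Consequences of an approximation algorithm\<close>

text \<open>One constant has to serve as coefficient, exponent and summand. 3^k does, because l + 2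
  is at most 3 l for positive l and k is at most 3^k.\<close>

lemma polyb_time:
  assumes "polyb F"
  shows "\<exists>c. \<forall>l. F (l + 2) \<le> c * l ^ c + c"
proof -
  obtain k where k: "\<And>S. 2 \<le> S \<Longrightarrow> F S \<le> S ^ k" using assms unfolding polyb_def by blast
  have k3: "k \<le> 3 ^ k" by (rule less_imp_le[OF power_gt_expt]) simp
  have "F (l + 2) \<le> 3 ^ k * l ^ (3 ^ k) + 3 ^ k" for l
  proof (cases l)
    case 0
    have "F 2 \<le> 2 ^ k" by (rule k) simp
    also have "2 ^ k \<le> (3 :: nat) ^ k" by (rule power_mono) auto
    finally show ?thesis using 0 by (simp add: power_0_left numeral_2_eq_2)
  next
    case (Suc m)
    have "F (l + 2) \<le> (l + 2) ^ k" by (rule k) simp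
    also have "\<dots> \<le> (3 * l) ^ k" by (rule power_mono) (use Suc in auto)
    also have "\<dots> \<le> 3 ^ k * l ^ (3 ^ k)"
      unfolding power_mult_distrib by (intro mult_le_mono2 power_increasing k3) (use Suc in auto)
    finally show ?thesis by simp
  qed
  then show ?thesis by blast
qed

lemma class_P_I:
  assumes "wf_tm M" "polyb F" "\<And>x. \<exists>t\<le>F (length x + 2). decides_within M x t (x \<in> L)"
  shows "L \<in> class_P"
proof -
  obtain c where "\<And>l. F (l + 2) \<le> c * l ^ c + c" using polyb_time[OF assms(2)] by blast
  then have "decides_within M x (c * length x ^ c + c) (x \<in> L)" for x
    using assms(3)[of x] decides_mono by (meson order_trans)
  then show ?thesis using assms(1) unfolding class_P_def by blast
qed

section \<open>P and NP\<close>

definition front :: "bool option list \<Rightarrow> bool list" where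
  "front y = map the (takeWhile (\<lambda>s. s \<noteq> None) y)"

lemma front_pair: "front (pair_word x w) = x"
proof -
  have "takeWhile (\<lambda>s. s \<noteq> None) (pair_word x w) = map Some x" by (induction x) (auto simp: pair_word_def)
  then show ?thesis by (simp add: front_def comp_def)
qed

lemma ended_iff: "i < length x \<Longrightarrow> ended (inp_of x) i \<longleftrightarrow> x ! i \<noteq> None" for x :: "bool option list"
  by (cases "x ! i") (auto simp: ended_def inp_of_def wcont_def idx_inj)

lemma length_takeWhile_sum: "length (takeWhile P xs) = (\<Sum>i<length xs. of_bool (\<forall>j<Suc i. P (xs ! j)))"
proof -
  have "(\<forall>j<Suc i. P (xs ! j)) \<longleftrightarrow> i < length (takeWhile P xs)" if "i < length xs" for i
  proof
    assume "\<forall>j<Suc i. P (xs ! j)"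
    then show "i < length (takeWhile P xs)"
      using that nth_length_takeWhile[of P xs] by (meson less_Suc_eq_le linorder_not_le order_le_less_trans)
  next
    assume "i < length (takeWhile P xs)"
    then show "\<forall>j<Suc i. P (xs ! j)" by (metis less_Suc_eq_le nth_mem order_le_less_trans set_takeWhileD takeWhile_nth)
  qed
  then have "(\<Sum>i<length xs. of_bool (\<forall>j<Suc i. P (xs ! j))) = (\<Sum>i<length xs. of_bool (i < length (takeWhile P xs)) :: nat)"
    by (intro sum.cong) auto
  also have "\<dots> = card ({..<length xs} \<inter> {i. i < length (takeWhile P xs)})" by simp
  also have "{..<length xs} \<inter> {i. i < length (takeWhile P xs)} = {..<length (takeWhile P xs)}"
    using length_takeWhile_le[of P xs] by auto
  finally show ?thesis by simp
qed

lemma pc_word_front: "pc_word front"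
  unfolding pc_word_def
proof (intro exI conjI allI impI)
  let ?L = "\<lambda>(X :: inp) (y :: nat \<Rightarrow> nat) (e :: env). \<Sum>i<snd X. of_bool (\<forall>j<Suc i. ended X j)"
  let ?sy = "\<lambda>(X :: inp) (y :: nat \<Rightarrow> nat) (e :: env). if fst X (e 0) = code (Sym (Some True)) then code (Sym True) else code (Sym False)"
  show "pc ?L" unfolding ended_def by (intro pc_intros)
  show "pc ?sy" by (intro pc_intros)
  fix x :: "bool option list"
  have "(\<Sum>i<snd (inp_of x). of_bool (\<forall>j<Suc i. ended (inp_of x) j)) = (\<Sum>i<length x. of_bool (\<forall>j<Suc i. x ! j \<noteq> None) :: nat)"
  proof (rule sum.cong)
    show "of_bool (\<forall>j<Suc i. ended (inp_of x) j) = (of_bool (\<forall>j<Suc i. x ! j \<noteq> None) :: nat)" if "i \<in> {..<length x}" for i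
      using that by (simp add: ended_iff)
  qed (simp add: inp_of_def)
  also have "\<dots> = length (front x)" unfolding front_def length_map length_takeWhile_sum ..
  finally show "?L (inp_of x) (\<lambda>_. 0) (\<lambda>_. 0) = length (front x)" .
  fix i assume "i < length (front x)"
  then have i: "i < length (takeWhile (\<lambda>s. s \<noteq> None) x)" by (simp add: front_def)
  have ix: "i < length x" using i length_takeWhile_le[of _ x] by (rule order_less_le_trans)
  have "x ! i \<noteq> None" using set_takeWhileD[OF nth_mem[OF i]] unfolding takeWhile_nth[OF i] by simp
  then obtain b where "x ! i = Some b" by blast
  then show "?sy (inp_of x) (\<lambda>_. 0) (\<lambda>_. i) = code (Sym (front x ! i))"
    using i ix takeWhile_nth[OF i] by (cases b) (simp_all add: front_def inp_of_def wcont_def idx_inj)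
qed

text \<open>With this, a collapse of NP into P contradicts the mere inequality of the two classes.
  The verifier forgets the witness; as it works over another alphabet, it is obtained by reducing to
  the decider through \<open>front\<close>.\<close>

lemma P_subset_NP: "(class_P :: bool list set set) \<subseteq> class_NP"
proof
  fix L :: "bool list set" assume "L \<in> class_P"
  then obtain M c where M: "wf_tm M" "\<And>x. decides_within M x (c * length x ^ c + c) (x \<in> L)"
    unfolding class_P_def by blast
  obtain M' :: "bool option tm" and C where M': "wf_tm M'" "\<And>y t. halted M (run M (front y) t) \<Longrightarrow>
      decides_within M' y ((length y + 2) ^ C + 3 * t) (fst (run M (front y) t) \<in> accepting M)"
    using reduce_decision[OF M(1) pc_word_front] by blast
  have "{y. front y \<in> L} \<in> class_P"
  proof (rule class_P_I[OF M'(1)])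
    show "polyb (\<lambda>S. S ^ C + 3 * (c * S ^ c + c))" by (intro polyb_intros)
    fix y
    let ?t = "c * length (front y) ^ c + c"
    have "decides_within M' y ((length y + 2) ^ C + 3 * ?t) (y \<in> {y. front y \<in> L})"
      using M(2)[of "front y"] M'(2)[of y ?t] unfolding decides_within_def by simp
    moreover have "length (front y) \<le> length y + 2"
      using length_takeWhile_le[of "\<lambda>s. s \<noteq> None" y] by (simp add: front_def)
    then have "length (front y) ^ c \<le> (length y + 2) ^ c" by (rule power_mono) simp
    then have "?t \<le> c * (length y + 2) ^ c + c" by simp
    ultimately show "\<exists>t\<le>(length y + 2) ^ C + 3 * (c * (length y + 2) ^ c + c). decides_within M' y t (y \<in> {y. front y \<in> L})"
      by (intro exI[of _ "(length y + 2) ^ C + 3 * ?t"]) simp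
  qed
  moreover have "x \<in> L \<longleftrightarrow> (\<exists>w. length w \<le> 0 * length x ^ 0 + 0 \<and> pair_word x w \<in> {y. front y \<in> L})" for x
    by (simp add: front_pair)
  ultimately show "L \<in> class_NP" unfolding class_NP_def by blast
qed

lemma NP_subset_P:
  fixes M :: "'q::{finite,field} option tm"
  assumes M: "l0_approx_in_time \<alpha> M (poly_time c0)" and \<alpha>: "1 < \<alpha>"
  shows "(class_NP :: bool list set set) \<subseteq> class_P"
proof
  fix L :: "bool list set" assume "L \<in> class_NP"
  then obtain W cw where W: "W \<in> class_P"
    and L: "\<And>x. x \<in> L \<longleftrightarrow> (\<exists>w. length w \<le> cw * length x ^ cw + cw \<and> pair_word x w \<in> W)"
    unfolding class_NP_def by blast
  then obtain V c where V: "wf_tm V" "\<And>y. decides_within V y (c * length y ^ c + c) (y \<in> W)"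
    unfolding class_P_def by blast
  interpret verifier V W c cw by (rule verifier.intro[OF V])
  obtain t where t: "\<alpha> * real (2 * CARD('q)) ^ t < real (2 * CARD('q) + 1) ^ t"
    using exists_amplification[where ?'q = 'q] by blast
  obtain M' :: "bool tm" and C where M': "wf_tm M'" "\<And>x. \<exists>n \<tau> \<tau>'. n \<le> (length x + 2) ^ C \<and>
      real \<tau>' \<le> poly_time c0 n (fam.ncols t (inp_of x) - 1) \<and> \<tau> \<le> (length x + 2) ^ C + 3 * \<tau>' \<and>
      decides_within M' x \<tau> (x \<in> L)"
    using fam.reduce_csp[OF M \<alpha> t, where ?'a = bool] wf unfolding csp_lang L[folded bw_def] by blast
  show "L \<in> class_P"
  proof (rule class_P_I[OF M'(1)])
    show "polyb (\<lambda>S. S ^ C + 3 * (c0 * S ^ (C * c0)))" by (intro polyb_intros)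
    fix x
    obtain n \<tau> \<tau>' where n: "n \<le> (length x + 2) ^ C" "real \<tau>' \<le> poly_time c0 n (fam.ncols t (inp_of x) - 1)"
      "\<tau> \<le> (length x + 2) ^ C + 3 * \<tau>'" "decides_within M' x \<tau> (x \<in> L)"
      using M'(2) by blast
    have "real \<tau>' \<le> real (c0 * n ^ c0)" using n(2) by (simp add: poly_time_def)
    then have "\<tau>' \<le> c0 * n ^ c0" by (simp only: of_nat_le_iff)
    also have "n ^ c0 \<le> ((length x + 2) ^ C) ^ c0" by (rule power_mono[OF n(1)]) simp
    finally have "\<tau>' \<le> c0 * (length x + 2) ^ (C * c0)" by (simp add: power_mult)
    then show "\<exists>t\<le>(length x + 2) ^ C + 3 * (c0 * (length x + 2) ^ (C * c0)). decides_within M' x t (x \<in> L)"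
      using n(3,4) by (intro exI[of _ \<tau>]) simp
  qed
qed

lemma sqrt_smallo: "(\<lambda>n. sqrt (real (2 * n + 3))) \<in> o(\<lambda>n. real n)"
proof (rule landau_o.smallI)
  fix c :: real assume c: "0 < c"
  show "\<forall>\<^sub>F n in sequentially. norm (sqrt (real (2 * n + 3))) \<le> c * norm (real n)"
    using eventually_ge_at_top[of "Suc (nat \<lceil>5 / c\<^sup>2\<rceil>)"]
  proof eventually_elim
    fix n assume n: "Suc (nat \<lceil>5 / c\<^sup>2\<rceil>) \<le> n"
    then have "5 / c\<^sup>2 \<le> real n" by linarith
    then have "5 * real n \<le> (c\<^sup>2 * real n) * real n"
      using c by (intro mult_right_mono) (simp_all add: field_simps)
    moreover have "1 \<le> real n" using n by simp
    moreover have "real (2 * n + 3) = 2 * real n + 3" by simp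
    moreover have "(c * real n)\<^sup>2 = (c\<^sup>2 * real n) * real n" by (simp add: power2_eq_square)
    ultimately have "real (2 * n + 3) \<le> (c * real n)\<^sup>2" by linarith
    then have "sqrt (real (2 * n + 3)) \<le> c * real n" using c by (intro real_le_lsqrt) auto
    then show "norm (sqrt (real (2 * n + 3))) \<le> c * norm (real n)" by simp
  qed
qed

text \<open>The exponent 1/(4t) would turn the bound on the rank into a linear function of n. Half
  of it gives a square root, which is in o(n).\<close>

lemma rank_powr:
  assumes t: "0 < t" and k: "k \<le> (2 * n + 3) ^ (4 * t)"
  shows "real k powr (1 / real (8 * t)) \<le> sqrt (real (2 * n + 3))"
proof -
  have "real k \<le> real ((2 * n + 3) ^ (4 * t))" using k by (simp only: of_nat_le_iff)
  also have "\<dots> = real (2 * n + 3) powr real (4 * t)" by (subst powr_realpow) auto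
  finally have "real k powr (1 / real (8 * t)) \<le> (real (2 * n + 3) powr real (4 * t)) powr (1 / real (8 * t))"
    by (intro powr_mono2) auto
  also have "\<dots> = real (2 * n + 3) powr (1 / 2)" unfolding powr_powr using t by (simp add: field_simps)
  also have "\<dots> = sqrt (real (2 * n + 3))" by (rule powr_half_sqrt) simp
  finally show ?thesis .
qed

text \<open>The columns of the matrix, and so the rank, depend on the number of variables alone,
  since clauses only add rows. The number of rows enters the polynomial factor, whereas the
  exponential factor becomes 2 powr sqrt (2n + 3).\<close>

lemma not_ETH:
  fixes M :: "'q::{finite,field} option tm"
  assumes M: "l0_approx_in_time \<alpha> M (subexp_time (1 / real (8 * t)) c)" and \<alpha>: "1 < \<alpha>"
    and t: "\<alpha> * real (2 * CARD('q)) ^ t < real (2 * CARD('q) + 1) ^ t" and t0: "0 < t"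
  shows "\<not> ETH"
proof -
  obtain M' :: "bool option tm" and C where M1: "wf_tm M'" and M2: "\<And>x. csp_wf (nf3 (inp_of x)) 2 (mf3 (inp_of x)) (cl3 (inp_of x)) (vl3 (inp_of x)) \<Longrightarrow>
      \<exists>N \<tau> \<tau>'. N \<le> (length x + 2) ^ C \<and> real \<tau>' \<le> subexp_time (1 / real (8 * t)) c N (sat3.ncols t (inp_of x) - 1) \<and>
        \<tau> \<le> (length x + 2) ^ C + 3 * \<tau>' \<and>
        decides_within M' x \<tau> (csp_sat (nf3 (inp_of x)) 2 (mf3 (inp_of x)) (cl3 (inp_of x)) (vl3 (inp_of x)))"
    using sat3.reduce_csp[OF M \<alpha> t, where ?'a = "bool option"] by blast
  have M3: "\<And>n F. cnf3_on n F \<Longrightarrow> \<exists>N \<tau> \<tau>'. N \<le> (length (cnf_word n F) + 2) ^ C \<and>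
      real \<tau>' \<le> subexp_time (1 / real (8 * t)) c N (sat3.ncols t (inp_of (cnf_word n F)) - 1) \<and>
      \<tau> \<le> (length (cnf_word n F) + 2) ^ C + 3 * \<tau>' \<and> decides_within M' (cnf_word n F) \<tau> (satisfiable F)"
    using M2[OF csp_wf3] csp_sat3 by simp
  have "polyb (\<lambda>S. S ^ C + 3 * (c * S ^ (C * c)))" by (intro polyb_intros)
  then obtain d where d: "\<And>l. (l + 2) ^ C + 3 * (c * (l + 2) ^ (C * c)) \<le> d * l ^ d + d" using polyb_time by blast
  define f where "f = (\<lambda>n. sqrt (real (2 * n + 3)))"
  have "\<exists>\<tau>. real \<tau> \<le> real (2 * d) * real (length (cnf_word n F)) ^ (2 * d) * 2 powr f n \<and>
      decides_within M' (cnf_word n F) \<tau> (satisfiable F)" if F: "cnf3_on n F" for n F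
  proof -
    let ?l = "length (cnf_word n F)"
    obtain N \<tau> \<tau>' where N: "N \<le> (?l + 2) ^ C"
      "real \<tau>' \<le> subexp_time (1 / real (8 * t)) c N (sat3.ncols t (inp_of (cnf_word n F)) - 1)"
      "\<tau> \<le> (?l + 2) ^ C + 3 * \<tau>'" "decides_within M' (cnf_word n F) \<tau> (satisfiable F)"
      using M3[OF F] by blast
    let ?k = "sat3.ncols t (inp_of (cnf_word n F)) - 1"
    have "sat3.ncols t (inp_of (cnf_word n F)) = (2 * n + 3) ^ (4 * t)"
    proof -
      have "Suc (Suc n * 2) = 2 * n + 3" by simp
      then show ?thesis
        unfolding sat3.ncols_def nf3_cnf cdim_def base_def by (simp only: power_mult power4_eq_xxxx mult.assoc)
    qed
    then have "real ?k powr (1 / real (8 * t)) \<le> f n" unfolding f_def by (intro rank_powr t0) simp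
    then have p: "2 powr (real ?k powr (1 / real (8 * t))) \<le> 2 powr f n" by simp
    have p1: "1 \<le> 2 powr f n" by (simp add: f_def ge_one_powr_ge_zero)
    have "real N ^ c \<le> real ((?l + 2) ^ C) ^ c" by (rule power_mono) (use N(1) in \<open>simp_all only: of_nat_le_iff of_nat_0_le_iff\<close>)
    then have "real c * real N ^ c * 2 powr (real ?k powr (1 / real (8 * t))) \<le> real c * real (?l + 2) ^ (C * c) * 2 powr f n"
      by (intro mult_mono p) (simp_all add: power_mult)
    then have t1: "real \<tau>' \<le> real c * real (?l + 2) ^ (C * c) * 2 powr f n" using N(2) unfolding subexp_time_def by linarith
    have "real ((?l + 2) ^ C) * 1 \<le> real ((?l + 2) ^ C) * 2 powr f n" by (rule mult_left_mono[OF p1]) simp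
    moreover have "real \<tau> \<le> real ((?l + 2) ^ C) + 3 * real \<tau>'" using N(3) by linarith
    ultimately have "real \<tau> \<le> real ((?l + 2) ^ C) * 2 powr f n + 3 * (real c * real (?l + 2) ^ (C * c) * 2 powr f n)"
      using t1 by linarith
    also have "\<dots> = real ((?l + 2) ^ C + 3 * (c * (?l + 2) ^ (C * c))) * 2 powr f n" by (simp add: algebra_simps)
    \<comment> \<open>\<open>ETH\<close> has a single constant as coefficient and exponent, and no
      additive term. Doubling \<open>d\<close> absorbs the summand, because the word is not
      empty.\<close>
    also have "\<dots> \<le> real (2 * d * ?l ^ (2 * d)) * 2 powr f n"
    proof (rule mult_right_mono)
      have l: "1 \<le> ?l" by (simp add: cnf_word_def lit_word_def)
      have "?l ^ d \<le> ?l ^ (2 * d)" using l by (intro power_increasing) auto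
      then have "d * ?l ^ d \<le> d * ?l ^ (2 * d)" by (rule mult_le_mono2)
      moreover have "d * 1 \<le> d * ?l ^ (2 * d)" using l by (intro mult_le_mono2) simp
      ultimately have "d * ?l ^ d + d \<le> 2 * d * ?l ^ (2 * d)" by linarith
      then show "real ((?l + 2) ^ C + 3 * (c * (?l + 2) ^ (C * c))) \<le> real (2 * d * ?l ^ (2 * d))"
        unfolding of_nat_le_iff by (rule order_trans[OF d])
    qed simp
    finally have "real \<tau> \<le> real (2 * d) * real ?l ^ (2 * d) * 2 powr f n" by simp
    then show ?thesis using N(4) by blast
  qed
  then have "solves_3SAT_in_time M' (\<lambda>n l. real (2 * d) * real l ^ (2 * d) * 2 powr f n)"
    using M1 unfolding solves_3SAT_in_time_def by blast
  then show ?thesis using sqrt_smallo unfolding ETH_def f_def by blast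
qed

theorem theorem1p6:
  fixes \<alpha> :: real
  assumes "\<alpha> > 1"
  shows "((class_P :: bool list set set) \<noteq> class_NP \<longrightarrow>
           \<not> (\<exists>(M :: 'q::{finite,field} option tm) c. l0_approx_in_time \<alpha> M (poly_time c)))
       \<and> (ETH \<longrightarrow>
           (\<exists>\<delta>>0. \<not> (\<exists>(M :: 'q option tm) c. l0_approx_in_time \<alpha> M (subexp_time \<delta> c))))"
proof -
  obtain t where t: "\<alpha> * real (2 * CARD('q)) ^ t < real (2 * CARD('q) + 1) ^ t"
    using exists_amplification[where ?'q = 'q] by blast
  have t0: "0 < t" using t assms by (cases t) auto
  then have "0 < 1 / real (8 * t)" by simp
  then show ?thesis using P_subset_NP NP_subset_P[where ?'q = 'q] not_ETH[OF _ assms t t0] assms by blast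
qed

end
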